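(* Assume that, for some $T<\infty$, the following hold. (1) $|q|_\infty<\infty$, and for all $0\le t\le T$, $g_t$ is positive and $|g_t|_\infty<\infty$. (2) $|\omega_t|_\infty<\infty$ for all $0\le t\le T$, and $|\vartheta_t|_\infty<\infty$, $|p_t|_\infty<\infty$ for all $1\le t\le T$. (3) For all $0\le t\le T-1$, $|\vartheta_{t|T}/\gamma_{t+1}|_\infty<\infty$ and $|r_{t|T}|_\infty<\infty$; for all $0\le t\le T$, $|\check\omega_{t|T}|_\infty<\infty$; and for all $1\le t\le T-1$, $|\tilde\vartheta_{t|T}\odot\gamma_{t+1}^{-1}|_\infty<\infty$, $|q\odot\gamma_{t+1}^{-1}|_\infty<\infty$, $|\tilde\omega_{t|T}|_\infty<\infty$ and $|\tilde r_{t|T}|_\infty<\infty$. Then, for all $1\le s\le T-1$ and all bounded measurable $h:\mathsf X\to\mathbb R$, the weighted sample $\{(\tilde\omega_{s|T}^\ell,\tilde\xi_{s|T}^\ell)\}_{\ell=1}^N$ produced by the two-filter algorithm of Fearnhead, Wyncoll and Tawn satisfies, as $N\to\infty$, $$\sqrt N\left(\sum_{i=1}^N\frac{\tilde\omega_{s|T}^i}{\tilde\Omega_{s|T}}h(\tilde\xi_{s|T}^i)-\phi_{\chi,s|T}[h]\right)\xrightarrow{\ \mathcal D\ }\mathcal N\left(0,\Upsilon_{\chi,s|T}\big[h-\phi_{\chi,s|T}[h]\big]\right),$$ where $$\Upsilon_{\chi,s|T}[h]=\sigma_s^{-2}\left\{\Sigma_s[h]+\phi_{\chi,s-1}\otimes\psi_{\gamma,s+1|T}\left[\tilde\vartheta_{s|T}\odot\gamma_{s+1}^{-1}\right]\times\phi_{\chi,s-1}\otimes\psi_{\gamma,s+1|T}\left[\int\tilde\omega_{s|T}(\cdot;x)q^{[2]}(\cdot;x)g_s(x)h^2(x)dx\odot\gamma_{s+1}^{-1}\right]\right\},$$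 $$\sigma_s=\phi_{\chi,s-1}\otimes\psi_{\gamma,s+1|T}\left[\int q^{[2]}(\cdot;x)g_s(x)dx\odot\gamma_{s+1}^{-1}\right],\qquad\Sigma_s[h]=\tilde\Gamma_{s-1,s+1|T}\left[\int q^{[2]}(\cdot;x)g_s(x)h(x)dx\odot\gamma_{s+1}^{-1}\right].$$
   Context: **Model.** $(\mathsf X,\mathcal X)$ is a measurable space with countably generated $\sigma$-field, $\lambda$ a ($\sigma$-finite) measure on it; $dx$ stands for $\lambda(dx)$. $Q$ is a Markov kernel on $\mathsf X$ with $Q(x,dx')=q(x,x')\,dx'$. $g_0,\dots,g_T$ are positive measurable functions on $\mathsf X$, $\chi$ a probability on $\mathsf X$. $|\cdot|_\infty$ is the supremum norm, $(f\odot g)(x,x')=f(x,x')g(x')$ for $f:\mathsf X^2\to\mathbb R$, $g:\mathsf X\to\mathbb R$, and $q^{[2]}(x,x';x'')=q(x,x'')q(x'',x')$; in expressions such as $q^{[2]}(\cdot;x)$ the dot stands for a pair in $\mathsf X^2$. $\mu[h]$ denotes $\int h\,d\mu$ and $\mu^2[h]=(\mu[h])^2$. The smoothing and filtering distributions are, for $0\le s\le n\le T$, $$\phi_{\chi,s|n}[h]=\frac{\int\chi(dx_0)g_0(x_0)\prod_{u=1}^nQ(x_{u-1},dx_u)g_u(x_u)\,h(x_s)}{\int\chi(dx_0)g_0(x_0)\prod_{u=1}^nQ(x_{u-1},dx_u)g_u(x_u)},\qquad\phi_{\chi,s}=\phi_{\chi,s|s}.$$ $\gamma_0,\dots,\gamma_T$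 are positive measurable functions with $\int\gamma_t(x_t)dx_t\left[\prod_{u=t+1}^Tg_{u-1}(x_{u-1})Q(x_{u-1},dx_u)\right]g_T(x_T)<\infty$ for all $0\le t\le T$, and the backward information filter is $$\psi_{\gamma,t|T}[h]=\frac{\int\gamma_t(x_t)dx_t\left[\prod_{u=t+1}^Tg_{u-1}(x_{u-1})Q(x_{u-1},dx_u)\right]g_T(x_T)h(x_t)}{\int\gamma_t(x_t)dx_t\left[\prod_{u=t+1}^Tg_{u-1}(x_{u-1})Q(x_{u-1},dx_u)\right]g_T(x_T)}.$$ **Forward filter.** $\rho_0$ is a probability with $\chi\ll\rho_0$; for $1\le t\le T$, $\vartheta_t\ge0$ is a measurable function on $\mathsf X$ and $p_t(x,\cdot)$ a Markov transition density w.r.t. $\lambda$. Set $$\omega_0(x)=\frac{d\chi}{d\rho_0}(x)g_0(x),\qquad \omega_t(x,x')=\frac{q(x,x')g_t(x')}{\vartheta_t(x)p_t(x,x')}\ (t\ge1).$$ For each $N$: $\xi_0^1,\dots,\xi_0^N$ are i.i.d. from $\rho_0$, $\omega_0^\ell=\omega_0(\xi_0^\ell)$. For $s\ge1$, conditionally on the past, the pairs $(I_s^\ell,\xi_s^\ell)$, $1\le \ell\le N$, are i.i.d. on $\{1,\dots,N\}\times\mathsf X$ with density proportional to $(i,x)\mapsto\omega_{s-1}^i\vartheta_s(\xi_{s-1}^i)p_s(\xi_{s-1}^i,x)$, and $\omega_s^\ell=\omega_s(\xi_{s-1}^{I_s^\ell},\xi_s^\ell)$. **Backward filter.** $\check\rho_T$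 is a probability density on $\mathsf X$; for $0\le t\le T-1$, $\vartheta_{t|T}\ge0$ is a measurable function on $\mathsf X$ and $r_{t|T}(x',\cdot)$ a Markov transition density. Set $$\check\omega_{T|T}(x)=\frac{g_T(x)\gamma_T(x)}{\check\rho_T(x)},\qquad\check\omega_{t|T}(x,x')=\frac{\gamma_t(x)g_t(x)q(x,x')}{\vartheta_{t|T}(x')r_{t|T}(x',x)}\ (t<T).$$ $\check\xi_{T|T}^1,\dots,\check\xi_{T|T}^N$ are i.i.d. from $\check\rho_T$, $\check\omega_{T|T}^i=\check\omega_{T|T}(\check\xi_{T|T}^i)$. For $t=T-1,\dots,0$, conditionally on the previously generated backward particles, the pairs $(\check I_t^i,\check\xi_{t|T}^i)$, $1\le i\le N$, are i.i.d. with density proportional to $(j,x)\mapsto\check\omega_{t+1|T}^j\,\vartheta_{t|T}(\check\xi_{t+1|T}^j)\,\gamma_{t+1}^{-1}(\check\xi_{t+1|T}^j)\,r_{t|T}(\check\xi_{t+1|T}^j,x)$, and $\check\omega_{t|T}^i=\check\omega_{t|T}(\check\xi_{t|T}^i,\check\xi_{t+1|T}^{\check I_t^i})$. The forward and backward particle systems are independent. **Two-filter algorithm of Fearnhead, Wyncoll and Tawn.** For $1\le t\le T-1$, $\tilde\vartheta_{t|T}\ge0$ is a measurable function on $\mathsf X^2$, $\tilde r_{t|T}(x,x';\cdot)$ is a probability density w.r.t. $\lambda$ for each $(x,x')$, and $$\tilde\omega_{t|T}(x,x';x'')=\frac{q^{[2]}(x,x';x'')g_t(x'')}{\tilde\vartheta_{t|T}(x,x')\tilde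 r_{t|T}(x,x';x'')}.$$ For $1\le s\le T-1$, conditionally on the forward particles and weights up to time $s-1$ and the backward particles and weights from time $T$ down to $s+1$, the triples $(I_s^\ell,\check I_s^\ell,\tilde\xi_{s|T}^\ell)$, $1\le\ell\le N$ (fresh indices, not those of the filters), are i.i.d. on $\{1,\dots,N\}^2\times\mathsf X$ with density proportional to $$(i,j,x)\mapsto\frac{\omega_{s-1}^i\,\tilde\vartheta_{s|T}(\xi_{s-1}^i,\check\xi_{s+1|T}^j)\,\check\omega_{s+1|T}^j}{\gamma_{s+1}(\check\xi_{s+1|T}^j)}\,\tilde r_{s|T}(\xi_{s-1}^i,\check\xi_{s+1|T}^j;x),$$ and $\tilde\omega_{s|T}^\ell=\tilde\omega_{s|T}(\xi_{s-1}^{I_s^\ell},\check\xi_{s+1|T}^{\check I_s^\ell};\tilde\xi_{s|T}^\ell)$, $\tilde\Omega_{s|T}=\sum_{\ell=1}^N\tilde\omega_{s|T}^\ell$. **Asymptotic variances.** For functions $h$ on $\mathsf X$, $$\Gamma_{\chi,0}[h]=\frac{\int\rho_0(dx)\omega_0^2(x)h^2(x)}{\left(\int\rho_0(dx)\omega_0(x)\right)^2},$$ and for $s\ge1$, $$\Gamma_{\chi,s}[h]=\frac{\Gamma_{\chi,s-1}\left[\int q(\cdot,x)g_s(x)h(x)dx\right]+\phi_{\chi,s-1}\left[\int\omega_s(\cdot,x)q(\cdot,x)g_s(x)h^2(x)dx\right]\phi_{\chi,s-1}[\vartheta_s]}{\phi_{\chi,s-1}^2\left[\int q(\cdot,x)g_s(x)dx\right]};$$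 $$\check\Gamma_{\gamma,T|T}[h]=\frac{\int\check\rho_T(x)\check\omega_{T|T}^2(x)h^2(x)dx}{\left(\int\check\rho_T(x)\check\omega_{T|T}(x)dx\right)^2},$$ and for $t\le T-1$, with $K_t(x,x')=\gamma_t(x)g_t(x)q(x,x')\gamma_{t+1}^{-1}(x')$, $$\check\Gamma_{\gamma,t|T}[h]=\frac{\check\Gamma_{\gamma,t+1|T}\left[\int K_t(x,\cdot)h(x)dx\right]+\psi_{\gamma,t+1|T}\left[\int\check\omega_{t|T}(x,\cdot)K_t(x,\cdot)h^2(x)dx\right]\psi_{\gamma,t+1|T}\left[\vartheta_{t|T}\gamma_{t+1}^{-1}\right]}{\psi_{\gamma,t+1|T}^2\left[\int K_t(x,\cdot)dx\right]}.$$ For functions $H$ on $\mathsf X^2$ and $0\le s<t\le T$, $$\tilde\Gamma_{s,t|T}[H]=\Gamma_{\chi,s}\left[\int\psi_{\gamma,t|T}(dx_t)H(\cdot,x_t)\right]+\check\Gamma_{\gamma,t|T}\left[\int\phi_{\chi,s}(dx_s)H(x_s,\cdot)\right].$$ **Conventions.** In weight functions, $0/0=0$ and $c/0=\infty$ for $c>0$. All sums of weights and normalizing constants appearing in denominators are assumed almost surely positive, so that all estimators and sampling distributions are well defined. $\mathcal N(0,0)$ is the Dirac mass at $0$. *)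

theory Defs
  imports "HOL-Probability.Probability"
begin

section \<open>General notions\<close>

definition sup_norm :: "'b set \<Rightarrow> ('b \<Rightarrow> real) \<Rightarrow> ennreal" where
  "sup_norm S f = (SUP x\<in>S. ennreal \<bar>f x\<bar>)"

text \<open>Weight functions are extended-valued: division on \<^typ>\<open>ennreal\<close> satisfies
  \<open>0 / 0 = 0\<close> and \<open>c / 0 = \<infinity>\<close> for \<open>c > 0\<close>, so a finite supremum norm forces
  the numerator of a weight to vanish wherever its denominator does.\<close>

definition esup_norm :: "'b set \<Rightarrow> ('b \<Rightarrow> ennreal) \<Rightarrow> ennreal" where
  "esup_norm S f = (SUP x\<in>S. f x)"

definition countably_generated :: "'b measure \<Rightarrow> bool" where
  "countably_generated M \<longleftrightarrow>
     (\<exists>E. countable E \<and> E \<subseteq> Pow (space M) \<and> sets M = sigma_sets (space M) E)"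

definition normalized_density :: "'b measure \<Rightarrow> ('b \<Rightarrow> ennreal) \<Rightarrow> 'b measure" where
  "normalized_density M f = density M (\<lambda>x. f x / (\<integral>\<^sup>+ y. f y \<partial>M))"

text \<open>The normalized law written as a ratio of integrals.\<close>

lemma integral_distr_normalized_density:
  fixes w :: "'b \<Rightarrow> real" and h :: "'c \<Rightarrow> real"
  assumes [measurable]: "w \<in> borel_measurable M" "X \<in> M \<rightarrow>\<^sub>M S" "h \<in> borel_measurable S"
    and nn: "\<And>x. x \<in> space M \<Longrightarrow> 0 \<le> w x"
    and fin: "(\<integral>\<^sup>+ x. ennreal (w x) \<partial>M) < \<infinity>" and pos: "(\<integral>\<^sup>+ x. ennreal (w x) \<partial>M) > 0"
  shows "(\<integral>y. h y \<partial>distr (normalized_density M (\<lambda>x. ennreal (w x))) S X)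
    = (\<integral>x. w x * h (X x) \<partial>M) / (\<integral>x. w x \<partial>M)"
proof -
  have int: "integrable M w"
    using nn fin by (intro integrableI_nonneg) (auto intro!: AE_I2)
  have nneq: "(\<integral>\<^sup>+ x. ennreal (w x) \<partial>M) = ennreal (\<integral>x. w x \<partial>M)"
    using nn by (intro nn_integral_eq_integral int) (auto intro!: AE_I2)
  have c: "(\<integral>x. w x \<partial>M) > 0"
    using pos unfolding nneq by simp
  have "normalized_density M (\<lambda>x. ennreal (w x)) = density M (\<lambda>x. ennreal (w x / (\<integral>x. w x \<partial>M)))"
    unfolding normalized_density_def nneq
    using nn c by (intro density_cong) (auto intro!: AE_I2 simp: divide_ennreal)
  moreover have "AE x in M. 0 \<le> w x / (\<integral>x. w x \<partial>M)"
    using nn c by (auto intro!: AE_I2)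
  ultimately have "(\<integral>y. h y \<partial>distr (normalized_density M (\<lambda>x. ennreal (w x))) S X)
    = (\<integral>x. (w x * h (X x)) / (\<integral>x. w x \<partial>M) \<partial>M)"
    by (simp add: integral_distr integral_density)
  then show ?thesis by simp
qed

definition gaussian_law :: "real \<Rightarrow> real measure" where
  "gaussian_law v =
     (if v = 0 then return borel 0 else density lborel (\<lambda>x. ennreal (normal_density 0 (sqrt v) x)))"

text \<open>Given the \<open>\<sigma>\<close>-field \<open>F\<close>, the variables \<open>X 1, \<dots>, X N\<close> are i.i.d. with the
  random law \<open>K\<close>.\<close>

definition cond_iid ::
  "'w measure \<Rightarrow> 'w measure \<Rightarrow> nat \<Rightarrow> 'b measure \<Rightarrow> (nat \<Rightarrow> 'w \<Rightarrow> 'b) \<Rightarrow> ('w \<Rightarrow> 'b measure) \<Rightarrow> bool"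
where
  "cond_iid P F N S X K \<longleftrightarrow>
     (\<forall>l\<in>{1..N}. X l \<in> P \<rightarrow>\<^sub>M S) \<and>
     (\<forall>B. (\<forall>l\<in>{1..N}. B l \<in> sets S) \<longrightarrow>
        (AE w in P. nn_cond_exp P F (indicator {w \<in> space P. \<forall>l\<in>{1..N}. X l w \<in> B l}) w
           = (\<Prod>l\<in>{1..N}. emeasure (K w) (B l))))"


section \<open>Model\<close>

text \<open>
  \<open>base\<close> is \<open>\<lambda>\<close>, \<open>hor\<close> is \<open>T\<close>, \<open>qd\<close> is \<open>q\<close>, \<open>pot\<close> is \<open>g\<close>, \<open>ini\<close> is \<open>\<chi>\<close>,
  \<open>gam\<close> is \<open>\<gamma>\<close>.
  Forward filter: \<open>rho0\<close> is \<open>\<rho>\<^sub>0\<close>, \<open>dini\<close> is the chosen version of \<open>d\<chi>/d\<rho>\<^sub>0\<close>,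
  \<open>fadj t\<close> is \<open>\<vartheta>\<^sub>t\<close>, \<open>fprop t\<close> is \<open>p\<^sub>t\<close>.
  Backward filter: \<open>rhoT\<close> is the initial density at time \<open>T\<close>,
  \<open>badj t\<close> is \<open>\<vartheta>\<^bsub>t|T\<^esub>\<close>, \<open>bprop t\<close> is \<open>r\<^bsub>t|T\<^esub>\<close> (first argument: conditioning point).
  Two-filter sampler: \<open>tadj t\<close> and \<open>tprop t\<close> are the functions
  \<open>\<vartheta>\<^bsub>t|T\<^esub>\<close> and \<open>r\<^bsub>t|T\<^esub>\<close> with a tilde.
\<close>

record 'a two_filter =
  base :: "'a measure"
  hor :: nat
  qd :: "'a \<Rightarrow> 'a \<Rightarrow> real"
  pot :: "nat \<Rightarrow> 'a \<Rightarrow> real"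
  ini :: "'a measure"
  gam :: "nat \<Rightarrow> 'a \<Rightarrow> real"
  rho0 :: "'a measure"
  dini :: "'a \<Rightarrow> ennreal"
  fadj :: "nat \<Rightarrow> 'a \<Rightarrow> real"
  fprop :: "nat \<Rightarrow> 'a \<Rightarrow> 'a \<Rightarrow> real"
  rhoT :: "'a \<Rightarrow> real"
  badj :: "nat \<Rightarrow> 'a \<Rightarrow> real"
  bprop :: "nat \<Rightarrow> 'a \<Rightarrow> 'a \<Rightarrow> real"
  tadj :: "nat \<Rightarrow> 'a \<Rightarrow> 'a \<Rightarrow> real"
  tprop :: "nat \<Rightarrow> 'a \<Rightarrow> 'a \<Rightarrow> 'a \<Rightarrow> real"

abbreviation states :: "'a two_filter \<Rightarrow> 'a set" where
  "states A \<equiv> space (base A)"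

definition markov_density :: "'a measure \<Rightarrow> ('a \<Rightarrow> 'a \<Rightarrow> real) \<Rightarrow> bool" where
  "markov_density L p \<longleftrightarrow>
     (\<lambda>(x, y). p x y) \<in> borel_measurable (L \<Otimes>\<^sub>M L) \<and>
     (\<forall>x\<in>space L. \<forall>y\<in>space L. 0 \<le> p x y) \<and>
     (\<forall>x\<in>space L. (\<integral>\<^sup>+ y. ennreal (p x y) \<partial>L) = 1)"

definition q2 :: "'a two_filter \<Rightarrow> 'a \<Rightarrow> 'a \<Rightarrow> 'a \<Rightarrow> real" where
  "q2 A x x' x'' = qd A x x'' * qd A x'' x'"

definition smoothing_weight :: "'a two_filter \<Rightarrow> nat \<Rightarrow> (nat \<Rightarrow> 'a) \<Rightarrow> real" where
  "smoothing_weight A n x =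
     pot A 0 (x 0) * (\<Prod>u\<in>{1..n}. qd A (x (u - 1)) (x u) * pot A u (x u))"

definition backward_info_weight :: "'a two_filter \<Rightarrow> nat \<Rightarrow> (nat \<Rightarrow> 'a) \<Rightarrow> real" where
  "backward_info_weight A t x =
     gam A t (x t) *
     (\<Prod>u\<in>{t+1..hor A}. pot A (u - 1) (x (u - 1)) * qd A (x (u - 1)) (x u)) *
     pot A (hor A) (x (hor A))"

text \<open>\<open>smoothing A s n\<close> is \<open>\<phi>\<^bsub>\<chi>,s|n\<^esub>\<close> and \<open>backward_info A t\<close> is \<open>\<psi>\<^bsub>\<gamma>,t|T\<^esub>\<close>, as measures on
  the state space.\<close>

definition smoothing :: "'a two_filter \<Rightarrow> nat \<Rightarrow> nat \<Rightarrow> 'a measure" where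
  "smoothing A s n =
     distr (normalized_density (\<Pi>\<^sub>M u\<in>{0..n}. if u = 0 then ini A else base A)
              (\<lambda>x. ennreal (smoothing_weight A n x)))
       (base A) (\<lambda>x. x s)"

abbreviation filtering :: "'a two_filter \<Rightarrow> nat \<Rightarrow> 'a measure" where
  "filtering A s \<equiv> smoothing A s s"

definition backward_info :: "'a two_filter \<Rightarrow> nat \<Rightarrow> 'a measure" where
  "backward_info A t =
     distr (normalized_density (\<Pi>\<^sub>M u\<in>{t..hor A}. base A)
              (\<lambda>x. ennreal (backward_info_weight A t x)))
       (base A) (\<lambda>x. x t)"

definition valid_model :: "'a two_filter \<Rightarrow> bool" where
  "valid_model A \<longleftrightarrow>
     countably_generated (base A) \<and> sigma_finite_measure (base A) \<and>
     markov_density (base A) (qd A) \<and>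
     (\<forall>t\<le>hor A. pot A t \<in> borel_measurable (base A) \<and> (\<forall>x\<in>states A. 0 < pot A t x)) \<and>
     prob_space (ini A) \<and> sets (ini A) = sets (base A) \<and>
     (\<forall>t\<le>hor A. gam A t \<in> borel_measurable (base A) \<and> (\<forall>x\<in>states A. 0 < gam A t x)) \<and>
     (\<forall>t\<le>hor A. (\<integral>\<^sup>+ x. ennreal (backward_info_weight A t x)
                    \<partial>(\<Pi>\<^sub>M u\<in>{t..hor A}. base A)) < \<infinity>)"

definition valid_forward_design :: "'a two_filter \<Rightarrow> bool" where
  "valid_forward_design A \<longleftrightarrow>
     prob_space (rho0 A) \<and> sets (rho0 A) = sets (base A) \<and>
     absolutely_continuous (rho0 A) (ini A) \<and>
     dini A \<in> borel_measurable (rho0 A) \<and> density (rho0 A) (dini A) = ini A \<and>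
     (\<forall>t\<in>{1..hor A}.
        fadj A t \<in> borel_measurable (base A) \<and> (\<forall>x\<in>states A. 0 \<le> fadj A t x) \<and>
        markov_density (base A) (fprop A t))"

definition valid_backward_design :: "'a two_filter \<Rightarrow> bool" where
  "valid_backward_design A \<longleftrightarrow>
     rhoT A \<in> borel_measurable (base A) \<and> (\<forall>x\<in>states A. 0 \<le> rhoT A x) \<and>
     (\<integral>\<^sup>+ x. ennreal (rhoT A x) \<partial>base A) = 1 \<and>
     (\<forall>t<hor A.
        badj A t \<in> borel_measurable (base A) \<and> (\<forall>x\<in>states A. 0 \<le> badj A t x) \<and>
        markov_density (base A) (bprop A t))"

definition valid_two_filter_design :: "'a two_filter \<Rightarrow> bool" where
  "valid_two_filter_design A \<longleftrightarrow>
     (\<forall>t. 1 \<le> t \<and> t < hor A \<longrightarrow>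
        (\<lambda>(x, x'). tadj A t x x') \<in> borel_measurable (base A \<Otimes>\<^sub>M base A) \<and>
        (\<forall>x\<in>states A. \<forall>x'\<in>states A. 0 \<le> tadj A t x x') \<and>
        (\<lambda>(x, x', x''). tprop A t x x' x'')
          \<in> borel_measurable (base A \<Otimes>\<^sub>M base A \<Otimes>\<^sub>M base A) \<and>
        (\<forall>x\<in>states A. \<forall>x'\<in>states A.
           (\<forall>x''\<in>states A. 0 \<le> tprop A t x x' x'') \<and>
           (\<integral>\<^sup>+ x''. ennreal (tprop A t x x' x'') \<partial>base A) = 1))"


section \<open>Weight functions\<close>

definition fweight0 :: "'a two_filter \<Rightarrow> 'a \<Rightarrow> ennreal" where
  "fweight0 A x = dini A x * ennreal (pot A 0 x)"

definition fweight :: "'a two_filter \<Rightarrow> nat \<Rightarrow> 'a \<Rightarrow> 'a \<Rightarrow> ennreal" where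
  "fweight A t x x' = ennreal (qd A x x' * pot A t x') / ennreal (fadj A t x * fprop A t x x')"

definition bweightT :: "'a two_filter \<Rightarrow> 'a \<Rightarrow> ennreal" where
  "bweightT A x = ennreal (pot A (hor A) x * gam A (hor A) x) / ennreal (rhoT A x)"

definition bweight :: "'a two_filter \<Rightarrow> nat \<Rightarrow> 'a \<Rightarrow> 'a \<Rightarrow> ennreal" where
  "bweight A t x x' =
     ennreal (gam A t x * pot A t x * qd A x x') / ennreal (badj A t x' * bprop A t x' x)"

definition tweight :: "'a two_filter \<Rightarrow> nat \<Rightarrow> 'a \<Rightarrow> 'a \<Rightarrow> 'a \<Rightarrow> ennreal" where
  "tweight A t x x' x'' =
     ennreal (q2 A x x' x'' * pot A t x'') / ennreal (tadj A t x x' * tprop A t x x' x'')"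


section \<open>Particle systems\<close>

text \<open>For fixed \<open>N\<close>, \<open>xi s l\<close> and \<open>I s l\<close> denote the \<open>l\<close>-th particle and ancestor index at time \<open>s\<close>
  (\<open>1 \<le> l \<le> N\<close>); forward indices are used for \<open>s \<ge> 1\<close>, backward indices for \<open>s < T\<close>.
  The almost sure positivity clauses concern the total masses of the sampling densities
  (the proposal densities integrate to one) and the sums of the resulting weights.\<close>

definition fpw ::
  "'a two_filter \<Rightarrow> (nat \<Rightarrow> nat \<Rightarrow> 'w \<Rightarrow> 'a) \<Rightarrow> (nat \<Rightarrow> nat \<Rightarrow> 'w \<Rightarrow> nat) \<Rightarrow> nat \<Rightarrow> nat \<Rightarrow> 'w \<Rightarrow> ennreal"
where
  "fpw A xi I s l w =
     (if s = 0 then fweight0 A (xi 0 l w)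
      else fweight A s (xi (s - 1) (I s l w) w) (xi s l w))"

definition bpw ::
  "'a two_filter \<Rightarrow> (nat \<Rightarrow> nat \<Rightarrow> 'w \<Rightarrow> 'a) \<Rightarrow> (nat \<Rightarrow> nat \<Rightarrow> 'w \<Rightarrow> nat) \<Rightarrow> nat \<Rightarrow> nat \<Rightarrow> 'w \<Rightarrow> ennreal"
where
  "bpw A bxi bI t l w =
     (if t = hor A then bweightT A (bxi t l w)
      else bweight A t (bxi t l w) (bxi (t + 1) (bI t l w) w))"

text \<open>\<open>\<sigma>\<close>-field generated by the forward system at times \<open>0, \<dots>, s - 1\<close>, and by the backward
  system at times \<open>T, \<dots>, t\<close>.\<close>

definition forward_history ::
  "'a two_filter \<Rightarrow> nat \<Rightarrow> 'w measure \<Rightarrow> (nat \<Rightarrow> nat \<Rightarrow> 'w \<Rightarrow> 'a) \<Rightarrow> (nat \<Rightarrow> nat \<Rightarrow> 'w \<Rightarrow> nat) \<Rightarrow> nat \<Rightarrow> 'w measure"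
where
  "forward_history A N P xi I s = sigma (space P)
     ({xi u l -` B \<inter> space P | u l B. u < s \<and> l \<in> {1..N} \<and> B \<in> sets (base A)} \<union>
      {I u l -` B \<inter> space P | u l B. 1 \<le> u \<and> u < s \<and> l \<in> {1..N}})"

definition backward_history ::
  "'a two_filter \<Rightarrow> nat \<Rightarrow> 'w measure \<Rightarrow> (nat \<Rightarrow> nat \<Rightarrow> 'w \<Rightarrow> 'a) \<Rightarrow> (nat \<Rightarrow> nat \<Rightarrow> 'w \<Rightarrow> nat) \<Rightarrow> nat \<Rightarrow> 'w measure"
where
  "backward_history A N P bxi bI t = sigma (space P)
     ({bxi u l -` B \<inter> space P | u l B. t \<le> u \<and> u \<le> hor A \<and> l \<in> {1..N} \<and> B \<in> sets (base A)} \<union>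
      {bI u l -` B \<inter> space P | u l B. t \<le> u \<and> u < hor A \<and> l \<in> {1..N}})"

definition forward_system ::
  "'a two_filter \<Rightarrow> nat \<Rightarrow> 'w measure \<Rightarrow> (nat \<Rightarrow> nat \<Rightarrow> 'w \<Rightarrow> 'a) \<Rightarrow> (nat \<Rightarrow> nat \<Rightarrow> 'w \<Rightarrow> nat) \<Rightarrow> bool"
where
  "forward_system A N P xi I \<longleftrightarrow>
     prob_space.indep_vars P (\<lambda>_. base A) (xi 0) {1..N} \<and>
     (\<forall>l\<in>{1..N}. distr P (base A) (xi 0 l) = rho0 A) \<and>
     (\<forall>s\<in>{1..hor A}.
        cond_iid P (forward_history A N P xi I s) N (count_space {1..N} \<Otimes>\<^sub>M base A)
          (\<lambda>l w. (I s l w, xi s l w))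
          (\<lambda>w. normalized_density (count_space {1..N} \<Otimes>\<^sub>M base A)
             (\<lambda>(i, x). fpw A xi I (s - 1) i w *
                ennreal (fadj A s (xi (s - 1) i w) * fprop A s (xi (s - 1) i w) x)))) \<and>
     (\<forall>s\<in>{1..hor A}. AE w in P.
        0 < (\<Sum>i\<in>{1..N}. fpw A xi I (s - 1) i w * ennreal (fadj A s (xi (s - 1) i w)))) \<and>
     (\<forall>s\<le>hor A. AE w in P. 0 < (\<Sum>i\<in>{1..N}. fpw A xi I s i w))"

definition backward_system ::
  "'a two_filter \<Rightarrow> nat \<Rightarrow> 'w measure \<Rightarrow> (nat \<Rightarrow> nat \<Rightarrow> 'w \<Rightarrow> 'a) \<Rightarrow> (nat \<Rightarrow> nat \<Rightarrow> 'w \<Rightarrow> nat) \<Rightarrow> bool"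
where
  "backward_system A N P bxi bI \<longleftrightarrow>
     prob_space.indep_vars P (\<lambda>_. base A) (bxi (hor A)) {1..N} \<and>
     (\<forall>l\<in>{1..N}. distributed P (base A) (bxi (hor A) l) (\<lambda>x. ennreal (rhoT A x))) \<and>
     (\<forall>t<hor A.
        cond_iid P (backward_history A N P bxi bI (t + 1)) N (count_space {1..N} \<Otimes>\<^sub>M base A)
          (\<lambda>l w. (bI t l w, bxi t l w))
          (\<lambda>w. normalized_density (count_space {1..N} \<Otimes>\<^sub>M base A)
             (\<lambda>(j, x). bpw A bxi bI (t + 1) j w *
                ennreal (badj A t (bxi (t + 1) j w) / gam A (t + 1) (bxi (t + 1) j w) *
                         bprop A t (bxi (t + 1) j w) x)))) \<and>
     (\<forall>t<hor A. AE w in P.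
        0 < (\<Sum>j\<in>{1..N}. bpw A bxi bI (t + 1) j w *
               ennreal (badj A t (bxi (t + 1) j w) / gam A (t + 1) (bxi (t + 1) j w)))) \<and>
     (\<forall>t\<le>hor A. AE w in P. 0 < (\<Sum>j\<in>{1..N}. bpw A bxi bI t j w))"

definition sampling_history ::
  "'a two_filter \<Rightarrow> nat \<Rightarrow> 'w measure \<Rightarrow> (nat \<Rightarrow> nat \<Rightarrow> 'w \<Rightarrow> 'a) \<Rightarrow> (nat \<Rightarrow> nat \<Rightarrow> 'w \<Rightarrow> nat) \<Rightarrow>
   (nat \<Rightarrow> nat \<Rightarrow> 'w \<Rightarrow> 'a) \<Rightarrow> (nat \<Rightarrow> nat \<Rightarrow> 'w \<Rightarrow> nat) \<Rightarrow> nat \<Rightarrow> 'w measure"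
where
  "sampling_history A N P xi I bxi bI s = sigma (space P)
     ({xi u l -` B \<inter> space P | u l B. u < s \<and> l \<in> {1..N} \<and> B \<in> sets (base A)} \<union>
      {fpw A xi I u l -` B \<inter> space P | u l B. u < s \<and> l \<in> {1..N} \<and> B \<in> sets borel} \<union>
      {bxi u l -` B \<inter> space P | u l B. s < u \<and> u \<le> hor A \<and> l \<in> {1..N} \<and> B \<in> sets (base A)} \<union>
      {bpw A bxi bI u l -` B \<inter> space P | u l B. s < u \<and> u \<le> hor A \<and> l \<in> {1..N} \<and> B \<in> sets borel})"

text \<open>\<open>(tI l, tJ l, txi l)\<close> is the \<open>l\<close>-th triple drawn at time \<open>s\<close>.\<close>

definition tpw ::
  "'a two_filter \<Rightarrow> (nat \<Rightarrow> nat \<Rightarrow> 'w \<Rightarrow> 'a) \<Rightarrow> (nat \<Rightarrow> nat \<Rightarrow> 'w \<Rightarrow> 'a) \<Rightarrow> nat \<Rightarrow>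
   (nat \<Rightarrow> 'w \<Rightarrow> nat) \<Rightarrow> (nat \<Rightarrow> 'w \<Rightarrow> nat) \<Rightarrow> (nat \<Rightarrow> 'w \<Rightarrow> 'a) \<Rightarrow> nat \<Rightarrow> 'w \<Rightarrow> ennreal"
where
  "tpw A xi bxi s tI tJ txi l w =
     tweight A s (xi (s - 1) (tI l w) w) (bxi (s + 1) (tJ l w) w) (txi l w)"

definition two_filter_sample ::
  "'a two_filter \<Rightarrow> nat \<Rightarrow> 'w measure \<Rightarrow> (nat \<Rightarrow> nat \<Rightarrow> 'w \<Rightarrow> 'a) \<Rightarrow> (nat \<Rightarrow> nat \<Rightarrow> 'w \<Rightarrow> nat) \<Rightarrow>
   (nat \<Rightarrow> nat \<Rightarrow> 'w \<Rightarrow> 'a) \<Rightarrow> (nat \<Rightarrow> nat \<Rightarrow> 'w \<Rightarrow> nat) \<Rightarrow> nat \<Rightarrow>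
   (nat \<Rightarrow> 'w \<Rightarrow> nat) \<Rightarrow> (nat \<Rightarrow> 'w \<Rightarrow> nat) \<Rightarrow> (nat \<Rightarrow> 'w \<Rightarrow> 'a) \<Rightarrow> bool"
where
  "two_filter_sample A N P xi I bxi bI s tI tJ txi \<longleftrightarrow>
     cond_iid P (sampling_history A N P xi I bxi bI s) N
       (count_space {1..N} \<Otimes>\<^sub>M count_space {1..N} \<Otimes>\<^sub>M base A)
       (\<lambda>l w. (tI l w, tJ l w, txi l w))
       (\<lambda>w. normalized_density (count_space {1..N} \<Otimes>\<^sub>M count_space {1..N} \<Otimes>\<^sub>M base A)
          (\<lambda>(i, j, x).
             fpw A xi I (s - 1) i w *
             ennreal (tadj A s (xi (s - 1) i w) (bxi (s + 1) j w)) *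
             bpw A bxi bI (s + 1) j w / ennreal (gam A (s + 1) (bxi (s + 1) j w)) *
             ennreal (tprop A s (xi (s - 1) i w) (bxi (s + 1) j w) x))) \<and>
     (AE w in P. 0 < (\<Sum>i\<in>{1..N}. \<Sum>j\<in>{1..N}.
             fpw A xi I (s - 1) i w *
             ennreal (tadj A s (xi (s - 1) i w) (bxi (s + 1) j w)) *
             bpw A bxi bI (s + 1) j w / ennreal (gam A (s + 1) (bxi (s + 1) j w)))) \<and>
     (AE w in P. 0 < (\<Sum>l\<in>{1..N}. tpw A xi bxi s tI tJ txi l w))"

definition two_filter_estimate ::
  "'a two_filter \<Rightarrow> nat \<Rightarrow> (nat \<Rightarrow> nat \<Rightarrow> 'w \<Rightarrow> 'a) \<Rightarrow> (nat \<Rightarrow> nat \<Rightarrow> 'w \<Rightarrow> 'a) \<Rightarrow> nat \<Rightarrow>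
   (nat \<Rightarrow> 'w \<Rightarrow> nat) \<Rightarrow> (nat \<Rightarrow> 'w \<Rightarrow> nat) \<Rightarrow> (nat \<Rightarrow> 'w \<Rightarrow> 'a) \<Rightarrow> ('a \<Rightarrow> real) \<Rightarrow> 'w \<Rightarrow> real"
where
  "two_filter_estimate A N xi bxi s tI tJ txi h w =
     (\<Sum>i\<in>{1..N}. enn2real (tpw A xi bxi s tI tJ txi i w) /
        (\<Sum>l\<in>{1..N}. enn2real (tpw A xi bxi s tI tJ txi l w)) * h (txi i w))"


section \<open>Asymptotic variances\<close>

primrec fvar :: "'a two_filter \<Rightarrow> nat \<Rightarrow> ('a \<Rightarrow> real) \<Rightarrow> real" where
  "fvar A 0 h =
     (\<integral>x. (enn2real (fweight0 A x))\<^sup>2 * (h x)\<^sup>2 \<partial>rho0 A) /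
     (\<integral>x. enn2real (fweight0 A x) \<partial>rho0 A)\<^sup>2"
| "fvar A (Suc s) h =
     (fvar A s (\<lambda>y. \<integral>x. qd A y x * pot A (Suc s) x * h x \<partial>base A) +
      (\<integral>y. (\<integral>x. enn2real (fweight A (Suc s) y x) * qd A y x * pot A (Suc s) x * (h x)\<^sup>2 \<partial>base A)
         \<partial>filtering A s) *
      (\<integral>y. fadj A (Suc s) y \<partial>filtering A s)) /
     (\<integral>y. (\<integral>x. qd A y x * pot A (Suc s) x \<partial>base A) \<partial>filtering A s)\<^sup>2"

definition bkernel :: "'a two_filter \<Rightarrow> nat \<Rightarrow> 'a \<Rightarrow> 'a \<Rightarrow> real" where
  "bkernel A t x x' = gam A t x * pot A t x * qd A x x' / gam A (t + 1) x'"

text \<open>The first branch is the case \<open>t = T\<close>; times beyond \<open>T\<close> are irrelevant.\<close>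

function bvar :: "'a two_filter \<Rightarrow> nat \<Rightarrow> ('a \<Rightarrow> real) \<Rightarrow> real" where
  "bvar A t h =
     (if hor A \<le> t then
        (\<integral>x. rhoT A x * (enn2real (bweightT A x))\<^sup>2 * (h x)\<^sup>2 \<partial>base A) /
        (\<integral>x. rhoT A x * enn2real (bweightT A x) \<partial>base A)\<^sup>2
      else
        (bvar A (t + 1) (\<lambda>y. \<integral>x. bkernel A t x y * h x \<partial>base A) +
         (\<integral>y. (\<integral>x. enn2real (bweight A t x y) * bkernel A t x y * (h x)\<^sup>2 \<partial>base A)
            \<partial>backward_info A (t + 1)) *
         (\<integral>y. badj A t y / gam A (t + 1) y \<partial>backward_info A (t + 1))) /
        (\<integral>y. (\<integral>x. bkernel A t x y \<partial>base A) \<partial>backward_info A (t + 1))\<^sup>2)"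
  by pat_completeness auto
termination by (relation "Wellfounded.measure (\<lambda>(A, t, h). hor A - t)") auto

declare bvar.simps [simp del]

definition pair_var :: "'a two_filter \<Rightarrow> nat \<Rightarrow> nat \<Rightarrow> ('a \<Rightarrow> 'a \<Rightarrow> real) \<Rightarrow> real" where
  "pair_var A s t H =
     fvar A s (\<lambda>x. \<integral>y. H x y \<partial>backward_info A t) +
     bvar A t (\<lambda>y. \<integral>x. H x y \<partial>filtering A s)"

text \<open>\<open>pair_law A s\<close> is \<open>\<phi>\<^bsub>\<chi>,s-1\<^esub> \<otimes> \<psi>\<^bsub>\<gamma>,s+1|T\<^esub>\<close>.\<close>

definition pair_law :: "'a two_filter \<Rightarrow> nat \<Rightarrow> ('a \<times> 'a) measure" where
  "pair_law A s = filtering A (s - 1) \<Otimes>\<^sub>M backward_info A (s + 1)"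

definition sigma_const :: "'a two_filter \<Rightarrow> nat \<Rightarrow> real" where
  "sigma_const A s =
     (\<integral>(x, x'). (\<integral>z. q2 A x x' z * pot A s z \<partial>base A) / gam A (s + 1) x' \<partial>pair_law A s)"

definition Sigma_var :: "'a two_filter \<Rightarrow> nat \<Rightarrow> ('a \<Rightarrow> real) \<Rightarrow> real" where
  "Sigma_var A s h =
     pair_var A (s - 1) (s + 1)
       (\<lambda>x x'. (\<integral>z. q2 A x x' z * pot A s z * h z \<partial>base A) / gam A (s + 1) x')"

definition Upsilon :: "'a two_filter \<Rightarrow> nat \<Rightarrow> ('a \<Rightarrow> real) \<Rightarrow> real" where
  "Upsilon A s h =
     (Sigma_var A s h +
      (\<integral>(x, x'). tadj A s x x' / gam A (s + 1) x' \<partial>pair_law A s) *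
      (\<integral>(x, x'). (\<integral>z. enn2real (tweight A s x x' z) * q2 A x x' z * pot A s z * (h z)\<^sup>2 \<partial>base A)
          / gam A (s + 1) x' \<partial>pair_law A s)) /
     (sigma_const A s)\<^sup>2"

end

theory Submission
  imports Defs
begin

text \<open>
  Write \<open>A N f\<close> for the unnormalised weighted average of \<open>f\<close> over a particle sample of size \<open>N\<close>.
  The proof transports one invariant through the algorithm: for bounded \<open>f\<close>, \<open>A N f\<close> has mean square
  error \<open>O(1/N)\<close> around \<open>c \<mu>(f)\<close>, and if \<open>\<mu>(f) = 0\<close> then \<open>\<surd>N A N f\<close> is asymptotically normal with variance
  \<open>V f\<close>, expressed by characteristic functions. In one selection and mutation step the new particles are
  conditionally i.i.d., so that up to \<open>O(1/\<surd>N)\<close> the conditional characteristic function is that of a Gaussian whose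
  variance converges, while the conditional mean is a ratio of averages over the old sample; this gives
  the recursions for \<open>\<Gamma>\<close> and its backward analogue.

  For the pair sample, independence of the two filters allows a Hoeffding decomposition: the double average
  is a sum of two independent single averages of the marginals of \<open>H\<close> plus a doubly centred remainder,
  which is \<open>O(1/N)\<close> in \<open>L\<^sup>1\<close>. The two-filter sampler is then one more selection and mutation step, started
  from the pair sample, and the estimator is a ratio of two averages over its output.
\<close>

section \<open>Conditionally i.i.d. samples\<close>

text \<open>Only centred f appear in the limit because every quantity passed on is a self-normalised
  ratio. With \<mu>(f) = 0 the numerator is already of order 1/\<surd>N, so replacing the
  denominator by its limit costs O(1/N) in mean, which is negligible after multiplication by
  \<surd>N. This is the use of the mean square rate, and it keeps covariances of numerator and
  denominator out of the variance. The variance carried along is that of the unnormalised average,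
  hence c^2 times the \<Gamma> of the filter; the constants c cancel in every ratio. The main
  obstacle is conditioning. Conditional independence is given as an identity for each rectangle,
  outside a null set that depends on the rectangle, and the random sampling law is a probability
  only almost surely. The proof has to integrate jointly over the past and the new sample. The law
  is therefore modified on a null set into a Markov kernel, and the identities are assembled into a
  disintegration of the joint law. Characteristic functions suit this setting: given the past, that
  of a sum of N new terms is an N-th power.\<close>

lemma measurable_PiM_kernel:
  assumes I: "finite I" and K: "K \<in> F \<rightarrow>\<^sub>M prob_algebra S"
  shows "(\<lambda>w. PiM I (\<lambda>_. K w)) \<in> F \<rightarrow>\<^sub>M prob_algebra (PiM I (\<lambda>_. S))"
proof -
  have K': "sets (K w) = sets S" "prob_space (K w)" "space (K w) = space S" if "w \<in> space F" for w
    using measurable_space[OF K that] by (auto simp: space_prob_algebra dest: sets_eq_imp_space_eq)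
  show ?thesis
  proof (rule measurable_prob_algebra_generated[OF sets_PiM Int_stable_prod_algebra prod_algebra_sets_into_space])
    fix w assume w: "w \<in> space F"
    show "prob_space (PiM I (\<lambda>_. K w))" using K'(2)[OF w] by (intro prob_space_PiM)
    show "sets (PiM I (\<lambda>_. K w)) = sets (PiM I (\<lambda>_. S))" using K'[OF w] by (intro sets_PiM_cong) auto
  next
    fix A assume "A \<in> prod_algebra I (\<lambda>_. S)"
    then obtain E where A: "A = Pi\<^sub>E I E" "E \<in> (\<Pi> i\<in>I. sets S)"
      using prod_algebra_eq_finite[OF I, of "\<lambda>_. S"] by auto
    have "emeasure (PiM I (\<lambda>_. K w)) A = (\<Prod>i\<in>I. emeasure (K w) (E i))" if w: "w \<in> space F" for w
    proof -
      interpret product_prob_space "\<lambda>_. K w" I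
        using K'(2)[OF w] by (simp add: product_prob_space_def product_prob_space_axioms_def product_sigma_finite_def prob_space_imp_sigma_finite)
      show ?thesis unfolding A using A(2) K'[OF w] I by (intro emeasure_PiM) auto
    qed
    moreover have "(\<lambda>w. \<Prod>i\<in>I. emeasure (K w) (E i)) \<in> borel_measurable F"
      using A(2) measurable_emeasure_kernel[OF measurable_prob_algebraD[OF K]]
      by (intro borel_measurable_prod_ennreal) auto
    ultimately show "(\<lambda>w. emeasure (PiM I (\<lambda>_. K w)) A) \<in> borel_measurable F"
      by (simp cong: measurable_cong)
  qed
qed

text \<open>The products of an event of \<open>F\<close> with a rectangle form an
  intersection-stable generator. On each of them the two laws agree by the defining property of
  conditional expectation, so the separate null sets of the rectangles disappear. The first
  coordinate is the outcome itself, seen only through \<open>F\<close>; integrands may thus depend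
  on everything that the past determines.\<close>

lemma cond_iid_disintegration:
  assumes P: "prob_space P" and F: "subalgebra P F"
    and Z: "cond_iid P F N S Z K" and K: "K \<in> F \<rightarrow>\<^sub>M prob_algebra S"
  defines "S' \<equiv> PiM {1..N} (\<lambda>_. S)"
  shows "distr P (F \<Otimes>\<^sub>M S') (\<lambda>w. (w, \<lambda>l\<in>{1..N}. Z l w)) =
    restr_to_subalg P F \<bind> (\<lambda>w. distr (PiM {1..N} (\<lambda>_. K w)) (F \<Otimes>\<^sub>M S') (Pair w))"
proof -
  interpret prob_space P by fact
  define L where "L = {1..N}"
  let ?\<Pi> = "\<lambda>w. PiM L (\<lambda>_. K w)"
  have finL[simp, intro]: "finite L" by (simp add: L_def)
  have cZ: "l \<in> L \<Longrightarrow> Z l \<in> P \<rightarrow>\<^sub>M S" "(\<And>l. l \<in> L \<Longrightarrow> B l \<in> sets S) \<Longrightarrow>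
      AE w in P. nn_cond_exp P F (indicator {w \<in> space P. \<forall>l\<in>L. Z l w \<in> B l}) w = (\<Prod>l\<in>L. emeasure (K w) (B l))" for l B
    using Z unfolding cond_iid_def L_def by blast+
  have S'_def: "S' = PiM L (\<lambda>_. S)" by (simp add: S'_def L_def)
  interpret sigma_finite_subalgebra P F
    by (rule finite_measure_subalgebra_is_sigma_finite) (use F in \<open>simp add: finite_measure_subalgebra_def finite_measure_axioms finite_measure_subalgebra_axioms_def\<close>)
  have sF: "space F = space P" using F by (simp add: subalgebra_def)
  have idF[measurable]: "(\<lambda>w. w) \<in> P \<rightarrow>\<^sub>M F" using F by (auto simp: measurable_def subalgebra_def)
  have Zm[measurable]: "Z l \<in> P \<rightarrow>\<^sub>M S" if "l \<in> L" for l
    using cZ that by auto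
  have K': "sets (K w) = sets S" "prob_space (K w)" "space (K w) = space S" if "w \<in> space F" for w
    using measurable_space[OF K that] by (auto simp: space_prob_algebra dest: sets_eq_imp_space_eq)
  have KP[measurable]: "(\<lambda>w. ?\<Pi> w) \<in> F \<rightarrow>\<^sub>M prob_algebra S'"
    unfolding S'_def by (rule measurable_PiM_kernel[OF _ K]) simp
  have kern: "(\<lambda>w. distr (?\<Pi> w) (F \<Otimes>\<^sub>M S') (Pair w)) \<in> F \<rightarrow>\<^sub>M prob_algebra (F \<Otimes>\<^sub>M S')"
    by measurable
  have kern': "(\<lambda>w. distr (?\<Pi> w) (F \<Otimes>\<^sub>M S') (Pair w)) \<in> restr_to_subalg P F \<rightarrow>\<^sub>M subprob_algebra (F \<Otimes>\<^sub>M S')"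
    using measurable_prob_algebraD[OF kern] measurable_in_subalg[OF F] by blast
  have ZmP[measurable]: "(\<lambda>w. (w, \<lambda>l\<in>L. Z l w)) \<in> P \<rightarrow>\<^sub>M F \<Otimes>\<^sub>M S'"
    unfolding S'_def by measurable
  let ?E = "{A \<times> Pi\<^sub>E L B | A B. A \<in> sets F \<and> B \<in> (\<Pi> l\<in>L. sets S)}"
  have setsE: "sets (F \<Otimes>\<^sub>M S') = sigma_sets (space F \<times> space S') ?E"
  proof -
    have "sets (F \<Otimes>\<^sub>M S') = sets (sigma (space F \<times> space S') {a \<times> b |a b. a \<in> sets F \<and> b \<in> Pi\<^sub>E L ` (\<Pi> l\<in>L. sets S)})"
    proof (rule sets_pair_eq)
      show "sets F = sigma_sets (space F) (sets F)" by (simp add: sets.sigma_sets_eq)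
      show "sets S' = sigma_sets (space S') (Pi\<^sub>E L ` (\<Pi> l\<in>L. sets S))"
        unfolding S'_def sets_PiM space_PiM prod_algebra_eq_finite[OF finL]
          by (rule arg_cong[where f="sigma_sets _"]) auto
      show "countable {space F}" "{space F} \<subseteq> sets F" "\<Union>{space F} = space F" by auto
      show "countable {space S'}" "\<Union>{space S'} = space S'" by auto
      show "{space S'} \<subseteq> Pi\<^sub>E L ` (\<Pi> l\<in>L. sets S)"
        unfolding S'_def space_PiM by auto
      show "Pi\<^sub>E L ` (\<Pi> l\<in>L. sets S) \<subseteq> Pow (space S')"
        unfolding S'_def space_PiM by (auto simp: PiE_iff dest!: sets.sets_into_space)
      show "sets F \<subseteq> Pow (space F)" by (rule sets.space_closed)
    qed
    also have "{a \<times> b |a b. a \<in> sets F \<and> b \<in> Pi\<^sub>E L ` (\<Pi> l\<in>L. sets S)} = ?E" by auto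
    finally show ?thesis
      by (subst (asm) sets_measure_of) (auto simp: S'_def space_PiM PiE_iff dest: sets.sets_into_space)
  qed
  let ?D' = "distr P (F \<Otimes>\<^sub>M S') (\<lambda>w. (w, \<lambda>l\<in>L. Z l w))"
    and ?B' = "restr_to_subalg P F \<bind> (\<lambda>w. distr (?\<Pi> w) (F \<Otimes>\<^sub>M S') (Pair w))"
  show ?thesis unfolding L_def[symmetric]
  proof (rule measure_eqI_generator_eq[where E="?E" and \<Omega>="space F \<times> space S'" and A="\<lambda>_. space F \<times> space S'"])
    show "Int_stable ?E"
    proof (rule Int_stableI, safe)
      fix a aa B Ba assume "a \<in> sets F" "aa \<in> sets F" "B \<in> L \<rightarrow> sets S" "Ba \<in> L \<rightarrow> sets S"
      then show "\<exists>A Bb. a \<times> Pi\<^sub>E L B \<inter> aa \<times> Pi\<^sub>E L Ba = A \<times> Pi\<^sub>E L Bb \<and> A \<in> sets F \<and> Bb \<in> L \<rightarrow> sets S"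
        by (intro exI[of _ "a \<inter> aa"] exI[of _ "\<lambda>l. B l \<inter> Ba l"]) (auto simp: PiE_Int[symmetric])
    qed
    show "?E \<subseteq> Pow (space F \<times> space S')"
      by (auto simp: S'_def space_PiM PiE_iff dest: sets.sets_into_space)
    show "sets ?D' = sigma_sets (space F \<times> space S') ?E" using setsE by simp
    show "sets ?B' = sigma_sets (space F \<times> space S') ?E"
      using setsE sets_bind[OF sets_kernel[OF kern'], of "restr_to_subalg P F"] not_empty by (simp add: space_restr_to_subalg del: sets_bind)
    show "range (\<lambda>_::nat. space F \<times> space S') \<subseteq> ?E"
      unfolding S'_def space_PiM by auto
    show "(\<Union>i::nat. space F \<times> space S') = space F \<times> space S'" by auto
    show "emeasure ?D' (space F \<times> space S') \<noteq> \<infinity>" for i::nat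
      using finite_measure.emeasure_finite[OF finite_measure_distr[OF ZmP]] by simp
    fix X assume "X \<in> ?E"
    then obtain A B where X: "X = A \<times> Pi\<^sub>E L B" and A[measurable]: "A \<in> sets F" and B: "\<And>l. l \<in> L \<Longrightarrow> B l \<in> sets S"
      by (auto simp: Pi_iff)
    have XS: "X \<in> sets (F \<Otimes>\<^sub>M S')" unfolding X S'_def using A B by auto
    have AP[measurable]: "A \<in> sets P" using A F by (auto simp: subalgebra_def)
    define ev where "ev = {w \<in> space P. \<forall>l\<in>L. Z l w \<in> B l}"
    have [measurable]: "ev \<in> sets P" unfolding ev_def using B by measurable
    have "emeasure ?D' X = emeasure P (A \<inter> ev)"
      using XS by (subst emeasure_distr) (auto simp: X intro!: arg_cong[where f="emeasure P"] simp: ev_def dest: sets.sets_into_space[OF AP, THEN subsetD])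
    also have "\<dots> = (\<integral>\<^sup>+w. indicator A w * indicator ev w \<partial>P)"
      by (simp add: indicator_inter_arith[symmetric])
    also have "\<dots> = (\<integral>\<^sup>+w. indicator A w * nn_cond_exp P F (indicator ev) w \<partial>P)"
      by (rule nn_cond_exp_intg[symmetric]) (auto intro!: borel_measurable_indicator)
    also have "\<dots> = (\<integral>\<^sup>+w. indicator A w * (\<Prod>l\<in>L. emeasure (K w) (B l)) \<partial>P)"
      using cZ(2)[of B, OF B, folded ev_def] by (intro nn_integral_cong_AE) auto
    also have "\<dots> = (\<integral>\<^sup>+w. emeasure (distr (?\<Pi> w) (F \<Otimes>\<^sub>M S') (Pair w)) X \<partial>P)"
    proof (rule nn_integral_cong)
      fix w assume "w \<in> space P"
      then have w: "w \<in> space F" by (simp add: sF)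
      interpret product_prob_space "\<lambda>_. K w" "L"
        using K'(2)[OF w] by (simp add: product_prob_space_def product_prob_space_axioms_def product_sigma_finite_def prob_space_imp_sigma_finite)
      have s: "sets (?\<Pi> w) = sets S'" unfolding S'_def using K'[OF w] by (intro sets_PiM_cong) auto
      have sp: "space (?\<Pi> w) = space S'" using sets_eq_imp_space_eq[OF s] .
      have "emeasure (distr (?\<Pi> w) (F \<Otimes>\<^sub>M S') (Pair w)) X = emeasure (?\<Pi> w) (Pair w -` X \<inter> space S')"
        using XS w by (subst emeasure_distr) (auto simp: measurable_cong_sets[OF s refl] sp)
      also have "Pair w -` X \<inter> space S' = (if w \<in> A then Pi\<^sub>E L B else {})"
        unfolding X S'_def space_PiM using B[THEN sets.sets_into_space] by (auto simp: PiE_iff)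
      also have "emeasure (?\<Pi> w) \<dots> = indicator A w * (\<Prod>l\<in>L. emeasure (K w) (B l))"
        using B K'[OF w] by (auto intro!: emeasure_PiM)
      finally show "indicator A w * (\<Prod>l\<in>L. emeasure (K w) (B l)) = emeasure (distr (?\<Pi> w) (F \<Otimes>\<^sub>M S') (Pair w)) X" ..
    qed
    also have "\<dots> = (\<integral>\<^sup>+w. emeasure (distr (?\<Pi> w) (F \<Otimes>\<^sub>M S') (Pair w)) X \<partial>restr_to_subalg P F)"
      using measurable_emeasure_kernel[OF measurable_prob_algebraD[OF kern] XS]
      by (intro nn_integral_subalgebra2[symmetric] F) auto
    also have "\<dots> = emeasure ?B' X"
      using not_empty by (intro emeasure_bind[symmetric, OF _ kern' XS]) (auto simp: space_restr_to_subalg)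
    finally show "emeasure ?D' X = emeasure ?B' X" .
  qed
qed

text \<open>The tower property, read off from the disintegration. The first claim, measurability of
  the inner integral with respect to \<open>F\<close>, is what lets the conditional integral be
  integrated or bounded further.\<close>

lemma cond_iid_integral_real:
  fixes f :: "'w \<times> (nat \<Rightarrow> 's) \<Rightarrow> real"
  assumes P: "prob_space P" and F: "subalgebra P F"
    and Z: "cond_iid P F N S Z K" and K: "K \<in> F \<rightarrow>\<^sub>M prob_algebra S"
    and f[measurable]: "f \<in> borel_measurable (F \<Otimes>\<^sub>M PiM {1..N} (\<lambda>_. S))"
    and B: "\<And>x. x \<in> space (F \<Otimes>\<^sub>M PiM {1..N} (\<lambda>_. S)) \<Longrightarrow> \<bar>f x\<bar> \<le> B"
  shows "(\<lambda>w. \<integral>z. f (w, z) \<partial>PiM {1..N} (\<lambda>_. K w)) \<in> borel_measurable F" (is ?m)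
    and "(\<integral>w. f (w, \<lambda>l\<in>{1..N}. Z l w) \<partial>P) = (\<integral>w. (\<integral>z. f (w, z) \<partial>PiM {1..N} (\<lambda>_. K w)) \<partial>P)" (is ?i)
proof -
  interpret prob_space P by fact
  define L where "L = {1..N}"
  let ?\<Pi> = "\<lambda>w. PiM L (\<lambda>_. K w)"
  have finL[simp, intro]: "finite L" by (simp add: L_def)
  define S' where "S' = PiM L (\<lambda>_. S)"
  note f[folded L_def, folded S'_def, measurable]
  note B' = B[folded L_def, folded S'_def]
  have cZ[measurable]: "l \<in> L \<Longrightarrow> Z l \<in> P \<rightarrow>\<^sub>M S" for l
    using Z unfolding cond_iid_def L_def by blast+
  have idF[measurable]: "(\<lambda>w. w) \<in> P \<rightarrow>\<^sub>M F" using F by (auto simp: measurable_def subalgebra_def)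
  have ZmP[measurable]: "(\<lambda>w. (w, \<lambda>l\<in>L. Z l w)) \<in> P \<rightarrow>\<^sub>M F \<Otimes>\<^sub>M S'"
    unfolding S'_def by measurable
  have KP[measurable]: "(\<lambda>w. ?\<Pi> w) \<in> F \<rightarrow>\<^sub>M prob_algebra S'"
    unfolding S'_def by (rule measurable_PiM_kernel[OF _ K]) simp
  have kern: "(\<lambda>w. distr (?\<Pi> w) (F \<Otimes>\<^sub>M S') (Pair w)) \<in> F \<rightarrow>\<^sub>M prob_algebra (F \<Otimes>\<^sub>M S')"
    by measurable
  have kern': "(\<lambda>w. distr (?\<Pi> w) (F \<Otimes>\<^sub>M S') (Pair w)) \<in> restr_to_subalg P F \<rightarrow>\<^sub>M subprob_algebra (F \<Otimes>\<^sub>M S')"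
    using measurable_prob_algebraD[OF kern] measurable_in_subalg[OF F] by blast
  have *: "(\<integral>y. f y \<partial>distr (?\<Pi> w) (F \<Otimes>\<^sub>M S') (Pair w)) = (\<integral>z. f (w, z) \<partial>?\<Pi> w)" if "w \<in> space F" for w
  proof (rule integral_distr)
    have s: "sets (?\<Pi> w) = sets S'" using measurable_space[OF KP that] by (simp add: space_prob_algebra)
    show "Pair w \<in> ?\<Pi> w \<rightarrow>\<^sub>M F \<Otimes>\<^sub>M S'"
      unfolding measurable_cong_sets[OF s refl] using that by measurable
  qed measurable
  have "(\<lambda>w. \<integral>y. f y \<partial>distr (?\<Pi> w) (F \<Otimes>\<^sub>M S') (Pair w)) \<in> borel_measurable F"
    by (rule measurable_compose[OF measurable_prob_algebraD[OF kern] integral_measurable_subprob_algebra]) measurable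
  then have m: "(\<lambda>w. \<integral>z. f (w, z) \<partial>?\<Pi> w) \<in> borel_measurable F"
    by (subst (asm) measurable_cong[OF *]) auto
  then show ?m by (simp only: L_def)
  have fS: "f \<in> borel_measurable (F \<Otimes>\<^sub>M S')" by measurable
  have fin: "finite_measure (restr_to_subalg P F)"
    using finite_measure_restr_to_subalg[OF F] finite_measure_axioms by blast
  define k where "k w = distr (?\<Pi> w) (F \<Otimes>\<^sub>M S') (Pair w)" for w
  have "emeasure (k w) (space (k w)) \<le> ennreal 1" if w: "w \<in> space F" for w
  proof -
    have "prob_space (k w)"
      using measurable_space[OF kern w] by (simp add: space_prob_algebra k_def)
    then show ?thesis by (simp add: prob_space.emeasure_space_1)
  qed
  then have bd: "AE w in restr_to_subalg P F. emeasure (k w) (space (k w)) \<le> ennreal 1"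
    using F by (intro AE_I2) (simp add: space_restr_to_subalg subalgebra_def)
  have "(\<integral>w. f (w, \<lambda>l\<in>L. Z l w) \<partial>P) = (\<integral>y. f y \<partial>distr P (F \<Otimes>\<^sub>M S') (\<lambda>w. (w, \<lambda>l\<in>L. Z l w)))"
    by (rule integral_distr[symmetric]) measurable
  also have "\<dots> = (\<integral>y. f y \<partial>(restr_to_subalg P F \<bind> (\<lambda>w. distr (?\<Pi> w) (F \<Otimes>\<^sub>M S') (Pair w))))"
    using cond_iid_disintegration[OF P F Z K] by (simp only: L_def S'_def)
  also have "\<dots> = (\<integral>w. (\<integral>y. f y \<partial>distr (?\<Pi> w) (F \<Otimes>\<^sub>M S') (Pair w)) \<partial>restr_to_subalg P F)"
    by (rule integral_bind[OF fS B' kern' fin bd[unfolded k_def]])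
  also have "\<dots> = (\<integral>w. (\<integral>z. f (w, z) \<partial>?\<Pi> w) \<partial>restr_to_subalg P F)"
    using F by (intro Bochner_Integration.integral_cong) (auto simp: * space_restr_to_subalg subalgebra_def)
  also have "\<dots> = (\<integral>w. (\<integral>z. f (w, z) \<partial>?\<Pi> w) \<partial>P)"
    by (rule integral_subalgebra2[OF F m])
  finally show ?i by (simp only: L_def)
qed

text \<open>Splits into real and imaginary parts, each bounded by the same \<open>B\<close>. This is
  the form in which the characteristic function of a new average is conditioned on the past.\<close>

lemma cond_iid_integral_complex:
  fixes f :: "'w \<times> (nat \<Rightarrow> 's) \<Rightarrow> complex"
  assumes P: "prob_space P" and F: "subalgebra P F"
    and Z: "cond_iid P F N S Z K" and K: "K \<in> F \<rightarrow>\<^sub>M prob_algebra S"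
    and f[measurable]: "f \<in> borel_measurable (F \<Otimes>\<^sub>M PiM {1..N} (\<lambda>_. S))"
    and B: "\<And>x. x \<in> space (F \<Otimes>\<^sub>M PiM {1..N} (\<lambda>_. S)) \<Longrightarrow> cmod (f x) \<le> B"
  shows "(\<integral>w. f (w, \<lambda>l\<in>{1..N}. Z l w) \<partial>P) = (\<integral>w. (\<integral>z. f (w, z) \<partial>PiM {1..N} (\<lambda>_. K w)) \<partial>P)"
proof -
  interpret prob_space P by fact
  define L where "L = {1..N}"
  let ?\<Pi> = "\<lambda>w. PiM L (\<lambda>_. K w)"
  have finL[simp, intro]: "finite L" by (simp add: L_def)
  define S' where "S' = PiM L (\<lambda>_. S)"
  have fL[measurable]: "f \<in> borel_measurable (F \<Otimes>\<^sub>M S')" using f by (simp add: S'_def L_def)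
  note B' = B[folded L_def, folded S'_def]
  have sF: "space F = space P" using F by (simp add: subalgebra_def)
  have cZ[measurable]: "l \<in> L \<Longrightarrow> Z l \<in> P \<rightarrow>\<^sub>M S" for l
    using Z unfolding cond_iid_def L_def by blast+
  have idF[measurable]: "(\<lambda>w. w) \<in> P \<rightarrow>\<^sub>M F" using F by (auto simp: measurable_def subalgebra_def)
  have ZmP[measurable]: "(\<lambda>w. (w, \<lambda>l\<in>L. Z l w)) \<in> P \<rightarrow>\<^sub>M F \<Otimes>\<^sub>M S'"
    unfolding S'_def by measurable
  have KP[measurable]: "(\<lambda>w. ?\<Pi> w) \<in> F \<rightarrow>\<^sub>M prob_algebra S'"
    unfolding S'_def by (rule measurable_PiM_kernel[OF _ K]) simp
  have KP': "prob_space (?\<Pi> w)" "sets (?\<Pi> w) = sets S'" "space (?\<Pi> w) = space S'" if "w \<in> space P" for w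
    using measurable_space[OF KP] that by (auto simp: space_prob_algebra sF dest: sets_eq_imp_space_eq)
  have ReIm: "\<bar>Re (f x)\<bar> \<le> B" "\<bar>Im (f x)\<bar> \<le> B" if "x \<in> space (F \<Otimes>\<^sub>M S')" for x
    using B'[OF that] abs_Re_le_cmod[of "f x"] abs_Im_le_cmod[of "f x"] by auto
  have in1: "integrable P (\<lambda>w. f (w, \<lambda>l\<in>L. Z l w))"
  proof (rule integrable_const_bound[of _ B])
    show "AE w in P. cmod (f (w, \<lambda>l\<in>L. Z l w)) \<le> B"
      by (rule AE_I2) (rule B'[OF measurable_space[OF ZmP]])
    show "(\<lambda>w. f (w, \<lambda>l\<in>L. Z l w)) \<in> borel_measurable P"
      using measurable_compose[OF ZmP fL] .
  qed
  have in2: "integrable (?\<Pi> w) (\<lambda>z. f (w, z))" if w: "w \<in> space P" for w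
  proof -
    interpret X: prob_space "?\<Pi> w" using KP' w by auto
    show ?thesis
    proof (rule X.integrable_const_bound[of _ B])
      show "AE z in ?\<Pi> w. cmod (f (w, z)) \<le> B"
        using w KP'(3)[OF w] by (intro AE_I2 B') (auto simp: space_pair_measure sF)
      show "(\<lambda>z. f (w, z)) \<in> borel_measurable (?\<Pi> w)"
        unfolding measurable_cong_sets[OF KP'(2)[OF w] refl]
        using w by (intro measurable_compose[OF measurable_Pair1' fL]) (simp add: sF)
    qed
  qed
  note re = cond_iid_integral_real[OF P F Z K, of "\<lambda>x. Re (f x)" B, folded L_def, folded S'_def]
  note im = cond_iid_integral_real[OF P F Z K, of "\<lambda>x. Im (f x)" B, folded L_def, folded S'_def]
  have mre: "(\<lambda>w. \<integral>z. Re (f (w, z)) \<partial>?\<Pi> w) \<in> borel_measurable P"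
    and mim: "(\<lambda>w. \<integral>z. Im (f (w, z)) \<partial>?\<Pi> w) \<in> borel_measurable P"
    using re(1) im(1) ReIm by (auto intro!: measurable_from_subalg[OF F])
  have eq: "(\<integral>z. f (w, z) \<partial>?\<Pi> w) = Complex (\<integral>z. Re (f (w, z)) \<partial>?\<Pi> w) (\<integral>z. Im (f (w, z)) \<partial>?\<Pi> w)"
    if w: "w \<in> space P" for w
    using in2[OF w] by (simp add: complex_eq_iff integral_Re integral_Im)
  have mc: "(\<lambda>w. (\<integral>z. f (w, z) \<partial>?\<Pi> w)) \<in> borel_measurable P"
    by (subst measurable_cong[OF eq]) (use mre mim in \<open>auto simp: complex_eq_iff Complex_eq\<close>)
  have bc: "cmod (\<integral>z. f (w, z) \<partial>?\<Pi> w) \<le> B" if w: "w \<in> space P" for w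
  proof -
    interpret X: prob_space "?\<Pi> w" using KP' w by auto
    have "cmod (\<integral>z. f (w, z) \<partial>?\<Pi> w) \<le> (\<integral>z. cmod (f (w, z)) \<partial>?\<Pi> w)"
      by (rule integral_norm_bound)
    also have "\<dots> \<le> (\<integral>z. B \<partial>?\<Pi> w)"
      using in2[OF w] B' w KP'(3)[OF w] by (intro integral_mono) (auto simp: space_pair_measure sF)
    finally show ?thesis by (simp add: X.prob_space)
  qed
  have in3: "integrable P (\<lambda>w. \<integral>z. f (w, z) \<partial>?\<Pi> w)"
    using mc bc by (intro integrable_const_bound[of _ B]) auto
  have "(\<integral>w. f (w, \<lambda>l\<in>L. Z l w) \<partial>P) = (\<integral>w. (\<integral>z. f (w, z) \<partial>?\<Pi> w) \<partial>P)"
  proof (rule complex_eqI)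
    have "Re (\<integral>w. f (w, \<lambda>l\<in>L. Z l w) \<partial>P) = (\<integral>w. Re (f (w, \<lambda>l\<in>L. Z l w)) \<partial>P)"
      by (rule integral_Re[OF in1, symmetric])
    also have "\<dots> = (\<integral>w. (\<integral>z. Re (f (w, z)) \<partial>?\<Pi> w) \<partial>P)"
      by (rule re(2)) (use ReIm in auto)
    also have "\<dots> = (\<integral>w. Re (\<integral>z. f (w, z) \<partial>?\<Pi> w) \<partial>P)"
      by (intro Bochner_Integration.integral_cong refl integral_Re in2)
    also have "\<dots> = Re (\<integral>w. (\<integral>z. f (w, z) \<partial>?\<Pi> w) \<partial>P)"
      by (rule integral_Re[OF in3])
    finally show "Re (\<integral>w. f (w, \<lambda>l\<in>L. Z l w) \<partial>P) = Re (\<integral>w. (\<integral>z. f (w, z) \<partial>?\<Pi> w) \<partial>P)" .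
  next
    have "Im (\<integral>w. f (w, \<lambda>l\<in>L. Z l w) \<partial>P) = (\<integral>w. Im (f (w, \<lambda>l\<in>L. Z l w)) \<partial>P)"
      by (rule integral_Im[OF in1, symmetric])
    also have "\<dots> = (\<integral>w. (\<integral>z. Im (f (w, z)) \<partial>?\<Pi> w) \<partial>P)"
      by (rule im(2)) (use ReIm in auto)
    also have "\<dots> = (\<integral>w. Im (\<integral>z. f (w, z) \<partial>?\<Pi> w) \<partial>P)"
      by (intro Bochner_Integration.integral_cong refl integral_Im in2)
    also have "\<dots> = Im (\<integral>w. (\<integral>z. f (w, z) \<partial>?\<Pi> w) \<partial>P)"
      by (rule integral_Im[OF in3])
    finally show "Im (\<integral>w. f (w, \<lambda>l\<in>L. Z l w) \<partial>P) = Im (\<integral>w. (\<integral>z. f (w, z) \<partial>?\<Pi> w) \<partial>P)" .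
  qed
  then show ?thesis by (simp only: L_def)
qed

section \<open>Moments and characteristic functions of i.i.d. sums, and one conditional sampling
  step\<close>

lemma iid_sum_variance:
  fixes g :: "'s \<Rightarrow> real"
  assumes K: "prob_space K" and L: "finite L" and g[measurable]: "g \<in> borel_measurable K"
    and B: "\<And>z. z \<in> space K \<Longrightarrow> \<bar>g z\<bar> \<le> B" and zero: "(\<integral>z. g z \<partial>K) = 0"
  shows "(\<integral>z. (\<Sum>l\<in>L. g (z l))\<^sup>2 \<partial>PiM L (\<lambda>_. K)) = real (card L) * (\<integral>z. (g z)\<^sup>2 \<partial>K)"
proof -
  interpret K: prob_space K by fact
  interpret product_prob_space "\<lambda>_. K" L
    using K by (simp add: product_prob_space_def product_prob_space_axioms_def product_sigma_finite_def prob_space_imp_sigma_finite)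
  have ig: "integrable K g" using B by (intro K.integrable_const_bound[of _ B]) auto
  have B2: "\<bar>g z * g y\<bar> \<le> B * B" if "z \<in> space K" "y \<in> space K" for z y
    unfolding abs_mult using B[OF that(1)] B[OF that(2)] by (intro mult_mono) auto
  have int: "integrable (PiM L (\<lambda>_. K)) (\<lambda>z. g (z i) * g (z j))" if "i \<in> L" "j \<in> L" for i j
    using that B2 by (intro integrable_const_bound[of _ "B * B"]) (auto simp: space_PiM PiE_iff)
  have cov: "(\<integral>z. g (z i) * g (z j) \<partial>PiM L (\<lambda>_. K)) = (if i = j then (\<integral>z. (g z)\<^sup>2 \<partial>K) else 0)"
    if ij: "i \<in> L" "j \<in> L" for i j
  proof (cases "i = j")
    case True
    have "(\<integral>z. (g z)\<^sup>2 \<partial>K) = (\<integral>z. (g z)\<^sup>2 \<partial>distr (PiM L (\<lambda>_. K)) K (\<lambda>z. z i))"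
      using PiM_component[OF ij(1)] by simp
    also have "\<dots> = (\<integral>z. (g (z i))\<^sup>2 \<partial>PiM L (\<lambda>_. K))"
      using ij by (intro integral_distr) auto
    finally show ?thesis using True by (simp add: power2_eq_square)
  next
    case False
    \<comment> \<open>The product of two coordinates is written as a product over all of
      \<open>L\<close>, padded with ones, so that the integral factorises over the whole product
      measure.\<close>
    define f where "f l = (if l = i \<or> l = j then g else (\<lambda>_. 1))" for l
    have "(\<Prod>l\<in>L. f l (z l)) = g (z i) * g (z j)" for z
    proof -
      have "(\<Prod>l\<in>L. f l (z l)) = f i (z i) * (f j (z j) * (\<Prod>l\<in>L - {i} - {j}. f l (z l)))"
        using L ij False by (simp add: prod.remove[of L i] prod.remove[of "L - {i}" j])
      also have "(\<Prod>l\<in>L - {i} - {j}. f l (z l)) = 1" by (intro prod.neutral) (auto simp: f_def)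
      finally show ?thesis by (simp add: f_def)
    qed
    then have "(\<integral>z. g (z i) * g (z j) \<partial>PiM L (\<lambda>_. K)) = (\<Prod>l\<in>L. \<integral>z. f l z \<partial>K)"
      using product_integral_prod[OF L, of f] ig by (simp add: f_def)
    also have "\<dots> = 0" using L ij zero by (auto simp: f_def intro!: prod_zero)
    finally show ?thesis using False by simp
  qed
  have "(\<integral>z. (\<Sum>l\<in>L. g (z l))\<^sup>2 \<partial>PiM L (\<lambda>_. K)) = (\<integral>z. (\<Sum>i\<in>L. \<Sum>j\<in>L. g (z i) * g (z j)) \<partial>PiM L (\<lambda>_. K))"
    by (simp add: power2_eq_square sum_product)
  also have "\<dots> = (\<Sum>i\<in>L. \<Sum>j\<in>L. \<integral>z. g (z i) * g (z j) \<partial>PiM L (\<lambda>_. K))"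
    using int by (simp add: Bochner_Integration.integral_sum)
  also have "\<dots> = (\<Sum>i\<in>L. \<Sum>j\<in>L. if i = j then (\<integral>z. (g z)\<^sup>2 \<partial>K) else 0)"
    by (intro sum.cong refl cov)
  also have "\<dots> = real (card L) * (\<integral>z. (g z)\<^sup>2 \<partial>K)" using L by (simp add: sum.delta)
  finally show ?thesis .
qed

text \<open>Both the characteristic function and the Gaussian factor are compared with 1 - u^2 V /
  2: the former by Taylor expansion with a third moment remainder, the latter by a bound on exp(-x).
  At u = t / \<surd>N the errors are of order N^(-3/2) and N^(-2), so even after N factors the total
  is O(1/\<surd>N). A vanishing \<open>V\<close> is included, since nothing is divided by the
  standard deviation.\<close>

lemma char_gauss_approx:
  fixes Y :: "'s \<Rightarrow> real"
  assumes K: "prob_space K" and [measurable]: "Y \<in> borel_measurable K"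
    and D: "\<And>z. z \<in> space K \<Longrightarrow> \<bar>Y z\<bar> \<le> D" and zero: "(\<integral>z. Y z \<partial>K) = 0"
    and V: "V = (\<integral>z. (Y z)\<^sup>2 \<partial>K)"
  shows "cmod ((\<integral>z. iexp (u * Y z) \<partial>K) - exp (- (u\<^sup>2 * V / 2))) \<le> \<bar>u\<bar> ^ 3 * D ^ 3 / 6 + u ^ 4 * D ^ 4 / 8"
proof -
  interpret K: prob_space K by fact
  have D0: "0 \<le> D" using D K.not_empty by fastforce
  have D2: "(Y z)\<^sup>2 \<le> D\<^sup>2" if "z \<in> space K" for z using D[OF that] by (metis abs_ge_zero power2_abs power_mono)
  have D3: "\<bar>Y z\<bar>^3 \<le> D^3" if "z \<in> space K" for z using D[OF that] by (metis abs_ge_zero power_mono)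
  have i1: "integrable K Y" using D by (intro K.integrable_const_bound[of _ D]) auto
  have i2: "integrable K (\<lambda>z. (Y z)\<^sup>2)" using D2 by (intro K.integrable_const_bound[of _ "D\<^sup>2"]) auto
  have V0: "0 \<le> V" unfolding V by simp
  have V2: "V \<le> D\<^sup>2" unfolding V using i2 D2 by (intro K.integral_le_const) auto
  have "cmod (char (distr K borel Y) u - (1 - u\<^sup>2 * V / 2)) \<le> (u\<^sup>2 / 6) * (\<integral>z. min (6 * (Y z)\<^sup>2) (\<bar>u\<bar> * \<bar>Y z\<bar>^3) \<partial>K)"
    using i1 i2 zero V by (intro K.char_approx3') auto
  also have "\<dots> \<le> (u\<^sup>2 / 6) * (\<bar>u\<bar> * D ^ 3)"
  proof (intro mult_left_mono K.integral_le_const AE_I2)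
    show "min (6 * (Y z)\<^sup>2) (\<bar>u\<bar> * \<bar>Y z\<bar>^3) \<le> \<bar>u\<bar> * D ^ 3" if "z \<in> space K" for z
      using D3[OF that] by (intro min.coboundedI2 mult_left_mono) auto
    show "integrable K (\<lambda>z. min (6 * (Y z)\<^sup>2) (\<bar>u\<bar> * \<bar>Y z\<bar>^3))"
      using D2 by (intro K.integrable_const_bound[of _ "6 * D\<^sup>2"]) (auto intro!: AE_I2 min.coboundedI1 simp: abs_of_nonneg)
  qed auto
  also have "\<dots> = \<bar>u\<bar> ^ 3 * D ^ 3 / 6"
    by (simp add: power3_eq_cube power2_eq_square)
  finally have 1: "cmod (char (distr K borel Y) u - (1 - u\<^sup>2 * V / 2)) \<le> \<bar>u\<bar> ^ 3 * D ^ 3 / 6" .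
  \<comment> \<open>The third order Lagrange remainder of exp(-x) is non-positive for x \<ge> 0,
    which gives the upper bound; the lower bound is convexity.\<close>
  have e: "\<bar>exp (- x) - (1 - x)\<bar> \<le> x\<^sup>2 / 2" if "0 \<le> x" for x :: real
  proof -
    have "exp (-x) \<le> 1 - x + x\<^sup>2 / 2"
    proof (cases "x = 0")
      case False
      then obtain t where t: "\<bar>t\<bar> \<le> \<bar>- x\<bar>" "exp (-x) = (\<Sum>m<3. (-x) ^ m / fact m) + exp t / fact 3 * (-x) ^ 3"
        using Maclaurin_exp_le[of "-x" 3] by blast
      have "0 \<le> exp t / fact 3 * x ^ 3" using that by (intro mult_nonneg_nonneg) auto
      then show ?thesis using t(2) by (simp add: eval_nat_numeral algebra_simps)
    qed simp
    moreover have "1 - x \<le> exp (-x)" using exp_ge_add_one_self[of "-x"] by simp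
    ultimately show ?thesis by simp
  qed
  have "\<bar>exp (- (u\<^sup>2 * V / 2)) - (1 - u\<^sup>2 * V / 2)\<bar> \<le> (u\<^sup>2 * V / 2)\<^sup>2 / 2"
    using V0 by (intro e) auto
  also have "\<dots> = u ^ 4 * V\<^sup>2 / 8" by (simp add: field_simps power2_eq_square power4_eq_xxxx)
  also have "\<dots> \<le> u ^ 4 * (D\<^sup>2)\<^sup>2 / 8" using V0 V2 by (intro divide_right_mono mult_left_mono power_mono) auto
  finally have "\<bar>exp (- (u\<^sup>2 * V / 2)) - (1 - u\<^sup>2 * V / 2)\<bar> \<le> u ^ 4 * D ^ 4 / 8" by simp
  then have 2: "cmod (complex_of_real (exp (- (u\<^sup>2 * V / 2))) - (1 - u\<^sup>2 * V / 2)) \<le> u ^ 4 * D ^ 4 / 8"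
    by (metis norm_of_real of_real_diff of_real_1)
  have c: "char (distr K borel Y) u = (\<integral>z. iexp (u * Y z) \<partial>K)"
    unfolding char_def by (subst integral_distr) auto
  show ?thesis using norm_triangle_ineq4[of "char (distr K borel Y) u - (1 - u\<^sup>2 * V / 2)" "complex_of_real (exp (- (u\<^sup>2 * V / 2))) - (1 - u\<^sup>2 * V / 2)"] 1 2
    unfolding c[symmetric] by (simp add: exp_of_real)
qed

text \<open>Pushing \<open>K w\<close> forward along \<open>Pair w\<close> turns an integrand that
  varies with \<open>w\<close> into one fixed function on the product space, whose integral against
  a kernel is measurable.\<close>

lemma borel_measurable_kernel_integral:
  fixes f :: "'w \<times> 's \<Rightarrow> 'b :: {banach, second_countable_topology}"
  assumes K: "K \<in> F \<rightarrow>\<^sub>M prob_algebra S" and f: "f \<in> borel_measurable (F \<Otimes>\<^sub>M S)"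
  shows "(\<lambda>w. \<integral>z. f (w, z) \<partial>K w) \<in> borel_measurable F"
proof -
  note K[measurable]
  have kern: "(\<lambda>w. distr (K w) (F \<Otimes>\<^sub>M S) (Pair w)) \<in> F \<rightarrow>\<^sub>M prob_algebra (F \<Otimes>\<^sub>M S)"
    by measurable
  have *: "(\<integral>y. f y \<partial>distr (K w) (F \<Otimes>\<^sub>M S) (Pair w)) = (\<integral>z. f (w, z) \<partial>K w)" if "w \<in> space F" for w
  proof (rule integral_distr[OF _ f])
    have s: "sets (K w) = sets S" using measurable_space[OF K that] by (simp add: space_prob_algebra)
    show "Pair w \<in> K w \<rightarrow>\<^sub>M F \<Otimes>\<^sub>M S"
      unfolding measurable_cong_sets[OF s refl] using that by measurable
  qed
  have "(\<lambda>w. \<integral>y. f y \<partial>distr (K w) (F \<Otimes>\<^sub>M S) (Pair w)) \<in> borel_measurable F"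
    by (rule measurable_compose[OF measurable_prob_algebraD[OF kern] integral_measurable_subprob_algebra[OF f]])
  then show ?thesis
    by (subst (asm) measurable_cong[OF *]) auto
qed

text \<open>Given the past, the deviation from the conditional mean is a centred i.i.d. average. The
  first claim is its variance. In the second, the factor \<open>U\<close> may be any bounded
  function of the past; it is later the exponential of the fluctuation of the conditional mean, so
  that the two sources of noise are separated within one expectation. The third is the law of a
  single new particle, used for error bounds by second moments. The function \<open>m\<close> is an
  everywhere defined and bounded version of the conditional mean, which is only known almost
  everywhere.\<close>

lemma cond_iid_step:
  fixes G :: "'w \<times> 's \<Rightarrow> real" and m :: "'w \<Rightarrow> real"
  assumes P: "prob_space P" and F: "subalgebra P F" and N: "1 \<le> N"
    and Z: "cond_iid P F N S Z K" and K: "K \<in> F \<rightarrow>\<^sub>M prob_algebra S"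
    and G[measurable]: "G \<in> borel_measurable (F \<Otimes>\<^sub>M S)"
    and C: "\<And>x. x \<in> space (F \<Otimes>\<^sub>M S) \<Longrightarrow> \<bar>G x\<bar> \<le> C" and C0: "0 \<le> C"
    and m[measurable]: "m \<in> borel_measurable F" and mC: "\<And>w. w \<in> space F \<Longrightarrow> \<bar>m w\<bar> \<le> C"
    and mean: "AE w in P. (\<integral>z. G (w, z) \<partial>K w) = m w"
  shows "(\<integral>w. ((\<Sum>l\<in>{1..N}. G (w, Z l w)) / N - m w)\<^sup>2 \<partial>P) \<le> (\<integral>w. (\<integral>z. (G (w, z))\<^sup>2 \<partial>K w) \<partial>P) / N" (is ?l2)
    and "\<And>U t. U \<in> borel_measurable F \<Longrightarrow> (\<And>w. w \<in> space F \<Longrightarrow> cmod (U w) \<le> 1) \<Longrightarrow>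
      cmod ((\<integral>w. U w * iexp (t * (sqrt N * ((\<Sum>l\<in>{1..N}. G (w, Z l w)) / N - m w))) \<partial>P)
        - (\<integral>w. U w * complex_of_real (exp (- (t\<^sup>2 * ((\<integral>z. (G (w, z))\<^sup>2 \<partial>K w) - (m w)\<^sup>2) / 2))) \<partial>P))
      \<le> (\<bar>t\<bar> ^ 3 * (2 * C) ^ 3 / 6 + t ^ 4 * (2 * C) ^ 4 / 8) / sqrt N"
    and "\<And>f. f \<in> borel_measurable (F \<Otimes>\<^sub>M S) \<Longrightarrow> (\<And>x. x \<in> space (F \<Otimes>\<^sub>M S) \<Longrightarrow> \<bar>f x\<bar> \<le> C) \<Longrightarrow>
      (\<integral>w. f (w, Z 1 w) \<partial>P) = (\<integral>w. (\<integral>z. f (w, z) \<partial>K w) \<partial>P)"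
proof -
  interpret prob_space P by fact
  define L where "L = {1..N}"
  let ?\<Pi> = "\<lambda>w. PiM L (\<lambda>_. K w)"
  have L[simp, intro]: "finite L" and cL: "card L = N" and L1: "1 \<in> L" using N by (auto simp: L_def)
  define S' where "S' = PiM L (\<lambda>_. S)"
  have sF: "space F = space P" using F by (simp add: subalgebra_def)
  have K': "prob_space (K w)" "sets (K w) = sets S" "space (K w) = space S" if "w \<in> space F" for w
    using measurable_space[OF K that] by (auto simp: space_prob_algebra dest: sets_eq_imp_space_eq)
  have KP[measurable]: "(\<lambda>w. ?\<Pi> w) \<in> F \<rightarrow>\<^sub>M prob_algebra S'"
    unfolding S'_def by (rule measurable_PiM_kernel[OF _ K]) simp
  have KP': "prob_space (?\<Pi> w)" "sets (?\<Pi> w) = sets S'" "space (?\<Pi> w) = space S'" if "w \<in> space F" for w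
    using measurable_space[OF KP that] by (auto simp: space_prob_algebra dest: sets_eq_imp_space_eq)
  have Gw: "(\<lambda>z. G (w, z)) \<in> borel_measurable (K w)" if "w \<in> space F" for w
    using that by (simp add: measurable_cong_sets[OF K'(2)[OF that] refl])
  have CG: "\<bar>G (w, z)\<bar> \<le> C" if "w \<in> space F" "z \<in> space (K w)" for w z
    using that K' by (intro C) (auto simp: space_pair_measure)
  have iG: "integrable (K w) (\<lambda>z. G (w, z))" "integrable (K w) (\<lambda>z. (G (w, z))\<^sup>2)" if w: "w \<in> space F" for w
  proof -
    interpret X: prob_space "K w" using K' w by auto
    have [measurable]: "(\<lambda>z. G (w, z)) \<in> borel_measurable (K w)" by (rule Gw[OF w])
    show "integrable (K w) (\<lambda>z. G (w, z))"
      using CG[OF w] by (intro X.integrable_const_bound[of _ C]) auto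
    have "(G (w, z))\<^sup>2 \<le> C\<^sup>2" if "z \<in> space (K w)" for z
      using CG[OF w that] C0 by (simp add: abs_le_square_iff[symmetric])
    then show "integrable (K w) (\<lambda>z. (G (w, z))\<^sup>2)"
      by (intro X.integrable_const_bound[of _ "C\<^sup>2"]) auto
  qed
  have comp: "(\<lambda>x. (fst x, snd x l)) \<in> F \<Otimes>\<^sub>M S' \<rightarrow>\<^sub>M F \<Otimes>\<^sub>M S" if "l \<in> L" for l
    using that unfolding S'_def by measurable
  have spS: "z l \<in> space S" if "z \<in> space S'" "l \<in> L" for z l using that by (auto simp: S'_def space_PiM)
  have Gl[measurable]: "(\<lambda>x. G (fst x, snd x l)) \<in> borel_measurable (F \<Otimes>\<^sub>M S')" if "l \<in> L" for l
    using measurable_compose[OF comp[OF that] G] by simp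
  have mx[measurable]: "(\<lambda>x. m (fst x)) \<in> borel_measurable (F \<Otimes>\<^sub>M S')" by measurable
  define dev where "dev x = (\<Sum>l\<in>L. G (fst x, snd x l)) / N - m (fst x)" for x
  have dev[measurable]: "dev \<in> borel_measurable (F \<Otimes>\<^sub>M S')" unfolding dev_def[abs_def] by measurable
  have devC: "\<bar>dev x\<bar> \<le> 2 * C" if "x \<in> space (F \<Otimes>\<^sub>M S')" for x
  proof -
    have "\<bar>\<Sum>l\<in>L. G (fst x, snd x l)\<bar> \<le> (\<Sum>l\<in>L. C)"
      using that spS by (intro order_trans[OF sum_abs] sum_mono C) (auto simp: space_pair_measure)
    then have "\<bar>(\<Sum>l\<in>L. G (fst x, snd x l)) / N\<bar> \<le> C" using N by (simp add: cL field_simps)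
    moreover have "\<bar>m (fst x)\<bar> \<le> C" using that by (intro mC) (auto simp: space_pair_measure)
    ultimately show ?thesis unfolding dev_def
      by (intro order_trans[OF abs_triangle_ineq4]) simp
  qed
  \<comment> \<open>Writing the deviation as a sum of centred terms makes it a function of the new
    sample to which the i.i.d. computations apply for a fixed past.\<close>
  have devN: "dev (w, z) = (\<Sum>l\<in>L. G (w, z l) - m w) / N" for w z
    using N by (simp add: dev_def sum_subtractf cL field_simps)
  have K1: "prob_space.expectation (K w) (\<lambda>z. G (w, z) - m w) = 0"
      "(\<integral>z. (G (w, z) - m w)\<^sup>2 \<partial>K w) = (\<integral>z. (G (w, z))\<^sup>2 \<partial>K w) - (m w)\<^sup>2"
    if w: "w \<in> space F" and e: "(\<integral>z. G (w, z) \<partial>K w) = m w" for w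
  proof -
    interpret X: prob_space "K w" using K' w by auto
    show "X.expectation (\<lambda>z. G (w, z) - m w) = 0" using iG[OF w] e by (simp add: X.prob_space)
    have "(\<integral>z. (G (w, z) - m w)\<^sup>2 \<partial>K w) = (\<integral>z. (G (w, z))\<^sup>2 - 2 * m w * G (w, z) + (m w)\<^sup>2 \<partial>K w)"
      by (intro Bochner_Integration.integral_cong) (auto simp: power2_eq_square algebra_simps)
    also have "\<dots> = (\<integral>z. (G (w, z))\<^sup>2 \<partial>K w) - (m w)\<^sup>2"
      using iG[OF w] e by (simp add: X.prob_space power2_eq_square)
    finally show "(\<integral>z. (G (w, z) - m w)\<^sup>2 \<partial>K w) = (\<integral>z. (G (w, z))\<^sup>2 \<partial>K w) - (m w)\<^sup>2" .
  qed
  have Y: "(\<lambda>z. G (w, z) - m w) \<in> borel_measurable (K w)" "\<And>z. z \<in> space (K w) \<Longrightarrow> \<bar>G (w, z) - m w\<bar> \<le> 2 * C"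
    if "w \<in> space F" for w
    using Gw[OF that] mC[OF that] by (auto intro!: abs_triangle_ineq4[THEN order_trans] dest!: CG[OF that])
  have AEF: "AE w in P. w \<in> space F \<and> (\<integral>z. G (w, z) \<partial>K w) = m w" using mean by (auto simp: sF)
  have G2m: "(\<lambda>w. \<integral>z. (G (w, z))\<^sup>2 \<partial>K w) \<in> borel_measurable F"
    using borel_measurable_kernel_integral[OF K, of "\<lambda>x. (G x)\<^sup>2"] by simp
  have G2b: "\<bar>\<integral>z. (G (w, z))\<^sup>2 \<partial>K w\<bar> \<le> C\<^sup>2" if w: "w \<in> space F" for w
  proof -
    interpret X: prob_space "K w" using K' w by auto
    have "(\<integral>z. (G (w, z))\<^sup>2 \<partial>K w) \<le> C\<^sup>2"
      using iG[OF w] CG[OF w] C0 by (intro X.integral_le_const) (auto intro!: AE_I2 simp: abs_le_square_iff[symmetric])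
    then show ?thesis by simp
  qed
  have FP: "f \<in> borel_measurable F \<Longrightarrow> f \<in> borel_measurable P" for f :: "'w \<Rightarrow> real"
    by (rule measurable_from_subalg[OF F])
  note tr = cond_iid_integral_real[OF P F Z K, folded L_def, folded S'_def]
  note tc = cond_iid_integral_complex[OF P F Z K, folded L_def, folded S'_def]
  show ?l2
  proof -
    have b: "\<bar>(dev x)\<^sup>2\<bar> \<le> (2 * C)\<^sup>2" if "x \<in> space (F \<Otimes>\<^sub>M S')" for x
      using power_mono[OF devC[OF that] abs_ge_zero, of 2] by simp
    have "(\<integral>w. (dev (w, \<lambda>l\<in>L. Z l w))\<^sup>2 \<partial>P) = (\<integral>w. (\<integral>z. (dev (w, z))\<^sup>2 \<partial>?\<Pi> w) \<partial>P)"
      using b by (intro tr(2)) auto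
    also have "\<dots> \<le> (\<integral>w. (\<integral>z. (G (w, z))\<^sup>2 \<partial>K w) / N \<partial>P)"
    proof (rule integral_mono_AE)
      have "(\<lambda>w. \<integral>z. (dev (w, z))\<^sup>2 \<partial>?\<Pi> w) \<in> borel_measurable F"
        using b by (intro tr(1)) auto
      moreover have "\<bar>\<integral>z. (dev (w, z))\<^sup>2 \<partial>?\<Pi> w\<bar> \<le> (2 * C)\<^sup>2" if w: "w \<in> space F" for w
      proof -
        interpret X: prob_space "?\<Pi> w" using KP' w by auto
        have [measurable]: "(\<lambda>z. dev (w, z)) \<in> borel_measurable (?\<Pi> w)"
          using w by (simp add: measurable_cong_sets[OF KP'(2)[OF w] refl])
        have bb: "AE z in ?\<Pi> w. (dev (w, z))\<^sup>2 \<le> (2 * C)\<^sup>2"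
          using b w KP'(3)[OF w] by (intro AE_I2) (auto simp: space_pair_measure)
        have "(\<integral>z. (dev (w, z))\<^sup>2 \<partial>?\<Pi> w) \<le> (2 * C)\<^sup>2"
          using bb by (intro X.integral_le_const X.integrable_const_bound[of _ "(2 * C)\<^sup>2"]) auto
        then show ?thesis by simp
      qed
      ultimately show "integrable P (\<lambda>w. \<integral>z. (dev (w, z))\<^sup>2 \<partial>?\<Pi> w)"
        by (intro integrable_const_bound[of _ "(2 * C)\<^sup>2"] FP) (auto simp: sF)
      show "integrable P (\<lambda>w. (\<integral>z. (G (w, z))\<^sup>2 \<partial>K w) / N)"
        using G2m G2b by (intro integrable_divide integrable_const_bound[of _ "C\<^sup>2"] FP) (auto simp: sF)
      show "AE w in P. (\<integral>z. (dev (w, z))\<^sup>2 \<partial>?\<Pi> w) \<le> (\<integral>z. (G (w, z))\<^sup>2 \<partial>K w) / N"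
        using AEF
      proof (rule AE_mp, intro AE_I2 impI, elim conjE)
        fix w assume w: "w \<in> space F" and e: "(\<integral>z. G (w, z) \<partial>K w) = m w"
        have "(\<integral>z. (dev (w, z))\<^sup>2 \<partial>?\<Pi> w) = (\<integral>z. (\<Sum>l\<in>L. G (w, z l) - m w)\<^sup>2 \<partial>?\<Pi> w) / N\<^sup>2"
          by (simp add: devN power_divide)
        also have "\<dots> = real (card L) * (\<integral>z. (G (w, z) - m w)\<^sup>2 \<partial>K w) / N\<^sup>2"
          using iid_sum_variance[OF K'(1)[OF w] L Y[OF w] K1(1)[OF w e]] by simp
        also have "\<dots> = (\<integral>z. (G (w, z) - m w)\<^sup>2 \<partial>K w) / N"
          using N by (simp add: cL power2_eq_square)
        also have "\<dots> \<le> (\<integral>z. (G (w, z))\<^sup>2 \<partial>K w) / N"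
          unfolding K1(2)[OF w e] by (intro divide_right_mono) auto
        finally show "(\<integral>z. (dev (w, z))\<^sup>2 \<partial>?\<Pi> w) \<le> (\<integral>z. (G (w, z))\<^sup>2 \<partial>K w) / N" .
      qed
    qed
    also have "\<dots> = (\<integral>w. (\<integral>z. (G (w, z))\<^sup>2 \<partial>K w) \<partial>P) / N" by simp
    finally show ?thesis by (simp add: dev_def L_def del: One_nat_def)
  qed
  show "(\<integral>w. f (w, Z 1 w) \<partial>P) = (\<integral>w. (\<integral>z. f (w, z) \<partial>K w) \<partial>P)"
    if f[measurable]: "f \<in> borel_measurable (F \<Otimes>\<^sub>M S)" and b: "\<And>x. x \<in> space (F \<Otimes>\<^sub>M S) \<Longrightarrow> \<bar>f x\<bar> \<le> C" for f
  proof -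
    have "(\<integral>w. f (w, Z 1 w) \<partial>P) = (\<integral>w. (\<integral>z. f (w, z 1) \<partial>?\<Pi> w) \<partial>P)"
      using tr(2)[of "\<lambda>x. f (fst x, snd x 1)" C] measurable_compose[OF comp[OF L1] f] b L1 spS
      by (auto simp: space_pair_measure)
    also have "\<dots> = (\<integral>w. (\<integral>z. f (w, z) \<partial>K w) \<partial>P)"
    proof (intro Bochner_Integration.integral_cong refl)
      fix w assume "w \<in> space P" then have w: "w \<in> space F" by (simp add: sF)
      interpret product_prob_space "\<lambda>_. K w" L
        using K'(1)[OF w] by (simp add: product_prob_space_def product_prob_space_axioms_def product_sigma_finite_def prob_space_imp_sigma_finite)
      have "(\<integral>z. f (w, z) \<partial>K w) = (\<integral>z. f (w, z) \<partial>distr (?\<Pi> w) (K w) (\<lambda>z. z 1))"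
        using PiM_component[OF L1] by simp
      also have "\<dots> = (\<integral>z. f (w, z 1) \<partial>?\<Pi> w)"
        using L1 w by (intro integral_distr) (auto simp: measurable_cong_sets[OF K'(2)[OF w] refl])
      finally show "(\<integral>z. f (w, z 1) \<partial>?\<Pi> w) = (\<integral>z. f (w, z) \<partial>K w)" ..
    qed
    finally show ?thesis .
  qed
  fix U :: "'w \<Rightarrow> complex" and t :: real
  assume U[measurable]: "U \<in> borel_measurable F" and U1: "\<And>w. w \<in> space F \<Longrightarrow> cmod (U w) \<le> 1"
  define V where "V w = (\<integral>z. (G (w, z))\<^sup>2 \<partial>K w) - (m w)\<^sup>2" for w
  have Vm[measurable]: "V \<in> borel_measurable F" unfolding V_def[abs_def] using G2m by measurable
  define R where "R = (\<bar>t\<bar> ^ 3 * (2 * C) ^ 3 / 6 + t ^ 4 * (2 * C) ^ 4 / 8) / sqrt N"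
  define \<Phi> where "\<Phi> x = U (fst x) * (iexp (t * (sqrt N * dev x)) - complex_of_real (exp (- (t\<^sup>2 * V (fst x) / 2))))" for x
  define \<Phi>1 where "\<Phi>1 x = U (fst x) * iexp (t * (sqrt N * dev x))" for x
  define \<Phi>2 where "\<Phi>2 w = U w * complex_of_real (exp (- (t\<^sup>2 * V w / 2)))" for w
  have [measurable]: "\<Phi>1 \<in> borel_measurable (F \<Otimes>\<^sub>M S')" "\<Phi>2 \<in> borel_measurable F"
    unfolding \<Phi>1_def[abs_def] \<Phi>2_def[abs_def] by measurable
  have \<Phi>1b: "cmod (\<Phi>1 x) \<le> 1" if "x \<in> space (F \<Otimes>\<^sub>M S')" for x
    using U1 that by (auto simp: \<Phi>1_def norm_mult space_pair_measure)
  have Vnn: "AE w in P. 0 \<le> V w"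
    using AEF by eventually_elim (auto simp: V_def K1(2)[symmetric])
  have \<Phi>2b: "AE w in P. cmod (\<Phi>2 w) \<le> 1"
    using AEF Vnn
  proof eventually_elim
    case (elim w)
    have "cmod (\<Phi>2 w) \<le> 1 * 1" unfolding \<Phi>2_def norm_mult
      using elim U1 by (intro mult_mono) (auto simp: norm_mult)
    then show ?case by simp
  qed
  have eq1: "(\<integral>w. \<Phi>1 (w, \<lambda>l\<in>L. Z l w) \<partial>P) = (\<integral>w. (\<integral>z. \<Phi>1 (w, z) \<partial>?\<Pi> w) \<partial>P)"
    using \<Phi>1b by (intro tc) auto
  have inner: "AE w in P. cmod ((\<integral>z. \<Phi>1 (w, z) \<partial>?\<Pi> w) - \<Phi>2 w) \<le> R"
    using AEF
  proof (rule AE_mp, intro AE_I2 impI, elim conjE)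
    fix w assume w: "w \<in> space F" and e: "(\<integral>z. G (w, z) \<partial>K w) = m w"
    interpret X: prob_space "K w" using K' w by auto
    interpret product_prob_space "\<lambda>_. K w" L
      using K'(1)[OF w] by (simp add: product_prob_space_def product_prob_space_axioms_def product_sigma_finite_def prob_space_imp_sigma_finite)
    \<comment> \<open>At this scale the conditional characteristic function is the N-th power of
      \<open>a\<close>, and the Gaussian factor is exactly the N-th power of \<open>b\<close>. Both
      have modulus at most one, so the powers differ by at most N times the difference of the
      bases.\<close>
    define u where "u = t / sqrt N"
    define a where "a = (\<integral>z. iexp (u * (G (w, z) - m w)) \<partial>K w)"
    define b where "b = complex_of_real (exp (- (u\<^sup>2 * V w / 2)))"
    have sN: "t * (sqrt N * (x / N)) = u * x" for x :: real
      using N unfolding u_def by (simp add: field_simps)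
    have [measurable]: "(\<lambda>z. G (w, z)) \<in> borel_measurable (K w)" by (rule Gw[OF w])
    have V0: "0 \<le> V w" using K1(2)[OF w e] by (simp add: V_def flip: K1(2)[OF w e])
    have "(\<integral>z. \<Phi>1 (w, z) \<partial>?\<Pi> w) = U w * (\<integral>z. (\<Prod>l\<in>L. iexp (u * (G (w, z l) - m w))) \<partial>?\<Pi> w)"
      unfolding \<Phi>1_def fst_conv snd_conv devN sN by (simp add: exp_sum[symmetric] sum_distrib_left)
    also have "(\<integral>z. (\<Prod>l\<in>L. iexp (u * (G (w, z l) - m w))) \<partial>?\<Pi> w) = (\<Prod>l\<in>L. a)"
      unfolding a_def by (intro product_integral_prod L X.integrable_const_bound[of _ 1]) auto
    also have "\<dots> = a ^ N" by (simp add: cL)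
    finally have i1: "(\<integral>z. \<Phi>1 (w, z) \<partial>?\<Pi> w) = U w * a ^ N" .
    have "u\<^sup>2 * real N = t\<^sup>2" using N by (simp add: u_def power_divide)
    note uN = this
    then have "real N * (u\<^sup>2 * V w / 2) = t\<^sup>2 * V w / 2" by (metis mult.assoc mult.commute times_divide_eq_right)
    then have i2: "\<Phi>2 w = U w * b ^ N"
      using uN[symmetric] by (simp add: mult.commute \<Phi>2_def b_def exp_of_nat_mult[symmetric] flip: of_real_power del: of_real_exp)
    have "cmod (a ^ N - b ^ N) \<le> N * cmod (a - b)"
    proof (rule norm_power_diff)
      have "cmod a \<le> (\<integral>z. cmod (iexp (u * (G (w, z) - m w))) \<partial>K w)" unfolding a_def by (rule integral_norm_bound)
      then show "cmod a \<le> 1" by (simp add: X.prob_space)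
      show "cmod b \<le> 1" using V0 by (simp add: b_def)
    qed
    also have "cmod (a - b) \<le> \<bar>u\<bar> ^ 3 * (2 * C) ^ 3 / 6 + u ^ 4 * (2 * C) ^ 4 / 8"
      unfolding a_def b_def V_def K1(2)[OF w e, symmetric]
      by (rule char_gauss_approx[OF K'(1)[OF w] Y[OF w] K1(1)[OF w e] refl])
    also have "real N * \<dots> \<le> R"
    proof -
      have "real N * (\<bar>u\<bar> ^ 3 * (2 * C) ^ 3 / 6 + u ^ 4 * (2 * C) ^ 4 / 8)
          = \<bar>t\<bar> ^ 3 * (2 * C) ^ 3 / 6 / sqrt N + t ^ 4 * (2 * C) ^ 4 / 8 / N"
      proof -
        have n3: "sqrt (real N) ^ 3 = real N * sqrt N" by (simp add: power3_eq_cube)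
        have n4: "sqrt (real N) ^ 4 = real N * N" by (simp add: power4_eq_xxxx)
        show ?thesis using N unfolding u_def power_divide abs_divide n4 by (simp add: n3 field_simps)
      qed
      also have "t ^ 4 * (2 * C) ^ 4 / 8 / N \<le> t ^ 4 * (2 * C) ^ 4 / 8 / sqrt N"
      proof (rule divide_left_mono)
        \<comment> \<open>The fourth order error is of order 1/N; it is coarsened to 1/\<surd>N in
          order to merge the two terms of the bound into \<open>R\<close>.\<close>
        show "sqrt N \<le> N" using N sqrt_le_D by (intro real_le_lsqrt) (auto simp: power2_eq_square)
        show "0 \<le> t ^ 4 * (2 * C) ^ 4 / 8" by auto
        show "0 < real N * sqrt N" using N by simp
      qed
      finally show ?thesis by (simp add: R_def add_divide_distrib)
    qed
    finally have "cmod (a ^ N - b ^ N) \<le> R" using N by simp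
    then have "cmod (U w) * cmod (a ^ N - b ^ N) \<le> 1 * R"
      using U1[OF w] by (intro mult_mono) auto
    then show "cmod ((\<integral>z. \<Phi>1 (w, z) \<partial>?\<Pi> w) - \<Phi>2 w) \<le> R"
      unfolding i1 i2 by (simp add: norm_mult flip: right_diff_distrib)
  qed
  have \<Phi>2P: "\<Phi>2 \<in> borel_measurable P" by (rule measurable_from_subalg[OF F]) measurable
  have i\<Phi>2: "integrable P \<Phi>2" using \<Phi>2b \<Phi>2P by (intro integrable_const_bound[of _ 1]) auto
  have \<Phi>1P: "(\<lambda>w. \<integral>z. \<Phi>1 (w, z) \<partial>?\<Pi> w) \<in> borel_measurable P"
  proof -
    have "(\<lambda>w. \<integral>z. \<Phi>1 (w, z) \<partial>?\<Pi> w) \<in> borel_measurable F"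
      by (rule borel_measurable_kernel_integral[OF KP]) measurable
    then show ?thesis by (rule measurable_from_subalg[OF F])
  qed
  have i\<Phi>1: "integrable P (\<lambda>w. \<integral>z. \<Phi>1 (w, z) \<partial>?\<Pi> w)"
  proof (rule integrable_const_bound[of _ 1])
    show "AE w in P. cmod (\<integral>z. \<Phi>1 (w, z) \<partial>?\<Pi> w) \<le> 1"
    proof (rule AE_I2)
      fix w assume "w \<in> space P" then have w: "w \<in> space F" by (simp add: sF)
      interpret X: prob_space "?\<Pi> w" using KP' w by auto
      have "cmod (\<integral>z. \<Phi>1 (w, z) \<partial>?\<Pi> w) \<le> (\<integral>z. cmod (\<Phi>1 (w, z)) \<partial>?\<Pi> w)"
        by (rule integral_norm_bound)
      also have "\<dots> = (\<integral>z. cmod (U w) \<partial>?\<Pi> w)" by (simp add: \<Phi>1_def norm_mult)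
      also have "\<dots> \<le> 1" using U1[OF w] by (simp add: X.prob_space)
      finally show "cmod (\<integral>z. \<Phi>1 (w, z) \<partial>?\<Pi> w) \<le> 1" .
    qed
  qed (rule \<Phi>1P)
  have "cmod ((\<integral>w. \<Phi>1 (w, \<lambda>l\<in>L. Z l w) \<partial>P) - (\<integral>w. \<Phi>2 w \<partial>P))
    = cmod (\<integral>w. (\<integral>z. \<Phi>1 (w, z) \<partial>?\<Pi> w) - \<Phi>2 w \<partial>P)"
    unfolding eq1 using i\<Phi>1 i\<Phi>2 by simp
  also have "\<dots> \<le> (\<integral>w. cmod ((\<integral>z. \<Phi>1 (w, z) \<partial>?\<Pi> w) - \<Phi>2 w) \<partial>P)"
    by (rule integral_norm_bound)
  also have "\<dots> \<le> R"
    using inner i\<Phi>1 i\<Phi>2 by (intro integral_le_const) auto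
  finally have "cmod ((\<integral>w. \<Phi>1 (w, \<lambda>l\<in>L. Z l w) \<partial>P) - (\<integral>w. \<Phi>2 w \<partial>P)) \<le> R" .
  then show "cmod ((\<integral>w. U w * iexp (t * (sqrt N * ((\<Sum>l\<in>{1..N}. G (w, Z l w)) / N - m w))) \<partial>P)
        - (\<integral>w. U w * complex_of_real (exp (- (t\<^sup>2 * ((\<integral>z. (G (w, z))\<^sup>2 \<partial>K w) - (m w)\<^sup>2) / 2))) \<partial>P))
      \<le> (\<bar>t\<bar> ^ 3 * (2 * C) ^ 3 / 6 + t ^ 4 * (2 * C) ^ 4 / 8) / sqrt N"
    by (simp only: \<Phi>1_def \<Phi>2_def V_def R_def dev_def fst_conv snd_conv restrict_apply' L_def cong: sum.cong)
qed

section \<open>Central limit theorems for weighted averages\<close>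

text \<open>The bound is an explicit argument so that estimates can be uniform over functions and
  scale with \<open>B\<close> or with its square, including for functions that depend on N or on
  another sample.\<close>

definition bounded_fn :: "'b measure \<Rightarrow> ('b \<Rightarrow> real) \<Rightarrow> real \<Rightarrow> bool" where
  "bounded_fn L f B \<longleftrightarrow> f \<in> borel_measurable L \<and> 0 \<le> B \<and> (\<forall>x\<in>space L. \<bar>f x\<bar> \<le> B)"

lemma bounded_fnD:
  assumes "bounded_fn L f B"
  shows "f \<in> borel_measurable L" "0 \<le> B" "\<And>x. x \<in> space L \<Longrightarrow> \<bar>f x\<bar> \<le> B"
  using assms by (auto simp: bounded_fn_def)

section \<open>Elementary estimates for ratios and for characteristic functions\<close>

lemma (in prob_space) integrable_bounded:
  fixes f :: "'a \<Rightarrow> 'b :: {banach, second_countable_topology}"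
  assumes "f \<in> borel_measurable M" "\<And>x. x \<in> space M \<Longrightarrow> norm (f x) \<le> B"
  shows "integrable M f"
  using assms by (intro integrable_const_bound[of _ B]) (auto intro!: AE_I2)

lemma (in prob_space) integrable_bounded_sq:
  fixes f :: "'a \<Rightarrow> real"
  assumes [measurable]: "f \<in> borel_measurable M" and B: "\<And>x. x \<in> space M \<Longrightarrow> \<bar>f x\<bar> \<le> B"
  shows "integrable M (\<lambda>x. (f x)\<^sup>2)"
proof (rule integrable_bounded[of _ "B\<^sup>2"])
  fix x assume x: "x \<in> space M"
  have "\<bar>f x\<bar>\<^sup>2 \<le> B\<^sup>2" using B[OF x] by (intro power_mono) auto
  then show "norm ((f x)\<^sup>2) \<le> B\<^sup>2" by simp
qed measurable

lemma (in prob_space) expectation_abs_le_sqrt: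
  fixes f :: "'a \<Rightarrow> real"
  assumes [measurable]: "f \<in> borel_measurable M" and B: "\<And>x. x \<in> space M \<Longrightarrow> \<bar>f x\<bar> \<le> B"
  shows "expectation (\<lambda>x. \<bar>f x\<bar>) \<le> sqrt (expectation (\<lambda>x. (f x)\<^sup>2))"
proof (rule real_le_rsqrt)
  have "0 \<le> variance (\<lambda>x. \<bar>f x\<bar>)" by (rule variance_positive)
  also have "\<dots> = expectation (\<lambda>x. \<bar>f x\<bar>\<^sup>2) - (expectation (\<lambda>x. \<bar>f x\<bar>))\<^sup>2"
    using integrable_bounded_sq[of f B] integrable_bounded[of "\<lambda>x. \<bar>f x\<bar>" B] B
    by (intro variance_eq) auto
  finally show "(expectation (\<lambda>x. \<bar>f x\<bar>))\<^sup>2 \<le> expectation (\<lambda>x. (f x)\<^sup>2)" by simp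
qed

lemma sum_sq_le:
  fixes x y :: real
  shows "(x + y)\<^sup>2 \<le> 2 * x\<^sup>2 + 2 * y\<^sup>2"
proof -
  have "0 \<le> (x - y)\<^sup>2" by simp
  then show ?thesis by (simp add: power2_eq_square algebra_simps)
qed

text \<open>Here m = a / b is written multiplicatively, and (m - \<alpha>/\<beta>) \<beta> = (a -
  \<alpha>) + m (\<beta> - b). The a priori bound \<open>D\<close> on the ratio takes the place of a
  lower bound on the random denominator, which may come arbitrarily close to zero.\<close>

lemma (in prob_space) ratio_L2:
  fixes a b m :: "'a \<Rightarrow> real"
  assumes [measurable]: "a \<in> borel_measurable M" "b \<in> borel_measurable M" "m \<in> borel_measurable M"
    and a: "\<And>x. x \<in> space M \<Longrightarrow> \<bar>a x\<bar> \<le> Ba" and b: "\<And>x. x \<in> space M \<Longrightarrow> \<bar>b x\<bar> \<le> Bb"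
    and m: "AE x in M. \<bar>m x\<bar> \<le> D" and mb: "AE x in M. m x * b x = a x" and \<beta>: "0 < \<beta>"
    and ea: "expectation (\<lambda>x. (a x - \<alpha>)\<^sup>2) \<le> ea" and eb: "expectation (\<lambda>x. (b x - \<beta>)\<^sup>2) \<le> eb"
  shows "expectation (\<lambda>x. (m x - \<alpha> / \<beta>)\<^sup>2) \<le> (2 * ea + 2 * D\<^sup>2 * eb) / \<beta>\<^sup>2"
proof -
  have ia: "integrable M (\<lambda>x. (a x - \<alpha>)\<^sup>2)"
    using a by (intro integrable_bounded_sq[of _ "Ba + \<bar>\<alpha>\<bar>"]) (auto intro!: abs_triangle_ineq4[THEN order_trans])
  have ib: "integrable M (\<lambda>x. (b x - \<beta>)\<^sup>2)"
    using b by (intro integrable_bounded_sq[of _ "Bb + \<bar>\<beta>\<bar>"]) (auto intro!: abs_triangle_ineq4[THEN order_trans])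
  have le: "AE x in M. (m x - \<alpha> / \<beta>)\<^sup>2 \<le> (2 * (a x - \<alpha>)\<^sup>2 + 2 * D\<^sup>2 * (b x - \<beta>)\<^sup>2) / \<beta>\<^sup>2"
    using m mb
  proof eventually_elim
    case (elim x)
    have "(m x - \<alpha> / \<beta>) * \<beta> = (a x - \<alpha>) + m x * (\<beta> - b x)" using \<beta> elim(2) by (simp add: left_diff_distrib right_diff_distrib)
    then have "(m x - \<alpha> / \<beta>)\<^sup>2 * \<beta>\<^sup>2 = ((a x - \<alpha>) + m x * (\<beta> - b x))\<^sup>2" by (metis power_mult_distrib)
    also have "\<dots> \<le> 2 * (a x - \<alpha>)\<^sup>2 + 2 * (m x * (\<beta> - b x))\<^sup>2" by (rule sum_sq_le)
    also have "(m x * (\<beta> - b x))\<^sup>2 = (m x)\<^sup>2 * (b x - \<beta>)\<^sup>2" by (simp add: power_mult_distrib power2_commute)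
    also have "(m x)\<^sup>2 \<le> D\<^sup>2" using power_mono[OF elim(1) abs_ge_zero, of 2] by simp
    finally show ?case using \<beta> by (simp add: pos_le_divide_eq mult_right_mono)
  qed
  have "expectation (\<lambda>x. (m x - \<alpha> / \<beta>)\<^sup>2) \<le> expectation (\<lambda>x. (2 * (a x - \<alpha>)\<^sup>2 + 2 * D\<^sup>2 * (b x - \<beta>)\<^sup>2) / \<beta>\<^sup>2)"
    using le ia ib by (intro integral_mono_AE') auto
  also have "\<dots> = (2 * expectation (\<lambda>x. (a x - \<alpha>)\<^sup>2) + 2 * D\<^sup>2 * expectation (\<lambda>x. (b x - \<beta>)\<^sup>2)) / \<beta>\<^sup>2"
    using ia ib by simp
  also have "\<dots> \<le> (2 * ea + 2 * D\<^sup>2 * eb) / \<beta>\<^sup>2"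
    using ea eb by (intro divide_right_mono add_mono mult_left_mono) auto
  finally show ?thesis .
qed

text \<open>The linearisation error equals m (\<beta> - b) / \<beta>, a product of two quantities
  each of order 1/\<surd>N in the applications. Bounding the product by half the sum of squares
  yields order 1/N in mean, one order better than the error of the ratio itself.\<close>

lemma (in prob_space) ratio_L1:
  fixes a b m :: "'a \<Rightarrow> real"
  assumes [measurable]: "a \<in> borel_measurable M" "b \<in> borel_measurable M" "m \<in> borel_measurable M"
    and b: "\<And>x. x \<in> space M \<Longrightarrow> \<bar>b x\<bar> \<le> Bb" and m: "AE x in M. \<bar>m x\<bar> \<le> D"
    and mb: "AE x in M. m x * b x = a x" and \<beta>: "0 < \<beta>"
  shows "expectation (\<lambda>x. \<bar>m x - a x / \<beta>\<bar>) \<le> (expectation (\<lambda>x. (m x)\<^sup>2) + expectation (\<lambda>x. (b x - \<beta>)\<^sup>2)) / (2 * \<beta>)"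
proof -
  have ib: "integrable M (\<lambda>x. (b x - \<beta>)\<^sup>2)"
    using b by (intro integrable_bounded_sq[of _ "Bb + \<bar>\<beta>\<bar>"]) (auto intro!: abs_triangle_ineq4[THEN order_trans])
  have "AE x in M. (m x)\<^sup>2 \<le> D\<^sup>2"
    using m by eventually_elim (use power_mono[OF _ abs_ge_zero, of _ _ 2] in force)
  then have im: "integrable M (\<lambda>x. (m x)\<^sup>2)" by (intro integrable_const_bound[of _ "D\<^sup>2"]) auto
  have le: "AE x in M. \<bar>m x - a x / \<beta>\<bar> \<le> ((m x)\<^sup>2 + (b x - \<beta>)\<^sup>2) / (2 * \<beta>)"
    using mb
  proof eventually_elim
    case (elim x)
    have "m x - a x / \<beta> = m x * (\<beta> - b x) / \<beta>" using \<beta> elim by (simp add: field_simps)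
    then have "\<bar>m x - a x / \<beta>\<bar> = \<bar>m x\<bar> * \<bar>b x - \<beta>\<bar> / \<beta>" using \<beta> by (simp add: abs_mult abs_minus_commute)
    also have "\<dots> \<le> ((m x)\<^sup>2 + (b x - \<beta>)\<^sup>2) / 2 / \<beta>"
      using sum_squares_bound[of "\<bar>m x\<bar>" "\<bar>b x - \<beta>\<bar>"] \<beta> by (intro divide_right_mono) auto
    finally show ?case by simp
  qed
  have "expectation (\<lambda>x. \<bar>m x - a x / \<beta>\<bar>) \<le> expectation (\<lambda>x. ((m x)\<^sup>2 + (b x - \<beta>)\<^sup>2) / (2 * \<beta>))"
    using le im ib \<beta> by (intro integral_mono_AE') auto
  also have "\<dots> = (expectation (\<lambda>x. (m x)\<^sup>2) + expectation (\<lambda>x. (b x - \<beta>)\<^sup>2)) / (2 * \<beta>)"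
    using im ib by simp
  finally show ?thesis .
qed

lemma cmod_iexp_diff: "cmod (iexp x - iexp y) \<le> \<bar>x - y\<bar>"
proof -
  have "iexp x - iexp y = iexp y * (iexp (x - y) - 1)"
    by (simp add: algebra_simps flip: exp_add)
  then have "cmod (iexp x - iexp y) = cmod (iexp (x - y) - 1)" by (simp add: norm_mult)
  also have "\<dots> \<le> \<bar>x - y\<bar>" using iexp_approx1[of "x - y" 0] by simp
  finally show ?thesis .
qed

lemma (in prob_space) expectation_iexp_diff:
  assumes [measurable]: "X \<in> borel_measurable M" "Y \<in> borel_measurable M" and i: "integrable M (\<lambda>x. X x - Y x)"
  shows "cmod ((\<integral>x. iexp (X x) \<partial>M) - (\<integral>x. iexp (Y x) \<partial>M)) \<le> expectation (\<lambda>x. \<bar>X x - Y x\<bar>)"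
proof -
  have i': "integrable M (\<lambda>x. iexp (X x))" "integrable M (\<lambda>x. iexp (Y x))"
    by (auto intro!: integrable_bounded[of _ 1])
  have "cmod ((\<integral>x. iexp (X x) \<partial>M) - (\<integral>x. iexp (Y x) \<partial>M)) = cmod (\<integral>x. iexp (X x) - iexp (Y x) \<partial>M)"
    using i' by simp
  also have "\<dots> \<le> (\<integral>x. cmod (iexp (X x) - iexp (Y x)) \<partial>M)" by (rule integral_norm_bound)
  also have "\<dots> \<le> expectation (\<lambda>x. \<bar>X x - Y x\<bar>)"
    by (rule integral_mono[OF integrable_norm[OF Bochner_Integration.integrable_diff[OF i'(1) i'(2)]] integrable_abs[OF i] cmod_iexp_diff])
  finally show ?thesis .
qed

text \<open>The constant c is the limit of the average of the function 1. The constant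
  \<open>C\<close> is chosen before N and f, because the pair argument inserts functions that vary
  with N and with the outcome of the other sample. The functional \<open>V\<close> is left abstract,
  its sign included, so that each step may supply whatever expression it produces. Indices start at
  N = 1, as nothing is known about \<open>P 0\<close>.\<close>

definition emp_clt ::
  "'e measure \<Rightarrow> (nat \<Rightarrow> 'w measure) \<Rightarrow> (nat \<Rightarrow> ('e \<Rightarrow> real) \<Rightarrow> 'w \<Rightarrow> real) \<Rightarrow> real \<Rightarrow> 'e measure \<Rightarrow> (('e \<Rightarrow> real) \<Rightarrow> real) \<Rightarrow> bool"
where
  "emp_clt L P A c \<mu> V \<longleftrightarrow>
     prob_space \<mu> \<and> sets \<mu> = sets L \<and> 0 < c \<and>
     (\<exists>C\<ge>0. \<forall>N\<ge>1. \<forall>f B. bounded_fn L f B \<longrightarrow>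
        A N f \<in> borel_measurable (P N) \<and> (\<forall>w\<in>space (P N). \<bar>A N f w\<bar> \<le> C * B) \<and>
        (\<integral>w. (A N f w - c * (\<integral>x. f x \<partial>\<mu>))\<^sup>2 \<partial>P N) \<le> C * B\<^sup>2 / real N) \<and>
     (\<forall>f B t. bounded_fn L f B \<longrightarrow> (\<integral>x. f x \<partial>\<mu>) = 0 \<longrightarrow>
        (\<lambda>N. \<integral>w. iexp (t * (sqrt (real N) * A N f w)) \<partial>P N) \<longlonglongrightarrow> complex_of_real (exp (- (t\<^sup>2 * V f / 2))))"

lemma emp_clt_bound:
  assumes "emp_clt L P A c \<mu> V"
  obtains C where "0 \<le> C" "\<And>N f B. 1 \<le> N \<Longrightarrow> bounded_fn L f B \<Longrightarrow>
        A N f \<in> borel_measurable (P N) \<and> (\<forall>w\<in>space (P N). \<bar>A N f w\<bar> \<le> C * B) \<and>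
        (\<integral>w. (A N f w - c * (\<integral>x. f x \<partial>\<mu>))\<^sup>2 \<partial>P N) \<le> C * B\<^sup>2 / real N"
proof -
  from assms have "\<exists>C\<ge>0. \<forall>N\<ge>1. \<forall>f B. bounded_fn L f B \<longrightarrow>
        A N f \<in> borel_measurable (P N) \<and> (\<forall>w\<in>space (P N). \<bar>A N f w\<bar> \<le> C * B) \<and>
        (\<integral>w. (A N f w - c * (\<integral>x. f x \<partial>\<mu>))\<^sup>2 \<partial>P N) \<le> C * B\<^sup>2 / real N"
    unfolding emp_clt_def by (elim conjE)
  then show thesis by (elim exE conjE) (rule that, auto)
qed

lemma emp_clt_limit:
  assumes "emp_clt L P A c \<mu> V" "bounded_fn L f B" "(\<integral>x. f x \<partial>\<mu>) = 0"
  shows "(\<lambda>N. \<integral>w. iexp (t * (sqrt (real N) * A N f w)) \<partial>P N) \<longlonglongrightarrow> complex_of_real (exp (- (t\<^sup>2 * V f / 2)))"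
proof -
  from assms(1) have "\<forall>f B t. bounded_fn L f B \<longrightarrow> (\<integral>x. f x \<partial>\<mu>) = 0 \<longrightarrow>
        (\<lambda>N. \<integral>w. iexp (t * (sqrt (real N) * A N f w)) \<partial>P N) \<longlonglongrightarrow> complex_of_real (exp (- (t\<^sup>2 * V f / 2)))"
    unfolding emp_clt_def by (elim conjE)
  then show ?thesis using assms(2,3) by blast
qed

text \<open>The ratio \<open>m\<close> of the f-average and the \<theta>-average is replaced by the
  f-average divided by its limiting denominator. The cost in mean is O(1/N), hence O(1/\<surd>N) for
  the characteristic functions after scaling. It serves for the conditional mean in a selection step
  and, with \<theta> = 1, for the final self-normalised estimator.\<close>

lemma emp_clt_ratio:
  assumes A: "emp_clt L P A c \<mu> V" and P: "\<And>N. 1 \<le> N \<Longrightarrow> prob_space (P N)"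
    and f: "bounded_fn L f B" and f0: "(\<integral>x. f x \<partial>\<mu>) = 0"
    and \<theta>: "bounded_fn L \<theta> B\<theta>" and \<theta>pos: "0 < (\<integral>x. \<theta> x \<partial>\<mu>)"
    and m: "\<And>N. 1 \<le> N \<Longrightarrow> m N \<in> borel_measurable (P N)" "\<And>N. 1 \<le> N \<Longrightarrow> AE w in P N. \<bar>m N w\<bar> \<le> D"
    and mA: "\<And>N. 1 \<le> N \<Longrightarrow> AE w in P N. m N w * A N \<theta> w = A N f w"
  shows "(\<lambda>N. \<integral>w. iexp (t * (sqrt (real N) * m N w)) \<partial>P N)
     \<longlonglongrightarrow> complex_of_real (exp (- (t\<^sup>2 * (V f / (c * (\<integral>x. \<theta> x \<partial>\<mu>))\<^sup>2) / 2)))"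
    and "\<exists>C\<ge>0. \<forall>N\<ge>1. (\<integral>w. (m N w)\<^sup>2 \<partial>P N) \<le> C / N"
proof -
  define \<beta> where "\<beta> = c * (\<integral>x. \<theta> x \<partial>\<mu>)"
  have \<beta>: "0 < \<beta>" using A \<theta>pos by (simp add: \<beta>_def emp_clt_def)
  obtain C where C0: "0 \<le> C" and C: "\<And>N f B. 1 \<le> N \<Longrightarrow> bounded_fn L f B \<Longrightarrow>
        A N f \<in> borel_measurable (P N) \<and> (\<forall>w\<in>space (P N). \<bar>A N f w\<bar> \<le> C * B) \<and>
        (\<integral>w. (A N f w - c * (\<integral>x. f x \<partial>\<mu>))\<^sup>2 \<partial>P N) \<le> C * B\<^sup>2 / real N"
    using emp_clt_bound[OF A] by blast
  define E where "E = (2 * (C * B\<^sup>2) + 2 * D\<^sup>2 * (C * B\<theta>\<^sup>2)) / \<beta>\<^sup>2"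
  have E0: "0 \<le> E" using C0 by (simp add: E_def)
  have m2: "(\<integral>w. (m N w)\<^sup>2 \<partial>P N) \<le> E / N" if N: "1 \<le> N" for N
  proof -
    interpret prob_space "P N" by (rule P[OF N])
    have "(\<integral>w. (m N w - 0 / \<beta>)\<^sup>2 \<partial>P N) \<le> (2 * (C * B\<^sup>2 / N) + 2 * D\<^sup>2 * (C * B\<theta>\<^sup>2 / N)) / \<beta>\<^sup>2"
      using C[OF N f] C[OF N \<theta>] m[OF N] mA[OF N] f0 \<beta>
      by (intro ratio_L2[of "A N f" "A N \<theta>" "m N" "C * B" "C * B\<theta>"]) (auto simp: \<beta>_def)
    then show ?thesis by (simp add: E_def add_divide_distrib mult.commute)
  qed
  show "\<exists>C\<ge>0. \<forall>N\<ge>1. (\<integral>w. (m N w)\<^sup>2 \<partial>P N) \<le> C / N" using E0 m2 by auto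
  \<comment> \<open>\<open>E\<close> bounds N times the second moment of the ratio, and C
    B\<theta>^2 bounds N times the mean square error of the denominator; \<open>E2\<close> is what
    \<open>ratio_L1\<close> makes of them.\<close>
  define E2 where "E2 = (E + C * B\<theta>\<^sup>2) / (2 * \<beta>)"
  have d: "cmod ((\<integral>w. iexp (t * (sqrt (real N) * m N w)) \<partial>P N) - (\<integral>w. iexp ((t / \<beta>) * (sqrt (real N) * A N f w)) \<partial>P N)) \<le> \<bar>t\<bar> * E2 / sqrt N"
    if N: "1 \<le> N" for N
  proof -
    interpret prob_space "P N" by (rule P[OF N])
    have [measurable]: "m N \<in> borel_measurable (P N)" "A N f \<in> borel_measurable (P N)" using m[OF N] C[OF N f] by auto
    have im: "integrable (P N) (m N)" using m[OF N] by (intro integrable_const_bound[of _ D]) auto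
    have ia: "integrable (P N) (A N f)" using C[OF N f] by (intro integrable_bounded[of _ "C * B"]) auto
    have eq: "t * (sqrt N * m N w) - (t / \<beta>) * (sqrt N * A N f w) = t * sqrt N * (m N w - A N f w / \<beta>)" for w
      by (simp add: algebra_simps)
    have "cmod ((\<integral>w. iexp (t * (sqrt (real N) * m N w)) \<partial>P N) - (\<integral>w. iexp ((t / \<beta>) * (sqrt (real N) * A N f w)) \<partial>P N))
      \<le> expectation (\<lambda>w. \<bar>t * (sqrt N * m N w) - (t / \<beta>) * (sqrt N * A N f w)\<bar>)"
      using im ia by (intro expectation_iexp_diff) auto
    also have "\<dots> = \<bar>t\<bar> * sqrt N * expectation (\<lambda>w. \<bar>m N w - A N f w / \<beta>\<bar>)"
      unfolding eq by (simp add: abs_mult)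
    also have "\<dots> \<le> \<bar>t\<bar> * sqrt N * ((E / N + C * B\<theta>\<^sup>2 / N) / (2 * \<beta>))"
    proof (rule mult_left_mono)
      have "expectation (\<lambda>w. \<bar>m N w - A N f w / \<beta>\<bar>) \<le> (expectation (\<lambda>x. (m N x)\<^sup>2) + expectation (\<lambda>x. (A N \<theta> x - \<beta>)\<^sup>2)) / (2 * \<beta>)"
        using C[OF N f] C[OF N \<theta>] m[OF N] mA[OF N] \<beta> by (intro ratio_L1[of _ _ _ "C * B\<theta>" D]) auto
      also have "\<dots> \<le> (E / N + C * B\<theta>\<^sup>2 / N) / (2 * \<beta>)"
        using C[OF N \<theta>] m2[OF N] \<beta> by (intro divide_right_mono add_mono) (auto simp: \<beta>_def)
      finally show "expectation (\<lambda>w. \<bar>m N w - A N f w / \<beta>\<bar>) \<le> (E / N + C * B\<theta>\<^sup>2 / N) / (2 * \<beta>)" .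
    qed auto
    also have "\<dots> = \<bar>t\<bar> * E2 / sqrt N"
    proof -
      have s: "\<bar>t\<bar> * sqrt N * (x / real N) = \<bar>t\<bar> * x / sqrt N" for x :: real
        using N by (simp add: field_simps)
      have "(E / N + C * B\<theta>\<^sup>2 / N) / (2 * \<beta>) = E2 / N"
        by (simp add: E2_def add_divide_distrib mult.commute)
      then show ?thesis by (simp only: s)
    qed
    finally show ?thesis .
  qed
  have lim: "(\<lambda>N. \<integral>w. iexp ((t / \<beta>) * (sqrt (real N) * A N f w)) \<partial>P N) \<longlonglongrightarrow> complex_of_real (exp (- ((t / \<beta>)\<^sup>2 * V f / 2)))"
    by (rule emp_clt_limit[OF A f f0])
  have "(\<lambda>N. (\<integral>w. iexp (t * (sqrt (real N) * m N w)) \<partial>P N) - (\<integral>w. iexp ((t / \<beta>) * (sqrt (real N) * A N f w)) \<partial>P N)) \<longlonglongrightarrow> 0"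
  proof (rule Lim_null_comparison)
    show "\<forall>\<^sub>F N in sequentially. cmod ((\<integral>w. iexp (t * (sqrt (real N) * m N w)) \<partial>P N) - (\<integral>w. iexp ((t / \<beta>) * (sqrt (real N) * A N f w)) \<partial>P N)) \<le> \<bar>t\<bar> * E2 / sqrt N"
      using d by (intro eventually_sequentiallyI[of 1])
    show "(\<lambda>N. \<bar>t\<bar> * E2 / sqrt (real N)) \<longlonglongrightarrow> 0"
      by (intro real_tendsto_divide_at_top[OF tendsto_const] filterlim_compose[OF sqrt_at_top filterlim_real_sequentially])
  qed
  from tendsto_add[OF this lim]
  show "(\<lambda>N. \<integral>w. iexp (t * (sqrt (real N) * m N w)) \<partial>P N)
     \<longlonglongrightarrow> complex_of_real (exp (- (t\<^sup>2 * (V f / (c * (\<integral>x. \<theta> x \<partial>\<mu>))\<^sup>2) / 2)))"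
    by (simp add: \<beta>_def[symmetric] power_divide)
qed

section \<open>Selection and mutation\<close>

text \<open>Only the consequences of the sampling mechanism are recorded: the first two conditional
  moments of one weighted new particle are ratios of averages over the old sample, with numerators
  \<open>k f\<close> and \<open>k2 f\<close> and the common denominator \<theta>, the selection
  mass. The limit of such a first moment is c' \<mu>'(f). The sample space \<open>S N\<close> varies
  with N since the objects drawn carry ancestor indices up to N, and \<open>X N\<close> forgets
  them.\<close>

locale resampling_step =
  fixes L :: "'e measure" and M :: "'x measure" and P F :: "nat \<Rightarrow> 'w measure"
    and A :: "nat \<Rightarrow> ('e \<Rightarrow> real) \<Rightarrow> 'w \<Rightarrow> real" and c :: real and \<mu> :: "'e measure" and V :: "('e \<Rightarrow> real) \<Rightarrow> real"
    and S :: "nat \<Rightarrow> 's measure" and Z :: "nat \<Rightarrow> nat \<Rightarrow> 'w \<Rightarrow> 's" and K :: "nat \<Rightarrow> 'w \<Rightarrow> 's measure"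
    and W :: "nat \<Rightarrow> 'w \<times> 's \<Rightarrow> real" and X :: "nat \<Rightarrow> 's \<Rightarrow> 'x"
    and \<theta> :: "'e \<Rightarrow> real" and k k2 :: "('x \<Rightarrow> real) \<Rightarrow> 'e \<Rightarrow> real" and c' :: real and \<mu>' :: "'x measure"
    and CW B\<theta> Ck :: real
  assumes P: "\<And>N. 1 \<le> N \<Longrightarrow> prob_space (P N)"
    and F: "\<And>N. 1 \<le> N \<Longrightarrow> subalgebra (P N) (F N)"
    and A: "emp_clt L P A c \<mu> V"
    and AF: "\<And>N f B. 1 \<le> N \<Longrightarrow> bounded_fn L f B \<Longrightarrow> A N f \<in> borel_measurable (F N)"
    and Z: "\<And>N. 1 \<le> N \<Longrightarrow> cond_iid (P N) (F N) N (S N) (Z N) (K N)"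
    and K: "\<And>N. 1 \<le> N \<Longrightarrow> K N \<in> F N \<rightarrow>\<^sub>M prob_algebra (S N)"
    and W: "\<And>N. 1 \<le> N \<Longrightarrow> W N \<in> borel_measurable (F N \<Otimes>\<^sub>M S N)"
    and WC: "\<And>N x. 1 \<le> N \<Longrightarrow> x \<in> space (F N \<Otimes>\<^sub>M S N) \<Longrightarrow> \<bar>W N x\<bar> \<le> CW" and CW: "0 \<le> CW"
    and X: "\<And>N. 1 \<le> N \<Longrightarrow> X N \<in> S N \<rightarrow>\<^sub>M M"
    and \<theta>: "bounded_fn L \<theta> B\<theta>" and \<theta>pos: "0 < (\<integral>x. \<theta> x \<partial>\<mu>)"
    and k: "\<And>f B. bounded_fn M f B \<Longrightarrow> bounded_fn L (k f) (Ck * B)"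
    and k2: "\<And>f B. bounded_fn M f B \<Longrightarrow> bounded_fn L (k2 f) (Ck * B\<^sup>2)"
    and k2nn: "\<And>f y. y \<in> space L \<Longrightarrow> 0 \<le> k2 f y"
    and A\<theta>: "\<And>N. 1 \<le> N \<Longrightarrow> AE w in P N. 0 < A N \<theta> w"
    and mean: "\<And>N f B. 1 \<le> N \<Longrightarrow> bounded_fn M f B \<Longrightarrow>
        AE w in P N. (\<integral>z. W N (w, z) * f (X N z) \<partial>K N w) = A N (k f) w / A N \<theta> w"
    and mean2: "\<And>N f B. 1 \<le> N \<Longrightarrow> bounded_fn M f B \<Longrightarrow>
        AE w in P N. (\<integral>z. (W N (w, z) * f (X N z))\<^sup>2 \<partial>K N w) = A N (k2 f) w / A N \<theta> w"
    and c': "0 < c'" and \<mu>': "prob_space \<mu>'" "sets \<mu>' = sets M"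
    and target: "\<And>f B. bounded_fn M f B \<Longrightarrow> c' * (\<integral>x. f x \<partial>\<mu>') = (\<integral>x. k f x \<partial>\<mu>) / (\<integral>x. \<theta> x \<partial>\<mu>)"
begin

abbreviation "kmean N f w \<equiv> \<integral>z. W N (w, z) * f (X N z) \<partial>K N w"
abbreviation "ksq N f w \<equiv> \<integral>z. (W N (w, z) * f (X N z))\<^sup>2 \<partial>K N w"

definition A' :: "nat \<Rightarrow> ('x \<Rightarrow> real) \<Rightarrow> 'w \<Rightarrow> real" where
  "A' N f w = (\<Sum>l\<in>{1..N}. W N (w, Z N l w) * f (X N (Z N l w))) / N"

text \<open>The first term is the variance inherited from the old sample through the conditional
  mean, the second is the fresh sampling noise. The latter should be a conditional variance, but for
  centred f the square of the conditional mean vanishes in the limit and the second moment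
  remains.\<close>

definition V' :: "('x \<Rightarrow> real) \<Rightarrow> real" where
  "V' f = V (k f) / (c * (\<integral>x. \<theta> x \<partial>\<mu>))\<^sup>2 + (\<integral>x. k2 f x \<partial>\<mu>) / (\<integral>x. \<theta> x \<partial>\<mu>)"

text \<open>The ratio of averages is the conditional mean only almost everywhere and could be
  unbounded elsewhere. Clipping it at the bound that the true conditional mean obeys gives a version
  that is measurable with respect to the past and bounded at every outcome.\<close>

definition cmean :: "nat \<Rightarrow> ('x \<Rightarrow> real) \<Rightarrow> real \<Rightarrow> 'w \<Rightarrow> real" where
  "cmean N f B w = max (- (CW * B)) (min (CW * B) (A N (k f) w / A N \<theta> w))"

lemma c: "0 < c" and \<mu>: "prob_space \<mu>" "sets \<mu> = sets L"
  using A by (simp_all add: emp_clt_def)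

context
  fixes N :: nat and f :: "'x \<Rightarrow> real" and B :: real
  assumes N: "1 \<le> N" and f: "bounded_fn M f B"
begin

lemma G: "(\<lambda>x. W N x * f (X N (snd x))) \<in> borel_measurable (F N \<Otimes>\<^sub>M S N)"
  using measurable_compose[OF measurable_compose[OF measurable_snd X[OF N]] bounded_fnD(1)[OF f]] W[OF N] by measurable

lemma GC: "x \<in> space (F N \<Otimes>\<^sub>M S N) \<Longrightarrow> \<bar>W N x * f (X N (snd x))\<bar> \<le> CW * B"
  unfolding abs_mult using WC[OF N] CW measurable_space[OF X[OF N]] bounded_fnD[OF f]
  by (intro mult_mono) (auto simp: space_pair_measure)

lemma CWB: "0 \<le> CW * B" using CW bounded_fnD(2)[OF f] by simp

lemma cmean_measurable: "cmean N f B \<in> borel_measurable (F N)"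
  using AF[OF N k[OF f]] AF[OF N \<theta>] unfolding cmean_def[abs_def] by measurable

lemma cmean_bound: "\<bar>cmean N f B w\<bar> \<le> CW * B"
  unfolding cmean_def using CWB by auto

lemma kernel_integral_bound:
  assumes w: "w \<in> space (F N)"
  shows "integrable (K N w) (\<lambda>z. W N (w, z) * f (X N z))"
    and "\<bar>kmean N f w\<bar> \<le> CW * B"
    and "\<bar>ksq N f w\<bar> \<le> (CW * B)\<^sup>2"
proof -
  have K': "prob_space (K N w)" "sets (K N w) = sets (S N)" "space (K N w) = space (S N)"
    using measurable_space[OF K[OF N] w] by (auto simp: space_prob_algebra dest: sets_eq_imp_space_eq)
  interpret X: prob_space "K N w" by fact
  have Gw[measurable]: "(\<lambda>z. W N (w, z) * f (X N z)) \<in> borel_measurable (K N w)"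
    unfolding measurable_cong_sets[OF K'(2) refl] using measurable_compose[OF measurable_Pair1'[OF w] G] by simp
  have b: "\<bar>W N (w, z) * f (X N z)\<bar> \<le> CW * B" if "z \<in> space (K N w)" for z
    using GC[of "(w, z)"] w that K' by (simp add: space_pair_measure)
  show i: "integrable (K N w) (\<lambda>z. W N (w, z) * f (X N z))"
    using b by (intro X.integrable_bounded[of _ "CW * B"]) auto
  show "\<bar>kmean N f w\<bar> \<le> CW * B"
  proof -
    have "\<bar>kmean N f w\<bar> \<le> (\<integral>z. \<bar>W N (w, z) * f (X N z)\<bar> \<partial>K N w)"
      using integral_norm_bound[of "K N w" "\<lambda>z. W N (w, z) * f (X N z)"] by simp
    also have "\<dots> \<le> CW * B" using b i by (intro X.integral_le_const) auto
    finally show ?thesis .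
  qed
  have "(W N (w, z) * f (X N z))\<^sup>2 \<le> (CW * B)\<^sup>2" if "z \<in> space (K N w)" for z
    using power_mono[OF b[OF that] abs_ge_zero, of 2] by simp
  then have "ksq N f w \<le> (CW * B)\<^sup>2"
    using X.integrable_bounded_sq[OF Gw b] by (intro X.integral_le_const) auto
  then show "\<bar>ksq N f w\<bar> \<le> (CW * B)\<^sup>2" by simp
qed

lemma space_F: "space (F N) = space (P N)"
  using F[OF N] by (simp add: subalgebra_def)

text \<open>Wherever the ratio equals the integral of the weighted function against the kernel it
  inherits the bound CW B, so the clipping is inactive there. The second claim is the multiplicative
  form of the ratio expected by the ratio estimates.\<close>

lemma cmean_AE:
  "AE w in P N. kmean N f w = cmean N f B w"
  "AE w in P N. cmean N f B w * A N \<theta> w = A N (k f) w"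
proof -
  have *: "AE w in P N. kmean N f w = cmean N f B w \<and> cmean N f B w * A N \<theta> w = A N (k f) w"
    using mean[OF N f] A\<theta>[OF N] AE_space
  proof eventually_elim
    case (elim w)
    have "\<bar>A N (k f) w / A N \<theta> w\<bar> \<le> CW * B"
      using kernel_integral_bound(2)[of w] elim by (simp add: space_F)
    then have "- (CW * B) \<le> A N (k f) w / A N \<theta> w" "A N (k f) w / A N \<theta> w \<le> CW * B"
      by (simp_all only: abs_le_iff minus_le_iff)
    then have "cmean N f B w = A N (k f) w / A N \<theta> w" by (simp only: cmean_def min_absorb2 max_absorb2)
    then show ?case using elim by simp
  qed
  show "AE w in P N. kmean N f w = cmean N f B w" using * by eventually_elim simp
  show "AE w in P N. cmean N f B w * A N \<theta> w = A N (k f) w" using * by eventually_elim simp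
qed

lemmas cstep = cond_iid_step[OF P[OF N] F[OF N] N Z[OF N] K[OF N] G GC CWB cmean_measurable cmean_bound, unfolded snd_conv]

lemma step_char:
  assumes "U \<in> borel_measurable (F N)" "\<And>w. w \<in> space (F N) \<Longrightarrow> cmod (U w) \<le> 1"
  shows "cmod ((\<integral>w. U w * iexp (t * (sqrt N * ((\<Sum>l\<in>{1..N}. W N (w, Z N l w) * f (X N (Z N l w))) / N - cmean N f B w))) \<partial>P N)
        - (\<integral>w. U w * complex_of_real (exp (- (t\<^sup>2 * (ksq N f w - (cmean N f B w)\<^sup>2) / 2))) \<partial>P N))
      \<le> (\<bar>t\<bar> ^ 3 * (2 * (CW * B)) ^ 3 / 6 + t ^ 4 * (2 * (CW * B)) ^ 4 / 8) / sqrt N"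
  by (rule cstep(2)[OF _ cmean_AE(1) assms])

text \<open>The difference is the variance under the sampling law, almost everywhere. Its sign keeps
  the Gaussian factors below one and places them where exp(-x) is Lipschitz.\<close>

lemma cvar_nonneg: "AE w in P N. 0 \<le> ksq N f w - (cmean N f B w)\<^sup>2"
  using cmean_AE(1) AE_space
proof eventually_elim
  case (elim w)
  then have w: "w \<in> space (F N)" using space_F by simp
  have K': "prob_space (K N w)" using measurable_space[OF K[OF N] w] by (auto simp: space_prob_algebra)
  interpret X: prob_space "K N w" by fact
  have s: "sets (K N w) = sets (S N)" using measurable_space[OF K[OF N] w] by (auto simp: space_prob_algebra)
  have Gw[measurable]: "(\<lambda>z. W N (w, z) * f (X N z)) \<in> borel_measurable (K N w)"
    unfolding measurable_cong_sets[OF s refl] using measurable_compose[OF measurable_Pair1'[OF w] G] by simp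
  have i2: "integrable (K N w) (\<lambda>z. (W N (w, z) * f (X N z))\<^sup>2)"
  proof (rule X.integrable_bounded_sq[OF Gw])
    show "\<bar>W N (w, z) * f (X N z)\<bar> \<le> CW * B" if "z \<in> space (K N w)" for z
      using GC[of "(w, z)"] w that sets_eq_imp_space_eq[OF s] by (simp add: space_pair_measure)
  qed
  have "0 \<le> X.variance (\<lambda>z. W N (w, z) * f (X N z))" by (rule X.variance_positive)
  also have "\<dots> = ksq N f w - (cmean N f B w)\<^sup>2"
    using X.variance_eq[OF kernel_integral_bound(1)[OF w] i2] elim by simp
  finally show ?case .
qed

lemma A'_measurable: "A' N f \<in> borel_measurable (P N)"
proof -
  have [measurable]: "(\<lambda>w. w) \<in> P N \<rightarrow>\<^sub>M F N" using F[OF N] by (auto simp: measurable_def subalgebra_def)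
  have Zm: "Z N l \<in> P N \<rightarrow>\<^sub>M S N" if "l \<in> {1..N}" for l
    using Z[OF N] that unfolding cond_iid_def by blast
  have "(\<lambda>w. W N (w, Z N l w) * f (X N (Z N l w))) \<in> borel_measurable (P N)" if "l \<in> {1..N}" for l
  proof -
    have "(\<lambda>w. (w, Z N l w)) \<in> P N \<rightarrow>\<^sub>M F N \<Otimes>\<^sub>M S N" using Zm[OF that] by measurable
    from measurable_compose[OF this G] show ?thesis by simp
  qed
  then show ?thesis unfolding A'_def[abs_def] by (intro borel_measurable_divide borel_measurable_sum) auto
qed

lemma A'_bound:
  assumes w: "w \<in> space (P N)"
  shows "\<bar>A' N f w\<bar> \<le> CW * B"
proof -
  have "\<bar>W N (w, Z N l w) * f (X N (Z N l w))\<bar> \<le> CW * B" if "l \<in> {1..N}" for l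
  proof -
    have "Z N l \<in> P N \<rightarrow>\<^sub>M S N" using Z[OF N] that unfolding cond_iid_def by blast
    from measurable_space[OF this w] show ?thesis
      using GC[of "(w, Z N l w)"] w by (simp add: space_pair_measure space_F)
  qed
  then have "\<bar>\<Sum>l\<in>{1..N}. W N (w, Z N l w) * f (X N (Z N l w))\<bar> \<le> (\<Sum>l\<in>{1..N}. CW * B)"
    by (intro order_trans[OF sum_abs] sum_mono)
  then show ?thesis using N unfolding A'_def by (simp add: field_simps)
qed

text \<open>The second moment under the kernel is kept on the right. The error bound in mean relies
  on it, whereas the mean square clause of the invariant only uses its supremum bound.\<close>

lemma step_L2: "(\<integral>w. (A' N f w - cmean N f B w)\<^sup>2 \<partial>P N) \<le> (\<integral>w. ksq N f w \<partial>P N) / N"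
  unfolding A'_def by (rule cstep(1)[OF _ cmean_AE(1)])

lemma cmoment_integrable: "integrable (P N) (\<lambda>w. ksq N f w)"
proof -
  interpret prob_space "P N" by (rule P[OF N])
  have "(\<lambda>w. ksq N f w) \<in> borel_measurable (F N)"
    using borel_measurable_kernel_integral[OF K[OF N] borel_measurable_power[OF G, of 2]] by simp
  then have "(\<lambda>w. ksq N f w) \<in> borel_measurable (P N)"
    by (rule measurable_from_subalg[OF F[OF N]])
  then show ?thesis
    by (rule integrable_bounded[of _ "(CW * B)\<^sup>2"]) (use kernel_integral_bound(3) space_F in auto)
qed

lemma step_L2': "(\<integral>w. (A' N f w - cmean N f B w)\<^sup>2 \<partial>P N) \<le> (CW * B)\<^sup>2 / N"
proof -
  interpret prob_space "P N" by (rule P[OF N])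
  have "(\<integral>w. ksq N f w \<partial>P N) \<le> (CW * B)\<^sup>2"
  proof (rule integral_le_const[OF cmoment_integrable])
    show "AE w in P N. ksq N f w \<le> (CW * B)\<^sup>2"
      using kernel_integral_bound(3) space_F by (intro AE_I2) force
  qed
  then show ?thesis using step_L2 N by (meson divide_right_mono of_nat_0_le_iff order_trans)
qed

end

text \<open>The new average is its conditional mean plus a conditionally centred i.i.d. average. The
  second part contributes the factor exp(-t^2 v / 2) with a deterministic limit v, so the
  expectation of the product tends to a product. The remaining factor is the characteristic function
  of a ratio over the old sample.\<close>

lemma clt: "emp_clt M P A' c' \<mu>' V'"
proof -
  define \<beta> where "\<beta> = c * (\<integral>x. \<theta> x \<partial>\<mu>)"
  have \<beta>: "0 < \<beta>" using c \<theta>pos by (simp add: \<beta>_def)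
  obtain C where C0: "0 \<le> C" and C: "\<And>N f B. 1 \<le> N \<Longrightarrow> bounded_fn L f B \<Longrightarrow>
        A N f \<in> borel_measurable (P N) \<and> (\<forall>w\<in>space (P N). \<bar>A N f w\<bar> \<le> C * B) \<and>
        (\<integral>w. (A N f w - c * (\<integral>x. f x \<partial>\<mu>))\<^sup>2 \<partial>P N) \<le> C * B\<^sup>2 / real N"
    using emp_clt_bound[OF A] by blast
  have tgt: "c' * (\<integral>x. f x \<partial>\<mu>') = (c * (\<integral>x. k f x \<partial>\<mu>)) / \<beta>" if "bounded_fn M f B" for f B
    using target[OF that] c by (simp add: \<beta>_def)
  \<comment> \<open>The first summand is the conditional fluctuation, the second the error of the
    conditional mean as a ratio; each is doubled by the square of a sum. The factor B^2 has been
    split off so that the constant serves all f.\<close>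
  define C2 where "C2 = 2 * CW\<^sup>2 + 2 * ((2 * (C * Ck\<^sup>2) + 2 * CW\<^sup>2 * (C * B\<theta>\<^sup>2)) / \<beta>\<^sup>2)"
  have L2: "(\<integral>w. (A' N f w - c' * (\<integral>x. f x \<partial>\<mu>'))\<^sup>2 \<partial>P N) \<le> C2 * B\<^sup>2 / N" if N: "1 \<le> N" and f: "bounded_fn M f B" for N f B
  proof -
    interpret prob_space "P N" by (rule P[OF N])
    let ?m = "cmean N f B"
    have [measurable]: "A' N f \<in> borel_measurable (P N)" by (rule A'_measurable[OF N f])
    have m[measurable]: "?m \<in> borel_measurable (P N)" by (rule measurable_from_subalg[OF F[OF N] cmean_measurable[OF N f]])
    have "(\<integral>w. (?m w - (c * (\<integral>x. k f x \<partial>\<mu>)) / \<beta>)\<^sup>2 \<partial>P N) \<le> (2 * (C * (Ck * B)\<^sup>2 / N) + 2 * (CW * B)\<^sup>2 * (C * B\<theta>\<^sup>2 / N)) / \<beta>\<^sup>2"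
      using C[OF N k[OF f]] C[OF N \<theta>] m cmean_AE(2)[OF N f] cmean_bound[OF N f] \<beta>
      by (intro ratio_L2[of "A N (k f)" "A N \<theta>" ?m "C * (Ck * B)" "C * B\<theta>"]) (auto simp: \<beta>_def)
    also have "\<dots> = (2 * (C * Ck\<^sup>2) + 2 * CW\<^sup>2 * (C * B\<theta>\<^sup>2)) / \<beta>\<^sup>2 * B\<^sup>2 / N"
      using N \<beta> by (simp add: field_simps power_mult_distrib)
    finally have 2: "(\<integral>w. (?m w - c' * (\<integral>x. f x \<partial>\<mu>'))\<^sup>2 \<partial>P N) \<le> (2 * (C * Ck\<^sup>2) + 2 * CW\<^sup>2 * (C * B\<theta>\<^sup>2)) / \<beta>\<^sup>2 * B\<^sup>2 / N"
      by (simp add: tgt[OF f])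
    have i1: "integrable (P N) (\<lambda>w. (A' N f w - ?m w)\<^sup>2)"
    proof (rule integrable_bounded_sq)
      show "\<bar>A' N f w - ?m w\<bar> \<le> CW * B + CW * B" if "w \<in> space (P N)" for w
        by (rule order_trans[OF abs_triangle_ineq4 add_mono[OF A'_bound[OF N f that] cmean_bound[OF N f]]])
    qed measurable
    have i2: "integrable (P N) (\<lambda>w. (?m w - c' * (\<integral>x. f x \<partial>\<mu>'))\<^sup>2)"
    proof (rule integrable_bounded_sq)
      show "\<bar>?m w - c' * (\<integral>x. f x \<partial>\<mu>')\<bar> \<le> CW * B + \<bar>c' * (\<integral>x. f x \<partial>\<mu>')\<bar>" for w
        by (rule order_trans[OF abs_triangle_ineq4 add_mono[OF cmean_bound[OF N f] order_refl]])
    qed measurable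
    have "(\<integral>w. (A' N f w - c' * (\<integral>x. f x \<partial>\<mu>'))\<^sup>2 \<partial>P N) \<le> (\<integral>w. 2 * (A' N f w - ?m w)\<^sup>2 + 2 * (?m w - c' * (\<integral>x. f x \<partial>\<mu>'))\<^sup>2 \<partial>P N)"
    proof (rule integral_mono')
      show "integrable (P N) (\<lambda>w. 2 * (A' N f w - ?m w)\<^sup>2 + 2 * (?m w - c' * (\<integral>x. f x \<partial>\<mu>'))\<^sup>2)" using i1 i2 by auto
      show "(A' N f w - c' * (\<integral>x. f x \<partial>\<mu>'))\<^sup>2 \<le> 2 * (A' N f w - ?m w)\<^sup>2 + 2 * (?m w - c' * (\<integral>x. f x \<partial>\<mu>'))\<^sup>2" for w
        using sum_sq_le[of "A' N f w - ?m w" "?m w - c' * (\<integral>x. f x \<partial>\<mu>')"] by simp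
    qed auto
    also have "\<dots> = 2 * (\<integral>w. (A' N f w - ?m w)\<^sup>2 \<partial>P N) + 2 * (\<integral>w. (?m w - c' * (\<integral>x. f x \<partial>\<mu>'))\<^sup>2 \<partial>P N)"
      using i1 i2 by simp
    also have "\<dots> \<le> 2 * ((CW * B)\<^sup>2 / N) + 2 * ((2 * (C * Ck\<^sup>2) + 2 * CW\<^sup>2 * (C * B\<theta>\<^sup>2)) / \<beta>\<^sup>2 * B\<^sup>2 / N)"
      using step_L2'[OF N f] 2 by (intro add_mono mult_left_mono) auto
    also have "\<dots> = C2 * B\<^sup>2 / N"
      unfolding C2_def by (simp add: power_mult_distrib distrib_right add_divide_distrib)
    finally show ?thesis .
  qed
  have C20: "0 \<le> C2" using C0 by (simp add: C2_def)
  have lim: "(\<lambda>N. \<integral>w. iexp (t * (sqrt (real N) * A' N f w)) \<partial>P N) \<longlonglongrightarrow> complex_of_real (exp (- (t\<^sup>2 * V' f / 2)))"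
    if f: "bounded_fn M f B" and f0: "(\<integral>x. f x \<partial>\<mu>') = 0" for f B t
  proof -
    define m where "m N = cmean N f B" for N
    have kf0: "(\<integral>x. k f x \<partial>\<mu>) = 0" using target[OF f] f0 \<theta>pos by auto
    have mP: "m N \<in> borel_measurable (P N)" if "1 \<le> N" for N
      unfolding m_def by (rule measurable_from_subalg[OF F[OF that] cmean_measurable[OF that f]])
    have b1: "AE w in P N. \<bar>m N w\<bar> \<le> CW * B" if "1 \<le> N" for N
      using cmean_bound[OF that f] by (simp add: m_def)
    have b2: "AE w in P N. m N w * A N \<theta> w = A N (k f) w" if "1 \<le> N" for N
      using cmean_AE(2)[OF that f] by (simp add: m_def)
    note r1 = emp_clt_ratio(1)[where m=m and D="CW * B" and A=A, OF A P k[OF f] kf0 \<theta> \<theta>pos mP b1 b2, of t]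
    note r2 = emp_clt_ratio(2)[where m=m and D="CW * B" and A=A, OF A P k[OF f] kf0 \<theta> \<theta>pos mP b1 b2]
    obtain E where E0: "0 \<le> E" and E: "\<And>N. 1 \<le> N \<Longrightarrow> (\<integral>w. (m N w)\<^sup>2 \<partial>P N) \<le> E / N" using r2 by blast
    define v where "v = (\<integral>x. k2 f x \<partial>\<mu>) / (\<integral>x. \<theta> x \<partial>\<mu>)"
    have v0: "0 \<le> v" unfolding v_def using \<theta>pos \<mu> k2nn by (intro divide_nonneg_pos Bochner_Integration.integral_nonneg) (auto dest: sets_eq_imp_space_eq)
    define v2 where "v2 N w = ksq N f w" for N w
    define U where "U N w = iexp (t * (sqrt (real N) * m N w))" for N w
    define g where "g N w = exp (- (t\<^sup>2 * (v2 N w - (m N w)\<^sup>2) / 2))" for N w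
    define D1 where "D1 = \<bar>t\<bar> ^ 3 * (2 * (CW * B)) ^ 3 / 6 + t ^ 4 * (2 * (CW * B)) ^ 4 / 8"
    \<comment> \<open>The conditional second moment is itself a ratio, of the averages of
      \<open>k2 f\<close> and \<theta>, with values at most (CW B)^2. \<open>D2\<close> is the
      constant of \<open>ratio_L2\<close> for it.\<close>
    define D2 where "D2 = (2 * (C * (Ck * B\<^sup>2)\<^sup>2) + 2 * ((CW * B)\<^sup>2)\<^sup>2 * (C * B\<theta>\<^sup>2)) / \<beta>\<^sup>2"
    have D20: "0 \<le> D2" using C0 by (simp add: D2_def)
    have bound: "cmod ((\<integral>w. iexp (t * (sqrt (real N) * A' N f w)) \<partial>P N) - (\<integral>w. U N w \<partial>P N) * exp (- (t\<^sup>2 * v / 2)))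
        \<le> D1 / sqrt N + t\<^sup>2 / 2 * (sqrt (D2 / N) + E / N)" if N: "1 \<le> N" for N
    proof -
      interpret prob_space "P N" by (rule P[OF N])
      have mF: "m N \<in> borel_measurable (F N)" unfolding m_def by (rule cmean_measurable[OF N f])
      have v2F: "v2 N \<in> borel_measurable (F N)"
        unfolding v2_def using borel_measurable_kernel_integral[OF K[OF N] borel_measurable_power[OF G[OF N f], of 2]] by simp
      have v2b: "\<bar>v2 N w\<bar> \<le> (CW * B)\<^sup>2" if "w \<in> space (P N)" for w
        using kernel_integral_bound(3)[OF N f] that space_F[OF N f] by (simp add: v2_def)
      have mb: "\<bar>m N w\<bar> \<le> CW * B" for w using cmean_bound[OF N f] by (simp add: m_def)
      note FP = measurable_from_subalg[OF F[OF N]]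
      have [measurable]: "m N \<in> borel_measurable (P N)" "v2 N \<in> borel_measurable (P N)" using mF v2F FP by auto
      have UF: "U N \<in> borel_measurable (F N)" unfolding U_def using mF by measurable
      have [measurable]: "U N \<in> borel_measurable (P N)" by (rule FP[OF UF])
      have Ub: "cmod (U N w) \<le> 1" for w by (simp add: U_def)
      have [measurable]: "g N \<in> borel_measurable (P N)" unfolding g_def by measurable
      have 1: "cmod ((\<integral>w. iexp (t * (sqrt (real N) * A' N f w)) \<partial>P N) - (\<integral>w. U N w * complex_of_real (g N w) \<partial>P N)) \<le> D1 / sqrt N"
      proof -
        have "iexp (t * (sqrt (real N) * A' N f w)) = U N w * iexp (t * (sqrt N * ((\<Sum>l\<in>{1..N}. W N (w, Z N l w) * f (X N (Z N l w))) / N - m N w)))" for w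
          unfolding U_def A'_def by (simp add: algebra_simps flip: exp_add)
        then show ?thesis using step_char[OF N f UF Ub, of t, folded m_def v2_def] by (simp only: g_def D1_def)
      qed
      have var: "AE w in P N. 0 \<le> v2 N w - (m N w)\<^sup>2"
        using cvar_nonneg[OF N f] by (simp add: v2_def m_def)
      have lip: "\<bar>exp (- x) - exp (- y)\<bar> \<le> \<bar>x - y\<bar>" if "0 \<le> x" "0 \<le> y" for x y :: real
      proof -
        have *: "exp (- x) - exp (- y) \<le> y - x" if "0 \<le> x" "x \<le> y" for x y :: real
        proof -
          have "exp (- x) - exp (- y) = exp (- x) * (1 - exp (- (y - x)))" by (simp add: algebra_simps flip: exp_add)
          also have "\<dots> \<le> 1 * (y - x)"
          proof (rule mult_mono)
            show "1 - exp (- (y - x)) \<le> y - x" using exp_ge_add_one_self[of "- (y - x)"] by linarith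
          qed (use that in auto)
          finally show ?thesis by simp
        qed
        show ?thesis using *[of x y] *[of y x] that by (cases "x \<le> y") auto
      qed
      have D2': "expectation (\<lambda>w. (v2 N w - v)\<^sup>2) \<le> D2 / N"
      proof -
        have "expectation (\<lambda>w. (v2 N w - (c * (\<integral>x. k2 f x \<partial>\<mu>)) / \<beta>)\<^sup>2)
            \<le> (2 * (C * (Ck * B\<^sup>2)\<^sup>2 / N) + 2 * ((CW * B)\<^sup>2)\<^sup>2 * (C * B\<theta>\<^sup>2 / N)) / \<beta>\<^sup>2"
        proof (rule ratio_L2[of "A N (k2 f)" "A N \<theta>" "v2 N" "C * (Ck * B\<^sup>2)" "C * B\<theta>"])
          show "AE w in P N. \<bar>v2 N w\<bar> \<le> (CW * B)\<^sup>2" using v2b by auto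
          show "AE w in P N. v2 N w * A N \<theta> w = A N (k2 f) w"
            using mean2[OF N f] A\<theta>[OF N] by eventually_elim (simp add: v2_def)
        qed (use C[OF N k2[OF f]] C[OF N \<theta>] \<beta> in \<open>auto simp: \<beta>_def\<close>)
        then show ?thesis using c by (simp add: v_def \<beta>_def D2_def add_divide_distrib mult.commute)
      qed
      have i3: "integrable (P N) (\<lambda>w. \<bar>v2 N w - v\<bar>)"
        using v2b by (intro integrable_bounded[of _ "(CW * B)\<^sup>2 + \<bar>v\<bar>"]) (auto intro!: abs_triangle_ineq4[THEN order_trans])
      have i4: "integrable (P N) (\<lambda>w. (m N w)\<^sup>2)"
        using mb by (intro integrable_bounded_sq) auto
      \<comment> \<open>The exponential is Lipschitz on the half line, so the conditional Gaussian
        factor differs from its limit by the error of the conditional second moment, O(1/\<surd>N)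
        in mean, and the squared conditional mean, O(1/N).\<close>
      have gle: "AE w in P N. cmod (U N w * complex_of_real (g N w) - U N w * exp (- (t\<^sup>2 * v / 2))) \<le> t\<^sup>2 / 2 * (\<bar>v2 N w - v\<bar> + (m N w)\<^sup>2)"
        using var
      proof eventually_elim
        case (elim w)
        have "cmod (U N w * complex_of_real (g N w) - U N w * exp (- (t\<^sup>2 * v / 2))) = \<bar>g N w - exp (- (t\<^sup>2 * v / 2))\<bar>"
        proof -
          have "U N w * complex_of_real (g N w) - U N w * exp (- (t\<^sup>2 * v / 2)) = U N w * complex_of_real (g N w - exp (- (t\<^sup>2 * v / 2)))"
            by (simp add: algebra_simps)
          then show ?thesis by (simp add: norm_mult U_def del: of_real_diff)
        qed
        also have "\<dots> \<le> \<bar>t\<^sup>2 * (v2 N w - (m N w)\<^sup>2) / 2 - t\<^sup>2 * v / 2\<bar>"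
          unfolding g_def using elim v0 by (intro lip) auto
        also have "t\<^sup>2 * (v2 N w - (m N w)\<^sup>2) / 2 - t\<^sup>2 * v / 2 = t\<^sup>2 / 2 * (v2 N w - v - (m N w)\<^sup>2)" by (simp add: right_diff_distrib diff_divide_distrib)
        also have "\<bar>\<dots>\<bar> \<le> t\<^sup>2 / 2 * (\<bar>v2 N w - v\<bar> + (m N w)\<^sup>2)"
          unfolding abs_mult using abs_triangle_ineq4[of "v2 N w - v" "(m N w)\<^sup>2"] by (intro mult_mono) auto
        finally show ?case .
      qed
      have ig: "integrable (P N) (\<lambda>w. U N w * complex_of_real (g N w))"
      proof (rule integrable_const_bound[of _ 1])
        show "AE w in P N. cmod (U N w * complex_of_real (g N w)) \<le> 1"
          using var by eventually_elim (auto simp: norm_mult U_def g_def)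
      qed measurable
      have iU: "integrable (P N) (U N)" using Ub by (intro integrable_bounded[of _ 1]) auto
      have "cmod ((\<integral>w. U N w * complex_of_real (g N w) \<partial>P N) - (\<integral>w. U N w \<partial>P N) * exp (- (t\<^sup>2 * v / 2)))
        = cmod (\<integral>w. U N w * complex_of_real (g N w) - U N w * exp (- (t\<^sup>2 * v / 2)) \<partial>P N)"
        using ig iU by simp
      also have "\<dots> \<le> (\<integral>w. cmod (U N w * complex_of_real (g N w) - U N w * exp (- (t\<^sup>2 * v / 2))) \<partial>P N)"
        by (rule integral_norm_bound)
      also have "\<dots> \<le> (\<integral>w. t\<^sup>2 / 2 * (\<bar>v2 N w - v\<bar> + (m N w)\<^sup>2) \<partial>P N)"
        using gle ig iU i3 i4 by (intro integral_mono_AE) auto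
      also have "\<dots> = t\<^sup>2 / 2 * (expectation (\<lambda>w. \<bar>v2 N w - v\<bar>) + expectation (\<lambda>w. (m N w)\<^sup>2))"
        using i3 i4 by simp
      also have "\<dots> \<le> t\<^sup>2 / 2 * (sqrt (D2 / N) + E / N)"
      proof (intro mult_left_mono add_mono E[OF N])
        have "expectation (\<lambda>w. \<bar>v2 N w - v\<bar>) \<le> sqrt (expectation (\<lambda>w. (v2 N w - v)\<^sup>2))"
          using v2b by (intro expectation_abs_le_sqrt[of _ "(CW * B)\<^sup>2 + \<bar>v\<bar>"]) (auto intro!: abs_triangle_ineq4[THEN order_trans])
        also have "\<dots> \<le> sqrt (D2 / N)" using D2' by simp
        finally show "expectation (\<lambda>w. \<bar>v2 N w - v\<bar>) \<le> sqrt (D2 / N)" .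
      qed auto
      finally have 2: "cmod ((\<integral>w. U N w * complex_of_real (g N w) \<partial>P N) - (\<integral>w. U N w \<partial>P N) * exp (- (t\<^sup>2 * v / 2))) \<le> t\<^sup>2 / 2 * (sqrt (D2 / N) + E / N)" .
      show ?thesis using norm_triangle_mono[OF 1 2] by simp
    qed
    have "(\<lambda>N. (\<integral>w. iexp (t * (sqrt (real N) * A' N f w)) \<partial>P N) - (\<integral>w. U N w \<partial>P N) * exp (- (t\<^sup>2 * v / 2))) \<longlonglongrightarrow> 0"
    proof (rule Lim_null_comparison)
      show "\<forall>\<^sub>F N in sequentially. cmod ((\<integral>w. iexp (t * (sqrt (real N) * A' N f w)) \<partial>P N) - (\<integral>w. U N w \<partial>P N) * exp (- (t\<^sup>2 * v / 2)))
        \<le> D1 / sqrt N + t\<^sup>2 / 2 * (sqrt (D2 / N) + E / N)"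
        using bound by (intro eventually_sequentiallyI[of 1])
      have "(\<lambda>N. D1 / sqrt (real N) + t\<^sup>2 / 2 * (sqrt (D2 / real N) + E / real N)) \<longlonglongrightarrow> 0 + t\<^sup>2 / 2 * (sqrt 0 + 0)"
        by (intro tendsto_intros real_tendsto_divide_at_top[OF tendsto_const] filterlim_compose[OF sqrt_at_top filterlim_real_sequentially] filterlim_real_sequentially)
      then show "(\<lambda>N. D1 / sqrt (real N) + t\<^sup>2 / 2 * (sqrt (D2 / real N) + E / real N)) \<longlonglongrightarrow> 0" by simp
    qed
    moreover have "(\<lambda>N. (\<integral>w. U N w \<partial>P N) * exp (- (t\<^sup>2 * v / 2))) \<longlonglongrightarrow> complex_of_real (exp (- (t\<^sup>2 * (V (k f) / (c * (\<integral>x. \<theta> x \<partial>\<mu>))\<^sup>2) / 2))) * exp (- (t\<^sup>2 * v / 2))"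
      using r1 unfolding U_def by (intro tendsto_mult tendsto_const)
    ultimately have "(\<lambda>N. \<integral>w. iexp (t * (sqrt (real N) * A' N f w)) \<partial>P N) \<longlonglongrightarrow> 0 + complex_of_real (exp (- (t\<^sup>2 * (V (k f) / (c * (\<integral>x. \<theta> x \<partial>\<mu>))\<^sup>2) / 2))) * exp (- (t\<^sup>2 * v / 2))"
      using tendsto_add by fastforce
    also have "0 + complex_of_real (exp (- (t\<^sup>2 * (V (k f) / (c * (\<integral>x. \<theta> x \<partial>\<mu>))\<^sup>2) / 2))) * exp (- (t\<^sup>2 * v / 2)) = complex_of_real (exp (- (t\<^sup>2 * V' f / 2)))"
    proof -
      have "- (t\<^sup>2 * V' f / 2) = - (t\<^sup>2 * (V (k f) / (c * (\<integral>x. \<theta> x \<partial>\<mu>))\<^sup>2) / 2) + - (t\<^sup>2 * v / 2)"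
        by (simp add: V'_def v_def algebra_simps add_divide_distrib)
      then show ?thesis by (simp only: exp_add of_real_mult add_0)
    qed
    finally show ?thesis .
  qed
  show ?thesis unfolding emp_clt_def
  proof (intro conjI \<mu>' c')
    show "\<exists>C\<ge>0. \<forall>N\<ge>1. \<forall>f B. bounded_fn M f B \<longrightarrow>
        A' N f \<in> borel_measurable (P N) \<and> (\<forall>w\<in>space (P N). \<bar>A' N f w\<bar> \<le> C * B) \<and>
        (\<integral>w. (A' N f w - c' * (\<integral>x. f x \<partial>\<mu>'))\<^sup>2 \<partial>P N) \<le> C * B\<^sup>2 / real N"
    proof (intro exI[of _ "CW + C2"] conjI allI impI ballI)
      fix N :: nat and f B assume N: "1 \<le> N" and f: "bounded_fn M f B"
      show "A' N f \<in> borel_measurable (P N)" by (rule A'_measurable[OF N f])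
      show "\<bar>A' N f w\<bar> \<le> (CW + C2) * B" if "w \<in> space (P N)" for w
        using A'_bound[OF N f that] C20 bounded_fnD(2)[OF f] by (simp add: distrib_right add_increasing2)
      have "C2 * B\<^sup>2 / N \<le> (CW + C2) * B\<^sup>2 / N" using CW by (intro divide_right_mono mult_right_mono) auto
      then show "(\<integral>w. (A' N f w - c' * (\<integral>x. f x \<partial>\<mu>'))\<^sup>2 \<partial>P N) \<le> (CW + C2) * B\<^sup>2 / real N"
        using L2[OF N f] by linarith
    qed (use CW C20 in auto)
  qed (use lim in blast)
qed

end

text \<open>An \<open>L\<^sup>1\<close> error bound by a second moment of \<open>f\<close> under some law, instead of its supremum: applied to the centred
  random section of \<open>H\<close> through the other sample, it makes the remainder of the Hoeffding decomposition \<open>O(1/N)\<close>,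
  where the supremum would not be small.\<close>

definition emp_L1 ::
  "'e measure \<Rightarrow> (nat \<Rightarrow> 'w measure) \<Rightarrow> (nat \<Rightarrow> ('e \<Rightarrow> real) \<Rightarrow> 'w \<Rightarrow> real) \<Rightarrow> real \<Rightarrow> 'e measure \<Rightarrow> bool"
where
  "emp_L1 L P A c \<mu> \<longleftrightarrow>
     (\<exists>C\<ge>0. \<exists>m. \<forall>N\<ge>1. prob_space (m N) \<and> sets (m N) = sets L \<and>
        (\<forall>f B. bounded_fn L f B \<longrightarrow>
          (\<integral>w. \<bar>A N f w - c * (\<integral>x. f x \<partial>\<mu>)\<bar> \<partial>P N) \<le> C * (1 / real N + (\<integral>x. (f x)\<^sup>2 \<partial>m N))))"

text \<open>A fair coin selects the law. It merges the two second moments arising in one step into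
  the second moment under a single law, at the price of a factor 2.\<close>

lemma mixture_exists:
  assumes "prob_space m1" "prob_space m2" "sets m1 = sets M" "sets m2 = sets M"
  shows "\<exists>m. prob_space m \<and> sets m = sets M \<and>
    (\<forall>f B. bounded_fn M f B \<longrightarrow> (\<integral>x. f x \<partial>m) = ((\<integral>x. f x \<partial>m1) + (\<integral>x. f x \<partial>m2)) / 2)"
proof (intro exI conjI allI impI)
  let ?p = "measure_pmf (bernoulli_pmf (1/2))" and ?k = "\<lambda>b. if b then m1 else m2"
  have k: "?k \<in> ?p \<rightarrow>\<^sub>M prob_algebra M" using assms by (auto simp: space_prob_algebra)
  note k' = measurable_prob_algebraD[OF k]
  show "prob_space (?p \<bind> ?k)"
    using assms by (intro prob_space.prob_space_bind[OF measure_pmf.prob_space_axioms _ k']) auto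
  show "sets (?p \<bind> ?k) = sets M" using assms by (intro sets_bind) auto
  fix f B assume f: "bounded_fn M f B"
  have "(\<integral>x. f x \<partial>(?p \<bind> ?k)) = (\<integral>b. (\<integral>x. f x \<partial>?k b) \<partial>?p)"
    using prob_space.emeasure_space_1[OF assms(1)] prob_space.emeasure_space_1[OF assms(2)]
    by (intro integral_bind[OF bounded_fnD(1)[OF f] bounded_fnD(3)[OF f] k', where B'=1] AE_I2) auto
  also have "\<dots> = ((\<integral>x. f x \<partial>m1) + (\<integral>x. f x \<partial>m2)) / 2"
    by (subst integral_measure_pmf_real[where A=UNIV]) (auto simp: UNIV_bool field_simps)
  finally show "(\<integral>x. f x \<partial>(?p \<bind> ?k)) = ((\<integral>x. f x \<partial>m1) + (\<integral>x. f x \<partial>m2)) / 2" .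
qed

lemma bounded_fn_sq: "bounded_fn M f B \<Longrightarrow> bounded_fn M (\<lambda>x. (f x)\<^sup>2) (B\<^sup>2)"
  unfolding bounded_fn_def
  by (auto intro!: borel_measurable_power) (metis abs_ge_zero power2_abs power_mono)

text \<open>The arithmetic-geometric inequality balanced at scale 1/N: a mean square error v/N
  becomes an error in mean of order 1/N + v, with v kept linear.\<close>

lemma abs_le_half_sq:
  fixes x :: real
  assumes N: "1 \<le> (N :: nat)"
  shows "\<bar>x\<bar> \<le> (1 / N + N * x\<^sup>2) / 2"
proof -
  have "0 \<le> (1 - N * \<bar>x\<bar>)\<^sup>2 / N" by simp
  also have "\<dots> = 1 / N + N * x\<^sup>2 - 2 * \<bar>x\<bar>"
    using N by (simp add: power2_eq_square field_simps)
  finally show ?thesis by simp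
qed

section \<open>Propagation of the error bound in mean\<close>

context resampling_step
begin

text \<open>The error splits at the conditional mean and at its linearisation. The first two pieces
  are governed by the second moment of f under the law of one new particle. The third is the old
  error for \<open>k f\<close>, whose square is dominated through the Markov kernel \<open>q\<close>
  by averages of f^2. No supremum of f enters the bound, which is the point of the notion.\<close>

lemma L1_step:
  assumes L1: "emp_L1 L P A c \<mu>" and q: "q \<in> L \<rightarrow>\<^sub>M prob_algebra M" and Cq: "0 \<le> Cq"
    and kq: "\<And>f B y. bounded_fn M f B \<Longrightarrow> y \<in> space L \<Longrightarrow> (k f y)\<^sup>2 \<le> Cq * (\<integral>x. (f x)\<^sup>2 \<partial>q y)"
  shows "emp_L1 M P A' c' \<mu>'"
proof -
  define \<beta> where "\<beta> = c * (\<integral>x. \<theta> x \<partial>\<mu>)"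
  have \<beta>: "0 < \<beta>" using c \<theta>pos by (simp add: \<beta>_def)
  obtain C where C0: "0 \<le> C" and C: "\<And>N f B. 1 \<le> N \<Longrightarrow> bounded_fn L f B \<Longrightarrow>
        A N f \<in> borel_measurable (P N) \<and> (\<forall>w\<in>space (P N). \<bar>A N f w\<bar> \<le> C * B) \<and>
        (\<integral>w. (A N f w - c * (\<integral>x. f x \<partial>\<mu>))\<^sup>2 \<partial>P N) \<le> C * B\<^sup>2 / real N"
    using emp_clt_bound[OF A] by blast
  have tgt: "c' * (\<integral>x. f x \<partial>\<mu>') = (c * (\<integral>x. k f x \<partial>\<mu>)) / \<beta>" if "bounded_fn M f B" for f B
    using target[OF that] c by (simp add: \<beta>_def)
  obtain D m where D0: "0 \<le> D" and m: "\<And>N. 1 \<le> N \<Longrightarrow> prob_space (m N)" "\<And>N. 1 \<le> N \<Longrightarrow> sets (m N) = sets L"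
    and D: "\<And>N f B. 1 \<le> N \<Longrightarrow> bounded_fn L f B \<Longrightarrow>
      (\<integral>w. \<bar>A N f w - c * (\<integral>x. f x \<partial>\<mu>)\<bar> \<partial>P N) \<le> D * (1 / real N + (\<integral>x. (f x)\<^sup>2 \<partial>m N))"
    using L1 unfolding emp_L1_def by blast
  define m1 where "m1 N = distr (P N) M (\<lambda>w. X N (Z N 1 w))" for N
  define m2 where "m2 N = m N \<bind> q" for N
  have Z1: "(\<lambda>w. X N (Z N 1 w)) \<in> P N \<rightarrow>\<^sub>M M" if N: "1 \<le> N" for N
  proof -
    have "Z N 1 \<in> P N \<rightarrow>\<^sub>M S N" using Z[OF N] N unfolding cond_iid_def by auto
    from measurable_compose[OF this X[OF N]] show ?thesis .
  qed
  have m1: "prob_space (m1 N)" "sets (m1 N) = sets M" if "1 \<le> N" for N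
    unfolding m1_def using prob_space.prob_space_distr[OF P[OF that] Z1[OF that]] by auto
  have qm: "q \<in> m N \<rightarrow>\<^sub>M prob_algebra M" if "1 \<le> N" for N
    using q by (simp add: measurable_cong_sets[OF m(2)[OF that] refl])
  have m2: "prob_space (m2 N)" "sets (m2 N) = sets M" if N: "1 \<le> N" for N
  proof -
    interpret prob_space "m N" by (rule m(1)[OF N])
    have "AE y in m N. prob_space (q y)"
      using measurable_space[OF qm[OF N]] by (intro AE_I2) (auto simp: space_prob_algebra)
    then show "prob_space (m2 N)"
      unfolding m2_def by (intro prob_space_bind[OF _ measurable_prob_algebraD[OF qm[OF N]]])
    show "sets (m2 N) = sets M"
      unfolding m2_def using measurable_space[OF qm[OF N]] not_empty by (intro sets_bind) (auto simp: space_prob_algebra)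
  qed
  have "\<forall>N. \<exists>m'. 1 \<le> N \<longrightarrow> prob_space m' \<and> sets m' = sets M \<and>
    (\<forall>f B. bounded_fn M f B \<longrightarrow> (\<integral>x. f x \<partial>m') = ((\<integral>x. f x \<partial>m1 N) + (\<integral>x. f x \<partial>m2 N)) / 2)"
    using mixture_exists m1 m2 by metis
  then obtain m' where m': "\<And>N. 1 \<le> N \<Longrightarrow> prob_space (m' N) \<and> sets (m' N) = sets M \<and>
    (\<forall>f B. bounded_fn M f B \<longrightarrow> (\<integral>x. f x \<partial>m' N) = ((\<integral>x. f x \<partial>m1 N) + (\<integral>x. f x \<partial>m2 N)) / 2)"
    by metis
  \<comment> \<open>A common upper bound for the coefficients of 1/N and of the two second moments.
    The factor 2 in the claim compensates for the weights one half of the mixture.\<close>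
  define E where "E = 1 / 2 + CW\<^sup>2 / 2 + (CW\<^sup>2 + C * B\<theta>\<^sup>2) / (2 * \<beta>) + D * (1 + Cq) / \<beta>"
  have E0: "0 \<le> E" using C0 D0 Cq \<beta> by (simp add: E_def)
  have main: "(\<integral>w. \<bar>A' N f w - c' * (\<integral>x. f x \<partial>\<mu>')\<bar> \<partial>P N) \<le> 2 * E * (1 / N + (\<integral>x. (f x)\<^sup>2 \<partial>m' N))"
    if N: "1 \<le> N" and f: "bounded_fn M f B" for N f B
  proof -
    interpret prob_space "P N" by (rule P[OF N])
    let ?m = "cmean N f B"
    define I1 where "I1 = (\<integral>x. (f x)\<^sup>2 \<partial>m1 N)"
    define I2 where "I2 = (\<integral>x. (f x)\<^sup>2 \<partial>m2 N)"
    have I0: "0 \<le> I1" "0 \<le> I2" by (simp_all add: I1_def I2_def)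
    have I12: "(\<integral>x. (f x)\<^sup>2 \<partial>m' N) = (I1 + I2) / 2"
      using m'[OF N] bounded_fn_sq[OF f] unfolding I1_def I2_def by blast
    have [measurable]: "A' N f \<in> borel_measurable (P N)" by (rule A'_measurable[OF N f])
    have mm[measurable]: "?m \<in> borel_measurable (P N)" by (rule measurable_from_subalg[OF F[OF N] cmean_measurable[OF N f]])
    have [measurable]: "A N (k f) \<in> borel_measurable (P N)" "A N \<theta> \<in> borel_measurable (P N)" using C[OF N k[OF f]] C[OF N \<theta>] by auto
    have fm: "(\<lambda>x. (f x)\<^sup>2) \<in> borel_measurable M" using bounded_fnD[OF bounded_fn_sq[OF f]] by simp
    have v2: "(\<integral>w. ksq N f w \<partial>P N) \<le> CW\<^sup>2 * I1"
    proof -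
      have "(\<integral>w. ksq N f w \<partial>P N) = (\<integral>w. (W N (w, Z N 1 w) * f (X N (Z N 1 w)))\<^sup>2 \<partial>P N)"
      proof -
        have "(\<integral>w. (\<lambda>x. (W N x * f (X N (snd x)))\<^sup>2) (w, Z N 1 w) \<partial>P N) = (\<integral>w. (\<integral>z. (\<lambda>x. (W N x * f (X N (snd x)))\<^sup>2) (w, z) \<partial>K N w) \<partial>P N)"
        proof (rule cond_iid_step(3)[OF P[OF N] F[OF N] N Z[OF N] K[OF N], where G="\<lambda>_. 0" and m="\<lambda>_. 0" and C="(CW * B)\<^sup>2"])
          show "(\<lambda>x. (W N x * f (X N (snd x)))\<^sup>2) \<in> borel_measurable (F N \<Otimes>\<^sub>M S N)"
            by (rule borel_measurable_power[OF G[OF N f]])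
          show "\<bar>(W N x * f (X N (snd x)))\<^sup>2\<bar> \<le> (CW * B)\<^sup>2" if "x \<in> space (F N \<Otimes>\<^sub>M S N)" for x
            using power_mono[OF GC[OF N f that] abs_ge_zero, of 2] by simp
        qed auto
        then show ?thesis by simp
      qed
      also have "\<dots> \<le> (\<integral>w. CW\<^sup>2 * (f (X N (Z N 1 w)))\<^sup>2 \<partial>P N)"
      proof (rule integral_mono')
        show "integrable (P N) (\<lambda>w. CW\<^sup>2 * (f (X N (Z N 1 w)))\<^sup>2)"
          using measurable_space[OF Z1[OF N]] bounded_fnD(3)[OF f]
          by (intro integrable_mult_right integrable_bounded_sq[of _ B] measurable_compose[OF Z1[OF N] bounded_fnD(1)[OF f]]) auto
        show "(W N (w, Z N 1 w) * f (X N (Z N 1 w)))\<^sup>2 \<le> CW\<^sup>2 * (f (X N (Z N 1 w)))\<^sup>2" if w: "w \<in> space (P N)" for w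
        proof -
          have "Z N 1 \<in> P N \<rightarrow>\<^sub>M S N" using Z[OF N] N unfolding cond_iid_def by auto
          from measurable_space[OF this w] have "\<bar>W N (w, Z N 1 w)\<bar> \<le> CW"
            using w F[OF N] by (intro WC[OF N]) (auto simp: space_pair_measure subalgebra_def)
          then have "(W N (w, Z N 1 w))\<^sup>2 \<le> CW\<^sup>2" using power_mono[OF _ abs_ge_zero, of "W N (w, Z N 1 w)" CW 2] by simp
          then show ?thesis by (simp add: power_mult_distrib mult_right_mono)
        qed
      qed auto
      also have "\<dots> = CW\<^sup>2 * I1"
        unfolding I1_def m1_def by (subst integral_distr[OF Z1[OF N] fm]) simp
      finally show ?thesis .
    qed
    have i1: "integrable (P N) (\<lambda>w. (A' N f w - ?m w)\<^sup>2)"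
    proof (rule integrable_bounded_sq)
      show "\<bar>A' N f w - ?m w\<bar> \<le> CW * B + CW * B" if "w \<in> space (P N)" for w
        by (rule order_trans[OF abs_triangle_ineq4 add_mono[OF A'_bound[OF N f that] cmean_bound[OF N f]]])
    qed measurable
    have i1': "integrable (P N) (\<lambda>w. \<bar>A' N f w - ?m w\<bar>)"
    proof (rule integrable_abs, rule integrable_bounded)
      show "norm (A' N f w - ?m w) \<le> CW * B + CW * B" if "w \<in> space (P N)" for w
        unfolding real_norm_def
        by (rule order_trans[OF abs_triangle_ineq4 add_mono[OF A'_bound[OF N f that] cmean_bound[OF N f]]])
    qed measurable
    have T1: "(\<integral>w. \<bar>A' N f w - ?m w\<bar> \<partial>P N) \<le> 1 / 2 * (1 / N) + CW\<^sup>2 / 2 * I1"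
    proof -
      have "(\<integral>w. \<bar>A' N f w - ?m w\<bar> \<partial>P N) \<le> (\<integral>w. (1 / N + N * (A' N f w - ?m w)\<^sup>2) / 2 \<partial>P N)"
        using i1 i1' abs_le_half_sq[OF N] by (intro integral_mono) auto
      also have "\<dots> = (1 / N + N * (\<integral>w. (A' N f w - ?m w)\<^sup>2 \<partial>P N)) / 2" using i1 by (simp add: prob_space)
      also have "N * (\<integral>w. (A' N f w - ?m w)\<^sup>2 \<partial>P N) \<le> N * (CW\<^sup>2 * I1 / N)"
        by (intro mult_left_mono order_trans[OF step_L2[OF N f]] divide_right_mono v2) auto
      finally show ?thesis using N by simp
    qed
    have im2: "integrable (P N) (\<lambda>w. (?m w)\<^sup>2)"
      by (rule integrable_bounded_sq) (use cmean_bound[OF N f] in auto)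
    have Em: "(\<integral>w. (?m w)\<^sup>2 \<partial>P N) \<le> CW\<^sup>2 * I1"
    proof (rule order_trans[OF _ v2], rule integral_mono_AE)
      show "AE w in P N. (?m w)\<^sup>2 \<le> ksq N f w"
        using cvar_nonneg[OF N f] by eventually_elim simp
    qed (use im2 cmoment_integrable[OF N f] in auto)
    have ia: "integrable (P N) (A N (k f))" using C[OF N k[OF f]] by (intro integrable_bounded[of _ "C * (Ck * B)"]) auto
    have im: "integrable (P N) ?m" using cmean_bound[OF N f] by (intro integrable_bounded[of _ "CW * B"]) auto
    have T2: "(\<integral>w. \<bar>?m w - A N (k f) w / \<beta>\<bar> \<partial>P N) \<le> CW\<^sup>2 / (2 * \<beta>) * I1 + C * B\<theta>\<^sup>2 / (2 * \<beta>) * (1 / N)"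
    proof -
      have "(\<integral>w. \<bar>?m w - A N (k f) w / \<beta>\<bar> \<partial>P N) \<le> ((\<integral>w. (?m w)\<^sup>2 \<partial>P N) + (\<integral>w. (A N \<theta> w - \<beta>)\<^sup>2 \<partial>P N)) / (2 * \<beta>)"
        using C[OF N \<theta>] cmean_bound[OF N f] cmean_AE(2)[OF N f] \<beta> by (intro ratio_L1[of _ _ _ "C * B\<theta>" "CW * B"]) auto
      also have "\<dots> \<le> (CW\<^sup>2 * I1 + C * B\<theta>\<^sup>2 / N) / (2 * \<beta>)"
        using Em C[OF N \<theta>] \<beta> by (intro divide_right_mono add_mono) (auto simp: \<beta>_def)
      finally show ?thesis by (simp add: add_divide_distrib mult.commute)
    qed
    have T3: "(\<integral>w. \<bar>A N (k f) w - c * (\<integral>x. k f x \<partial>\<mu>)\<bar> / \<beta> \<partial>P N) \<le> D / \<beta> * (1 / N) + D * Cq / \<beta> * I2"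
    proof -
      have "(\<integral>x. (k f x)\<^sup>2 \<partial>m N) \<le> (\<integral>y. Cq * (\<integral>x. (f x)\<^sup>2 \<partial>q y) \<partial>m N)"
      proof (rule integral_mono')
        interpret mN: prob_space "m N" by (rule m(1)[OF N])
        have sm: "space (m N) = space L" using sets_eq_imp_space_eq[OF m(2)[OF N]] .
        show "integrable (m N) (\<lambda>y. Cq * (\<integral>x. (f x)\<^sup>2 \<partial>q y))"
        proof (rule integrable_mult_right, rule mN.integrable_bounded[of _ "B\<^sup>2"])
          have "(\<lambda>y. \<integral>x. (\<lambda>p. (f (snd p))\<^sup>2) (y, x) \<partial>q y) \<in> borel_measurable (m N)"
            by (rule borel_measurable_kernel_integral[OF qm[OF N]]) (rule measurable_compose[OF measurable_snd fm])
          then show "(\<lambda>y. \<integral>x. (f x)\<^sup>2 \<partial>q y) \<in> borel_measurable (m N)" by simp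
          fix y assume "y \<in> space (m N)"
          then have qy: "prob_space (q y)" "sets (q y) = sets M" using measurable_space[OF qm[OF N]] by (auto simp: space_prob_algebra)
          interpret qy: prob_space "q y" by fact
          have fq: "f \<in> borel_measurable (q y)" using bounded_fnD(1)[OF f] by (simp add: measurable_cong_sets[OF qy(2) refl])
          have "(\<integral>x. (f x)\<^sup>2 \<partial>q y) \<le> B\<^sup>2"
            using bounded_fnD(3)[OF bounded_fn_sq[OF f]] bounded_fnD(3)[OF f] sets_eq_imp_space_eq[OF qy(2)]
            by (intro qy.integral_le_const qy.integrable_bounded_sq[OF fq, of B]) auto
          then show "norm (\<integral>x. (f x)\<^sup>2 \<partial>q y) \<le> B\<^sup>2" by simp
        qed
        show "(k f y)\<^sup>2 \<le> Cq * (\<integral>x. (f x)\<^sup>2 \<partial>q y)" if "y \<in> space (m N)" for y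
          using kq[OF f] that sm by simp
        show "0 \<le> Cq * (\<integral>x. (f x)\<^sup>2 \<partial>q y)" for y
          using Cq by (intro mult_nonneg_nonneg Bochner_Integration.integral_nonneg) auto
      qed
      also have "\<dots> = Cq * I2"
      proof -
        interpret mN: prob_space "m N" by (rule m(1)[OF N])
        have "I2 = (\<integral>y. (\<integral>x. (f x)\<^sup>2 \<partial>q y) \<partial>m N)"
          unfolding I2_def m2_def
        proof (rule integral_bind[OF fm _ measurable_prob_algebraD[OF qm[OF N]], where B'=1 and B="B\<^sup>2"])
          show "\<bar>(f x)\<^sup>2\<bar> \<le> B\<^sup>2" if "x \<in> space M" for x using bounded_fnD(3)[OF bounded_fn_sq[OF f] that] .
          show "finite_measure (m N)" by unfold_locales
          have "emeasure (q y) (space (q y)) \<le> ennreal 1" if "y \<in> space (m N)" for y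
          proof -
            have "prob_space (q y)" using measurable_space[OF qm[OF N] that] by (auto simp: space_prob_algebra)
            then show ?thesis using prob_space.emeasure_space_1 by force
          qed
          then show "AE y in m N. emeasure (q y) (space (q y)) \<le> ennreal 1" by (rule AE_I2)
        qed
        then show ?thesis by simp
      qed
      finally have kk: "(\<integral>x. (k f x)\<^sup>2 \<partial>m N) \<le> Cq * I2" .
      have "(\<integral>w. \<bar>A N (k f) w - c * (\<integral>x. k f x \<partial>\<mu>)\<bar> / \<beta> \<partial>P N) = (\<integral>w. \<bar>A N (k f) w - c * (\<integral>x. k f x \<partial>\<mu>)\<bar> \<partial>P N) / \<beta>"
        by simp
      also have "\<dots> \<le> D * (1 / N + Cq * I2) / \<beta>"
        using kk D0 \<beta> by (intro divide_right_mono order_trans[OF D[OF N k[OF f]]] mult_left_mono add_left_mono) auto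
      finally show ?thesis by (simp add: distrib_left add_divide_distrib mult.commute mult.left_commute)
    qed
    have "(\<integral>w. \<bar>A' N f w - c' * (\<integral>x. f x \<partial>\<mu>')\<bar> \<partial>P N)
      \<le> (\<integral>w. \<bar>A' N f w - ?m w\<bar> + \<bar>?m w - A N (k f) w / \<beta>\<bar> + \<bar>A N (k f) w - c * (\<integral>x. k f x \<partial>\<mu>)\<bar> / \<beta> \<partial>P N)"
    proof (rule integral_mono')
      show "integrable (P N) (\<lambda>w. \<bar>A' N f w - ?m w\<bar> + \<bar>?m w - A N (k f) w / \<beta>\<bar> + \<bar>A N (k f) w - c * (\<integral>x. k f x \<partial>\<mu>)\<bar> / \<beta>)"
        using i1' im ia by auto
      show "\<bar>A' N f w - c' * (\<integral>x. f x \<partial>\<mu>')\<bar> \<le> \<bar>A' N f w - ?m w\<bar> + \<bar>?m w - A N (k f) w / \<beta>\<bar> + \<bar>A N (k f) w - c * (\<integral>x. k f x \<partial>\<mu>)\<bar> / \<beta>" for w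
      proof -
        have "\<bar>A N (k f) w - c * (\<integral>x. k f x \<partial>\<mu>)\<bar> / \<beta> = \<bar>A N (k f) w / \<beta> - c * (\<integral>x. k f x \<partial>\<mu>) / \<beta>\<bar>"
          using \<beta> by (simp add: abs_divide diff_divide_distrib[symmetric])
        moreover have "\<bar>a - d\<bar> \<le> \<bar>a - b\<bar> + \<bar>b - e\<bar> + \<bar>e - d\<bar>" for a b d e :: real by arith
        ultimately show ?thesis unfolding tgt[OF f] by metis
      qed
    qed (use \<beta> in auto)
    also have "\<dots> = (\<integral>w. \<bar>A' N f w - ?m w\<bar> \<partial>P N) + (\<integral>w. \<bar>?m w - A N (k f) w / \<beta>\<bar> \<partial>P N) + (\<integral>w. \<bar>A N (k f) w - c * (\<integral>x. k f x \<partial>\<mu>)\<bar> / \<beta> \<partial>P N)"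
    proof -
      have j: "integrable (P N) (\<lambda>w. \<bar>?m w - A N (k f) w / \<beta>\<bar>)" "integrable (P N) (\<lambda>w. \<bar>A N (k f) w - c * (\<integral>x. k f x \<partial>\<mu>)\<bar> / \<beta>)"
        using im ia by auto
      show ?thesis
        by (subst Bochner_Integration.integral_add[OF Bochner_Integration.integrable_add[OF i1' j(1)] j(2)],
            subst Bochner_Integration.integral_add[OF i1' j(1)]) (rule refl)
    qed
    also have "\<dots> \<le> (1 / 2 * (1 / N) + CW\<^sup>2 / 2 * I1) + (CW\<^sup>2 / (2 * \<beta>) * I1 + C * B\<theta>\<^sup>2 / (2 * \<beta>) * (1 / N)) + (D / \<beta> * (1 / N) + D * Cq / \<beta> * I2)"
      by (intro add_mono T1 T2 T3)
    also have "\<dots> = (1 / 2 + C * B\<theta>\<^sup>2 / (2 * \<beta>) + D / \<beta>) * (1 / N) + (CW\<^sup>2 / 2 + CW\<^sup>2 / (2 * \<beta>)) * I1 + (D * Cq / \<beta>) * I2"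
      by (simp only: distrib_right)
    also have "\<dots> \<le> E * (1 / N) + E * I1 + E * I2"
    proof (intro add_mono mult_right_mono I0)
      show "1 / 2 + C * B\<theta>\<^sup>2 / (2 * \<beta>) + D / \<beta> \<le> E" "CW\<^sup>2 / 2 + CW\<^sup>2 / (2 * \<beta>) \<le> E" "D * Cq / \<beta> \<le> E"
        using C0 D0 Cq \<beta> by (simp_all add: E_def distrib_left add_divide_distrib)
    qed auto
    also have "\<dots> \<le> 2 * E * (1 / N + (I1 + I2) / 2)"
    proof -
      have "2 * E * (1 / N + (I1 + I2) / 2) = E * (1 / N) + (E * (1 / N) + E * I1 + E * I2)"
        by (simp add: distrib_left add_divide_distrib)
      moreover have "0 \<le> E * (1 / N)" using E0 by simp
      ultimately show ?thesis by linarith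
    qed
    finally show ?thesis by (simp only: I12)
  qed
  show ?thesis unfolding emp_L1_def
    using E0 m' main by (intro exI[of _ "2 * E"] conjI exI[of _ m']) auto
qed

end

text \<open>The identity map, viewed once with values in each subalgebra, gives two independent
  variables, so the law of the diagonal pair (w, w) is a product measure. Fubini then allows the
  outcome of the second \<sigma>-field to be frozen while integrating over the first.\<close>

lemma indep_subalgebra_integral:
  fixes f :: "'w \<times> 'w \<Rightarrow> 'b :: {banach, second_countable_topology}"
  assumes P: "prob_space P" and F: "subalgebra P F1" "subalgebra P F2"
    and ind: "prob_space.indep_set P (sets F1) (sets F2)"
    and f: "f \<in> borel_measurable (F1 \<Otimes>\<^sub>M F2)"
    and B: "\<And>x. x \<in> space P \<times> space P \<Longrightarrow> norm (f x) \<le> B"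
  shows "(\<integral>w. f (w, w) \<partial>P) = (\<integral>w'. (\<integral>w. f (w, w') \<partial>P) \<partial>P)" (is ?eq)
    and "(\<lambda>w'. \<integral>w. f (w, w') \<partial>P) \<in> borel_measurable F2" (is ?meas)
proof -
  interpret prob_space P by fact
  have sp: "space F1 = space P" "space F2 = space P" using F by (auto simp: subalgebra_def)
  define R1 where "R1 = restr_to_subalg P F1"
  define R2 where "R2 = restr_to_subalg P F2"
  have R: "prob_space R1" "prob_space R2"
    unfolding R1_def R2_def using F by (auto intro!: prob_space_restr_to_subalg prob_space_axioms)
  interpret R1: prob_space R1 by fact
  interpret R2: prob_space R2 by fact
  interpret R: pair_prob_space R1 R2 ..
  have sR: "sets R1 = sets F1" "sets R2 = sets F2" "space R1 = space P" "space R2 = space P"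
    unfolding R1_def R2_def using F by (simp_all add: sets_restr_to_subalg space_restr_to_subalg)
  have fR: "f \<in> borel_measurable (R1 \<Otimes>\<^sub>M R2)"
    using f by (simp add: measurable_cong_sets[OF sets_pair_measure_cong[OF sR(1,2)] refl])
  have id: "(\<lambda>w. w) \<in> P \<rightarrow>\<^sub>M R1" "(\<lambda>w. w) \<in> P \<rightarrow>\<^sub>M R2"
    using F sR by (auto simp: measurable_def subalgebra_def)
  have iv: "indep_var R1 (\<lambda>w. w) R2 (\<lambda>w. w)"
    unfolding indep_var_eq
  proof (intro conjI id)
    have e1: "(\<lambda>w. w) -` A \<inter> space P = A" if "A \<in> sets R1" for A
      using sets.sets_into_space[OF that] sR by auto
    have 1: "{(\<lambda>w. w) -` A \<inter> space P |A. A \<in> sets R1} = sets F1"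
      unfolding Setcompr_eq_image using e1 sR(1) by (simp cong: image_cong)
    have e2: "(\<lambda>w. w) -` A \<inter> space P = A" if "A \<in> sets R2" for A
      using sets.sets_into_space[OF that] sR by auto
    have 2: "{(\<lambda>w. w) -` A \<inter> space P |A. A \<in> sets R2} = sets F2"
      unfolding Setcompr_eq_image using e2 sR(2) by (simp cong: image_cong)
    have "sigma_sets (space P) (sets F1) = sets F1" "sigma_sets (space P) (sets F2) = sets F2"
      using sets.sigma_sets_eq[of F1] sets.sigma_sets_eq[of F2] sp by auto
    then show "indep_set (sigma_sets (space P) {(\<lambda>w. w) -` A \<inter> space P |A. A \<in> sets R1}) (sigma_sets (space P) {(\<lambda>w. w) -` A \<inter> space P |A. A \<in> sets R2})"
      using ind by (simp only: 1 2)
  qed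
  have d1: "distr P R1 (\<lambda>w. w) = R1"
  proof (rule measure_eqI)
    fix A assume "A \<in> sets (distr P R1 (\<lambda>w. w))"
    then have a: "A \<in> sets F1" "A \<in> sets R1" by (simp_all add: sR)
    then have "A \<subseteq> space P" using sets.sets_into_space sp(1) by metis
    then show "emeasure (distr P R1 (\<lambda>w. w)) A = emeasure R1 A"
      using emeasure_restr_to_subalg[OF F(1) a(1), folded R1_def] by (simp only: emeasure_distr[OF id(1) a(2)] vimage_ident Int_absorb2)
  qed simp
  have d2: "distr P R2 (\<lambda>w. w) = R2"
  proof (rule measure_eqI)
    fix A assume "A \<in> sets (distr P R2 (\<lambda>w. w))"
    then have a: "A \<in> sets F2" "A \<in> sets R2" by (simp_all add: sR)
    then have "A \<subseteq> space P" using sets.sets_into_space sp(2) by metis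
    then show "emeasure (distr P R2 (\<lambda>w. w)) A = emeasure R2 A"
      using emeasure_restr_to_subalg[OF F(2) a(1), folded R2_def] by (simp only: emeasure_distr[OF id(2) a(2)] vimage_ident Int_absorb2)
  qed simp
  have D: "distr P (R1 \<Otimes>\<^sub>M R2) (\<lambda>w. (w, w)) = R1 \<Otimes>\<^sub>M R2"
    using iv indep_var_distribution_eq[of R1 "\<lambda>w. w" R2 "\<lambda>w. w"] by (simp only: d1 d2)
  have intf: "integrable (R1 \<Otimes>\<^sub>M R2) f"
    using fR B by (intro R.integrable_const_bound[of _ B]) (auto simp: space_pair_measure sR)
  have inner: "(\<integral>w. f (w, w') \<partial>R1) = (\<integral>w. f (w, w') \<partial>P)" if "w' \<in> space P" for w'
    unfolding R1_def using that sp
    by (intro integral_subalgebra2[OF F(1)] measurable_compose[OF _ f]) auto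
  have m: "(\<lambda>w'. \<integral>w. f (w, w') \<partial>R1) \<in> borel_measurable R2"
    using fR by (intro R1.borel_measurable_lebesgue_integral) (auto intro: measurable_pair_swap)
  then have "(\<lambda>w'. \<integral>w. f (w, w') \<partial>R1) \<in> borel_measurable F2"
    by (simp add: measurable_cong_sets[OF sR(2) refl])
  then show ?meas by (subst (asm) measurable_cong[OF inner]) (auto simp: sp)
  have "(\<integral>w. f (w, w) \<partial>P) = (\<integral>x. f x \<partial>distr P (R1 \<Otimes>\<^sub>M R2) (\<lambda>w. (w, w)))"
    using id by (intro integral_distr[symmetric] fR) (rule measurable_Pair)
  also have "\<dots> = (\<integral>w'. (\<integral>w. f (w, w') \<partial>R1) \<partial>R2)"
    unfolding D by (rule R.integral_snd[symmetric, of "\<lambda>x y. f (x, y)", simplified]) (use intf in simp)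
  also have "\<dots> = (\<integral>w'. (\<integral>w. f (w, w') \<partial>P) \<partial>R2)"
    by (intro Bochner_Integration.integral_cong refl inner) (simp add: sR)
  also have "\<dots> = (\<integral>w'. (\<integral>w. f (w, w') \<partial>P) \<partial>P)"
    unfolding R2_def by (rule integral_subalgebra2[OF F(2) \<open>?meas\<close>])
  finally show ?eq .
qed

section \<open>Pairs of independent samples\<close>

text \<open>The error bound by second moments is asked of the first sample: the argument freezes the
  second sample and applies that bound to a section depending on it. The second sample enters
  through its mean square error at each fixed point of the first space.\<close>

locale pair_average =
  fixes L1 :: "'x measure" and L2 :: "'y measure" and P F1 F2 :: "nat \<Rightarrow> 'w measure"
    and om1 om2 :: "nat \<Rightarrow> nat \<Rightarrow> 'w \<Rightarrow> real" and x1 :: "nat \<Rightarrow> nat \<Rightarrow> 'w \<Rightarrow> 'x" and x2 :: "nat \<Rightarrow> nat \<Rightarrow> 'w \<Rightarrow> 'y"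
    and A1 A2 c1 c2 \<mu>1 \<mu>2 V1 V2
  assumes P: "\<And>N. 1 \<le> N \<Longrightarrow> prob_space (P N)"
    and F: "\<And>N. 1 \<le> N \<Longrightarrow> subalgebra (P N) (F1 N)" "\<And>N. 1 \<le> N \<Longrightarrow> subalgebra (P N) (F2 N)"
    and ind: "\<And>N. 1 \<le> N \<Longrightarrow> prob_space.indep_set (P N) (sets (F1 N)) (sets (F2 N))"
    and om1: "\<And>N l. 1 \<le> N \<Longrightarrow> l \<in> {1..N} \<Longrightarrow> om1 N l \<in> borel_measurable (F1 N)"
    and om2: "\<And>N l. 1 \<le> N \<Longrightarrow> l \<in> {1..N} \<Longrightarrow> om2 N l \<in> borel_measurable (F2 N)"
    and x1: "\<And>N l. 1 \<le> N \<Longrightarrow> l \<in> {1..N} \<Longrightarrow> x1 N l \<in> F1 N \<rightarrow>\<^sub>M L1"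
    and x2: "\<And>N l. 1 \<le> N \<Longrightarrow> l \<in> {1..N} \<Longrightarrow> x2 N l \<in> F2 N \<rightarrow>\<^sub>M L2"
    and A1: "\<And>N f w. A1 N f w = (\<Sum>l\<in>{1..N}. om1 N l w * f (x1 N l w)) / real N"
    and A2: "\<And>N f w. A2 N f w = (\<Sum>l\<in>{1..N}. om2 N l w * f (x2 N l w)) / real N"
    and clt1: "emp_clt L1 P A1 c1 \<mu>1 V1" and clt2: "emp_clt L2 P A2 c2 \<mu>2 V2" and L1: "emp_L1 L1 P A1 c1 \<mu>1"
begin

definition A :: "nat \<Rightarrow> ('x \<times> 'y \<Rightarrow> real) \<Rightarrow> 'w \<Rightarrow> real" where
  "A N H w = A1 N (\<lambda>x. A2 N (\<lambda>y. H (x, y)) w) w"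

text \<open>To leading order the double average is c2 times the first average of one marginal of H
  plus c1 times the second average of the other. By independence the variances of the two terms
  add.\<close>

definition V :: "('x \<times> 'y \<Rightarrow> real) \<Rightarrow> real" where
  "V H = c2\<^sup>2 * V1 (\<lambda>x. \<integral>y. H (x, y) \<partial>\<mu>2) + c1\<^sup>2 * V2 (\<lambda>y. \<integral>x. H (x, y) \<partial>\<mu>1)"

lemma c: "0 < c1" "0 < c2" and \<mu>: "prob_space \<mu>1" "sets \<mu>1 = sets L1" "prob_space \<mu>2" "sets \<mu>2 = sets L2"
  using clt1 clt2 by (simp_all add: emp_clt_def)

sublocale \<mu>: pair_prob_space \<mu>1 \<mu>2
  using \<mu> by (simp add: pair_prob_space_def pair_sigma_finite_def prob_space_imp_sigma_finite)

lemma space_\<mu>: "space \<mu>1 = space L1" "space \<mu>2 = space L2"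
  using \<mu> by (auto dest: sets_eq_imp_space_eq)

lemma sets_pair_\<mu>: "sets (\<mu>1 \<Otimes>\<^sub>M \<mu>2) = sets (L1 \<Otimes>\<^sub>M L2)"
  using \<mu> by (intro sets_pair_measure_cong)

context
  fixes H :: "'x \<times> 'y \<Rightarrow> real" and B :: real
  assumes H: "bounded_fn (L1 \<Otimes>\<^sub>M L2) H B"
begin

lemma H_meas: "H \<in> borel_measurable (L1 \<Otimes>\<^sub>M L2)" and H_bound: "\<And>x y. x \<in> space L1 \<Longrightarrow> y \<in> space L2 \<Longrightarrow> \<bar>H (x, y)\<bar> \<le> B"
  and B0: "0 \<le> B"
  using bounded_fnD[OF H] by (auto simp: space_pair_measure)

lemma section1: "x \<in> space L1 \<Longrightarrow> bounded_fn L2 (\<lambda>y. H (x, y)) B"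
  unfolding bounded_fn_def using H_bound B0 measurable_compose[OF measurable_Pair1' H_meas] by auto

lemma section2: "y \<in> space L2 \<Longrightarrow> bounded_fn L1 (\<lambda>x. H (x, y)) B"
  unfolding bounded_fn_def using H_bound B0 measurable_compose[OF measurable_Pair2' H_meas] by auto

lemma marginal1: "bounded_fn L1 (\<lambda>x. \<integral>y. H (x, y) \<partial>\<mu>2) B"
  unfolding bounded_fn_def
proof (intro conjI ballI B0)
  have "(\<lambda>x. \<integral>y. H (x, y) \<partial>\<mu>2) \<in> borel_measurable \<mu>1"
    using H_meas by (intro \<mu>.M2.borel_measurable_lebesgue_integral) (simp add: measurable_cong_sets[OF sets_pair_\<mu> refl])
  then show "(\<lambda>x. \<integral>y. H (x, y) \<partial>\<mu>2) \<in> borel_measurable L1" by (simp add: measurable_cong_sets[OF \<mu>(2) refl])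
  fix x assume x: "x \<in> space L1"
  have s: "(\<lambda>y. H (x, y)) \<in> borel_measurable \<mu>2" using bounded_fnD(1)[OF section1[OF x]] by (simp add: measurable_cong_sets[OF \<mu>(4) refl])
  have i: "integrable \<mu>2 (\<lambda>y. H (x, y))"
    using H_bound[OF x] by (intro \<mu>.M2.integrable_bounded[OF s, of B]) (auto simp: space_\<mu>)
  have "\<bar>\<integral>y. H (x, y) \<partial>\<mu>2\<bar> \<le> (\<integral>y. \<bar>H (x, y)\<bar> \<partial>\<mu>2)" using integral_norm_bound[of \<mu>2 "\<lambda>y. H (x, y)"] by simp
  also have "\<dots> \<le> B" using i H_bound[OF x] by (intro \<mu>.M2.integral_le_const) (auto simp: space_\<mu>)
  finally show "\<bar>\<integral>y. H (x, y) \<partial>\<mu>2\<bar> \<le> B" .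
qed

lemma marginal2: "bounded_fn L2 (\<lambda>y. \<integral>x. H (x, y) \<partial>\<mu>1) B"
  unfolding bounded_fn_def
proof (intro conjI ballI B0)
  have "(\<lambda>y. \<integral>x. H (x, y) \<partial>\<mu>1) \<in> borel_measurable \<mu>2"
    using H_meas by (intro \<mu>.M1.borel_measurable_lebesgue_integral) (auto intro!: measurable_pair_swap simp: measurable_cong_sets[OF sets_pair_\<mu> refl])
  then show "(\<lambda>y. \<integral>x. H (x, y) \<partial>\<mu>1) \<in> borel_measurable L2" by (simp add: measurable_cong_sets[OF \<mu>(4) refl])
  fix y assume y: "y \<in> space L2"
  have s: "(\<lambda>x. H (x, y)) \<in> borel_measurable \<mu>1" using bounded_fnD(1)[OF section2[OF y]] by (simp add: measurable_cong_sets[OF \<mu>(2) refl])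
  have i: "integrable \<mu>1 (\<lambda>x. H (x, y))"
    using H_bound y by (intro \<mu>.M1.integrable_bounded[OF s, of B]) (auto simp: space_\<mu>)
  have "\<bar>\<integral>x. H (x, y) \<partial>\<mu>1\<bar> \<le> (\<integral>x. \<bar>H (x, y)\<bar> \<partial>\<mu>1)" using integral_norm_bound[of \<mu>1 "\<lambda>x. H (x, y)"] by simp
  also have "\<dots> \<le> B" using i H_bound y by (intro \<mu>.M1.integral_le_const) (auto simp: space_\<mu>)
  finally show "\<bar>\<integral>x. H (x, y) \<partial>\<mu>1\<bar> \<le> B" .
qed

lemma fubini: "(\<integral>x. (\<integral>y. H (x, y) \<partial>\<mu>2) \<partial>\<mu>1) = (\<integral>z. H z \<partial>(\<mu>1 \<Otimes>\<^sub>M \<mu>2))"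
  "(\<integral>y. (\<integral>x. H (x, y) \<partial>\<mu>1) \<partial>\<mu>2) = (\<integral>z. H z \<partial>(\<mu>1 \<Otimes>\<^sub>M \<mu>2))"
proof -
  have i: "integrable (\<mu>1 \<Otimes>\<^sub>M \<mu>2) H"
    using H_meas H_bound by (intro \<mu>.integrable_bounded[of _ B]) (auto simp: measurable_cong_sets[OF sets_pair_\<mu> refl] space_pair_measure space_\<mu>)
  show "(\<integral>x. (\<integral>y. H (x, y) \<partial>\<mu>2) \<partial>\<mu>1) = (\<integral>z. H z \<partial>(\<mu>1 \<Otimes>\<^sub>M \<mu>2))" by (rule \<mu>.integral_fst'[OF i])
  show "(\<integral>y. (\<integral>x. H (x, y) \<partial>\<mu>1) \<partial>\<mu>2) = (\<integral>z. H z \<partial>(\<mu>1 \<Otimes>\<^sub>M \<mu>2))"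
    using \<mu>.integral_snd[of "\<lambda>x y. H (x, y)"] i by simp
qed


end

text \<open>The section of H averaged over the second sample, read at an outcome w' of its own.
  Separating w' from the outcome of the first sample is what the decoupling of independent
  \<sigma>-fields requires.\<close>

definition G :: "nat \<Rightarrow> ('x \<times> 'y \<Rightarrow> real) \<Rightarrow> 'w \<Rightarrow> 'x \<Rightarrow> real" where
  "G N H w' x = A2 N (\<lambda>y. H (x, y)) w'"

context
  fixes N :: nat assumes N: "1 \<le> N"
begin

lemma spaceF: "space (F1 N) = space (P N)" "space (F2 N) = space (P N)"
  using F[OF N] by (auto simp: subalgebra_def)

lemma A1_F: "f \<in> borel_measurable L1 \<Longrightarrow> A1 N f \<in> borel_measurable (F1 N)"
  unfolding A1[abs_def]
  by (intro borel_measurable_divide borel_measurable_sum borel_measurable_times measurable_compose[OF x1[OF N]] om1 N borel_measurable_const)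

lemma A2_F: "f \<in> borel_measurable L2 \<Longrightarrow> A2 N f \<in> borel_measurable (F2 N)"
  unfolding A2[abs_def]
  by (intro borel_measurable_divide borel_measurable_sum borel_measurable_times measurable_compose[OF x2[OF N]] om2 N borel_measurable_const)

lemma x2_space: "l \<in> {1..N} \<Longrightarrow> w \<in> space (P N) \<Longrightarrow> x2 N l w \<in> space L2"
  using measurable_space[OF x2[OF N]] spaceF by auto

lemma A1_linear: "A1 N (\<lambda>x. a * f x + b * g x) w = a * A1 N f w + b * A1 N g w"
  unfolding A1 by (simp add: sum.distrib sum_distrib_left add_divide_distrib algebra_simps)

lemma A_pair_measurable:
  assumes H: "H \<in> borel_measurable (L1 \<Otimes>\<^sub>M L2)"
  shows "(\<lambda>z. A1 N (G N H (snd z)) (fst z)) \<in> borel_measurable (F1 N \<Otimes>\<^sub>M F2 N)"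
proof -
  have "(\<lambda>z. H (x1 N i (fst z), x2 N j (snd z))) \<in> borel_measurable (F1 N \<Otimes>\<^sub>M F2 N)" if "i \<in> {1..N}" "j \<in> {1..N}" for i j
    using measurable_compose[OF measurable_fst x1[OF N that(1)]] measurable_compose[OF measurable_snd x2[OF N that(2)]]
    by (intro measurable_compose[OF measurable_Pair H])
  then show ?thesis
    unfolding A1 A2 G_def
    by (intro borel_measurable_divide borel_measurable_sum borel_measurable_times borel_measurable_const
        measurable_compose[OF measurable_fst om1[OF N]] measurable_compose[OF measurable_snd om2[OF N]])
qed

lemma G_measurable:
  assumes H: "H \<in> borel_measurable (L1 \<Otimes>\<^sub>M L2)"
  shows "(\<lambda>z. G N H (snd z) (fst z)) \<in> borel_measurable (L1 \<Otimes>\<^sub>M F2 N)"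
proof -
  have "(\<lambda>z. H (fst z, x2 N j (snd z))) \<in> borel_measurable (L1 \<Otimes>\<^sub>M F2 N)" if "j \<in> {1..N}" for j
    using measurable_compose[OF measurable_snd x2[OF N that]]
    by (intro measurable_compose[OF measurable_Pair[OF measurable_fst] H])
  then show ?thesis
    unfolding A2 G_def
    by (intro borel_measurable_divide borel_measurable_sum borel_measurable_times borel_measurable_const
        measurable_compose[OF measurable_snd om2[OF N]])
qed

lemma A_eq: "A N H w = A1 N (G N H w) w"
  by (simp add: A_def G_def[abs_def])

lemma A_measurable:
  assumes F': "\<And>l. l \<in> {1..N} \<Longrightarrow> om1 N l \<in> borel_measurable F'" "\<And>l. l \<in> {1..N} \<Longrightarrow> om2 N l \<in> borel_measurable F'"
    "\<And>l. l \<in> {1..N} \<Longrightarrow> x1 N l \<in> F' \<rightarrow>\<^sub>M L1" "\<And>l. l \<in> {1..N} \<Longrightarrow> x2 N l \<in> F' \<rightarrow>\<^sub>M L2"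
    and H: "H \<in> borel_measurable (L1 \<Otimes>\<^sub>M L2)"
  shows "A N H \<in> borel_measurable F'"
proof -
  have "(\<lambda>w. H (x1 N i w, x2 N j w)) \<in> borel_measurable F'" if "i \<in> {1..N}" "j \<in> {1..N}" for i j
    using F'(3)[OF that(1)] F'(4)[OF that(2)] by (intro measurable_compose[OF measurable_Pair H])
  then show ?thesis
    unfolding A_def[abs_def] A1 A2
    by (intro borel_measurable_divide borel_measurable_sum borel_measurable_times borel_measurable_const F')
qed

lemma mean_G:
  assumes H: "bounded_fn (L1 \<Otimes>\<^sub>M L2) H B" and w: "w \<in> space (P N)"
  shows "(\<integral>x. G N H w x \<partial>\<mu>1) = A2 N (\<lambda>y. \<integral>x. H (x, y) \<partial>\<mu>1) w"
proof -
  have i: "integrable \<mu>1 (\<lambda>x. H (x, x2 N j w))" if "j \<in> {1..N}" for j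
  proof -
    note b = section2[OF H x2_space[OF that w]]
    show ?thesis
      using bounded_fnD[OF b] by (intro \<mu>.M1.integrable_bounded[of _ B]) (auto simp: space_\<mu> measurable_cong_sets[OF \<mu>(2) refl])
  qed
  show ?thesis unfolding G_def A2 using i by (simp add: Bochner_Integration.integral_sum)
qed

end

text \<open>The two clauses use different decompositions. For the mean square clause it suffices to
  subtract the projection on the second sample, since conditionally on that sample the rest is an
  ordinary error of the first average. For the limit both projections are subtracted, and the
  remainder has to be of order 1/N in mean; a bound through the supremum of the section would only
  give 1/\<surd>N.\<close>

lemma clt: "emp_clt (L1 \<Otimes>\<^sub>M L2) P A (c1 * c2) (\<mu>1 \<Otimes>\<^sub>M \<mu>2) V"
proof -
  obtain C1 where C10: "0 \<le> C1" and C1: "\<And>N f B. 1 \<le> N \<Longrightarrow> bounded_fn L1 f B \<Longrightarrow>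
        A1 N f \<in> borel_measurable (P N) \<and> (\<forall>w\<in>space (P N). \<bar>A1 N f w\<bar> \<le> C1 * B) \<and>
        (\<integral>w. (A1 N f w - c1 * (\<integral>x. f x \<partial>\<mu>1))\<^sup>2 \<partial>P N) \<le> C1 * B\<^sup>2 / real N"
    using emp_clt_bound[OF clt1] by blast
  obtain C2 where C20: "0 \<le> C2" and C2: "\<And>N f B. 1 \<le> N \<Longrightarrow> bounded_fn L2 f B \<Longrightarrow>
        A2 N f \<in> borel_measurable (P N) \<and> (\<forall>w\<in>space (P N). \<bar>A2 N f w\<bar> \<le> C2 * B) \<and>
        (\<integral>w. (A2 N f w - c2 * (\<integral>x. f x \<partial>\<mu>2))\<^sup>2 \<partial>P N) \<le> C2 * B\<^sup>2 / real N"
    using emp_clt_bound[OF clt2] by blast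
  obtain D m where D0: "0 \<le> D" and m: "\<And>N. 1 \<le> N \<Longrightarrow> prob_space (m N)" "\<And>N. 1 \<le> N \<Longrightarrow> sets (m N) = sets L1"
    and D: "\<And>N f B. 1 \<le> N \<Longrightarrow> bounded_fn L1 f B \<Longrightarrow>
      (\<integral>w. \<bar>A1 N f w - c1 * (\<integral>x. f x \<partial>\<mu>1)\<bar> \<partial>P N) \<le> D * (1 / real N + (\<integral>x. (f x)\<^sup>2 \<partial>m N))"
    using L1 unfolding emp_L1_def by blast
  have Gb: "bounded_fn L1 (G N H w) (C2 * B)" if N: "1 \<le> N" and H: "bounded_fn (L1 \<Otimes>\<^sub>M L2) H B" and w: "w \<in> space (P N)" for N H B w
    unfolding bounded_fn_def
  proof (intro conjI ballI)
    have "w \<in> space (F2 N)" using w spaceF[OF N] by simp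
    from measurable_compose[OF measurable_Pair2'[OF this] G_measurable[OF N H_meas[OF H]]]
    show "G N H w \<in> borel_measurable L1" by simp
    show "0 \<le> C2 * B" using C20 B0[OF H] by simp
    show "\<bar>G N H w x\<bar> \<le> C2 * B" if "x \<in> space L1" for x
      unfolding G_def using C2[OF N section1[OF H that]] w by auto
  qed
  have main: "A N H \<in> borel_measurable (P N)" "\<forall>w\<in>space (P N). \<bar>A N H w\<bar> \<le> C1 * (C2 * B)"
    "(\<integral>w. (A N H w - c1 * c2 * (\<integral>z. H z \<partial>(\<mu>1 \<Otimes>\<^sub>M \<mu>2)))\<^sup>2 \<partial>P N) \<le> (2 * (C1 * C2\<^sup>2) + 2 * (c1\<^sup>2 * C2)) * B\<^sup>2 / N"
    if N: "1 \<le> N" and H: "bounded_fn (L1 \<Otimes>\<^sub>M L2) H B" for N H B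
  proof -
    interpret prob_space "P N" by (rule P[OF N])
    show AP: "A N H \<in> borel_measurable (P N)" by (intro A_measurable[OF N] measurable_from_subalg[OF F(1)[OF N]] measurable_from_subalg[OF F(2)[OF N]] om1 om2 x1 x2 N H_meas[OF H])
    show Ab: "\<forall>w\<in>space (P N). \<bar>A N H w\<bar> \<le> C1 * (C2 * B)"
      unfolding A_eq[OF N] using C1[OF N Gb[OF N H]] by blast
    define h2 where "h2 y = (\<integral>x. H (x, y) \<partial>\<mu>1)" for y
    note h2 = marginal2[OF H, folded h2_def]
    define R where "R w = A N H w - c1 * A2 N h2 w" for w
    define \<Phi> where "\<Phi> z = A1 N (G N H (snd z)) (fst z) - c1 * A2 N h2 (snd z)" for z
    have A2F: "A2 N h2 \<in> borel_measurable (F2 N)" by (rule A2_F[OF N bounded_fnD(1)[OF h2]])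
    have \<Phi>m: "\<Phi> \<in> borel_measurable (F1 N \<Otimes>\<^sub>M F2 N)"
      unfolding \<Phi>_def[abs_def] by (intro borel_measurable_diff A_pair_measurable[OF N H_meas[OF H]] borel_measurable_times borel_measurable_const measurable_compose[OF measurable_snd A2F])
    define BR where "BR = C1 * (C2 * B) + c1 * (C2 * B)"
    have \<Phi>b: "\<bar>\<Phi> (w, w')\<bar> \<le> BR" if "w \<in> space (P N)" "w' \<in> space (P N)" for w w'
    proof -
      have "\<bar>A1 N (G N H w') w\<bar> \<le> C1 * (C2 * B)" using C1[OF N Gb[OF N H that(2)]] that by blast
      moreover have "\<bar>c1 * A2 N h2 w'\<bar> \<le> c1 * (C2 * B)" using C2[OF N h2] that c by (auto simp: abs_mult)
      ultimately show ?thesis unfolding \<Phi>_def BR_def fst_conv snd_conv by (intro order_trans[OF abs_triangle_ineq4 add_mono])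
    qed
    have R\<Phi>: "R w = \<Phi> (w, w)" for w by (simp add: R_def \<Phi>_def A_eq[OF N])
    have A2P[measurable]: "A2 N h2 \<in> borel_measurable (P N)" using C2[OF N h2] by simp
    have Rm[measurable]: "R \<in> borel_measurable (P N)"
      unfolding R_def[abs_def] using AP by measurable
    have ER: "(\<integral>w. (R w)\<^sup>2 \<partial>P N) \<le> C1 * (C2 * B)\<^sup>2 / N"
    proof -
      have bb: "norm ((\<Phi> z)\<^sup>2) \<le> BR\<^sup>2" if "z \<in> space (P N) \<times> space (P N)" for z
        using power_mono[OF \<Phi>b abs_ge_zero, of "fst z" "snd z" 2] that by auto
      note ii = indep_subalgebra_integral[OF P[OF N] F(1)[OF N] F(2)[OF N] ind[OF N] borel_measurable_power[OF \<Phi>m, of 2] bb]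
      have "(\<integral>w. (R w)\<^sup>2 \<partial>P N) = (\<integral>w'. (\<integral>w. (\<Phi> (w, w'))\<^sup>2 \<partial>P N) \<partial>P N)"
        using ii(1) by (simp add: R\<Phi>)
      also have "\<dots> \<le> C1 * (C2 * B)\<^sup>2 / N"
      proof (rule integral_le_const)
        have le: "(\<integral>w. (\<Phi> (w, w'))\<^sup>2 \<partial>P N) \<le> C1 * (C2 * B)\<^sup>2 / N" if w': "w' \<in> space (P N)" for w'
        proof -
          have "\<Phi> (w, w') = A1 N (G N H w') w - c1 * (\<integral>x. G N H w' x \<partial>\<mu>1)" for w
            by (simp add: \<Phi>_def mean_G[OF N H w'] h2_def[abs_def])
          then show ?thesis using C1[OF N Gb[OF N H w']] by simp
        qed
        then show "AE w' in P N. (\<integral>w. (\<Phi> (w, w'))\<^sup>2 \<partial>P N) \<le> C1 * (C2 * B)\<^sup>2 / N" by (rule AE_I2)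
        show "integrable (P N) (\<lambda>w'. \<integral>w. (\<Phi> (w, w'))\<^sup>2 \<partial>P N)"
        proof (rule integrable_bounded)
          show "(\<lambda>w'. \<integral>w. (\<Phi> (w, w'))\<^sup>2 \<partial>P N) \<in> borel_measurable (P N)"
            using ii(2) by (rule measurable_from_subalg[OF F(2)[OF N]])
          show "norm (\<integral>w. (\<Phi> (w, w'))\<^sup>2 \<partial>P N) \<le> C1 * (C2 * B)\<^sup>2 / N" if w': "w' \<in> space (P N)" for w'
            using le[OF w'] by simp
        qed
      qed
      finally show ?thesis .
    qed
    have iR: "integrable (P N) (\<lambda>w. (R w)\<^sup>2)"
      by (rule integrable_bounded_sq[OF Rm, of BR]) (use \<Phi>b R\<Phi> in auto)
    have i2: "integrable (P N) (\<lambda>w. (A2 N h2 w - c2 * (\<integral>y. h2 y \<partial>\<mu>2))\<^sup>2)"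
    proof (rule integrable_bounded_sq)
      show "\<bar>A2 N h2 w - c2 * (\<integral>y. h2 y \<partial>\<mu>2)\<bar> \<le> C2 * B + \<bar>c2 * (\<integral>y. h2 y \<partial>\<mu>2)\<bar>" if "w \<in> space (P N)" for w
        using C2[OF N h2] that by (intro order_trans[OF abs_triangle_ineq4 add_right_mono]) auto
    qed measurable
    have "(\<integral>w. (A N H w - c1 * c2 * (\<integral>z. H z \<partial>(\<mu>1 \<Otimes>\<^sub>M \<mu>2)))\<^sup>2 \<partial>P N)
      \<le> (\<integral>w. 2 * (R w)\<^sup>2 + 2 * (c1\<^sup>2 * (A2 N h2 w - c2 * (\<integral>y. h2 y \<partial>\<mu>2))\<^sup>2) \<partial>P N)"
    proof (rule integral_mono')
      show "integrable (P N) (\<lambda>w. 2 * (R w)\<^sup>2 + 2 * (c1\<^sup>2 * (A2 N h2 w - c2 * (\<integral>y. h2 y \<partial>\<mu>2))\<^sup>2))" using iR i2 by auto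
      show "(A N H w - c1 * c2 * (\<integral>z. H z \<partial>(\<mu>1 \<Otimes>\<^sub>M \<mu>2)))\<^sup>2 \<le> 2 * (R w)\<^sup>2 + 2 * (c1\<^sup>2 * (A2 N h2 w - c2 * (\<integral>y. h2 y \<partial>\<mu>2))\<^sup>2)" for w
      proof -
        have "A N H w - c1 * c2 * (\<integral>z. H z \<partial>(\<mu>1 \<Otimes>\<^sub>M \<mu>2)) = R w + c1 * (A2 N h2 w - c2 * (\<integral>y. h2 y \<partial>\<mu>2))"
          using fubini(2)[OF H, folded h2_def] by (simp add: R_def algebra_simps)
        then show ?thesis
          using sum_sq_le[of "R w" "c1 * (A2 N h2 w - c2 * (\<integral>y. h2 y \<partial>\<mu>2))"] by (simp only: power_mult_distrib)
      qed
    qed auto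
    also have "\<dots> = 2 * (\<integral>w. (R w)\<^sup>2 \<partial>P N) + 2 * (c1\<^sup>2 * (\<integral>w. (A2 N h2 w - c2 * (\<integral>y. h2 y \<partial>\<mu>2))\<^sup>2 \<partial>P N))"
      using iR i2 by simp
    also have "\<dots> \<le> 2 * (C1 * (C2 * B)\<^sup>2 / N) + 2 * (c1\<^sup>2 * (C2 * B\<^sup>2 / N))"
      using ER C2[OF N h2] by (intro add_mono mult_left_mono) auto
    also have "\<dots> = (2 * (C1 * C2\<^sup>2) + 2 * (c1\<^sup>2 * C2)) * B\<^sup>2 / N"
      by (simp add: power_mult_distrib distrib_right add_divide_distrib)
    finally show "(\<integral>w. (A N H w - c1 * c2 * (\<integral>z. H z \<partial>(\<mu>1 \<Otimes>\<^sub>M \<mu>2)))\<^sup>2 \<partial>P N) \<le> (2 * (C1 * C2\<^sup>2) + 2 * (c1\<^sup>2 * C2)) * B\<^sup>2 / N" .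
  qed
  have lim: "(\<lambda>N. \<integral>w. iexp (t * (sqrt (real N) * A N H w)) \<partial>P N) \<longlonglongrightarrow> complex_of_real (exp (- (t\<^sup>2 * V H / 2)))"
    if H: "bounded_fn (L1 \<Otimes>\<^sub>M L2) H B" and H0: "(\<integral>z. H z \<partial>(\<mu>1 \<Otimes>\<^sub>M \<mu>2)) = 0" for H B t
  proof -
    define h1 where "h1 x = (\<integral>y. H (x, y) \<partial>\<mu>2)" for x
    define h2 where "h2 y = (\<integral>x. H (x, y) \<partial>\<mu>1)" for y
    note h1 = marginal1[OF H, folded h1_def]
    note h2 = marginal2[OF H, folded h2_def]
    have h10: "(\<integral>x. h1 x \<partial>\<mu>1) = 0" and h20: "(\<integral>y. h2 y \<partial>\<mu>2) = 0"
      using fubini[OF H] H0 by (simp_all add: h1_def h2_def)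
    \<comment> \<open>At each fixed x this is the error of the second average at H(x, .), of mean
      square O(1/N). It is centred under the second law for no finite N, but its integral over
      \<mu>1 is precisely the projection on the second sample, because \<open>h1\<close> is
      centred.\<close>
    define g where "g N w' x = G N H w' x - c2 * h1 x" for N w' x
    \<comment> \<open>The summand 1 is the 1/N term of the error bound in mean; C2 B^2 is N times
      the mean square of \<open>g\<close> at a fixed point.\<close>
    define DD where "DD = D * (1 + C2 * B\<^sup>2)"
    have bound: "cmod ((\<integral>w. iexp (t * (sqrt (real N) * A N H w)) \<partial>P N)
        - (\<integral>w. iexp ((t * c2) * (sqrt (real N) * A1 N h1 w)) \<partial>P N) * (\<integral>w. iexp ((t * c1) * (sqrt (real N) * A2 N h2 w)) \<partial>P N))
      \<le> \<bar>t\<bar> * DD / sqrt N" if N: "1 \<le> N" for N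
    proof -
      interpret prob_space "P N" by (rule P[OF N])
      define BG where "BG = C2 * B + c2 * B"
      have gb: "bounded_fn L1 (g N w') BG" if w': "w' \<in> space (P N)" for w'
        unfolding bounded_fn_def
      proof (intro conjI ballI)
        show "g N w' \<in> borel_measurable L1" unfolding g_def using bounded_fnD(1)[OF Gb[OF N H w']] bounded_fnD(1)[OF h1] by measurable
        show "0 \<le> BG" unfolding BG_def using C20 B0[OF H] c by simp
        show "\<bar>g N w' x\<bar> \<le> BG" if "x \<in> space L1" for x
          unfolding g_def BG_def using bounded_fnD(3)[OF Gb[OF N H w'] that] bounded_fnD(3)[OF h1 that] c
          by (intro order_trans[OF abs_triangle_ineq4 add_mono]) (auto simp: abs_mult)
      qed
      have g\<mu>: "(\<integral>x. g N w' x \<partial>\<mu>1) = A2 N h2 w'" if w': "w' \<in> space (P N)" for w'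
      proof -
        have "integrable \<mu>1 (G N H w')" "integrable \<mu>1 h1"
          using bounded_fnD[OF Gb[OF N H w']] bounded_fnD[OF h1]
          by (auto intro!: \<mu>.M1.integrable_bounded simp: space_\<mu> measurable_cong_sets[OF \<mu>(2) refl])
        then show ?thesis unfolding g_def using mean_G[OF N H w', folded h2_def] h10 by simp
      qed
      define R where "R w = A N H w - c2 * A1 N h1 w - c1 * A2 N h2 w" for w
      define \<Phi> where "\<Phi> z = A1 N (G N H (snd z)) (fst z) - c2 * A1 N h1 (fst z) - c1 * A2 N h2 (snd z)" for z
      have A1F: "A1 N h1 \<in> borel_measurable (F1 N)" by (rule A1_F[OF N bounded_fnD(1)[OF h1]])
      have A2F: "A2 N h2 \<in> borel_measurable (F2 N)" by (rule A2_F[OF N bounded_fnD(1)[OF h2]])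
      have [measurable]: "A1 N h1 \<in> borel_measurable (P N)" "A2 N h2 \<in> borel_measurable (P N)" "A N H \<in> borel_measurable (P N)"
        using C1[OF N h1] C2[OF N h2] main(1)[OF N H] by auto
      have \<Phi>m: "\<Phi> \<in> borel_measurable (F1 N \<Otimes>\<^sub>M F2 N)"
        unfolding \<Phi>_def[abs_def]
        by (intro borel_measurable_diff A_pair_measurable[OF N H_meas[OF H]] borel_measurable_times borel_measurable_const
            measurable_compose[OF measurable_snd A2F] measurable_compose[OF measurable_fst A1F])
      have \<Phi>g: "\<Phi> (w, w') = A1 N (g N w') w - c1 * (\<integral>x. g N w' x \<partial>\<mu>1)" if "w' \<in> space (P N)" for w w'
        using A1_linear[OF N, of 1 "G N H w'" "- c2" h1 w] by (simp add: \<Phi>_def g_def[abs_def] g\<mu>[OF that, unfolded g_def])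
      define BR where "BR = C1 * BG + c1 * (C2 * B)"
      have \<Phi>b: "\<bar>\<Phi> (w, w')\<bar> \<le> BR" if "w \<in> space (P N)" "w' \<in> space (P N)" for w w'
      proof -
        have "\<bar>A1 N (g N w') w\<bar> \<le> C1 * BG" using C1[OF N gb[OF that(2)]] that by blast
        moreover have "\<bar>c1 * A2 N h2 w'\<bar> \<le> c1 * (C2 * B)" using C2[OF N h2] that c by (auto simp: abs_mult)
        ultimately show ?thesis unfolding \<Phi>g[OF that(2)] g\<mu>[OF that(2)] BR_def by (intro order_trans[OF abs_triangle_ineq4 add_mono])
      qed
      have R\<Phi>: "R w = \<Phi> (w, w)" for w by (simp add: R_def \<Phi>_def A_eq[OF N])
      have ER: "(\<integral>w. \<bar>R w\<bar> \<partial>P N) \<le> DD / N"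
      proof -
        interpret mN: prob_space "m N" by (rule m(1)[OF N])
        interpret mP: pair_prob_space "m N" "P N" ..
        have sm: "space (m N) = space L1" using sets_eq_imp_space_eq[OF m(2)[OF N]] .
        have bb: "norm \<bar>\<Phi> z\<bar> \<le> BR" if "z \<in> space (P N) \<times> space (P N)" for z
          using \<Phi>b[of "fst z" "snd z"] that by auto
        note ii = indep_subalgebra_integral[OF P[OF N] F(1)[OF N] F(2)[OF N] ind[OF N] borel_measurable_abs[OF \<Phi>m] bb]
        have gm: "(\<lambda>z. g N (snd z) (fst z)) \<in> borel_measurable (m N \<Otimes>\<^sub>M P N)"
        proof -
          have "(\<lambda>z. g N (snd z) (fst z)) \<in> borel_measurable (L1 \<Otimes>\<^sub>M F2 N)"
            unfolding g_def by (intro borel_measurable_diff G_measurable[OF N H_meas[OF H]] borel_measurable_times borel_measurable_const measurable_compose[OF measurable_fst bounded_fnD(1)[OF h1]])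
          moreover have "(\<lambda>z. z) \<in> m N \<Otimes>\<^sub>M P N \<rightarrow>\<^sub>M L1 \<Otimes>\<^sub>M F2 N"
          proof (rule measurable_pair)
            have "fst \<in> m N \<Otimes>\<^sub>M P N \<rightarrow>\<^sub>M L1" using measurable_fst[of "m N" "P N"] by (simp add: measurable_cong_sets[OF refl m(2)[OF N]])
            then show "fst \<circ> (\<lambda>z. z) \<in> m N \<Otimes>\<^sub>M P N \<rightarrow>\<^sub>M L1" by (simp add: comp_def)
            have "(\<lambda>w. w) \<in> P N \<rightarrow>\<^sub>M F2 N" using F(2)[OF N] by (auto simp: measurable_def subalgebra_def)
            from measurable_compose[OF measurable_snd this] show "snd \<circ> (\<lambda>z. z) \<in> m N \<Otimes>\<^sub>M P N \<rightarrow>\<^sub>M F2 N" by (simp add: comp_def)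
          qed
          ultimately show ?thesis using measurable_compose by blast
        qed
        have ig: "integrable (m N \<Otimes>\<^sub>M P N) (\<lambda>z. (g N (snd z) (fst z))\<^sup>2)"
          using bounded_fnD(3)[OF gb] by (intro mP.integrable_bounded_sq[OF gm, of BG]) (auto simp: space_pair_measure sm)
        \<comment> \<open>The law \<open>m N\<close> does not depend on the outcome, so the
          integrals may be exchanged. The inner expectation is then the mean square error of the
          second average at a fixed section of H.\<close>
        have gE: "(\<integral>w'. (\<integral>x. (g N w' x)\<^sup>2 \<partial>m N) \<partial>P N) \<le> C2 * B\<^sup>2 / N"
        proof -
          have "(\<integral>w'. (\<integral>x. (g N w' x)\<^sup>2 \<partial>m N) \<partial>P N) = (\<integral>x. (\<integral>w'. (g N w' x)\<^sup>2 \<partial>P N) \<partial>m N)"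
            using mP.Fubini_integral[of "\<lambda>x w'. (g N w' x)\<^sup>2"] ig by (simp add: case_prod_beta')
          also have "\<dots> \<le> C2 * B\<^sup>2 / N"
          proof (rule mN.integral_le_const)
            show "integrable (m N) (\<lambda>x. \<integral>w'. (g N w' x)\<^sup>2 \<partial>P N)"
              using mP.integrable_fst'[OF ig] by simp
            show "AE x in m N. (\<integral>w'. (g N w' x)\<^sup>2 \<partial>P N) \<le> C2 * B\<^sup>2 / N"
              using C2[OF N section1[OF H]] by (intro AE_I2) (simp add: sm g_def G_def h1_def)
          qed
          finally show ?thesis .
        qed
        have ig': "integrable (P N) (\<lambda>w'. \<integral>x. (g N w' x)\<^sup>2 \<partial>m N)"
          using mP.integrable_snd[of "\<lambda>x w'. (g N w' x)\<^sup>2"] ig by (simp add: case_prod_beta')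
        have "(\<integral>w. \<bar>R w\<bar> \<partial>P N) = (\<integral>w'. (\<integral>w. \<bar>\<Phi> (w, w')\<bar> \<partial>P N) \<partial>P N)"
          using ii(1) by (simp add: R\<Phi>)
        also have "\<dots> \<le> (\<integral>w'. D * (1 / real N + (\<integral>x. (g N w' x)\<^sup>2 \<partial>m N)) \<partial>P N)"
        proof (rule integral_mono')
          show "integrable (P N) (\<lambda>w'. D * (1 / real N + (\<integral>x. (g N w' x)\<^sup>2 \<partial>m N)))" using ig' by auto
          show "(\<integral>w. \<bar>\<Phi> (w, w')\<bar> \<partial>P N) \<le> D * (1 / real N + (\<integral>x. (g N w' x)\<^sup>2 \<partial>m N))" if "w' \<in> space (P N)" for w'
            using D[OF N gb[OF that]] by (simp add: \<Phi>g[OF that])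
          show "0 \<le> D * (1 / real N + (\<integral>x. (g N w' x)\<^sup>2 \<partial>m N))" for w'
            using D0 by (intro mult_nonneg_nonneg add_nonneg_nonneg Bochner_Integration.integral_nonneg) auto
        qed
        also have "\<dots> = D * (1 / real N + (\<integral>w'. (\<integral>x. (g N w' x)\<^sup>2 \<partial>m N) \<partial>P N))"
          using ig' by (simp add: prob_space)
        also have "\<dots> \<le> D * (1 / N + C2 * B\<^sup>2 / N)" using gE D0 by (intro mult_left_mono add_left_mono) auto
        also have "\<dots> = DD / N" by (simp add: DD_def distrib_left add_divide_distrib)
        finally show ?thesis .
      qed
      define E1 where "E1 w = iexp ((t * c2) * (sqrt (real N) * A1 N h1 w))" for w
      define E2 where "E2 w = iexp ((t * c1) * (sqrt (real N) * A2 N h2 w))" for w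
      \<comment> \<open>The two projections belong to independent \<sigma>-fields, so the
        characteristic function of their sum factorises exactly, before any limit.\<close>
      have prodE: "(\<integral>w. E1 w * E2 w \<partial>P N) = (\<integral>w. E1 w \<partial>P N) * (\<integral>w. E2 w \<partial>P N)"
      proof -
        have E1F: "E1 \<in> borel_measurable (F1 N)" unfolding E1_def[abs_def] using A1F by measurable
        have E2F: "E2 \<in> borel_measurable (F2 N)" unfolding E2_def[abs_def] using A2F by measurable
        have "(\<integral>w. (\<lambda>z. E1 (fst z) * E2 (snd z)) (w, w) \<partial>P N) = (\<integral>w'. (\<integral>w. (\<lambda>z. E1 (fst z) * E2 (snd z)) (w, w') \<partial>P N) \<partial>P N)"
        proof (rule indep_subalgebra_integral(1)[OF P[OF N] F(1)[OF N] F(2)[OF N] ind[OF N], where B=1])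
          show "(\<lambda>z. E1 (fst z) * E2 (snd z)) \<in> borel_measurable (F1 N \<Otimes>\<^sub>M F2 N)"
            by (intro borel_measurable_times measurable_compose[OF measurable_fst E1F] measurable_compose[OF measurable_snd E2F])
        qed (simp add: E1_def E2_def norm_mult)
        then show ?thesis by simp
      qed
      have eq: "t * (sqrt N * (c2 * A1 N h1 w + c1 * A2 N h2 w)) = (t * c2) * (sqrt (real N) * A1 N h1 w) + (t * c1) * (sqrt (real N) * A2 N h2 w)" for w
        by (simp add: algebra_simps)
      have E12: "iexp (t * (sqrt N * (c2 * A1 N h1 w + c1 * A2 N h2 w))) = E1 w * E2 w" for w
        unfolding eq E1_def E2_def by (simp add: distrib_left exp_add)
      have iR: "integrable (P N) R"
      proof (rule integrable_bounded)
        show "R \<in> borel_measurable (P N)" unfolding R_def[abs_def] by measurable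
        show "norm (R w) \<le> BR" if "w \<in> space (P N)" for w using \<Phi>b[OF that that] by (simp add: R\<Phi>)
      qed
      have e: "t * (sqrt (real N) * A N H w) - t * (sqrt N * (c2 * A1 N h1 w + c1 * A2 N h2 w)) = t * sqrt N * R w" for w
        by (simp add: R_def algebra_simps)
      have "cmod ((\<integral>w. iexp (t * (sqrt (real N) * A N H w)) \<partial>P N) - (\<integral>w. iexp (t * (sqrt N * (c2 * A1 N h1 w + c1 * A2 N h2 w))) \<partial>P N))
        \<le> expectation (\<lambda>w. \<bar>t * (sqrt (real N) * A N H w) - t * (sqrt N * (c2 * A1 N h1 w + c1 * A2 N h2 w))\<bar>)"
      proof (rule expectation_iexp_diff)
        show "integrable (P N) (\<lambda>w. t * (sqrt (real N) * A N H w) - t * (sqrt N * (c2 * A1 N h1 w + c1 * A2 N h2 w)))"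
          unfolding e using iR by simp
      qed measurable
      also have "\<dots> = \<bar>t\<bar> * sqrt N * (\<integral>w. \<bar>R w\<bar> \<partial>P N)" unfolding e by (simp add: abs_mult)
      also have "\<dots> \<le> \<bar>t\<bar> * sqrt N * (DD / N)" using ER by (intro mult_left_mono) auto
      also have "\<dots> = \<bar>t\<bar> * DD / sqrt N" using N by (simp add: field_simps)
      finally show ?thesis unfolding E12 prodE unfolding E1_def E2_def .
    qed
    have l1: "(\<lambda>N. \<integral>w. iexp ((t * c2) * (sqrt (real N) * A1 N h1 w)) \<partial>P N) \<longlonglongrightarrow> complex_of_real (exp (- ((t * c2)\<^sup>2 * V1 h1 / 2)))"
      by (rule emp_clt_limit[OF clt1 h1 h10])
    have l2: "(\<lambda>N. \<integral>w. iexp ((t * c1) * (sqrt (real N) * A2 N h2 w)) \<partial>P N) \<longlonglongrightarrow> complex_of_real (exp (- ((t * c1)\<^sup>2 * V2 h2 / 2)))"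
      by (rule emp_clt_limit[OF clt2 h2 h20])
    have "(\<lambda>N. (\<integral>w. iexp (t * (sqrt (real N) * A N H w)) \<partial>P N)
        - (\<integral>w. iexp ((t * c2) * (sqrt (real N) * A1 N h1 w)) \<partial>P N) * (\<integral>w. iexp ((t * c1) * (sqrt (real N) * A2 N h2 w)) \<partial>P N)) \<longlonglongrightarrow> 0"
    proof (rule Lim_null_comparison)
      show "\<forall>\<^sub>F N in sequentially. cmod ((\<integral>w. iexp (t * (sqrt (real N) * A N H w)) \<partial>P N)
        - (\<integral>w. iexp ((t * c2) * (sqrt (real N) * A1 N h1 w)) \<partial>P N) * (\<integral>w. iexp ((t * c1) * (sqrt (real N) * A2 N h2 w)) \<partial>P N)) \<le> \<bar>t\<bar> * DD / sqrt N"
        using bound by (intro eventually_sequentiallyI[of 1])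
      show "(\<lambda>N. \<bar>t\<bar> * DD / sqrt (real N)) \<longlonglongrightarrow> 0"
        by (intro real_tendsto_divide_at_top[OF tendsto_const] filterlim_compose[OF sqrt_at_top filterlim_real_sequentially])
    qed
    from tendsto_add[OF this tendsto_mult[OF l1 l2]]
    have "(\<lambda>N. \<integral>w. iexp (t * (sqrt (real N) * A N H w)) \<partial>P N) \<longlonglongrightarrow>
      complex_of_real (exp (- ((t * c2)\<^sup>2 * V1 h1 / 2))) * complex_of_real (exp (- ((t * c1)\<^sup>2 * V2 h2 / 2)))" by simp
    also have "complex_of_real (exp (- ((t * c2)\<^sup>2 * V1 h1 / 2))) * complex_of_real (exp (- ((t * c1)\<^sup>2 * V2 h2 / 2))) = complex_of_real (exp (- (t\<^sup>2 * V H / 2)))"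
    proof -
      have "- (t\<^sup>2 * V H / 2) = - ((t * c2)\<^sup>2 * V1 h1 / 2) + - ((t * c1)\<^sup>2 * V2 h2 / 2)"
        unfolding V_def h1_def[symmetric] h2_def[symmetric] by (simp add: power_mult_distrib distrib_left add_divide_distrib)
      then show ?thesis by (simp only: exp_add of_real_mult)
    qed
    finally show ?thesis .
  qed
  define C where "C = C1 * C2 + (2 * (C1 * C2\<^sup>2) + 2 * (c1\<^sup>2 * C2))"
  have C0: "0 \<le> C" using C10 C20 by (simp add: C_def)
  show ?thesis unfolding emp_clt_def
  proof (intro conjI)
    show "prob_space (\<mu>1 \<Otimes>\<^sub>M \<mu>2)" by (rule \<mu>.prob_space_axioms)
    show "sets (\<mu>1 \<Otimes>\<^sub>M \<mu>2) = sets (L1 \<Otimes>\<^sub>M L2)" by (rule sets_pair_\<mu>)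
    show "0 < c1 * c2" using c by simp
    show "\<exists>C\<ge>0. \<forall>N\<ge>1. \<forall>f B. bounded_fn (L1 \<Otimes>\<^sub>M L2) f B \<longrightarrow>
        A N f \<in> borel_measurable (P N) \<and> (\<forall>w\<in>space (P N). \<bar>A N f w\<bar> \<le> C * B) \<and>
        (\<integral>w. (A N f w - c1 * c2 * (\<integral>x. f x \<partial>(\<mu>1 \<Otimes>\<^sub>M \<mu>2)))\<^sup>2 \<partial>P N) \<le> C * B\<^sup>2 / real N"
    proof (intro exI[of _ C] conjI allI impI C0)
      fix N :: nat and H B assume N: "1 \<le> N" and H: "bounded_fn (L1 \<Otimes>\<^sub>M L2) H B"
      show "A N H \<in> borel_measurable (P N)" by (rule main(1)[OF N H])
      have "C1 * (C2 * B) \<le> C * B"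
        unfolding C_def mult.assoc[symmetric] using C10 C20 B0[OF H] by (intro mult_right_mono) auto
      then show "\<forall>w\<in>space (P N). \<bar>A N H w\<bar> \<le> C * B" using main(2)[OF N H] by force
      have "(2 * (C1 * C2\<^sup>2) + 2 * (c1\<^sup>2 * C2)) * B\<^sup>2 / N \<le> C * B\<^sup>2 / N"
        unfolding C_def using C10 C20 by (intro divide_right_mono mult_right_mono) auto
      then show "(\<integral>w. (A N H w - c1 * c2 * (\<integral>x. H x \<partial>(\<mu>1 \<Otimes>\<^sub>M \<mu>2)))\<^sup>2 \<partial>P N) \<le> C * B\<^sup>2 / real N"
        using main(3)[OF N H] by linarith
    qed
  qed (use lim in blast)
qed

end

section \<open>Finite bounds and laws given by normalised densities\<close>

lemma sup_norm_bound:
  assumes "sup_norm S f < \<infinity>"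
  obtains B where "0 \<le> B" "\<And>x. x \<in> S \<Longrightarrow> \<bar>f x\<bar> \<le> B"
proof -
  have "\<bar>f x\<bar> \<le> enn2real (sup_norm S f)" if "x \<in> S" for x
  proof -
    have "ennreal \<bar>f x\<bar> \<le> sup_norm S f" unfolding sup_norm_def using that by (rule SUP_upper)
    also have "\<dots> = ennreal (enn2real (sup_norm S f))" using assms by simp
    finally show ?thesis by (simp add: ennreal_le_iff)
  qed
  then show thesis by (intro that[of "enn2real (sup_norm S f)"]) auto
qed

lemma esup_norm_bound:
  assumes "esup_norm S f < \<infinity>"
  obtains B where "0 \<le> B" "\<And>x. x \<in> S \<Longrightarrow> f x \<le> ennreal B"
proof -
  have "f x \<le> ennreal (enn2real (esup_norm S f))" if "x \<in> S" for x
  proof -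
    have "f x \<le> esup_norm S f" unfolding esup_norm_def using that by (rule SUP_upper)
    then show ?thesis using assms by simp
  qed
  then show thesis by (intro that[of "enn2real (esup_norm S f)"]) auto
qed

text \<open>Division on the extended reals is multiplication by an inverse and commutes with
  integration. The identity therefore holds for every total mass, zero and infinity
  included.\<close>

lemma emeasure_distr_normalized_density:
  assumes [measurable]: "w \<in> borel_measurable M" "X \<in> M \<rightarrow>\<^sub>M L" and f[measurable]: "f \<in> borel_measurable L"
  shows "(\<integral>\<^sup>+ y. f y \<partial>distr (normalized_density M w) L X) = (\<integral>\<^sup>+ x. w x * f (X x) \<partial>M) / (\<integral>\<^sup>+ x. w x \<partial>M)"
proof -
  have "(\<integral>\<^sup>+ y. f y \<partial>distr (normalized_density M w) L X) = (\<integral>\<^sup>+ x. f (X x) \<partial>normalized_density M w)"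
    by (rule nn_integral_distr) (simp_all add: normalized_density_def)
  also have "\<dots> = (\<integral>\<^sup>+ x. w x / (\<integral>\<^sup>+ y. w y \<partial>M) * f (X x) \<partial>M)"
    unfolding normalized_density_def by (rule nn_integral_density) measurable
  also have "\<dots> = (\<integral>\<^sup>+ x. w x * f (X x) / (\<integral>\<^sup>+ y. w y \<partial>M) \<partial>M)"
    by (simp add: divide_ennreal_def mult_ac)
  also have "\<dots> = (\<integral>\<^sup>+ x. w x * f (X x) \<partial>M) / (\<integral>\<^sup>+ x. w x \<partial>M)" by (rule nn_integral_divide) measurable
  finally show ?thesis .
qed

lemma ennreal_divide_divide_cancel:
  fixes a b c :: ennreal
  assumes "c \<noteq> 0" "c \<noteq> \<top>" "b \<noteq> 0" "b \<noteq> \<top>"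
  shows "(a / c) / (b / c) = a / b"
proof -
  obtain c' where c: "c = ennreal c'" "0 < c'" using assms(1,2) by (cases c) (auto simp: less_le)
  obtain b' where b: "b = ennreal b'" "0 < b'" using assms(3,4) by (cases b) (auto simp: less_le)
  show ?thesis
  proof (cases a)
    case (real a')
    then show ?thesis using b c by (simp add: divide_ennreal)
  next
    case top
    then show ?thesis using b c by (simp add: divide_ennreal ennreal_top_divide)
  qed
qed

text \<open>One argument for the filtering, backward and smoothing recursions: the new law is the
  second marginal of the density k on \<mu> \<otimes> L. The uniform bound on the masses of k makes
  the total mass finite, so the identity between extended integrals on sets passes to real integrals
  of bounded functions.\<close>

lemma kernel_ratio:
  fixes k :: "'e \<times> 'x \<Rightarrow> real"
  assumes \<mu>: "prob_space \<mu>" and L: "sigma_finite_measure L"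
    and k[measurable]: "k \<in> borel_measurable (\<mu> \<Otimes>\<^sub>M L)" and k0: "\<And>y x. y \<in> space \<mu> \<Longrightarrow> x \<in> space L \<Longrightarrow> 0 \<le> k (y, x)"
    and kC: "\<And>y. y \<in> space \<mu> \<Longrightarrow> (\<integral>\<^sup>+ x. ennreal (k (y, x)) \<partial>L) \<le> ennreal C"
    and pos: "(\<integral>\<^sup>+ y. \<integral>\<^sup>+ x. ennreal (k (y, x)) \<partial>L \<partial>\<mu>) \<noteq> 0"
    and \<mu>': "sets \<mu>' = sets L"
    and eq: "\<And>B. B \<in> sets L \<Longrightarrow> emeasure \<mu>' B =
      (\<integral>\<^sup>+ y. \<integral>\<^sup>+ x. ennreal (k (y, x)) * indicator B x \<partial>L \<partial>\<mu>) / (\<integral>\<^sup>+ y. \<integral>\<^sup>+ x. ennreal (k (y, x)) \<partial>L \<partial>\<mu>)"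
  shows "prob_space \<mu>'" "0 < (\<integral>y. (\<integral>x. k (y, x) \<partial>L) \<partial>\<mu>)"
    and "\<And>f B. bounded_fn L f B \<Longrightarrow> (\<integral>x. f x \<partial>\<mu>') = (\<integral>y. (\<integral>x. k (y, x) * f x \<partial>L) \<partial>\<mu>) / (\<integral>y. (\<integral>x. k (y, x) \<partial>L) \<partial>\<mu>)"
proof -
  interpret \<mu>: prob_space \<mu> by fact
  interpret L: sigma_finite_measure L by fact
  interpret pair_sigma_finite \<mu> L ..
  define Z where "Z = (\<integral>\<^sup>+ z. ennreal (k z) \<partial>(\<mu> \<Otimes>\<^sub>M L))"
  have Z: "(\<integral>\<^sup>+ y. \<integral>\<^sup>+ x. ennreal (k (y, x)) \<partial>L \<partial>\<mu>) = Z"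
    unfolding Z_def by (rule L.nn_integral_fst) measurable
  have Zfin: "Z < \<infinity>"
  proof -
    have "Z \<le> (\<integral>\<^sup>+ y. ennreal C \<partial>\<mu>)" unfolding Z[symmetric] using kC by (intro nn_integral_mono)
    also have "\<dots> < \<infinity>" by (simp add: \<mu>.emeasure_space_1)
    finally show ?thesis .
  qed
  have Z0: "0 < Z" using pos Z by (simp add: zero_less_iff_neq_zero)
  have k0': "0 \<le> k z" if "z \<in> space (\<mu> \<Otimes>\<^sub>M L)" for z using k0 that by (auto simp: space_pair_measure)
  have \<mu>'_eq: "\<mu>' = distr (normalized_density (\<mu> \<Otimes>\<^sub>M L) (\<lambda>z. ennreal (k z))) L snd"
  proof (rule measure_eqI)
    show "sets \<mu>' = sets (distr (normalized_density (\<mu> \<Otimes>\<^sub>M L) (\<lambda>z. ennreal (k z))) L snd)" using \<mu>' by simp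
    fix B assume "B \<in> sets \<mu>'"
    then have B[measurable]: "B \<in> sets L" using \<mu>' by simp
    have "emeasure (distr (normalized_density (\<mu> \<Otimes>\<^sub>M L) (\<lambda>z. ennreal (k z))) L snd) B
      = (\<integral>\<^sup>+ x. indicator B x \<partial>distr (normalized_density (\<mu> \<Otimes>\<^sub>M L) (\<lambda>z. ennreal (k z))) L snd)"
      by (simp add: nn_integral_indicator)
    also have "\<dots> = (\<integral>\<^sup>+ z. ennreal (k z) * indicator B (snd z) \<partial>(\<mu> \<Otimes>\<^sub>M L)) / Z"
      unfolding Z_def by (rule emeasure_distr_normalized_density) measurable
    also have "(\<integral>\<^sup>+ z. ennreal (k z) * indicator B (snd z) \<partial>(\<mu> \<Otimes>\<^sub>M L)) = (\<integral>\<^sup>+ y. \<integral>\<^sup>+ x. ennreal (k (y, x)) * indicator B x \<partial>L \<partial>\<mu>)"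
      by (subst L.nn_integral_fst[symmetric]) auto
    finally show "emeasure \<mu>' B = emeasure (distr (normalized_density (\<mu> \<Otimes>\<^sub>M L) (\<lambda>z. ennreal (k z))) L snd) B"
      using eq[OF B] Z by simp
  qed
  have "emeasure \<mu>' (space \<mu>') = Z / Z"
    using eq[of "space L"] Z sets_eq_imp_space_eq[OF \<mu>'] by (simp cong: nn_integral_cong)
  also have "\<dots> = 1" using Z0 Zfin by (simp add: ennreal_divide_self)
  finally show "prob_space \<mu>'" by (rule prob_spaceI)
  have ik: "integrable (\<mu> \<Otimes>\<^sub>M L) k"
    using k0' Zfin unfolding Z_def by (intro integrableI_nonneg) (auto intro!: AE_I2)
  have Ik: "(\<integral>y. (\<integral>x. k (y, x) \<partial>L) \<partial>\<mu>) = (\<integral>z. k z \<partial>(\<mu> \<Otimes>\<^sub>M L))" by (rule integral_fst'[OF ik])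
  have "ennreal (\<integral>z. k z \<partial>(\<mu> \<Otimes>\<^sub>M L)) = Z"
    unfolding Z_def using k0' by (intro nn_integral_eq_integral[symmetric] ik) (auto intro!: AE_I2)
  then show "0 < (\<integral>y. (\<integral>x. k (y, x) \<partial>L) \<partial>\<mu>)" using Z0 Ik by (metis ennreal_eq_0_iff not_le zero_less_iff_neq_zero)
  fix f :: "'x \<Rightarrow> real" and B assume f: "bounded_fn L f B"
  note [measurable] = bounded_fnD(1)[OF f]
  have "integrable (\<mu> \<Otimes>\<^sub>M L) (\<lambda>z. B * k z)" using ik by simp
  then have ikf: "integrable (\<mu> \<Otimes>\<^sub>M L) (\<lambda>z. k z * f (snd z))"
  proof (rule Bochner_Integration.integrable_bound)
    show "AE z in \<mu> \<Otimes>\<^sub>M L. norm (k z * f (snd z)) \<le> norm (B * k z)"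
    proof (rule AE_I2)
      fix z assume "z \<in> space (\<mu> \<Otimes>\<^sub>M L)"
      then have "\<bar>f (snd z)\<bar> \<le> B" using bounded_fnD(3)[OF f] by (auto simp: space_pair_measure)
      then show "norm (k z * f (snd z)) \<le> norm (B * k z)"
        using bounded_fnD(2)[OF f] by (simp add: abs_mult mult.commute[of B] mult_left_mono)
    qed
  qed measurable
  have "(\<integral>x. f x \<partial>\<mu>') = (\<integral>z. k z * f (snd z) \<partial>(\<mu> \<Otimes>\<^sub>M L)) / (\<integral>z. k z \<partial>(\<mu> \<Otimes>\<^sub>M L))"
    unfolding \<mu>'_eq using Z0 Zfin k0' by (intro integral_distr_normalized_density) (auto simp: Z_def)
  also have "(\<integral>z. k z * f (snd z) \<partial>(\<mu> \<Otimes>\<^sub>M L)) = (\<integral>y. (\<integral>x. k (y, x) * f x \<partial>L) \<partial>\<mu>)"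
    using integral_fst'[OF ikf] by simp
  finally show "(\<integral>x. f x \<partial>\<mu>') = (\<integral>y. (\<integral>x. k (y, x) * f x \<partial>L) \<partial>\<mu>) / (\<integral>y. (\<integral>x. k (y, x) \<partial>L) \<partial>\<mu>)"
    by (simp only: Ik)
qed

section \<open>Filtering, backward and smoothing laws\<close>

locale filter_model =
  fixes A :: "'a two_filter"
  assumes model: "valid_model A"
    and g_fin: "\<And>t. t \<le> hor A \<Longrightarrow> sup_norm (states A) (pot A t) < \<infinity>"
begin

abbreviation "L \<equiv> base A"
abbreviation "q \<equiv> qd A"
abbreviation "g \<equiv> pot A"
abbreviation "\<gamma> \<equiv> gam A"
abbreviation "T \<equiv> hor A"
abbreviation "Lu \<equiv> (\<lambda>u::nat. if u = 0 then ini A else base A)"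

lemma sigma_finite_L: "sigma_finite_measure L"
  and markov_q: "markov_density L q"
  and g_meas: "t \<le> T \<Longrightarrow> g t \<in> borel_measurable L" and g_pos: "t \<le> T \<Longrightarrow> x \<in> space L \<Longrightarrow> 0 < g t x"
  and \<gamma>_meas: "t \<le> T \<Longrightarrow> \<gamma> t \<in> borel_measurable L" and \<gamma>_pos: "t \<le> T \<Longrightarrow> x \<in> space L \<Longrightarrow> 0 < \<gamma> t x"
  and ini: "prob_space (ini A)" "sets (ini A) = sets L"
  and backward_finite: "t \<le> T \<Longrightarrow> (\<integral>\<^sup>+ x. ennreal (backward_info_weight A t x) \<partial>(\<Pi>\<^sub>M u\<in>{t..T}. L)) < \<infinity>"
  using model by (auto simp: valid_model_def)

sublocale L: sigma_finite_measure L by (rule sigma_finite_L)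

lemma space_ini: "space (ini A) = space L" using sets_eq_imp_space_eq[OF ini(2)] .

lemma q_meas: "(\<lambda>z. q (fst z) (snd z)) \<in> borel_measurable (L \<Otimes>\<^sub>M L)"
  and q_nonneg: "x \<in> space L \<Longrightarrow> y \<in> space L \<Longrightarrow> 0 \<le> q x y"
  and q_mass: "x \<in> space L \<Longrightarrow> (\<integral>\<^sup>+ y. ennreal (q x y) \<partial>L) = 1"
  using markov_q by (auto simp: markov_density_def case_prod_beta')

lemma q_meas2[measurable (raw)]:
  assumes "f \<in> N \<rightarrow>\<^sub>M L" "h \<in> N \<rightarrow>\<^sub>M L"
  shows "(\<lambda>z. q (f z) (h z)) \<in> borel_measurable N"
  using measurable_compose[OF measurable_Pair[OF assms] q_meas] by simp

sublocale PL: product_sigma_finite Lu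
  using sigma_finite_L ini by (simp add: product_sigma_finite_def prob_space_imp_sigma_finite)

sublocale PB: product_sigma_finite "\<lambda>_::nat. L"
  using sigma_finite_L by (simp add: product_sigma_finite_def)

lemma sets_Lu: "sets (Lu u) = sets L" "space (Lu u) = space L"
  using ini space_ini by auto

lemma comp_Lu: "u \<in> J \<Longrightarrow> (\<lambda>x. x u) \<in> PiM J Lu \<rightarrow>\<^sub>M L"
  using measurable_component_singleton[of u J Lu] measurable_cong_sets[OF refl sets_Lu(1), of "PiM J Lu" u] by blast

lemma space_PiM_Lu: "x \<in> space (PiM J Lu) \<Longrightarrow> u \<in> J \<Longrightarrow> x u \<in> space L"
  using measurable_space[OF comp_Lu] .

section \<open>The unnormalised filter and the filtering recursion\<close>

lemma smoothing_weight_measurable: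
  assumes "n \<le> T" "{0..n} \<subseteq> J" shows "smoothing_weight A n \<in> borel_measurable (PiM J Lu)"
  unfolding smoothing_weight_def[abs_def] using assms
  by (intro borel_measurable_times borel_measurable_prod measurable_compose[OF comp_Lu g_meas] q_meas2 comp_Lu) auto

lemma smoothing_weight_nonneg:
  assumes "n \<le> T" "{0..n} \<subseteq> J" "x \<in> space (PiM J Lu)"
  shows "0 \<le> smoothing_weight A n x"
proof -
  have "x u \<in> space L" if "u \<le> n" for u using that assms space_PiM_Lu[OF assms(3)] by auto
  then show ?thesis
    unfolding smoothing_weight_def using assms(1)
    by (intro mult_nonneg_nonneg prod_nonneg) (auto intro!: mult_nonneg_nonneg q_nonneg less_imp_le[OF g_pos])
qed

text \<open>The unnormalised filter at time n. Extended values allow Tonelli to be applied to it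
  before its finiteness has been established.\<close>

definition U :: "nat \<Rightarrow> ('a \<Rightarrow> ennreal) \<Rightarrow> ennreal" where
  "U n f = (\<integral>\<^sup>+ x. ennreal (smoothing_weight A n x) * f (x n) \<partial>PiM {0..n} Lu)"

lemma smoothing_weight_cong: "(\<And>u. u \<le> n \<Longrightarrow> x u = y u) \<Longrightarrow> smoothing_weight A n x = smoothing_weight A n y"
  unfolding smoothing_weight_def by (intro arg_cong2[where f="(*)"] prod.cong) auto

lemma U_Suc:
  assumes n: "Suc n \<le> T" and f[measurable]: "f \<in> borel_measurable L"
  shows "U (Suc n) f = U n (\<lambda>y. \<integral>\<^sup>+ x. ennreal (q y x * g (Suc n) x) * f x \<partial>L)"
proof -
  have "{0..Suc n} = insert (Suc n) {0..n}" by auto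
  then have "U (Suc n) f = (\<integral>\<^sup>+ x. ennreal (smoothing_weight A (Suc n) x) * f (x (Suc n)) \<partial>PiM (insert (Suc n) {0..n}) Lu)"
    by (simp add: U_def)
  also have "\<dots> = (\<integral>\<^sup>+ x. \<integral>\<^sup>+ y. ennreal (smoothing_weight A (Suc n) (x(Suc n := y))) * f ((x(Suc n := y)) (Suc n)) \<partial>Lu (Suc n) \<partial>PiM {0..n} Lu)"
  proof (rule PL.product_nn_integral_insert)
    have "(\<lambda>x. x (Suc n)) \<in> PiM (insert (Suc n) {0..n}) Lu \<rightarrow>\<^sub>M L" by (rule comp_Lu) simp
    from measurable_compose[OF this f]
    show "(\<lambda>x. ennreal (smoothing_weight A (Suc n) x) * f (x (Suc n))) \<in> borel_measurable (PiM (insert (Suc n) {0..n}) Lu)"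
      by (intro borel_measurable_times_ennreal measurable_compose[OF _ measurable_ennreal] smoothing_weight_measurable[OF n]) auto
  qed auto
  also have "\<dots> = U n (\<lambda>y. \<integral>\<^sup>+ x. ennreal (q y x * g (Suc n) x) * f x \<partial>L)"
    unfolding U_def
  proof (intro nn_integral_cong)
    fix x assume x: "x \<in> space (PiM {0..n} Lu)"
    have xn: "x n \<in> space L" using space_PiM_Lu[OF x] by simp
    have w0: "0 \<le> smoothing_weight A n x" using smoothing_weight_nonneg[OF _ _ x] n by simp
    have w: "smoothing_weight A (Suc n) (x(Suc n := y)) = smoothing_weight A n x * (q (x n) y * g (Suc n) y)" for y
    proof -
      have "smoothing_weight A (Suc n) (x(Suc n := y)) = smoothing_weight A n (x(Suc n := y)) * (q (x n) y * g (Suc n) y)"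
        unfolding smoothing_weight_def by (simp add: mult.assoc prod.atLeast_Suc_atMost_Suc_shift)
      also have "smoothing_weight A n (x(Suc n := y)) = smoothing_weight A n x" by (rule smoothing_weight_cong) auto
      finally show ?thesis .
    qed
    have "(\<integral>\<^sup>+ y. ennreal (smoothing_weight A (Suc n) (x(Suc n := y))) * f ((x(Suc n := y)) (Suc n)) \<partial>Lu (Suc n))
      = (\<integral>\<^sup>+ y. ennreal (smoothing_weight A n x) * (ennreal (q (x n) y * g (Suc n) y) * f y) \<partial>L)"
      unfolding w using w0 by (simp add: ennreal_mult' mult.assoc)
    also have "\<dots> = ennreal (smoothing_weight A n x) * (\<integral>\<^sup>+ y. ennreal (q (x n) y * g (Suc n) y) * f y \<partial>L)"
    proof (rule nn_integral_cmult)
      note [measurable] = g_meas[OF n] f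
      show "(\<lambda>y. ennreal (q (x n) y * g (Suc n) y) * f y) \<in> borel_measurable L" using xn by measurable
    qed
    finally show "(\<integral>\<^sup>+ y. ennreal (smoothing_weight A (Suc n) (x(Suc n := y))) * f ((x(Suc n := y)) (Suc n)) \<partial>Lu (Suc n))
      = ennreal (smoothing_weight A n x) * (\<integral>\<^sup>+ y. ennreal (q (x n) y * g (Suc n) y) * f y \<partial>L)" .
  qed
  finally show ?thesis .
qed

lemma U_0:
  assumes f[measurable]: "f \<in> borel_measurable L"
  shows "U 0 f = (\<integral>\<^sup>+ x. ennreal (g 0 x) * f x \<partial>ini A)"
proof -
  have fm: "(\<lambda>x. ennreal (g 0 x) * f x) \<in> borel_measurable (ini A)"
    using g_meas[of 0] unfolding measurable_cong_sets[OF ini(2) refl] by measurable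
  have "U 0 f = (\<integral>\<^sup>+ x. ennreal (g 0 (x 0)) * f (x 0) \<partial>PiM {0} Lu)"
    by (simp add: U_def smoothing_weight_def)
  also have "\<dots> = (\<integral>\<^sup>+ x. ennreal (g 0 x) * f x \<partial>Lu 0)"
    using fm by (intro PL.product_nn_integral_singleton) simp
  finally show ?thesis by simp
qed

lemma U_kernel_measurable:
  assumes "n \<le> T" and [measurable]: "f \<in> borel_measurable L"
  shows "(\<lambda>y. \<integral>\<^sup>+ x. ennreal (q y x * g n x) * f x \<partial>L) \<in> borel_measurable L"
  using g_meas[OF assms(1)] by measurable

text \<open>Integrating out the last state turns a positive f into a function that is again
  positive: the potential is positive and the transition density has mass one, so it cannot vanish
  almost everywhere.\<close>

lemma U_pos:
  assumes "n \<le> T" "f \<in> borel_measurable L" "\<And>x. x \<in> space L \<Longrightarrow> 0 < f x"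
  shows "0 < U n f"
  using assms
proof (induction n arbitrary: f)
  case 0
  have m: "(\<lambda>x. ennreal (g 0 x) * f x) \<in> borel_measurable (ini A)"
    using g_meas[of 0] 0 unfolding measurable_cong_sets[OF ini(2) refl] by measurable
  have "U 0 f \<noteq> 0"
  proof
    assume "U 0 f = 0"
    then have "AE x in ini A. ennreal (g 0 x) * f x = 0"
      using nn_integral_0_iff_AE[OF m] U_0[OF 0(2)] by simp
    then have "AE x in ini A. False"
      using AE_space
    proof eventually_elim
      case (elim x)
      then have x: "x \<in> space L" by (simp add: space_ini)
      have "ennreal (g 0 x) \<noteq> 0" "f x \<noteq> 0" using g_pos[OF 0(1) x] 0(3)[OF x] by (auto simp: ennreal_eq_0_iff)
      then show ?case using elim by simp
    qed
    then show False using prob_space.AE_False[OF ini(1)] by simp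
  qed
  then show ?case by (simp add: zero_less_iff_neq_zero)
next
  case (Suc n)
  have [measurable]: "f \<in> borel_measurable L" "g (Suc n) \<in> borel_measurable L" using Suc g_meas by auto
  show ?case unfolding U_Suc[OF Suc.prems(1,2)]
  proof (rule Suc.IH)
    fix y assume y: "y \<in> space L"
    have "(\<integral>\<^sup>+ x. ennreal (q y x * g (Suc n) x) * f x \<partial>L) \<noteq> 0"
    proof
      assume "(\<integral>\<^sup>+ x. ennreal (q y x * g (Suc n) x) * f x \<partial>L) = 0"
      then have "AE x in L. ennreal (q y x * g (Suc n) x) * f x = 0"
        using y by (subst (asm) nn_integral_0_iff_AE) measurable
      then have "AE x in L. ennreal (q y x) = 0"
      proof (rule AE_mp, intro AE_I2 impI)
        fix x assume x: "x \<in> space L" and e: "ennreal (q y x * g (Suc n) x) * f x = 0"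
        have "f x \<noteq> 0" using Suc.prems(3)[OF x] by simp
        then have "q y x * g (Suc n) x \<le> 0" using e by (simp add: ennreal_eq_0_iff)
        then show "ennreal (q y x) = 0" using g_pos[OF Suc.prems(1) x] by (simp add: ennreal_eq_0_iff mult_le_0_iff)
      qed
      then have "(\<integral>\<^sup>+ x. ennreal (q y x) \<partial>L) = 0" using y by (subst nn_integral_0_iff_AE) measurable
      then show False using q_mass[OF y] by simp
    qed
    then show "0 < (\<integral>\<^sup>+ x. ennreal (q y x * g (Suc n) x) * f x \<partial>L)" by (simp add: zero_less_iff_neq_zero)
  qed (use Suc in auto)
qed

text \<open>Each integration of the last state multiplies the bound on f by a bound on the
  potential, because the transition density has mass one.\<close>

lemma U_finite:
  assumes "n \<le> T" "f \<in> borel_measurable L" "\<And>x. x \<in> space L \<Longrightarrow> f x \<le> ennreal B"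
  shows "U n f < \<infinity>"
  using assms
proof (induction n arbitrary: f B)
  case 0
  obtain G where G: "0 \<le> G" "\<And>x. x \<in> space L \<Longrightarrow> \<bar>g 0 x\<bar> \<le> G" by (rule sup_norm_bound[OF g_fin[of 0]]) auto
  have "U 0 f \<le> (\<integral>\<^sup>+ x. ennreal G * ennreal B \<partial>ini A)"
    unfolding U_0[OF 0(2)]
  proof (rule nn_integral_mono)
    fix x assume "x \<in> space (ini A)"
    then have x: "x \<in> space L" by (simp add: space_ini)
    have "g 0 x \<le> G" using G(2)[OF x] by simp
    then show "ennreal (g 0 x) * f x \<le> ennreal G * ennreal B"
      using 0(3)[OF x] by (intro mult_mono[OF ennreal_leI]) auto
  qed
  also have "\<dots> < \<infinity>" using prob_space.emeasure_space_1[OF ini(1)] by (simp add: ennreal_mult_less_top)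
  finally show ?case .
next
  case (Suc n)
  obtain G where G: "0 \<le> G" "\<And>x. x \<in> space L \<Longrightarrow> \<bar>g (Suc n) x\<bar> \<le> G" by (rule sup_norm_bound[OF g_fin[OF Suc.prems(1)]]) auto
  have [measurable]: "f \<in> borel_measurable L" "g (Suc n) \<in> borel_measurable L" using Suc g_meas by auto
  show ?case unfolding U_Suc[OF Suc.prems(1,2)]
  proof (rule Suc.IH)
    fix y assume y: "y \<in> space L"
    \<comment> \<open>The maximum with zero covers a negative \<open>B\<close>, for which
      \<open>ennreal B\<close> is zero while the product with \<open>G\<close> must remain a correct
      bound.\<close>
    have "(\<integral>\<^sup>+ x. ennreal (q y x * g (Suc n) x) * f x \<partial>L) \<le> (\<integral>\<^sup>+ x. ennreal (q y x) * ennreal (G * max 0 B) \<partial>L)"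
    proof (rule nn_integral_mono)
      fix x assume x: "x \<in> space L"
      have "q y x * g (Suc n) x \<le> q y x * G"
        using G(2)[OF x] by (intro mult_left_mono q_nonneg[OF y x]) simp
      moreover have "f x \<le> ennreal (max 0 B)"
        by (rule order_trans[OF Suc.prems(3)[OF x]]) (simp add: ennreal_leI)
      ultimately have "ennreal (q y x * g (Suc n) x) * f x \<le> ennreal (q y x * G) * ennreal (max 0 B)"
        by (intro mult_mono[OF ennreal_leI]) auto
      also have "\<dots> = ennreal (q y x) * ennreal (G * max 0 B)"
        using G q_nonneg[OF y x] by (simp add: ennreal_mult' mult.assoc)
      finally show "ennreal (q y x * g (Suc n) x) * f x \<le> ennreal (q y x) * ennreal (G * max 0 B)" .
    qed
    also have "\<dots> = (\<integral>\<^sup>+ x. ennreal (q y x) \<partial>L) * ennreal (G * max 0 B)"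
      using y by (intro nn_integral_multc) measurable
    also have "\<dots> = ennreal (G * max 0 B)" using q_mass[OF y] by simp
    finally show "(\<integral>\<^sup>+ x. ennreal (q y x * g (Suc n) x) * f x \<partial>L) \<le> ennreal (G * max 0 B)" .
  qed (use Suc in auto)
qed

lemma nn_integral_filtering:
  assumes n: "n \<le> T" and f: "f \<in> borel_measurable L"
  shows "(\<integral>\<^sup>+ x. f x \<partial>filtering A n) = U n f / U n (\<lambda>_. 1)"
  unfolding smoothing_def U_def
  using smoothing_weight_measurable[OF n, of "{0..n}"] comp_Lu[of n "{0..n}"]
  by (subst emeasure_distr_normalized_density[OF _ _ f]) auto

lemma sets_filtering[simp]: "sets (smoothing A s n) = sets L" by (simp add: smoothing_def)
lemma space_filtering[simp]: "space (smoothing A s n) = space L" by (simp add: smoothing_def)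

lemma filtering_prob: "n \<le> T \<Longrightarrow> prob_space (filtering A n)"
  using nn_integral_filtering[of n "\<lambda>_. 1"] U_pos[of n "\<lambda>_. 1"] U_finite[of n "\<lambda>_. 1" 1]
  by (intro prob_spaceI) (simp add: ennreal_divide_self)

text \<open>The recursion holds for the unnormalised filter. Numerator and denominator are both
  divided by the mass at time n, which is positive and finite and therefore cancels.\<close>

lemma filtering_Suc:
  assumes n: "Suc n \<le> T"
  shows "0 < (\<integral>y. (\<integral>x. q y x * g (Suc n) x \<partial>L) \<partial>filtering A n)"
    and "\<And>f B. bounded_fn L f B \<Longrightarrow> (\<integral>x. f x \<partial>filtering A (Suc n)) =
      (\<integral>y. (\<integral>x. q y x * g (Suc n) x * f x \<partial>L) \<partial>filtering A n) / (\<integral>y. (\<integral>x. q y x * g (Suc n) x \<partial>L) \<partial>filtering A n)"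
proof -
  obtain G where G: "0 \<le> G" "\<And>x. x \<in> space L \<Longrightarrow> \<bar>g (Suc n) x\<bar> \<le> G" by (rule sup_norm_bound[OF g_fin[OF n]]) auto
  note [measurable] = g_meas[OF n]
  have n': "n \<le> T" using n by simp
  let ?k = "\<lambda>z. q (fst z) (snd z) * g (Suc n) (snd z)"
  have U1: "U n (\<lambda>_. 1) \<noteq> 0" "U n (\<lambda>_. 1) \<noteq> \<top>"
    using U_pos[OF n', of "\<lambda>_. 1"] U_finite[OF n', of "\<lambda>_. 1" 1] by auto
  have nn: "(\<integral>\<^sup>+ y. \<integral>\<^sup>+ x. ennreal (?k (y, x)) * f x \<partial>L \<partial>filtering A n) = U (Suc n) f / U n (\<lambda>_. 1)"
    if f: "f \<in> borel_measurable L" for f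
    using nn_integral_filtering[OF n' U_kernel_measurable[OF n f]] U_Suc[OF n f] by simp
  have nn1: "(\<integral>\<^sup>+ y. \<integral>\<^sup>+ x. ennreal (?k (y, x)) \<partial>L \<partial>filtering A n) = U (Suc n) (\<lambda>_. 1) / U n (\<lambda>_. 1)"
    using nn[of "\<lambda>_. 1"] by simp
  have s: "sets (filtering A n \<Otimes>\<^sub>M L) = sets (L \<Otimes>\<^sub>M L)" by (intro sets_pair_measure_cong) auto
  have km: "?k \<in> borel_measurable (filtering A n \<Otimes>\<^sub>M L)" unfolding measurable_cong_sets[OF s refl] by measurable
  have k0: "0 \<le> ?k (y, x)" if "y \<in> space (filtering A n)" "x \<in> space L" for y x
      using that q_nonneg g_pos[OF n] by (simp add: less_imp_le)
  have kG: "(\<integral>\<^sup>+ x. ennreal (?k (y, x)) \<partial>L) \<le> ennreal G" if "y \<in> space (filtering A n)" for y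
    proof -
      have y: "y \<in> space L" using that by simp
      have "(\<integral>\<^sup>+ x. ennreal (?k (y, x)) \<partial>L) \<le> (\<integral>\<^sup>+ x. ennreal (q y x) * ennreal G \<partial>L)"
      proof (rule nn_integral_mono)
        fix x assume x: "x \<in> space L"
        have "q y x * g (Suc n) x \<le> q y x * G"
          using G(2)[OF x] by (intro mult_left_mono q_nonneg[OF y x]) simp
        then show "ennreal (?k (y, x)) \<le> ennreal (q y x) * ennreal G"
          using q_nonneg[OF y x] by (simp add: ennreal_mult'[symmetric] ennreal_leI)
      qed
      also have "\<dots> = (\<integral>\<^sup>+ x. ennreal (q y x) \<partial>L) * ennreal G"
        using y by (intro nn_integral_multc) measurable
      also have "\<dots> = ennreal G" using q_mass[OF y] by simp
      finally show ?thesis .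
    qed
  have kpos: "(\<integral>\<^sup>+ y. \<integral>\<^sup>+ x. ennreal (?k (y, x)) \<partial>L \<partial>filtering A n) \<noteq> 0"
      unfolding nn1 using U_pos[OF n, of "\<lambda>_. 1"] U1 by (simp add: ennreal_divide_eq_0_iff)
  \<comment> \<open>Inserting the mass at time n into both terms of the ratio turns unnormalised
    integrals at time n + 1 into integrals against the filter at time n.\<close>
  have keq: "emeasure (filtering A (Suc n)) B = (\<integral>\<^sup>+ y. \<integral>\<^sup>+ x. ennreal (?k (y, x)) * indicator B x \<partial>L \<partial>filtering A n) / (\<integral>\<^sup>+ y. \<integral>\<^sup>+ x. ennreal (?k (y, x)) \<partial>L \<partial>filtering A n)"
    if B: "B \<in> sets L" for B
  proof -
    have "emeasure (filtering A (Suc n)) B = U (Suc n) (indicator B) / U (Suc n) (\<lambda>_. 1)"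
      using nn_integral_filtering[OF n, of "indicator B"] B by simp
    also have "\<dots> = (U (Suc n) (indicator B) / U n (\<lambda>_. 1)) / (U (Suc n) (\<lambda>_. 1) / U n (\<lambda>_. 1))"
      using U1 U_pos[OF n, of "\<lambda>_. 1"] U_finite[OF n, of "\<lambda>_. 1" 1] by (intro ennreal_divide_divide_cancel[symmetric]) auto
    also have "\<dots> = (\<integral>\<^sup>+ y. \<integral>\<^sup>+ x. ennreal (?k (y, x)) * indicator B x \<partial>L \<partial>filtering A n) / (\<integral>\<^sup>+ y. \<integral>\<^sup>+ x. ennreal (?k (y, x)) \<partial>L \<partial>filtering A n)"
      using nn[of "indicator B"] nn1 B by simp
    finally show ?thesis .
  qed
  note r = kernel_ratio[OF filtering_prob[OF n'] sigma_finite_L km k0 kG kpos _ keq]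
  show "0 < (\<integral>y. (\<integral>x. q y x * g (Suc n) x \<partial>L) \<partial>filtering A n)" using r(2) by simp
  show "(\<integral>x. f x \<partial>filtering A (Suc n)) =
      (\<integral>y. (\<integral>x. q y x * g (Suc n) x * f x \<partial>L) \<partial>filtering A n) / (\<integral>y. (\<integral>x. q y x * g (Suc n) x \<partial>L) \<partial>filtering A n)"
    if "bounded_fn L f B" for f B using r(3)[where f=f and B=B] that by simp
qed

lemma filtering_0:
  assumes f: "bounded_fn L f B"
  shows "(\<integral>x. f x \<partial>filtering A 0) = (\<integral>x. g 0 x * f x \<partial>ini A) / (\<integral>x. g 0 x \<partial>ini A)"
    and "0 < (\<integral>x. g 0 x \<partial>ini A)"
proof -
  note [measurable] = g_meas[of 0, simplified] bounded_fnD(1)[OF f]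
  have gm: "g 0 \<in> borel_measurable (ini A)" "(\<lambda>x. x) \<in> ini A \<rightarrow>\<^sub>M L"
    unfolding measurable_cong_sets[OF ini(2) refl] by measurable
  have Z: "(\<integral>\<^sup>+ x. ennreal (g 0 x) \<partial>ini A) = U 0 (\<lambda>_. 1)" using U_0[of "\<lambda>_. 1"] by simp
  have Z1: "0 < U 0 (\<lambda>_. 1)" "U 0 (\<lambda>_. 1) < \<infinity>" using U_pos[of 0 "\<lambda>_. 1"] U_finite[of 0 "\<lambda>_. 1" 1] by auto
  have g0: "0 \<le> g 0 x" if "x \<in> space (ini A)" for x using g_pos[of 0 x] that by (simp add: space_ini)
  have eq: "filtering A 0 = distr (normalized_density (ini A) (\<lambda>x. ennreal (g 0 x))) L (\<lambda>x. x)"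
  proof (rule measure_eqI)
    fix B assume "B \<in> sets (filtering A 0)"
    then have B[measurable]: "B \<in> sets L" by simp
    have "emeasure (filtering A 0) B = (\<integral>\<^sup>+ x. ennreal (g 0 x) * indicator B x \<partial>ini A) / U 0 (\<lambda>_. 1)"
      using nn_integral_filtering[of 0 "indicator B"] U_0[of "indicator B"] by simp
    also have "\<dots> = (\<integral>\<^sup>+ x. indicator B x \<partial>distr (normalized_density (ini A) (\<lambda>x. ennreal (g 0 x))) L (\<lambda>x. x))"
      using gm by (subst emeasure_distr_normalized_density) (auto simp: Z)
    finally show "emeasure (filtering A 0) B = emeasure (distr (normalized_density (ini A) (\<lambda>x. ennreal (g 0 x))) L (\<lambda>x. x)) B"
      by simp
  qed simp
  show "(\<integral>x. f x \<partial>filtering A 0) = (\<integral>x. g 0 x * f x \<partial>ini A) / (\<integral>x. g 0 x \<partial>ini A)"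
    unfolding eq using gm g0 Z Z1 by (intro integral_distr_normalized_density) auto
  have ig: "integrable (ini A) (g 0)" using gm(1) g0 Z Z1 by (intro integrableI_nonneg) auto
  have "ennreal (\<integral>x. g 0 x \<partial>ini A) = U 0 (\<lambda>_. 1)"
    unfolding Z[symmetric] using g0 by (intro nn_integral_eq_integral[symmetric] ig) auto
  then show "0 < (\<integral>x. g 0 x \<partial>ini A)" using Z1 by (metis ennreal_eq_0_iff not_le zero_less_iff_neq_zero)
qed

section \<open>The backward information filter and its recursion\<close>

lemma space_PiM_L: "x \<in> space (PiM J (\<lambda>_. L)) \<Longrightarrow> u \<in> J \<Longrightarrow> x u \<in> space L"
  by (auto simp: space_PiM)

lemma comp_L: "u \<in> J \<Longrightarrow> (\<lambda>x. x u) \<in> PiM J (\<lambda>_. L) \<rightarrow>\<^sub>M L"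
  by (rule measurable_component_singleton)

lemma backward_weight_measurable:
  assumes "t \<le> T" "{t..T} \<subseteq> J" shows "backward_info_weight A t \<in> borel_measurable (PiM J (\<lambda>_. L))"
proof -
  have [simp]: "u \<in> J" if "t \<le> u" "u \<le> T" for u using that assms by auto
  show ?thesis
    unfolding backward_info_weight_def[abs_def] using assms(1)
    by (intro borel_measurable_times borel_measurable_prod
      measurable_compose[OF comp_L g_meas] measurable_compose[OF comp_L \<gamma>_meas] q_meas2 comp_L) auto
qed

lemma backward_weight_nonneg:
  assumes "t \<le> T" "{t..T} \<subseteq> J" "x \<in> space (PiM J (\<lambda>_. L))"
  shows "0 \<le> backward_info_weight A t x"
proof -
  have "x u \<in> space L" if "t \<le> u" "u \<le> T" for u using that assms space_PiM_L[OF assms(3)] by auto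
  then show ?thesis
    unfolding backward_info_weight_def using assms(1)
    by (intro mult_nonneg_nonneg prod_nonneg) (auto intro!: mult_nonneg_nonneg q_nonneg less_imp_le[OF g_pos] less_imp_le[OF \<gamma>_pos])
qed

definition W :: "nat \<Rightarrow> ('a \<Rightarrow> ennreal) \<Rightarrow> ennreal" where
  "W t f = (\<integral>\<^sup>+ x. ennreal (backward_info_weight A t x) * f (x t) \<partial>PiM {t..T} (\<lambda>_. L))"

lemma bkernel_measurable:
  assumes "t < T"
  shows "(\<lambda>z. bkernel A t (snd z) (fst z)) \<in> borel_measurable (L \<Otimes>\<^sub>M L)"
proof -
  have "t \<le> T" "t + 1 \<le> T" using assms by auto
  note [measurable] = g_meas[OF this(1)] \<gamma>_meas[OF this(1)] \<gamma>_meas[OF this(2)]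
  show ?thesis unfolding bkernel_def by measurable
qed

lemma bkernel_nonneg: "t < T \<Longrightarrow> x \<in> space L \<Longrightarrow> y \<in> space L \<Longrightarrow> 0 \<le> bkernel A t x y"
  unfolding bkernel_def using g_pos[of t x] \<gamma>_pos[of t x] \<gamma>_pos[of "t + 1" y] q_nonneg[of x y]
  by (intro divide_nonneg_nonneg mult_nonneg_nonneg) auto

text \<open>The weight from time t + 1 carries the artificial density \<gamma> at t + 1, while the
  weight from time t does not. The division by that density in \<open>bkernel\<close> removes
  it.\<close>

lemma backward_weight_step:
  assumes t: "t < T" and y: "x (Suc t) \<in> space L"
  shows "backward_info_weight A t (x(t := z)) = bkernel A t z (x (Suc t)) * backward_info_weight A (Suc t) x"
proof -
  have \<gamma>0: "\<gamma> (Suc t) (x (Suc t)) \<noteq> 0" using \<gamma>_pos[of "Suc t"] t y by force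
  have "{t + 1..T} = insert (Suc t) {Suc t + 1..T}" using t by auto
  then have e1: "(\<Prod>u\<in>{t+1..T}. g (u - 1) ((x(t := z)) (u - 1)) * q ((x(t := z)) (u - 1)) ((x(t := z)) u))
    = g t z * q z (x (Suc t)) * (\<Prod>u\<in>{Suc t + 1..T}. g (u - 1) ((x(t := z)) (u - 1)) * q ((x(t := z)) (u - 1)) ((x(t := z)) u))"
    by simp
  have e2: "(\<Prod>u\<in>{Suc t + 1..T}. g (u - 1) ((x(t := z)) (u - 1)) * q ((x(t := z)) (u - 1)) ((x(t := z)) u))
    = (\<Prod>u\<in>{Suc t + 1..T}. g (u - 1) (x (u - 1)) * q (x (u - 1)) (x u))"
    by (intro prod.cong) auto
  show ?thesis
    unfolding backward_info_weight_def bkernel_def e1 e2 using t \<gamma>0 by simp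
qed

lemma W_step:
  assumes t: "t < T" and f[measurable]: "f \<in> borel_measurable L"
  shows "W t f = W (Suc t) (\<lambda>y. \<integral>\<^sup>+ x. ennreal (bkernel A t x y) * f x \<partial>L)"
proof -
  have "{t..T} = insert t {Suc t..T}" using t by auto
  then have "W t f = (\<integral>\<^sup>+ x. ennreal (backward_info_weight A t x) * f (x t) \<partial>PiM (insert t {Suc t..T}) (\<lambda>_. L))"
    by (simp add: W_def)
  also have "\<dots> = (\<integral>\<^sup>+ x. \<integral>\<^sup>+ z. ennreal (backward_info_weight A t (x(t := z))) * f ((x(t := z)) t) \<partial>L \<partial>PiM {Suc t..T} (\<lambda>_. L))"
  proof (rule PB.product_nn_integral_insert)
    have "(\<lambda>x. x t) \<in> PiM (insert t {Suc t..T}) (\<lambda>_. L) \<rightarrow>\<^sub>M L" by (rule measurable_component_singleton) simp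
    from measurable_compose[OF this f]
    show "(\<lambda>x. ennreal (backward_info_weight A t x) * f (x t)) \<in> borel_measurable (PiM (insert t {Suc t..T}) (\<lambda>_. L))"
      using t by (intro borel_measurable_times_ennreal measurable_compose[OF _ measurable_ennreal] backward_weight_measurable) auto
  qed auto
  also have "\<dots> = W (Suc t) (\<lambda>y. \<integral>\<^sup>+ x. ennreal (bkernel A t x y) * f x \<partial>L)"
    unfolding W_def
  proof (intro nn_integral_cong)
    fix x assume x: "x \<in> space (PiM {Suc t..T} (\<lambda>_. L))"
    have xn: "x (Suc t) \<in> space L" using space_PiM_L[OF x] t by simp
    have w0: "0 \<le> backward_info_weight A (Suc t) x" using backward_weight_nonneg[OF _ _ x] t by simp
    have "(\<integral>\<^sup>+ z. ennreal (backward_info_weight A t (x(t := z))) * f ((x(t := z)) t) \<partial>L)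
      = (\<integral>\<^sup>+ z. ennreal (backward_info_weight A (Suc t) x) * (ennreal (bkernel A t z (x (Suc t))) * f z) \<partial>L)"
    proof (intro nn_integral_cong)
      fix z
      show "ennreal (backward_info_weight A t (x(t := z))) * f ((x(t := z)) t)
        = ennreal (backward_info_weight A (Suc t) x) * (ennreal (bkernel A t z (x (Suc t))) * f z)"
        unfolding backward_weight_step[of t x, OF t xn] ennreal_mult''[OF w0] by (simp add: mult_ac)
    qed
    also have "\<dots> = ennreal (backward_info_weight A (Suc t) x) * (\<integral>\<^sup>+ z. ennreal (bkernel A t z (x (Suc t))) * f z \<partial>L)"
    proof (rule nn_integral_cmult)
      have "(\<lambda>z. bkernel A t z (x (Suc t))) \<in> borel_measurable L"
        using measurable_compose[OF measurable_Pair1'[OF xn] bkernel_measurable[OF t]] by simp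
      then show "(\<lambda>z. ennreal (bkernel A t z (x (Suc t))) * f z) \<in> borel_measurable L" by measurable
    qed
    finally show "(\<integral>\<^sup>+ z. ennreal (backward_info_weight A t (x(t := z))) * f ((x(t := z)) t) \<partial>L)
      = ennreal (backward_info_weight A (Suc t) x) * (\<integral>\<^sup>+ z. ennreal (bkernel A t z (x (Suc t))) * f z \<partial>L)" .
  qed
  finally show ?thesis .
qed

lemma W_T:
  assumes f[measurable]: "f \<in> borel_measurable L"
  shows "W T f = (\<integral>\<^sup>+ x. ennreal (g T x * \<gamma> T x) * f x \<partial>L)"
proof -
  note [measurable] = g_meas[OF order_refl] \<gamma>_meas[OF order_refl]
  have "W T f = (\<integral>\<^sup>+ x. ennreal (g T (x T) * \<gamma> T (x T)) * f (x T) \<partial>PiM {T} (\<lambda>_. L))"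
    by (simp add: W_def backward_info_weight_def mult.commute)
  also have "\<dots> = (\<integral>\<^sup>+ x. ennreal (g T x * \<gamma> T x) * f x \<partial>L)"
    by (intro PB.product_nn_integral_singleton) measurable
  finally show ?thesis .
qed

text \<open>The reference measure is not zero: the state space carries the initial probability,
  hence has a point y, and q y . integrates to one against the measure.\<close>

lemma L_nontrivial:
  assumes f[measurable]: "f \<in> borel_measurable L" and pos: "\<And>x. x \<in> space L \<Longrightarrow> (0::ennreal) < f x"
  shows "(\<integral>\<^sup>+ x. f x \<partial>L) \<noteq> 0"
proof
  assume "(\<integral>\<^sup>+ x. f x \<partial>L) = 0"
  then have "AE x in L. f x = 0" by (subst (asm) nn_integral_0_iff_AE) measurable
  then have F: "AE x in L. False" using AE_space by eventually_elim (use pos in force)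
  obtain y where y: "y \<in> space L" using prob_space.not_empty[OF ini(1)] by (auto simp: space_ini)
  have "(\<integral>\<^sup>+ x. ennreal (q y x) \<partial>L) = (\<integral>\<^sup>+ x. 0 \<partial>L)"
    using F by (intro nn_integral_cong_AE) (auto elim: eventually_mono)
  then show False using q_mass[OF y] by simp
qed

text \<open>The induction appends states at the far end, against the direction of the backward
  recursion. Positivity propagates when q is integrated in its second argument, where it has mass
  one; an integral in the first argument at a given endpoint may be zero. Hence the terminal
  function f is kept general.\<close>

lemma backward_pos:
  assumes "t \<le> n" "n \<le> T" "f \<in> borel_measurable L" "\<And>x. x \<in> space L \<Longrightarrow> (0::ennreal) < f x"
  shows "(\<integral>\<^sup>+ x. ennreal (\<gamma> t (x t) * (\<Prod>u\<in>{t+1..n}. g (u - 1) (x (u - 1)) * q (x (u - 1)) (x u))) * f (x n) \<partial>PiM {t..n} (\<lambda>_. L)) \<noteq> 0"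
  using assms
proof (induction n arbitrary: f rule: dec_induct)
  case base
  note [measurable] = \<gamma>_meas[OF base(1)] base(2)
  have "(\<integral>\<^sup>+ x. ennreal (\<gamma> t (x t)) * f (x t) \<partial>PiM {t} (\<lambda>_. L)) = (\<integral>\<^sup>+ x. ennreal (\<gamma> t x) * f x \<partial>L)"
    by (intro PB.product_nn_integral_singleton) measurable
  also have "\<dots> \<noteq> 0"
    using \<gamma>_pos[OF base(1)] base(3) by (intro L_nontrivial) (auto simp: ennreal_zero_less_mult_iff)
  finally show ?case by simp
next
  case (step n)
  have n: "n \<le> T" using step.prems by simp
  note [measurable] = step.prems(2) g_meas[OF n]
  let ?w = "\<lambda>n x. \<gamma> t (x t) * (\<Prod>u\<in>{t+1..n}. g (u - 1) (x (u - 1)) * q (x (u - 1)) (x u))"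
  have wm: "?w m \<in> borel_measurable (PiM J (\<lambda>_. L))" if "t \<le> m" "m \<le> T" "{t..m} \<subseteq> J" for m J
  proof -
    have [simp]: "u \<in> J" if "t \<le> u" "u \<le> m" for u using that \<open>{t..m} \<subseteq> J\<close> by auto
    show ?thesis using \<open>t \<le> m\<close> \<open>m \<le> T\<close>
      by (intro borel_measurable_times borel_measurable_prod
        measurable_compose[OF comp_L g_meas] measurable_compose[OF comp_L \<gamma>_meas] q_meas2 comp_L) auto
  qed
  have "{t..Suc n} = insert (Suc n) {t..n}" using step.hyps by auto
  then have "(\<integral>\<^sup>+ x. ennreal (?w (Suc n) x) * f (x (Suc n)) \<partial>PiM {t..Suc n} (\<lambda>_. L))
    = (\<integral>\<^sup>+ x. ennreal (?w (Suc n) x) * f (x (Suc n)) \<partial>PiM (insert (Suc n) {t..n}) (\<lambda>_. L))" by (simp only:)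
  also have "\<dots> = (\<integral>\<^sup>+ x. \<integral>\<^sup>+ z. ennreal (?w (Suc n) (x(Suc n := z))) * f ((x(Suc n := z)) (Suc n)) \<partial>L \<partial>PiM {t..n} (\<lambda>_. L))"
  proof (rule PB.product_nn_integral_insert)
    have "(\<lambda>x. x (Suc n)) \<in> PiM (insert (Suc n) {t..n}) (\<lambda>_. L) \<rightarrow>\<^sub>M L" by (rule measurable_component_singleton) simp
    from measurable_compose[OF this step.prems(2)]
    show "(\<lambda>x. ennreal (?w (Suc n) x) * f (x (Suc n))) \<in> borel_measurable (PiM (insert (Suc n) {t..n}) (\<lambda>_. L))"
      using step.hyps step.prems by (intro borel_measurable_times_ennreal measurable_compose[OF _ measurable_ennreal] wm) auto
  qed auto
  \<comment> \<open>The appended state is absorbed into a new terminal function, g n times the image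
    of f under the transition, to which the induction hypothesis applies.\<close>
  also have "\<dots> = (\<integral>\<^sup>+ x. ennreal (?w n x) * (\<lambda>y. ennreal (g n y) * (\<integral>\<^sup>+ z. ennreal (q y z) * f z \<partial>L)) (x n) \<partial>PiM {t..n} (\<lambda>_. L))"
  proof (intro nn_integral_cong)
    fix x assume x: "x \<in> space (PiM {t..n} (\<lambda>_. L))"
    have xs: "x u \<in> space L" if "t \<le> u" "u \<le> n" for u using space_PiM_L[OF x] that by simp
    have xn: "x n \<in> space L" using xs step.hyps by simp
    have w0: "0 \<le> ?w n x"
      using xs step.hyps n by (intro mult_nonneg_nonneg prod_nonneg) (auto intro!: mult_nonneg_nonneg q_nonneg less_imp_le[OF g_pos] less_imp_le[OF \<gamma>_pos])
    have w: "?w (Suc n) (x(Suc n := z)) = ?w n x * g n (x n) * q (x n) z" for z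
    proof -
      have "{t + 1..Suc n} = insert (Suc n) {t + 1..n}" using step.hyps by auto
      then have "?w (Suc n) (x(Suc n := z)) = \<gamma> t (x t) * (g n (x n) * q (x n) z * (\<Prod>u\<in>{t+1..n}. g (u - 1) ((x(Suc n := z)) (u - 1)) * q ((x(Suc n := z)) (u - 1)) ((x(Suc n := z)) u)))"
        using step.hyps by simp
      also have "(\<Prod>u\<in>{t+1..n}. g (u - 1) ((x(Suc n := z)) (u - 1)) * q ((x(Suc n := z)) (u - 1)) ((x(Suc n := z)) u)) = (\<Prod>u\<in>{t+1..n}. g (u - 1) (x (u - 1)) * q (x (u - 1)) (x u))"
        by (intro prod.cong) auto
      finally show ?thesis by (simp add: mult_ac)
    qed
    have e: "ennreal (?w n x * g n (x n)) = ennreal (?w n x) * ennreal (g n (x n))" using w0 by (rule ennreal_mult')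
    have "(\<integral>\<^sup>+ z. ennreal (?w (Suc n) (x(Suc n := z))) * f ((x(Suc n := z)) (Suc n)) \<partial>L)
      = (\<integral>\<^sup>+ z. ennreal (?w n x * g n (x n)) * (ennreal (q (x n) z) * f z) \<partial>L)"
    proof (intro nn_integral_cong)
      fix z
      have "0 \<le> ?w n x * g n (x n)" using w0 g_pos[OF n xn] by simp
      then show "ennreal (?w (Suc n) (x(Suc n := z))) * f ((x(Suc n := z)) (Suc n)) = ennreal (?w n x * g n (x n)) * (ennreal (q (x n) z) * f z)"
        unfolding w fun_upd_same by (subst ennreal_mult') (simp_all add: mult.assoc)
    qed
    also have "\<dots> = ennreal (?w n x * g n (x n)) * (\<integral>\<^sup>+ z. ennreal (q (x n) z) * f z \<partial>L)"
      using xn by (intro nn_integral_cmult) measurable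
    also have "\<dots> = ennreal (?w n x) * (\<lambda>y. ennreal (g n y) * (\<integral>\<^sup>+ z. ennreal (q y z) * f z \<partial>L)) (x n)"
      unfolding e by (rule mult.assoc)
    finally show "(\<integral>\<^sup>+ z. ennreal (?w (Suc n) (x(Suc n := z))) * f ((x(Suc n := z)) (Suc n)) \<partial>L)
      = ennreal (?w n x) * (\<lambda>y. ennreal (g n y) * (\<integral>\<^sup>+ z. ennreal (q y z) * f z \<partial>L)) (x n)"
      .
  qed
  also have "\<dots> \<noteq> 0"
  proof (rule step.IH[OF n])
    show "(\<lambda>y. ennreal (g n y) * (\<integral>\<^sup>+ z. ennreal (q y z) * f z \<partial>L)) \<in> borel_measurable L" by measurable
    fix y assume y: "y \<in> space L"
    have "(\<integral>\<^sup>+ z. ennreal (q y z) * f z \<partial>L) \<noteq> 0"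
    proof
      assume "(\<integral>\<^sup>+ z. ennreal (q y z) * f z \<partial>L) = 0"
      then have "AE z in L. ennreal (q y z) * f z = 0" using y by (subst (asm) nn_integral_0_iff_AE) measurable
      then have "AE z in L. ennreal (q y z) = 0"
        using AE_space by eventually_elim (use step.prems(3) in force)
      then have "(\<integral>\<^sup>+ z. ennreal (q y z) \<partial>L) = 0" using y by (subst nn_integral_0_iff_AE) measurable
      then show False using q_mass[OF y] by simp
    qed
    then show "0 < ennreal (g n y) * (\<integral>\<^sup>+ z. ennreal (q y z) * f z \<partial>L)"
      using g_pos[OF n y] by (simp add: ennreal_zero_less_mult_iff zero_less_iff_neq_zero)
  qed
  finally show ?case .
qed

text \<open>Positivity comes from the forward product with terminal function g at the horizon;
  finiteness is the integrability condition imposed on the densities \<gamma> in the model.\<close>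

lemma W_1:
  assumes t: "t \<le> T"
  shows "W t (\<lambda>_. 1) \<noteq> 0" "W t (\<lambda>_. 1) \<noteq> \<top>"
proof -
  have "W t (\<lambda>_. 1) = (\<integral>\<^sup>+ x. ennreal (\<gamma> t (x t) * (\<Prod>u\<in>{t+1..T}. g (u - 1) (x (u - 1)) * q (x (u - 1)) (x u))) * ennreal (g T (x T)) \<partial>PiM {t..T} (\<lambda>_. L))"
    unfolding W_def
  proof (intro nn_integral_cong)
    fix x assume x: "x \<in> space (PiM {t..T} (\<lambda>_. L))"
    have "0 \<le> g T (x T)" using g_pos[OF order_refl, of "x T"] space_PiM_L[OF x, of T] t by simp
    then show "ennreal (backward_info_weight A t x) * 1 = ennreal (\<gamma> t (x t) * (\<Prod>u\<in>{t+1..T}. g (u - 1) (x (u - 1)) * q (x (u - 1)) (x u))) * ennreal (g T (x T))"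
      by (simp add: backward_info_weight_def ennreal_mult'')
  qed
  also have "\<dots> \<noteq> 0"
    using g_meas[OF order_refl] g_pos[OF order_refl] t by (intro backward_pos) auto
  finally show "W t (\<lambda>_. 1) \<noteq> 0" .
  show "W t (\<lambda>_. 1) \<noteq> \<top>" using backward_finite[OF t] by (simp add: W_def)
qed

lemma nn_integral_backward_info:
  assumes t: "t \<le> T" and f: "f \<in> borel_measurable L"
  shows "(\<integral>\<^sup>+ x. f x \<partial>backward_info A t) = W t f / W t (\<lambda>_. 1)"
  unfolding backward_info_def W_def
  using backward_weight_measurable[OF t, of "{t..T}"] t
  by (subst emeasure_distr_normalized_density[OF _ _ f]) (auto intro!: measurable_component_singleton)

lemma sets_backward_info[simp]: "sets (backward_info A t) = sets L" by (simp add: backward_info_def)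
lemma space_backward_info[simp]: "space (backward_info A t) = space L" by (simp add: backward_info_def)

lemma backward_info_prob: "t \<le> T \<Longrightarrow> prob_space (backward_info A t)"
  using nn_integral_backward_info[of t "\<lambda>_. 1"] W_1[of t]
  by (intro prob_spaceI) (simp add: ennreal_divide_self less_top)

lemma backward_info_T:
  assumes f: "bounded_fn L f B"
  shows "(\<integral>x. f x \<partial>backward_info A T) = (\<integral>x. g T x * \<gamma> T x * f x \<partial>L) / (\<integral>x. g T x * \<gamma> T x \<partial>L)"
    and "0 < (\<integral>x. g T x * \<gamma> T x \<partial>L)"
proof -
  note [measurable] = g_meas[OF order_refl] \<gamma>_meas[OF order_refl] bounded_fnD(1)[OF f]
  let ?w = "\<lambda>x. g T x * \<gamma> T x"
  have Z: "(\<integral>\<^sup>+ x. ennreal (?w x) \<partial>L) = W T (\<lambda>_. 1)" using W_T[of "\<lambda>_. 1"] by simp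
  have Z1: "0 < W T (\<lambda>_. 1)" "W T (\<lambda>_. 1) < \<infinity>" using W_1[of T] by (auto simp: less_top zero_less_iff_neq_zero)
  have w0: "0 \<le> ?w x" if "x \<in> space L" for x using g_pos[of T x] \<gamma>_pos[of T x] that by simp
  have eq: "backward_info A T = distr (normalized_density L (\<lambda>x. ennreal (?w x))) L (\<lambda>x. x)"
  proof (rule measure_eqI)
    fix B assume "B \<in> sets (backward_info A T)"
    then have B[measurable]: "B \<in> sets L" by simp
    have "emeasure (backward_info A T) B = (\<integral>\<^sup>+ x. ennreal (?w x) * indicator B x \<partial>L) / W T (\<lambda>_. 1)"
      using nn_integral_backward_info[of T "indicator B"] W_T[of "indicator B"] by simp
    also have "\<dots> = (\<integral>\<^sup>+ x. indicator B x \<partial>distr (normalized_density L (\<lambda>x. ennreal (?w x))) L (\<lambda>x. x))"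
      by (subst emeasure_distr_normalized_density) (auto simp: Z)
    finally show "emeasure (backward_info A T) B = emeasure (distr (normalized_density L (\<lambda>x. ennreal (?w x))) L (\<lambda>x. x)) B"
      by simp
  qed simp
  show "(\<integral>x. f x \<partial>backward_info A T) = (\<integral>x. ?w x * f x \<partial>L) / (\<integral>x. ?w x \<partial>L)"
    unfolding eq using w0 Z Z1 by (intro integral_distr_normalized_density) auto
  have ig: "integrable L ?w" using w0 Z Z1 by (intro integrableI_nonneg) auto
  have "ennreal (\<integral>x. ?w x \<partial>L) = W T (\<lambda>_. 1)"
    unfolding Z[symmetric] using w0 by (intro nn_integral_eq_integral[symmetric] ig) auto
  then show "0 < (\<integral>x. ?w x \<partial>L)" using Z1 by (metis ennreal_eq_0_iff not_le zero_less_iff_neq_zero)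
qed

text \<open>\<open>bkernel\<close> is integrated here in the first argument of q, where it has no
  normalisation of its own. The uniform bound \<open>C\<close> on its mass is supplied later by the
  bounded weights and adjustment functions of the design.\<close>

lemma backward_info_step:
  assumes t: "t < T" and C: "\<And>y. y \<in> space L \<Longrightarrow> (\<integral>\<^sup>+ x. ennreal (bkernel A t x y) \<partial>L) \<le> ennreal C"
  shows "0 < (\<integral>y. (\<integral>x. bkernel A t x y \<partial>L) \<partial>backward_info A (t + 1))"
    and "\<And>f B. bounded_fn L f B \<Longrightarrow> (\<integral>x. f x \<partial>backward_info A t) =
      (\<integral>y. (\<integral>x. bkernel A t x y * f x \<partial>L) \<partial>backward_info A (t + 1)) / (\<integral>y. (\<integral>x. bkernel A t x y \<partial>L) \<partial>backward_info A (t + 1))"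
proof -
  have t': "t \<le> T" "Suc t \<le> T" using t by auto
  let ?k = "\<lambda>z. bkernel A t (snd z) (fst z)"
  note [measurable] = bkernel_measurable[OF t]
  have km': "(\<lambda>y. \<integral>\<^sup>+ x. ennreal (bkernel A t x y) * f x \<partial>L) \<in> borel_measurable L" if [measurable]: "f \<in> borel_measurable L" for f
  proof -
    have "(\<lambda>z. ennreal (?k z) * f (snd z)) \<in> borel_measurable (L \<Otimes>\<^sub>M L)" by measurable
    from L.borel_measurable_nn_integral_fst[OF this] show ?thesis by simp
  qed
  have nn: "(\<integral>\<^sup>+ y. \<integral>\<^sup>+ x. ennreal (?k (y, x)) * f x \<partial>L \<partial>backward_info A (t + 1)) = W t f / W (Suc t) (\<lambda>_. 1)"
    if f: "f \<in> borel_measurable L" for f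
    using nn_integral_backward_info[OF t'(2) km'[OF f]] W_step[OF t f] by simp
  have nn1: "(\<integral>\<^sup>+ y. \<integral>\<^sup>+ x. ennreal (?k (y, x)) \<partial>L \<partial>backward_info A (t + 1)) = W t (\<lambda>_. 1) / W (Suc t) (\<lambda>_. 1)"
    using nn[of "\<lambda>_. 1"] by simp
  have s: "sets (backward_info A (t + 1) \<Otimes>\<^sub>M L) = sets (L \<Otimes>\<^sub>M L)" by (intro sets_pair_measure_cong) auto
  have km: "?k \<in> borel_measurable (backward_info A (t + 1) \<Otimes>\<^sub>M L)" unfolding measurable_cong_sets[OF s refl] by measurable
  have k0: "0 \<le> ?k (y, x)" if "y \<in> space (backward_info A (t + 1))" "x \<in> space L" for y x
    using that bkernel_nonneg[OF t] by simp
  have kC: "(\<integral>\<^sup>+ x. ennreal (?k (y, x)) \<partial>L) \<le> ennreal C" if "y \<in> space (backward_info A (t + 1))" for y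
    using C that by simp
  have kpos: "(\<integral>\<^sup>+ y. \<integral>\<^sup>+ x. ennreal (?k (y, x)) \<partial>L \<partial>backward_info A (t + 1)) \<noteq> 0"
    unfolding nn1 using W_1[OF t'(1)] W_1[OF t'(2)] by (simp add: ennreal_divide_eq_0_iff)
  have keq: "emeasure (backward_info A t) B = (\<integral>\<^sup>+ y. \<integral>\<^sup>+ x. ennreal (?k (y, x)) * indicator B x \<partial>L \<partial>backward_info A (t + 1)) / (\<integral>\<^sup>+ y. \<integral>\<^sup>+ x. ennreal (?k (y, x)) \<partial>L \<partial>backward_info A (t + 1))"
    if B: "B \<in> sets L" for B
  proof -
    have "emeasure (backward_info A t) B = W t (indicator B) / W t (\<lambda>_. 1)"
      using nn_integral_backward_info[OF t'(1), of "indicator B"] B by simp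
    also have "\<dots> = (W t (indicator B) / W (Suc t) (\<lambda>_. 1)) / (W t (\<lambda>_. 1) / W (Suc t) (\<lambda>_. 1))"
      using W_1[OF t'(1)] W_1[OF t'(2)] by (intro ennreal_divide_divide_cancel[symmetric]) auto
    also have "\<dots> = (\<integral>\<^sup>+ y. \<integral>\<^sup>+ x. ennreal (?k (y, x)) * indicator B x \<partial>L \<partial>backward_info A (t + 1)) / (\<integral>\<^sup>+ y. \<integral>\<^sup>+ x. ennreal (?k (y, x)) \<partial>L \<partial>backward_info A (t + 1))"
      using nn[of "indicator B"] nn1 B by simp
    finally show ?thesis .
  qed
  have pr: "prob_space (backward_info A (t + 1))" using backward_info_prob[OF t'(2)] by simp
  note r = kernel_ratio[OF pr sigma_finite_L km k0 kC kpos _ keq]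
  show "0 < (\<integral>y. (\<integral>x. bkernel A t x y \<partial>L) \<partial>backward_info A (t + 1))" using r(2) by simp
  show "(\<integral>x. f x \<partial>backward_info A t) =
      (\<integral>y. (\<integral>x. bkernel A t x y * f x \<partial>L) \<partial>backward_info A (t + 1)) / (\<integral>y. (\<integral>x. bkernel A t x y \<partial>L) \<partial>backward_info A (t + 1))"
    if "bounded_fn L f B" for f B using r(3)[where f=f and B=B] that by simp
qed

end

text \<open>The forward weight attaches a potential to the arrival point of each move, the backward
  weight to its departure point. This shift of the index converts one convention into the
  other.\<close>

lemma prod_shift_weights:
  fixes G Q :: "nat \<Rightarrow> real"
  assumes "m \<le> n"
  shows "G m * (\<Prod>u\<in>{m+1..n}. Q u * G u) = (\<Prod>u\<in>{m+1..n}. G (u - 1) * Q u) * G n"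
  using assms
proof (induction n rule: dec_induct)
  case (step n)
  have "{m+1..Suc n} = insert (Suc n) {m+1..n}" using step.hyps by auto
  then show ?case using step.IH by (simp add: mult_ac)
qed simp

section \<open>The smoothing law seen from the two neighbouring states\<close>

context filter_model
begin

text \<open>Up to normalisation, the density of the state at time s given the two neighbouring
  states. Dividing by \<gamma> cancels the artificial density contained in the backward law at time
  s + 1.\<close>

definition pair_kernel :: "nat \<Rightarrow> ('a \<times> 'a) \<times> 'a \<Rightarrow> real" where
  "pair_kernel s = (\<lambda>((x, x'), z). q2 A x x' z * g s z / \<gamma> (s + 1) x')"

lemma pair_kernel_measurable:
  assumes "s < T"
  shows "pair_kernel s \<in> borel_measurable ((L \<Otimes>\<^sub>M L) \<Otimes>\<^sub>M L)"
proof -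
  have "s \<le> T" "s + 1 \<le> T" using assms by auto
  note [measurable] = g_meas[OF this(1)] \<gamma>_meas[OF this(2)]
  show ?thesis unfolding pair_kernel_def q2_def case_prod_beta' by measurable
qed

lemma pair_kernel_nonneg:
  "s < T \<Longrightarrow> x \<in> space L \<Longrightarrow> x' \<in> space L \<Longrightarrow> z \<in> space L \<Longrightarrow> 0 \<le> pair_kernel s ((x, x'), z)"
  unfolding pair_kernel_def q2_def using g_pos[of s z] \<gamma>_pos[of "s + 1" x'] q_nonneg[of x z] q_nonneg[of z x']
  by (simp add: divide_nonneg_nonneg)

text \<open>Given the states around time s, the path weight separates into the past up to s - 1, a
  bridge through the state at s, and the future from s + 1. The artificial density is inserted into
  the future part and divided out of the bridge.\<close>

lemma smoothing_weight_split:
  assumes s: "1 \<le> s" "s < T" and x: "x (s + 1) \<in> space L"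
  shows "smoothing_weight A T (x(s := z)) =
    smoothing_weight A (s - 1) x * (backward_info_weight A (s + 1) x * pair_kernel s ((x (s - 1), x (s + 1)), z))"
proof -
  define y where "y = x(s := z)"
  define Q where "Q u = q (y (u - 1)) (y u)" for u
  define G where "G u = g u (y u)" for u
  have yx: "y u = x u" if "u \<noteq> s" for u using that by (simp add: y_def)
  have ys: "y s = z" by (simp add: y_def)
  have gg: "\<gamma> (s + 1) (x (s + 1)) \<noteq> 0" using \<gamma>_pos[of "s + 1" "x (s + 1)"] s x by simp
  have split: "{1..T} = ({1..s - 1} \<union> {s, s + 1}) \<union> {s + 1 + 1..T}" using s by auto
  have "smoothing_weight A T y = G 0 * (\<Prod>u\<in>{1..T}. Q u * G u)"
    by (simp add: smoothing_weight_def G_def Q_def)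
  also have "(\<Prod>u\<in>{1..T}. Q u * G u) = (\<Prod>u\<in>{1..s - 1} \<union> {s, s + 1}. Q u * G u) * (\<Prod>u\<in>{s + 1 + 1..T}. Q u * G u)"
    unfolding split by (rule prod.union_disjoint) auto
  also have "(\<Prod>u\<in>{1..s - 1} \<union> {s, s + 1}. Q u * G u) = (\<Prod>u\<in>{1..s - 1}. Q u * G u) * (\<Prod>u\<in>{s, s + 1}. Q u * G u)"
    by (rule prod.union_disjoint) (use s in auto)
  also have "(\<Prod>u\<in>{s, s + 1}. Q u * G u) = Q s * G s * (Q (s + 1) * G (s + 1))" by simp
  finally have "smoothing_weight A T y = (G 0 * (\<Prod>u\<in>{1..s - 1}. Q u * G u)) * (Q s * G s * Q (s + 1)) * (G (s + 1) * (\<Prod>u\<in>{s + 1 + 1..T}. Q u * G u))"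
    by (simp only: mult_ac)
  also have "G (s + 1) * (\<Prod>u\<in>{s + 1 + 1..T}. Q u * G u) = (\<Prod>u\<in>{s + 1 + 1..T}. G (u - 1) * Q u) * G T"
    using s by (intro prod_shift_weights) simp
  also have "G 0 * (\<Prod>u\<in>{1..s - 1}. Q u * G u) = smoothing_weight A (s - 1) y"
    by (simp add: smoothing_weight_def G_def Q_def)
  also have "smoothing_weight A (s - 1) y = smoothing_weight A (s - 1) x"
    using s by (intro smoothing_weight_cong yx) auto
  also have "(\<Prod>u\<in>{s + 1 + 1..T}. G (u - 1) * Q u) * G T = backward_info_weight A (s + 1) x / \<gamma> (s + 1) (x (s + 1))"
  proof -
    have "(\<Prod>u\<in>{s + 1 + 1..T}. G (u - 1) * Q u) = (\<Prod>u\<in>{s + 1 + 1..T}. g (u - 1) (x (u - 1)) * q (x (u - 1)) (x u))"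
      by (intro prod.cong refl) (auto simp: G_def Q_def yx)
    moreover have "G T = g T (x T)" using s by (simp add: G_def yx)
    ultimately show ?thesis using gg by (simp add: backward_info_weight_def)
  qed
  also have "Q s * G s * Q (s + 1) = q2 A (x (s - 1)) (x (s + 1)) z * g s z"
    using s by (simp add: Q_def G_def q2_def ys yx)
  finally have "smoothing_weight A T y = smoothing_weight A (s - 1) x * (q2 A (x (s - 1)) (x (s + 1)) z * g s z) *
      (backward_info_weight A (s + 1) x / \<gamma> (s + 1) (x (s + 1)))" .
  then show ?thesis unfolding y_def[symmetric] by (simp add: pair_kernel_def mult_ac)
qed

lemma U_divide:
  assumes "n \<le> T" and f: "f \<in> borel_measurable L"
  shows "U n (\<lambda>y. f y / c) = U n f / c"
proof -
  have "(\<lambda>x. ennreal (smoothing_weight A n x) * f (x n)) \<in> borel_measurable (PiM {0..n} Lu)"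
    using assms by (intro borel_measurable_times_ennreal measurable_compose[OF _ measurable_ennreal]
        smoothing_weight_measurable measurable_compose[OF comp_Lu f]) auto
  then show ?thesis unfolding U_def by (subst nn_integral_divide[symmetric]) (simp_all add: ennreal_times_divide)
qed

text \<open>The coordinate s is integrated out, which leaves an integral over disjoint past and
  future blocks. Tonelli between these blocks produces the forward and the backward unnormalised
  filters.\<close>

lemma smoothing_nn_integral:
  assumes s: "1 \<le> s" "s < T" and f[measurable]: "f \<in> borel_measurable L"
  shows "(\<integral>\<^sup>+ x. ennreal (smoothing_weight A T x) * f (x s) \<partial>PiM {0..T} Lu)
    = U (s - 1) (\<lambda>y. W (s + 1) (\<lambda>y'. \<integral>\<^sup>+ z. ennreal (pair_kernel s ((y, y'), z)) * f z \<partial>L))"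
proof -
  define I where "I = {0..s - 1}"
  define J where "J = {s + 1..T}"
  have IJ: "I \<inter> J = {}" "finite I" "finite J" "s \<notin> I \<union> J" and U: "{0..T} = insert s (I \<union> J)"
    using s by (auto simp: I_def J_def)
  have sIJ: "s - 1 \<in> I" "s + 1 \<in> J" using s by (auto simp: I_def J_def)
  define \<kappa> where "\<kappa> y y' = (\<integral>\<^sup>+ z. ennreal (pair_kernel s ((y, y'), z)) * f z \<partial>L)" for y y'
  have km: "(\<lambda>p. \<kappa> (fst p) (snd p)) \<in> borel_measurable (L \<Otimes>\<^sub>M L)"
  proof -
    have "(\<lambda>z. ennreal (pair_kernel s z) * f (snd z)) \<in> borel_measurable ((L \<Otimes>\<^sub>M L) \<Otimes>\<^sub>M L)"
      using pair_kernel_measurable[OF s(2)] by measurable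
    from L.borel_measurable_nn_integral_fst[OF this] show ?thesis by (simp add: \<kappa>_def)
  qed
  define \<Psi> where "\<Psi> x = ennreal (smoothing_weight A (s - 1) x) * (ennreal (backward_info_weight A (s + 1) x) * \<kappa> (x (s - 1)) (x (s + 1)))" for x
  \<comment> \<open>The block starts at s + 1, hence never contains the time 0 at which the
    reference measure is replaced by the initial law.\<close>
  have JL: "PiM J Lu = PiM J (\<lambda>_. L)" by (rule PiM_cong) (auto simp: J_def)
  have bwm: "backward_info_weight A (s + 1) \<in> borel_measurable (PiM (I \<union> J) Lu)"
  proof -
    have "(\<lambda>x. restrict x J) \<in> PiM (I \<union> J) Lu \<rightarrow>\<^sub>M PiM J Lu" by (rule measurable_restrict_subset) auto
    from measurable_compose[OF this[unfolded JL] backward_weight_measurable]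
    have "(\<lambda>x. backward_info_weight A (s + 1) (restrict x J)) \<in> borel_measurable (PiM (I \<union> J) Lu)"
      using s by (simp add: J_def)
    moreover have "backward_info_weight A (s + 1) (restrict x J) = backward_info_weight A (s + 1) x" for x
      unfolding backward_info_weight_def J_def using s
      by (intro arg_cong2[where f="(*)"] prod.cong) auto
    ultimately show ?thesis by simp
  qed
  have \<Psi>m: "\<Psi> \<in> borel_measurable (PiM (I \<union> J) Lu)"
  proof -
    have "(\<lambda>x. \<kappa> (x (s - 1)) (x (s + 1))) \<in> borel_measurable (PiM (I \<union> J) Lu)"
      using measurable_compose[OF measurable_Pair[OF comp_Lu comp_Lu] km, of "s - 1" "I \<union> J" "s + 1"] sIJ by simp
    then show ?thesis unfolding \<Psi>_def[abs_def]
      using s by (intro borel_measurable_times_ennreal measurable_compose[OF _ measurable_ennreal] smoothing_weight_measurable bwm) (auto simp: I_def)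
  qed
  have "(\<integral>\<^sup>+ x. ennreal (smoothing_weight A T x) * f (x s) \<partial>PiM {0..T} Lu)
    = (\<integral>\<^sup>+ x. \<integral>\<^sup>+ z. ennreal (smoothing_weight A T (x(s := z))) * f ((x(s := z)) s) \<partial>Lu s \<partial>PiM (I \<union> J) Lu)"
    unfolding U
  proof (rule PL.product_nn_integral_insert)
    show "(\<lambda>x. ennreal (smoothing_weight A T x) * f (x s)) \<in> borel_measurable (PiM (insert s (I \<union> J)) Lu)"
      using U by (intro borel_measurable_times_ennreal measurable_compose[OF _ measurable_ennreal]
        smoothing_weight_measurable measurable_compose[OF comp_Lu f]) auto
  qed (use IJ in auto)
  also have "\<dots> = (\<integral>\<^sup>+ x. \<Psi> x \<partial>PiM (I \<union> J) Lu)"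
  proof (intro nn_integral_cong)
    fix x assume x: "x \<in> space (PiM (I \<union> J) Lu)"
    have xs: "x (s - 1) \<in> space L" "x (s + 1) \<in> space L" using space_PiM_Lu[OF x] sIJ by auto
    have w0: "0 \<le> smoothing_weight A (s - 1) x" using s by (intro smoothing_weight_nonneg[OF _ _ x]) (auto simp: I_def)
    have b0: "0 \<le> backward_info_weight A (s + 1) x"
    proof -
      have "x u \<in> space L" if "s + 1 \<le> u" "u \<le> T" for u using space_PiM_Lu[OF x, of u] that by (auto simp: J_def)
      then show ?thesis unfolding backward_info_weight_def using s
        by (intro mult_nonneg_nonneg prod_nonneg) (auto intro!: mult_nonneg_nonneg q_nonneg less_imp_le[OF g_pos] less_imp_le[OF \<gamma>_pos])
    qed
    have "(\<integral>\<^sup>+ z. ennreal (smoothing_weight A T (x(s := z))) * f ((x(s := z)) s) \<partial>Lu s)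
      = (\<integral>\<^sup>+ z. ennreal (smoothing_weight A (s - 1) x) * ennreal (backward_info_weight A (s + 1) x) * (ennreal (pair_kernel s ((x (s - 1), x (s + 1)), z)) * f z) \<partial>L)"
      unfolding smoothing_weight_split[where x=x, OF s xs(2)] ennreal_mult'[OF w0] ennreal_mult'[OF b0] using s by (simp add: mult.assoc)
    also have "\<dots> = ennreal (smoothing_weight A (s - 1) x) * ennreal (backward_info_weight A (s + 1) x) * \<kappa> (x (s - 1)) (x (s + 1))"
      unfolding \<kappa>_def
    proof (rule nn_integral_cmult)
      have "(x (s - 1), x (s + 1)) \<in> space (L \<Otimes>\<^sub>M L)" using xs by (simp add: space_pair_measure)
      from measurable_compose[OF measurable_Pair1'[OF this] pair_kernel_measurable[OF s(2)]]
      show "(\<lambda>z. ennreal (pair_kernel s ((x (s - 1), x (s + 1)), z)) * f z) \<in> borel_measurable L" by measurable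
    qed
    finally show "(\<integral>\<^sup>+ z. ennreal (smoothing_weight A T (x(s := z))) * f ((x(s := z)) s) \<partial>Lu s) = \<Psi> x"
      by (simp add: \<Psi>_def mult.assoc)
  qed
  also have "\<dots> = (\<integral>\<^sup>+ x. \<integral>\<^sup>+ y. \<Psi> (merge I J (x, y)) \<partial>PiM J Lu \<partial>PiM I Lu)"
    using IJ by (intro PL.product_nn_integral_fold \<Psi>m)
  also have "\<dots> = (\<integral>\<^sup>+ x. ennreal (smoothing_weight A (s - 1) x) * W (s + 1) (\<kappa> (x (s - 1))) \<partial>PiM I Lu)"
  proof (intro nn_integral_cong)
    fix x assume x: "x \<in> space (PiM I Lu)"
    have xs: "x (s - 1) \<in> space L" using space_PiM_Lu[OF x] sIJ by auto
    have m: "\<Psi> (merge I J (x, y)) = ennreal (smoothing_weight A (s - 1) x) * (ennreal (backward_info_weight A (s + 1) y) * \<kappa> (x (s - 1)) (y (s + 1)))" for y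
    proof -
      have "smoothing_weight A (s - 1) (merge I J (x, y)) = smoothing_weight A (s - 1) x"
        by (rule smoothing_weight_cong) (auto simp: I_def merge_def)
      moreover have my: "merge I J (x, y) u = y u" if "s + 1 \<le> u" "u \<le> T" for u
        using that IJ by (auto simp: merge_def I_def J_def)
      moreover have "backward_info_weight A (s + 1) (merge I J (x, y)) = backward_info_weight A (s + 1) y"
        unfolding backward_info_weight_def using s
        by (intro arg_cong2[where f="(*)"] prod.cong) (auto simp: my)
      ultimately show ?thesis using sIJ IJ by (simp add: \<Psi>_def)
    qed
    have "(\<integral>\<^sup>+ y. \<Psi> (merge I J (x, y)) \<partial>PiM J Lu)
      = ennreal (smoothing_weight A (s - 1) x) * (\<integral>\<^sup>+ y. ennreal (backward_info_weight A (s + 1) y) * \<kappa> (x (s - 1)) (y (s + 1)) \<partial>PiM J Lu)"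
      unfolding m
    proof (rule nn_integral_cmult)
      have "(\<lambda>y'. \<kappa> (x (s - 1)) y') \<in> borel_measurable L"
        using measurable_compose[OF measurable_Pair1'[OF xs] km] by simp
      then show "(\<lambda>y. ennreal (backward_info_weight A (s + 1) y) * \<kappa> (x (s - 1)) (y (s + 1))) \<in> borel_measurable (PiM J Lu)"
        unfolding JL using s sIJ
        by (intro borel_measurable_times_ennreal measurable_compose[OF _ measurable_ennreal] backward_weight_measurable
            measurable_compose[OF comp_L, of _ _ "\<kappa> (x (s - 1))"]) (auto simp: J_def)
    qed
    then show "(\<integral>\<^sup>+ y. \<Psi> (merge I J (x, y)) \<partial>PiM J Lu) = ennreal (smoothing_weight A (s - 1) x) * W (s + 1) (\<kappa> (x (s - 1)))"
      unfolding JL unfolding W_def J_def .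
  qed
  also have "\<dots> = U (s - 1) (\<lambda>y. W (s + 1) (\<kappa> y))" by (simp only: U_def I_def)
  finally show ?thesis unfolding \<kappa>_def[abs_def] .
qed

lemma sets_pair_law: "sets (pair_law A s) = sets (L \<Otimes>\<^sub>M L)"
  unfolding pair_law_def by (intro sets_pair_measure_cong) auto

lemma space_pair_law: "space (pair_law A s) = space L \<times> space L"
  using sets_eq_imp_space_eq[OF sets_pair_law] by (simp add: space_pair_measure)

lemma pair_law_prob: "1 \<le> s \<Longrightarrow> s < T \<Longrightarrow> prob_space (pair_law A s)"
  unfolding pair_law_def by (intro prob_space_pair filtering_prob backward_info_prob) auto

text \<open>The smoothing law is the image of the pair law under the bridge kernel. The masses of
  the two filters, multiplied in \<open>D\<close>, are common to numerator and denominator.\<close>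

lemma smoothing_pair:
  assumes s: "1 \<le> s" "s < T"
    and C: "\<And>x x'. x \<in> space L \<Longrightarrow> x' \<in> space L \<Longrightarrow> (\<integral>\<^sup>+ z. ennreal (pair_kernel s ((x, x'), z)) \<partial>L) \<le> ennreal C"
  shows "prob_space (smoothing A s T)" "0 < (\<integral>p. (\<integral>z. pair_kernel s (p, z) \<partial>L) \<partial>pair_law A s)"
    and "\<And>f B. bounded_fn L f B \<Longrightarrow> (\<integral>x. f x \<partial>smoothing A s T) =
      (\<integral>p. (\<integral>z. pair_kernel s (p, z) * f z \<partial>L) \<partial>pair_law A s) / (\<integral>p. (\<integral>z. pair_kernel s (p, z) \<partial>L) \<partial>pair_law A s)"
proof -
  have t: "s - 1 \<le> T" "s + 1 \<le> T" using s by auto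
  interpret \<phi>: prob_space "filtering A (s - 1)" by (rule filtering_prob[OF t(1)])
  interpret \<psi>: prob_space "backward_info A (s + 1)" by (rule backward_info_prob[OF t(2)])
  note [measurable] = pair_kernel_measurable[OF s(2)]
  define J where "J f = (\<integral>\<^sup>+ x. ennreal (smoothing_weight A T x) * f (x s) \<partial>PiM {0..T} Lu)" for f :: "'a \<Rightarrow> ennreal"
  define D where "D = W (s + 1) (\<lambda>_. 1) * U (s - 1) (\<lambda>_. 1)"
  have D: "D \<noteq> 0" "D \<noteq> \<top>"
    unfolding D_def using W_1[OF t(2)] U_pos[OF t(1), of "\<lambda>_. 1"] U_finite[OF t(1), of "\<lambda>_. 1" 1]
    by (auto simp: ennreal_mult_eq_top_iff)
  have J1: "J (\<lambda>_. 1) \<noteq> 0" "J (\<lambda>_. 1) \<noteq> \<top>"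
    using U_pos[OF order_refl, of "\<lambda>_. 1"] U_finite[OF order_refl, of "\<lambda>_. 1" 1] by (auto simp: J_def U_def)
  have smooth: "(\<integral>\<^sup>+ x. f x \<partial>smoothing A s T) = J f / J (\<lambda>_. 1)" if f: "f \<in> borel_measurable L" for f
  proof -
    have "(\<lambda>x. x s) \<in> PiM {0..T} Lu \<rightarrow>\<^sub>M L" using s by (intro comp_Lu) simp
    from emeasure_distr_normalized_density[OF measurable_compose[OF smoothing_weight_measurable[OF order_refl order_refl] measurable_ennreal] this f]
    show ?thesis unfolding smoothing_def J_def by simp
  qed
  have nn: "(\<integral>\<^sup>+ p. \<integral>\<^sup>+ z. ennreal (pair_kernel s (p, z)) * f z \<partial>L \<partial>pair_law A s) = J f / D"
    if f[measurable]: "f \<in> borel_measurable L" for f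
  proof -
    define \<kappa> where "\<kappa> y y' = (\<integral>\<^sup>+ z. ennreal (pair_kernel s ((y, y'), z)) * f z \<partial>L)" for y y'
    have km: "(\<lambda>p. \<kappa> (fst p) (snd p)) \<in> borel_measurable (L \<Otimes>\<^sub>M L)"
    proof -
      have "(\<lambda>z. ennreal (pair_kernel s z) * f (snd z)) \<in> borel_measurable ((L \<Otimes>\<^sub>M L) \<Otimes>\<^sub>M L)" by measurable
      from L.borel_measurable_nn_integral_fst[OF this] show ?thesis by (simp add: \<kappa>_def)
    qed
    have km': "(\<lambda>p. \<kappa> (fst p) (snd p)) \<in> borel_measurable (filtering A (s - 1) \<Otimes>\<^sub>M backward_info A (s + 1))"
      unfolding measurable_cong_sets[OF sets_pair_law[unfolded pair_law_def] refl] by (rule km)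
    have inner: "(\<integral>\<^sup>+ y'. \<kappa> y y' \<partial>backward_info A (s + 1)) = W (s + 1) (\<kappa> y) / W (s + 1) (\<lambda>_. 1)" if "y \<in> space L" for y
      using measurable_compose[OF measurable_Pair1'[OF that] km] by (intro nn_integral_backward_info[OF t(2)]) simp
    \<comment> \<open>Measurability of the unnormalised integral is recovered from that of an
      integral against a probability law, by multiplying the normalising mass back in.\<close>
    have Wm: "(\<lambda>y. W (s + 1) (\<kappa> y)) \<in> borel_measurable L"
    proof -
      have "(\<lambda>y. \<integral>\<^sup>+ y'. \<kappa> y y' \<partial>backward_info A (s + 1)) \<in> borel_measurable (filtering A (s - 1))"
        using \<psi>.borel_measurable_nn_integral_fst[OF km'] by simp
      then have "(\<lambda>y. W (s + 1) (\<lambda>_. 1) * (\<integral>\<^sup>+ y'. \<kappa> y y' \<partial>backward_info A (s + 1))) \<in> borel_measurable L"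
        by (simp add: measurable_cong_sets[OF sets_filtering refl])
      moreover have "W (s + 1) (\<lambda>_. 1) * (\<integral>\<^sup>+ y'. \<kappa> y y' \<partial>backward_info A (s + 1)) = W (s + 1) (\<kappa> y)" if "y \<in> space L" for y
        unfolding inner[OF that] ennreal_times_divide mult.commute[of "W (s + 1) (\<lambda>_. 1)"]
          by (rule mult_divide_eq_ennreal[OF W_1[OF t(2)]])
      ultimately show ?thesis by (subst (asm) measurable_cong) auto
    qed
    have "(\<integral>\<^sup>+ p. \<integral>\<^sup>+ z. ennreal (pair_kernel s (p, z)) * f z \<partial>L \<partial>pair_law A s) = (\<integral>\<^sup>+ p. \<kappa> (fst p) (snd p) \<partial>pair_law A s)"
      by (simp add: \<kappa>_def)
    also have "\<dots> = (\<integral>\<^sup>+ y. \<integral>\<^sup>+ y'. \<kappa> y y' \<partial>backward_info A (s + 1) \<partial>filtering A (s - 1))"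
      unfolding pair_law_def using \<psi>.nn_integral_fst[OF km'] by simp
    also have "\<dots> = (\<integral>\<^sup>+ y. W (s + 1) (\<kappa> y) / W (s + 1) (\<lambda>_. 1) \<partial>filtering A (s - 1))"
      by (intro nn_integral_cong inner) simp
    also have "\<dots> = U (s - 1) (\<lambda>y. W (s + 1) (\<kappa> y) / W (s + 1) (\<lambda>_. 1)) / U (s - 1) (\<lambda>_. 1)"
    proof (rule nn_integral_filtering[OF t(1)])
      define c where "c = W (s + 1) (\<lambda>_. 1)"
      show "(\<lambda>y. W (s + 1) (\<kappa> y) / W (s + 1) (\<lambda>_. 1)) \<in> borel_measurable L"
        unfolding c_def[symmetric] using Wm by measurable
    qed
    also have "\<dots> = U (s - 1) (\<lambda>y. W (s + 1) (\<kappa> y)) / W (s + 1) (\<lambda>_. 1) / U (s - 1) (\<lambda>_. 1)"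
      by (simp only: U_divide[OF t(1) Wm])
    also have "U (s - 1) (\<lambda>y. W (s + 1) (\<kappa> y)) = J f"
      unfolding J_def \<kappa>_def[abs_def] by (rule smoothing_nn_integral[OF s f, symmetric])
    also have "J f / W (s + 1) (\<lambda>_. 1) / U (s - 1) (\<lambda>_. 1) = J f / D"
      unfolding D_def using W_1[OF t(2)] U_pos[OF t(1), of "\<lambda>_. 1"] U_finite[OF t(1), of "\<lambda>_. 1" 1]
      by (simp add: divide_ennreal_def mult.assoc ennreal_inverse_mult less_top)
    finally show ?thesis .
  qed
  have nn1: "(\<integral>\<^sup>+ p. \<integral>\<^sup>+ z. ennreal (pair_kernel s (p, z)) \<partial>L \<partial>pair_law A s) = J (\<lambda>_. 1) / D"
    using nn[of "\<lambda>_. 1"] by simp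
  have km: "pair_kernel s \<in> borel_measurable (pair_law A s \<Otimes>\<^sub>M L)"
    unfolding measurable_cong_sets[OF sets_pair_measure_cong[OF sets_pair_law refl] refl] by measurable
  have k0: "0 \<le> pair_kernel s (p, z)" if "p \<in> space (pair_law A s)" "z \<in> space L" for p z
    using that pair_kernel_nonneg[OF s(2)] by (auto simp: space_pair_law)
  have kC: "(\<integral>\<^sup>+ z. ennreal (pair_kernel s (p, z)) \<partial>L) \<le> ennreal C" if "p \<in> space (pair_law A s)" for p
    using that C by (auto simp: space_pair_law)
  have kpos: "(\<integral>\<^sup>+ p. \<integral>\<^sup>+ z. ennreal (pair_kernel s (p, z)) \<partial>L \<partial>pair_law A s) \<noteq> 0"
    unfolding nn1 using J1 D by (simp add: ennreal_divide_eq_0_iff)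
  have keq: "emeasure (smoothing A s T) B = (\<integral>\<^sup>+ p. \<integral>\<^sup>+ z. ennreal (pair_kernel s (p, z)) * indicator B z \<partial>L \<partial>pair_law A s) / (\<integral>\<^sup>+ p. \<integral>\<^sup>+ z. ennreal (pair_kernel s (p, z)) \<partial>L \<partial>pair_law A s)"
    if B: "B \<in> sets L" for B
  proof -
    have "emeasure (smoothing A s T) B = J (indicator B) / J (\<lambda>_. 1)"
      using smooth[of "indicator B"] B by simp
    also have "\<dots> = (J (indicator B) / D) / (J (\<lambda>_. 1) / D)"
      using D J1 by (intro ennreal_divide_divide_cancel[symmetric]) auto
    finally show ?thesis using nn[of "indicator B"] nn1 B by simp
  qed
  note r = kernel_ratio[OF pair_law_prob[OF s] sigma_finite_L km k0 kC kpos _ keq]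
  show "prob_space (smoothing A s T)" using r(1) by simp
  show "0 < (\<integral>p. (\<integral>z. pair_kernel s (p, z) \<partial>L) \<partial>pair_law A s)" using r(2) by simp
  show "(\<integral>x. f x \<partial>smoothing A s T) =
      (\<integral>p. (\<integral>z. pair_kernel s (p, z) * f z \<partial>L) \<partial>pair_law A s) / (\<integral>p. (\<integral>z. pair_kernel s (p, z) \<partial>L) \<partial>pair_law A s)"
    if "bounded_fn L f B" for f B using r(3)[where f=f and B=B] that by simp
qed

end

section \<open>Sampling from finite mixtures\<close>

lemma normalized_density_cong:
  assumes "\<And>x. x \<in> space M \<Longrightarrow> f x = f' x"
  shows "normalized_density M f = normalized_density M f'"
proof -
  have "density M (\<lambda>x. f x / c) = density M (\<lambda>x. f' x / c)" for c
    unfolding density_def using assms by (simp cong: nn_integral_cong)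
  then show ?thesis unfolding normalized_density_def using assms by (simp cong: nn_integral_cong)
qed

lemma cond_iid_cong_AE:
  assumes "cond_iid P F N S Z K" "AE w in P. K w = K' w"
  shows "cond_iid P F N S Z K'"
  unfolding cond_iid_def
proof (intro conjI allI impI)
  show "\<forall>l\<in>{1..N}. Z l \<in> P \<rightarrow>\<^sub>M S" using assms(1) unfolding cond_iid_def by blast
  fix B assume "\<forall>l\<in>{1..N}. B l \<in> sets S"
  then have "AE w in P. nn_cond_exp P F (indicator {w \<in> space P. \<forall>l\<in>{1..N}. Z l w \<in> B l}) w
      = (\<Prod>l\<in>{1..N}. emeasure (K w) (B l))" using assms(1) unfolding cond_iid_def by blast
  then show "AE w in P. nn_cond_exp P F (indicator {w \<in> space P. \<forall>l\<in>{1..N}. Z l w \<in> B l}) w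
      = (\<Prod>l\<in>{1..N}. emeasure (K' w) (B l))" using assms(2) by eventually_elim simp
qed

lemma normalized_density_prob:
  assumes [measurable]: "d \<in> borel_measurable S" and "0 < (\<integral>\<^sup>+ z. d z \<partial>S)" "(\<integral>\<^sup>+ z. d z \<partial>S) < \<infinity>"
  shows "prob_space (normalized_density S d)"
proof (rule prob_spaceI)
  have "emeasure (normalized_density S d) (space (normalized_density S d)) = (\<integral>\<^sup>+ z. d z / (\<integral>\<^sup>+ y. d y \<partial>S) \<partial>S)"
    by (simp add: normalized_density_def emeasure_density cong: nn_integral_cong)
  also have "\<dots> = 1" using assms by (simp add: nn_integral_divide ennreal_divide_self)
  finally show "emeasure (normalized_density S d) (space (normalized_density S d)) = 1" .
qed

text \<open>Where the total mass is zero or infinite, the normalised density is replaced by a point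
  mass. This yields a probability at every outcome, measurable in the past; since it changes the law
  only on a null set, the conditional sampling property is preserved.\<close>

lemma normalized_density_version:
  assumes S: "sigma_finite_measure S" "space S \<noteq> {}" and F: "subalgebra P F"
    and d: "d \<in> borel_measurable (F \<Otimes>\<^sub>M S)"
    and ae: "AE w in P. 0 < (\<integral>\<^sup>+ z. d (w, z) \<partial>S) \<and> (\<integral>\<^sup>+ z. d (w, z) \<partial>S) < \<infinity>"
    and ci: "cond_iid P F N S Z (\<lambda>w. normalized_density S (\<lambda>z. d (w, z)))"
  shows "\<exists>K. K \<in> F \<rightarrow>\<^sub>M prob_algebra S \<and> cond_iid P F N S Z K \<and> (AE w in P. K w = normalized_density S (\<lambda>z. d (w, z)))"
proof -
  interpret S: sigma_finite_measure S by (rule S(1))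
  obtain z0 where z0: "z0 \<in> space S" using S(2) by auto
  have Zm[measurable]: "(\<lambda>w. \<integral>\<^sup>+ z. d (w, z) \<partial>S) \<in> borel_measurable F" using S.borel_measurable_nn_integral_fst[OF d] .
  define K where "K w = (if 0 < (\<integral>\<^sup>+ z. d (w, z) \<partial>S) \<and> (\<integral>\<^sup>+ z. d (w, z) \<partial>S) < \<infinity> then normalized_density S (\<lambda>z. d (w, z)) else return S z0)" for w
  have dw: "(\<lambda>z. d (w, z)) \<in> borel_measurable S" if "w \<in> space F" for w
    using measurable_compose[OF measurable_Pair1'[OF that] d] by simp
  have K: "K \<in> F \<rightarrow>\<^sub>M prob_algebra S"
  proof (rule measurable_prob_algebra_generated[OF sets.sigma_sets_eq[symmetric] sets.Int_stable sets.space_closed])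
    fix w assume w: "w \<in> space F"
    show "prob_space (K w)" unfolding K_def using normalized_density_prob[OF dw[OF w]] prob_space_return[OF z0] by auto
    show "sets (K w) = sets S" unfolding K_def normalized_density_def by auto
  next
    fix B assume B[measurable]: "B \<in> sets S"
    have m1: "(\<lambda>w. \<integral>\<^sup>+ z. d (w, z) * indicator B z \<partial>S) \<in> borel_measurable F"
    proof -
      have "(\<lambda>x. d x * indicator B (snd x)) \<in> borel_measurable (F \<Otimes>\<^sub>M S)" using d by measurable
      from S.borel_measurable_nn_integral_fst[OF this] show ?thesis by simp
    qed
    have eq: "emeasure (K w) B = (if 0 < (\<integral>\<^sup>+ z. d (w, z) \<partial>S) \<and> (\<integral>\<^sup>+ z. d (w, z) \<partial>S) < \<infinity>
        then (\<integral>\<^sup>+ z. d (w, z) * indicator B z \<partial>S) / (\<integral>\<^sup>+ z. d (w, z) \<partial>S) else indicator B z0)" if w: "w \<in> space F" for w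
    proof -
      note [measurable] = dw[OF w]
      have "emeasure (normalized_density S (\<lambda>z. d (w, z))) B = (\<integral>\<^sup>+ z. d (w, z) * indicator B z \<partial>S) / (\<integral>\<^sup>+ z. d (w, z) \<partial>S)"
      proof -
        have "emeasure (normalized_density S (\<lambda>z. d (w, z))) B = (\<integral>\<^sup>+ z. d (w, z) / (\<integral>\<^sup>+ z. d (w, z) \<partial>S) * indicator B z \<partial>S)"
          unfolding normalized_density_def by (rule emeasure_density) auto
        also have "\<dots> = (\<integral>\<^sup>+ z. d (w, z) * indicator B z / (\<integral>\<^sup>+ z. d (w, z) \<partial>S) \<partial>S)"
          by (simp add: divide_ennreal_def mult_ac)
        also have "\<dots> = (\<integral>\<^sup>+ z. d (w, z) * indicator B z \<partial>S) / (\<integral>\<^sup>+ z. d (w, z) \<partial>S)"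
          by (rule nn_integral_divide) measurable
        finally show ?thesis .
      qed
      then show ?thesis unfolding K_def by (simp add: emeasure_return)
    qed
    show "(\<lambda>w. emeasure (K w) B) \<in> borel_measurable F"
      by (subst measurable_cong[OF eq]) (use m1 in measurable)
  qed
  have KAE: "AE w in P. K w = normalized_density S (\<lambda>z. d (w, z))"
    using ae by eventually_elim (simp add: K_def)
  have "AE w in P. normalized_density S (\<lambda>z. d (w, z)) = K w" using KAE by eventually_elim simp
  from cond_iid_cong_AE[OF ci this] show ?thesis using K KAE by blast
qed

text \<open>Covers both spaces of sampled objects, an index with a state and a pair of indices with
  a state: integration over them is a finite sum of integrals over the state space, taken along the
  embeddings \<open>e j\<close>.\<close>

locale indexed_base =
  fixes S :: "'s measure" and L :: "'x measure" and J :: "'j set" and e :: "'j \<Rightarrow> 'x \<Rightarrow> 's"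
  assumes J: "finite J" and e: "\<And>j. j \<in> J \<Longrightarrow> e j \<in> L \<rightarrow>\<^sub>M S"
    and nn_sum: "\<And>\<phi>. \<phi> \<in> borel_measurable S \<Longrightarrow> (\<integral>\<^sup>+ z. \<phi> z \<partial>S) = (\<Sum>j\<in>J. \<integral>\<^sup>+ x. \<phi> (e j x) \<partial>L)"
begin

lemma integral_sum:
  fixes \<phi> :: "'s \<Rightarrow> real"
  assumes i: "integrable S \<phi>"
  shows "(\<integral>z. \<phi> z \<partial>S) = (\<Sum>j\<in>J. \<integral>x. \<phi> (e j x) \<partial>L)"
proof -
  have m[measurable]: "\<phi> \<in> borel_measurable S" using i by auto
  have mj: "(\<lambda>x. \<phi> (e j x)) \<in> borel_measurable L" if "j \<in> J" for j using measurable_compose[OF e[OF that] m] .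
  have fin: "(\<integral>\<^sup>+ z. ennreal (norm (\<phi> z)) \<partial>S) < \<infinity>" using i by (simp add: integrable_iff_bounded)
  then have fj: "(\<integral>\<^sup>+ x. ennreal (norm (\<phi> (e j x))) \<partial>L) < \<infinity>" if "j \<in> J" for j
    using nn_sum[of "\<lambda>z. ennreal (norm (\<phi> z))"] member_le_sum[of j J "\<lambda>j. \<integral>\<^sup>+ x. ennreal (norm (\<phi> (e j x))) \<partial>L"] that J
    by (auto simp: less_top)
  have ij: "integrable L (\<lambda>x. \<phi> (e j x))" if "j \<in> J" for j
    using mj[OF that] fj[OF that] by (simp add: integrable_iff_bounded)
  have fpos: "(\<integral>\<^sup>+ x. ennreal (\<phi> (e j x)) \<partial>L) \<noteq> \<top>" "(\<integral>\<^sup>+ x. ennreal (- \<phi> (e j x)) \<partial>L) \<noteq> \<top>" if "j \<in> J" for j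
    using ij[OF that] by (auto simp: real_integrable_def)
  have s: "enn2real (\<Sum>j\<in>J. f j) = (\<Sum>j\<in>J. enn2real (f j))" if "\<And>j. j \<in> J \<Longrightarrow> f j \<noteq> \<top>" for f :: "'j \<Rightarrow> ennreal"
    using that by (subst enn2real_sum) (auto simp: less_top comp_def)
  have "(\<integral>z. \<phi> z \<partial>S) = enn2real (\<integral>\<^sup>+ z. ennreal (\<phi> z) \<partial>S) - enn2real (\<integral>\<^sup>+ z. ennreal (- \<phi> z) \<partial>S)"
    by (rule real_lebesgue_integral_def[OF i])
  also have "(\<integral>\<^sup>+ z. ennreal (\<phi> z) \<partial>S) = (\<Sum>j\<in>J. \<integral>\<^sup>+ x. ennreal (\<phi> (e j x)) \<partial>L)" by (rule nn_sum) measurable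
  also have "(\<integral>\<^sup>+ z. ennreal (- \<phi> z) \<partial>S) = (\<Sum>j\<in>J. \<integral>\<^sup>+ x. ennreal (- \<phi> (e j x)) \<partial>L)" by (rule nn_sum) measurable
  also have "enn2real (\<Sum>j\<in>J. \<integral>\<^sup>+ x. ennreal (\<phi> (e j x)) \<partial>L) - enn2real (\<Sum>j\<in>J. \<integral>\<^sup>+ x. ennreal (- \<phi> (e j x)) \<partial>L)
    = (\<Sum>j\<in>J. enn2real (\<integral>\<^sup>+ x. ennreal (\<phi> (e j x)) \<partial>L) - enn2real (\<integral>\<^sup>+ x. ennreal (- \<phi> (e j x)) \<partial>L))"
    using fpos by (simp add: s sum_subtractf)
  also have "\<dots> = (\<Sum>j\<in>J. \<integral>x. \<phi> (e j x) \<partial>L)"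
    by (intro sum.cong refl real_lebesgue_integral_def[symmetric] ij)
  finally show ?thesis .
qed

lemma mixture_mass:
  assumes p: "\<And>j. j \<in> J \<Longrightarrow> p j \<in> borel_measurable L" "\<And>j. j \<in> J \<Longrightarrow> (\<integral>\<^sup>+ x. ennreal (p j x) \<partial>L) = 1"
    and a: "\<And>j. j \<in> J \<Longrightarrow> 0 \<le> a j"
    and d: "d \<in> borel_measurable S" "\<And>j x. j \<in> J \<Longrightarrow> x \<in> space L \<Longrightarrow> d (e j x) = a j * p j x"
  shows "(\<integral>\<^sup>+ z. ennreal (d z) \<partial>S) = ennreal (\<Sum>j\<in>J. a j)"
proof -
  have "(\<integral>\<^sup>+ z. ennreal (d z) \<partial>S) = (\<Sum>j\<in>J. \<integral>\<^sup>+ x. ennreal (d (e j x)) \<partial>L)"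
    using d by (intro nn_sum) measurable
  also have "\<dots> = (\<Sum>j\<in>J. \<integral>\<^sup>+ x. ennreal (a j) * ennreal (p j x) \<partial>L)"
    using d(2) a by (intro sum.cong refl nn_integral_cong) (simp add: ennreal_mult')
  also have "\<dots> = (\<Sum>j\<in>J. ennreal (a j))"
    using p by (intro sum.cong refl) (simp add: nn_integral_cmult)
  finally show ?thesis using a by (simp add: sum_ennreal)
qed

text \<open>Under the normalised density, component j is chosen with probability proportional to
  \<open>a j\<close> and the state is drawn from the density \<open>p j\<close>. The mass of each
  component is \<open>a j\<close> because \<open>p j\<close> integrates to one.\<close>

lemma mixture_integral:
  fixes h d :: "'s \<Rightarrow> real"
  assumes p: "\<And>j. j \<in> J \<Longrightarrow> p j \<in> borel_measurable L" "\<And>j. j \<in> J \<Longrightarrow> (\<integral>\<^sup>+ x. ennreal (p j x) \<partial>L) = 1"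
    and a: "\<And>j. j \<in> J \<Longrightarrow> 0 \<le> a j" and pos: "0 < (\<Sum>j\<in>J. a j)"
    and d: "d \<in> borel_measurable S" "\<And>j x. j \<in> J \<Longrightarrow> x \<in> space L \<Longrightarrow> d (e j x) = a j * p j x" "\<And>z. z \<in> space S \<Longrightarrow> 0 \<le> d z"
    and h: "h \<in> borel_measurable S" "\<And>z. z \<in> space S \<Longrightarrow> \<bar>h z\<bar> \<le> B"
  shows "(\<integral>z. h z \<partial>normalized_density S (\<lambda>z. ennreal (d z))) = (\<Sum>j\<in>J. a j * (\<integral>x. p j x * h (e j x) \<partial>L)) / (\<Sum>j\<in>J. a j)"
proof -
  have mass: "(\<integral>\<^sup>+ z. ennreal (d z) \<partial>S) = ennreal (\<Sum>j\<in>J. a j)" using mixture_mass[OF p a d(1,2)] by simp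
  have sd: "sets (normalized_density S (\<lambda>z. ennreal (d z))) = sets S" by (simp add: normalized_density_def)
  have id: "distr (normalized_density S (\<lambda>z. ennreal (d z))) S (\<lambda>z. z) = normalized_density S (\<lambda>z. ennreal (d z))"
    by (rule distr_id2) (simp add: sd)
  have "(\<integral>z. h z \<partial>normalized_density S (\<lambda>z. ennreal (d z))) = (\<integral>z. d z * h z \<partial>S) / (\<integral>z. d z \<partial>S)"
    using integral_distr_normalized_density[OF d(1) _ h(1) d(3), where X="\<lambda>z. z"] pos mass
    by (simp add: id)
  also have "(\<integral>z. d z \<partial>S) = (\<Sum>j\<in>J. a j)"
    using pos mass d by (intro integral_eq_nn_integral[THEN trans]) auto
  also have "(\<integral>z. d z * h z \<partial>S) = (\<Sum>j\<in>J. \<integral>x. d (e j x) * h (e j x) \<partial>L)"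
  proof (rule integral_sum)
    have "integrable S d" using d mass by (intro integrableI_nonneg) auto
    then have "integrable S (\<lambda>z. B * d z)" by simp
    then show "integrable S (\<lambda>z. d z * h z)"
    proof (rule Bochner_Integration.integrable_bound)
      show "AE z in S. norm (d z * h z) \<le> norm (B * d z)"
      proof (rule AE_I2)
        fix z assume z: "z \<in> space S"
        have "\<bar>d z\<bar> * \<bar>h z\<bar> \<le> \<bar>d z\<bar> * \<bar>B\<bar>" using h(2)[OF z] by (intro mult_left_mono) auto
        then show "norm (d z * h z) \<le> norm (B * d z)" by (simp add: abs_mult mult.commute)
      qed
    qed (use d h in measurable)
  qed
  also have "\<dots> = (\<Sum>j\<in>J. a j * (\<integral>x. p j x * h (e j x) \<partial>L))"
  proof (intro sum.cong refl)
    fix j assume j: "j \<in> J"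
    have "(\<integral>x. d (e j x) * h (e j x) \<partial>L) = (\<integral>x. a j * (p j x * h (e j x)) \<partial>L)"
      using d(2)[OF j] by (intro Bochner_Integration.integral_cong) auto
    then show "(\<integral>x. d (e j x) * h (e j x) \<partial>L) = a j * (\<integral>x. p j x * h (e j x) \<partial>L)" by simp
  qed
  finally show ?thesis .
qed

end

lemma indexed_base_single:
  assumes L: "sigma_finite_measure L" and J: "finite J"
  shows "indexed_base (count_space J \<Otimes>\<^sub>M L) L J Pair"
proof
  interpret sigma_finite_measure L by (rule L)
  show "finite J" by (rule J)
  show "Pair j \<in> L \<rightarrow>\<^sub>M count_space J \<Otimes>\<^sub>M L" if "j \<in> J" for j using that by (intro measurable_Pair1') simp
  fix \<phi> :: "'b \<times> 'a \<Rightarrow> ennreal" assume \<phi>: "\<phi> \<in> borel_measurable (count_space J \<Otimes>\<^sub>M L)"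
  have "(\<integral>\<^sup>+ z. \<phi> z \<partial>(count_space J \<Otimes>\<^sub>M L)) = (\<integral>\<^sup>+ j. \<integral>\<^sup>+ x. \<phi> (j, x) \<partial>L \<partial>count_space J)"
    by (rule nn_integral_fst[symmetric, OF \<phi>])
  also have "\<dots> = (\<Sum>j\<in>J. \<integral>\<^sup>+ x. \<phi> (j, x) \<partial>L)" by (rule nn_integral_count_space_finite[OF J])
  finally show "(\<integral>\<^sup>+ z. \<phi> z \<partial>(count_space J \<Otimes>\<^sub>M L)) = (\<Sum>j\<in>J. \<integral>\<^sup>+ x. \<phi> (j, x) \<partial>L)" .
qed

lemma sigma_finite_count_pair:
  assumes L: "sigma_finite_measure L" and J: "finite J"
  shows "sigma_finite_measure (count_space J \<Otimes>\<^sub>M L)"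
  using assms by (intro sigma_finite_pair_measure sigma_finite_measure_count_space_finite)

lemma indexed_base_double:
  assumes L: "sigma_finite_measure L" and I: "finite I" and J: "finite J"
  shows "indexed_base (count_space I \<Otimes>\<^sub>M count_space J \<Otimes>\<^sub>M L) L (I \<times> J) (\<lambda>p x. (fst p, snd p, x))"
proof
  interpret A: indexed_base "count_space J \<Otimes>\<^sub>M L" L J Pair by (rule indexed_base_single[OF L J])
  interpret B: indexed_base "count_space I \<Otimes>\<^sub>M count_space J \<Otimes>\<^sub>M L" "count_space J \<Otimes>\<^sub>M L" I Pair
    by (rule indexed_base_single[OF sigma_finite_count_pair[OF L J] I])
  show "finite (I \<times> J)" using I J by simp
  show "(\<lambda>x. (fst p, snd p, x)) \<in> L \<rightarrow>\<^sub>M count_space I \<Otimes>\<^sub>M count_space J \<Otimes>\<^sub>M L" if "p \<in> I \<times> J" for p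
    using that by (intro measurable_Pair) auto
  fix \<phi> :: "'b \<times> 'c \<times> 'a \<Rightarrow> ennreal" assume \<phi>: "\<phi> \<in> borel_measurable (count_space I \<Otimes>\<^sub>M count_space J \<Otimes>\<^sub>M L)"
  have "(\<integral>\<^sup>+ z. \<phi> z \<partial>(count_space I \<Otimes>\<^sub>M count_space J \<Otimes>\<^sub>M L)) = (\<Sum>i\<in>I. \<integral>\<^sup>+ y. \<phi> (i, y) \<partial>(count_space J \<Otimes>\<^sub>M L))"
    by (rule B.nn_sum[OF \<phi>])
  also have "\<dots> = (\<Sum>i\<in>I. \<Sum>j\<in>J. \<integral>\<^sup>+ x. \<phi> (i, j, x) \<partial>L)"
    by (intro sum.cong refl A.nn_sum measurable_compose[OF B.e \<phi>])
  also have "\<dots> = (\<Sum>p\<in>I \<times> J. \<integral>\<^sup>+ x. \<phi> (fst p, snd p, x) \<partial>L)"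
    by (simp add: sum.cartesian_product case_prod_beta')
  finally show "(\<integral>\<^sup>+ z. \<phi> z \<partial>(count_space I \<Otimes>\<^sub>M count_space J \<Otimes>\<^sub>M L)) = (\<Sum>p\<in>I \<times> J. \<integral>\<^sup>+ x. \<phi> (fst p, snd p, x) \<partial>L)" .
qed

section \<open>The initial sample as a step from a one-point past, and the mixture form of a
  step\<close>

lemma cond_iid_trivial:
  assumes P: "prob_space P" and N: "1 \<le> N"
    and ind: "prob_space.indep_vars P (\<lambda>_. S) X {1..N}" and law: "\<And>l. l \<in> {1..N} \<Longrightarrow> distr P S (X l) = \<rho>"
  shows "cond_iid P (sigma (space P) {}) N S X (\<lambda>_. \<rho>)"
  unfolding cond_iid_def
proof (intro conjI ballI allI impI)
  interpret prob_space P by fact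
  have sub: "subalgebra P (sigma (space P) {})" by (simp add: subalgebra_def sigma_sets_empty_eq)
  interpret sigma_finite_subalgebra P "sigma (space P) {}"
    by (rule finite_measure_subalgebra_is_sigma_finite) (use sub in \<open>simp add: finite_measure_subalgebra_def finite_measure_axioms finite_measure_subalgebra_axioms_def\<close>)
  have rv: "X l \<in> P \<rightarrow>\<^sub>M S" if "l \<in> {1..N}" for l using ind that unfolding indep_vars_def by blast
  then show "X l \<in> P \<rightarrow>\<^sub>M S" if "l \<in> {1..N}" for l using that .
  fix B assume B: "\<forall>l\<in>{1..N}. B l \<in> sets S"
  let ?ev = "{w \<in> space P. \<forall>l\<in>{1..N}. X l w \<in> B l}"
  \<comment> \<open>For N \<ge> 1 the intersection runs over a non-empty index set and is thus
    contained in the whole space, as the product formula for independent events expects.\<close>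
  have ev: "?ev = (\<Inter>l\<in>{1..N}. X l -` B l \<inter> space P)" using N by auto
  have evm: "?ev \<in> sets P" unfolding ev using N B rv by (intro sets.finite_INT) auto
  have "prob (\<Inter>l\<in>{1..N}. X l -` B l \<inter> space P) = (\<Prod>l\<in>{1..N}. prob (X l -` B l \<inter> space P))"
    using ind N B by (intro indep_varsD) auto
  then have "emeasure P ?ev = (\<Prod>l\<in>{1..N}. emeasure P (X l -` B l \<inter> space P))"
    unfolding ev by (simp add: emeasure_eq_measure prod_ennreal)
  also have "\<dots> = (\<Prod>l\<in>{1..N}. emeasure \<rho> (B l))"
    using B law rv by (intro prod.cong refl) (metis emeasure_distr)
  finally have e: "emeasure P ?ev = (\<Prod>l\<in>{1..N}. emeasure \<rho> (B l))" .
  have "AE w in P. (\<Prod>l\<in>{1..N}. emeasure \<rho> (B l)) = nn_cond_exp P (sigma (space P) {}) (indicator ?ev) w"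
  proof (rule nn_cond_exp_charact)
    fix A assume "A \<in> sets (sigma (space P) {})"
    then have "A = {} \<or> A = space P" by (simp add: sigma_sets_empty_eq)
    then show "(\<integral>\<^sup>+ x\<in>A. indicator ?ev x \<partial>P) = (\<integral>\<^sup>+ x\<in>A. (\<Prod>l\<in>{1..N}. emeasure \<rho> (B l)) \<partial>P)"
    proof
      assume A: "A = space P"
      have "(\<integral>\<^sup>+ x\<in>A. indicator ?ev x \<partial>P) = (\<integral>\<^sup>+ x. indicator ?ev x \<partial>P)"
        unfolding A by (intro nn_integral_cong) simp
      also have "\<dots> = (\<Prod>l\<in>{1..N}. emeasure \<rho> (B l))" using evm e by (simp add: nn_integral_indicator)
      also have "\<dots> = (\<integral>\<^sup>+ x\<in>A. (\<Prod>l\<in>{1..N}. emeasure \<rho> (B l)) \<partial>P)"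
        unfolding A by (simp add: nn_integral_cmult_indicator emeasure_space_1)
      finally show ?thesis .
    qed simp
  qed (use evm in auto)
  then show "AE w in P. nn_cond_exp P (sigma (space P) {}) (indicator ?ev) w = (\<Prod>l\<in>{1..N}. emeasure \<rho> (B l))"
    by eventually_elim simp
qed

text \<open>A degenerate old sample: on a one-point space every average is exact, with zero variance
  and zero error. Drawing the initial particles becomes a selection and mutation step started from
  it.\<close>

lemma unit_emp:
  assumes P: "\<And>N. 1 \<le> N \<Longrightarrow> prob_space (P N)"
  shows "emp_clt (count_space (UNIV :: unit set)) P (\<lambda>N f w. f ()) 1 (return (count_space UNIV) ()) (\<lambda>_. 0)"
    and "emp_L1 (count_space (UNIV :: unit set)) P (\<lambda>N f w. f ()) 1 (return (count_space UNIV) ())"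
proof -
  have r: "prob_space (return (count_space (UNIV :: unit set)) ())" by (rule prob_space_return) simp
  have i: "(\<integral>x. f x \<partial>return (count_space (UNIV :: unit set)) ()) = f ()" for f :: "unit \<Rightarrow> real"
    by (subst integral_return) auto
  show "emp_clt (count_space (UNIV :: unit set)) P (\<lambda>N f w. f ()) 1 (return (count_space UNIV) ()) (\<lambda>_. 0)"
    unfolding emp_clt_def i
  proof (intro conjI r exI[of _ 1] allI impI)
    fix f :: "unit \<Rightarrow> real" and t assume f0: "f () = 0"
    have "(\<lambda>N. \<integral>w. iexp (t * (sqrt (real N) * f ())) \<partial>P N) \<longlonglongrightarrow> 1"
    proof (rule tendsto_eventually, rule eventually_sequentiallyI)
      fix N :: nat assume "1 \<le> N"
      then interpret prob_space "P N" by (rule P)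
      show "(\<integral>w. iexp (t * (sqrt (real N) * f ())) \<partial>P N) = 1" using f0 by (simp add: prob_space)
    qed
    then show "(\<lambda>N. \<integral>w. iexp (t * (sqrt (real N) * f ())) \<partial>P N) \<longlonglongrightarrow> complex_of_real (exp (- (t\<^sup>2 * 0 / 2)))" by simp
  qed (auto simp: bounded_fn_def)
  show "emp_L1 (count_space (UNIV :: unit set)) P (\<lambda>N f w. f ()) 1 (return (count_space UNIV) ())"
    unfolding emp_L1_def i
    by (intro exI[of _ 1] exI[of _ "\<lambda>_. return (count_space UNIV) ()"] conjI allI impI r) (simp_all add: i)
qed

lemma (in prob_space) expectation_sq_le:
  fixes f :: "'a \<Rightarrow> real"
  assumes "f \<in> borel_measurable M" "\<And>x. x \<in> space M \<Longrightarrow> \<bar>f x\<bar> \<le> B"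
  shows "(expectation f)\<^sup>2 \<le> expectation (\<lambda>x. (f x)\<^sup>2)"
proof -
  have "0 \<le> variance f" by (rule variance_positive)
  also have "\<dots> = expectation (\<lambda>x. (f x)\<^sup>2) - (expectation f)\<^sup>2"
    using integrable_bounded_sq[OF assms] integrable_bounded[of f B] assms by (intro variance_eq) auto
  finally show ?thesis by simp
qed

text \<open>The sampled object \<open>z \<in> S N\<close> carries the selected ancestor \<open>sel z \<in> J N\<close> and the new state \<open>X z\<close>; \<open>e N j x\<close> is the object with
  ancestor \<open>j\<close> and state \<open>x\<close>. Ancestors are single indices for the filters and pairs of indices for the two-filter sampler.\<close>

locale mixture_step =
  fixes E :: "'e measure" and M :: "'x measure" and P F :: "nat \<Rightarrow> 'w measure"
    and A :: "nat \<Rightarrow> ('e \<Rightarrow> real) \<Rightarrow> 'w \<Rightarrow> real" and c :: real and \<mu> :: "'e measure" and V :: "('e \<Rightarrow> real) \<Rightarrow> real"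
    and J :: "nat \<Rightarrow> 'j set" and v :: "nat \<Rightarrow> 'j \<Rightarrow> 'w \<Rightarrow> real" and Y :: "nat \<Rightarrow> 'j \<Rightarrow> 'w \<Rightarrow> 'e" and n :: "nat \<Rightarrow> real"
    and S :: "nat \<Rightarrow> 's measure" and e :: "nat \<Rightarrow> 'j \<Rightarrow> 'x \<Rightarrow> 's" and sel :: "'s \<Rightarrow> 'j" and X :: "'s \<Rightarrow> 'x"
    and Z :: "nat \<Rightarrow> nat \<Rightarrow> 'w \<Rightarrow> 's"
    and \<theta> :: "'e \<Rightarrow> real" and p \<omega> \<kappa> :: "'e \<Rightarrow> 'x \<Rightarrow> real" and B\<theta> CW :: real and \<mu>' :: "'x measure"
  assumes P: "\<And>N. 1 \<le> N \<Longrightarrow> prob_space (P N)"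
    and F: "\<And>N. 1 \<le> N \<Longrightarrow> subalgebra (P N) (F N)"
    and A: "emp_clt E P A c \<mu> V"
    and A_eq: "\<And>N f w. 1 \<le> N \<Longrightarrow> A N f w = (\<Sum>j\<in>J N. v N j w * f (Y N j w)) / n N"
    and n: "\<And>N. 1 \<le> N \<Longrightarrow> 0 < n N"
    and M: "sigma_finite_measure M"
    and S: "\<And>N. 1 \<le> N \<Longrightarrow> indexed_base (S N) M (J N) (e N)" "\<And>N. 1 \<le> N \<Longrightarrow> sigma_finite_measure (S N)"
      "\<And>N. 1 \<le> N \<Longrightarrow> space (S N) \<noteq> {}"
    and v: "\<And>N j. 1 \<le> N \<Longrightarrow> j \<in> J N \<Longrightarrow> v N j \<in> borel_measurable (F N)"
      "\<And>N j w. 1 \<le> N \<Longrightarrow> j \<in> J N \<Longrightarrow> w \<in> space (P N) \<Longrightarrow> 0 \<le> v N j w"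
    and Y: "\<And>N j. 1 \<le> N \<Longrightarrow> j \<in> J N \<Longrightarrow> Y N j \<in> F N \<rightarrow>\<^sub>M E"
    and sel: "\<And>N. 1 \<le> N \<Longrightarrow> sel \<in> S N \<rightarrow>\<^sub>M count_space (J N)" "\<And>N j x. sel (e N j x) = j"
    and X: "\<And>N. 1 \<le> N \<Longrightarrow> X \<in> S N \<rightarrow>\<^sub>M M" "\<And>N j x. X (e N j x) = x"
    and \<theta>: "bounded_fn E \<theta> B\<theta>" "\<And>y. y \<in> space E \<Longrightarrow> 0 \<le> \<theta> y"
    and p: "(\<lambda>z. p (fst z) (snd z)) \<in> borel_measurable (E \<Otimes>\<^sub>M M)" "\<And>y x. y \<in> space E \<Longrightarrow> x \<in> space M \<Longrightarrow> 0 \<le> p y x"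
      "\<And>y. y \<in> space E \<Longrightarrow> (\<integral>\<^sup>+ x. ennreal (p y x) \<partial>M) = 1"
    and \<omega>: "(\<lambda>z. \<omega> (fst z) (snd z)) \<in> borel_measurable (E \<Otimes>\<^sub>M M)" "\<And>y x. y \<in> space E \<Longrightarrow> x \<in> space M \<Longrightarrow> 0 \<le> \<omega> y x"
      "\<And>y x. y \<in> space E \<Longrightarrow> x \<in> space M \<Longrightarrow> \<omega> y x \<le> CW" and CW: "0 \<le> CW"
    and \<kappa>: "\<And>y x. y \<in> space E \<Longrightarrow> x \<in> space M \<Longrightarrow> \<kappa> y x = \<omega> y x * (\<theta> y * p y x)"
    and Z: "\<And>N. 1 \<le> N \<Longrightarrow> cond_iid (P N) (F N) N (S N) (Z N)
        (\<lambda>w. normalized_density (S N) (\<lambda>z. ennreal (v N (sel z) w * (\<theta> (Y N (sel z) w) * p (Y N (sel z) w) (X z)))))"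
    and pos: "\<And>N. 1 \<le> N \<Longrightarrow> AE w in P N. 0 < (\<Sum>j\<in>J N. v N j w * \<theta> (Y N j w))"
    and \<mu>': "prob_space \<mu>'" "sets \<mu>' = sets M"
    and \<kappa>pos: "0 < (\<integral>y. (\<integral>x. \<kappa> y x \<partial>M) \<partial>\<mu>)"
    and target: "\<And>f B. bounded_fn M f B \<Longrightarrow> (\<integral>x. f x \<partial>\<mu>') = (\<integral>y. (\<integral>x. \<kappa> y x * f x \<partial>M) \<partial>\<mu>) / (\<integral>y. (\<integral>x. \<kappa> y x \<partial>M) \<partial>\<mu>)"
begin

definition k :: "('x \<Rightarrow> real) \<Rightarrow> 'e \<Rightarrow> real" where
  "k f y = (\<integral>x. \<kappa> y x * f x \<partial>M)"

text \<open>The second moment of \<omega> f under \<theta> p. One of the two factors \<omega> is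
  absorbed through \<kappa> = \<omega> \<theta> p, which gives the integrand the shape it has in the
  variance recursions.\<close>

definition k2 :: "('x \<Rightarrow> real) \<Rightarrow> 'e \<Rightarrow> real" where
  "k2 f y = (\<integral>x. \<omega> y x * \<kappa> y x * (f x)\<^sup>2 \<partial>M)"

definition W :: "nat \<Rightarrow> 'w \<times> 's \<Rightarrow> real" where
  "W N z = \<omega> (Y N (sel (snd z)) (fst z)) (X (snd z))"

text \<open>The limiting average weight of the new sample: the total mass of the weighted kernel
  relative to the total selection mass.\<close>

definition c' :: real where
  "c' = (\<integral>y. (\<integral>x. \<kappa> y x \<partial>M) \<partial>\<mu>) / (\<integral>y. \<theta> y \<partial>\<mu>)"

lemma c: "0 < c" and \<mu>: "prob_space \<mu>" "sets \<mu> = sets E"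
  using A by (simp_all add: emp_clt_def)

lemma AF:
  assumes N: "1 \<le> N" and f: "bounded_fn E f B"
  shows "A N f \<in> borel_measurable (F N)"
proof -
  have "A N f = (\<lambda>w. (\<Sum>j\<in>J N. v N j w * f (Y N j w)) / n N)" by (rule ext) (rule A_eq[OF N])
  then show ?thesis
    by (simp only:) (intro borel_measurable_divide borel_measurable_sum borel_measurable_times borel_measurable_const v(1)[OF N]
        measurable_compose[OF Y[OF N] bounded_fnD(1)[OF f]])
qed

lemma space_\<mu>: "space \<mu> = space E" using sets_eq_imp_space_eq[OF \<mu>(2)] .

lemma spaceF: "1 \<le> N \<Longrightarrow> space (F N) = space (P N)" using F by (simp add: subalgebra_def)

lemma kernel_bounded:
  assumes h: "(\<lambda>z. h (fst z) (snd z)) \<in> borel_measurable (E \<Otimes>\<^sub>M M)"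
    and hB: "\<And>y x. y \<in> space E \<Longrightarrow> x \<in> space M \<Longrightarrow> \<bar>h y x\<bar> \<le> C" and C: "0 \<le> C"
  shows "bounded_fn E (\<lambda>y. \<integral>x. \<theta> y * p y x * h y x \<partial>M) (B\<theta> * C)"
    and "\<And>y. y \<in> space E \<Longrightarrow> integrable M (\<lambda>x. p y x * h y x)"
    and "\<And>y. y \<in> space E \<Longrightarrow> \<bar>\<integral>x. p y x * h y x \<partial>M\<bar> \<le> C"
proof -
  interpret M: sigma_finite_measure M by (rule M)
  have py: "p y \<in> borel_measurable M" and hy: "h y \<in> borel_measurable M" if "y \<in> space E" for y
    using measurable_compose[OF measurable_Pair1'[OF that] p(1)] measurable_compose[OF measurable_Pair1'[OF that] h] by simp_all
  have ip: "integrable M (p y)" and Ip: "(\<integral>x. p y x \<partial>M) = 1" if y: "y \<in> space E" for y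
  proof -
    show "integrable M (p y)" using py[OF y] p(2)[OF y] p(3)[OF y] by (intro integrableI_nonneg) auto
    show "(\<integral>x. p y x \<partial>M) = 1" using py[OF y] p(2)[OF y] p(3)[OF y] by (subst integral_eq_nn_integral) auto
  qed
  show i: "integrable M (\<lambda>x. p y x * h y x)" if y: "y \<in> space E" for y
  proof (rule Bochner_Integration.integrable_bound)
    show "integrable M (\<lambda>x. C * p y x)" using ip[OF y] by simp
    show "AE x in M. norm (p y x * h y x) \<le> norm (C * p y x)"
    proof (rule AE_I2)
      fix x assume x: "x \<in> space M"
      have "\<bar>p y x\<bar> * \<bar>h y x\<bar> \<le> \<bar>p y x\<bar> * C" using hB[OF y x] by (intro mult_left_mono) auto
      then show "norm (p y x * h y x) \<le> norm (C * p y x)" using C by (simp add: abs_mult mult.commute)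
    qed
  qed (use py[OF y] hy[OF y] in measurable)
  show b: "\<bar>\<integral>x. p y x * h y x \<partial>M\<bar> \<le> C" if y: "y \<in> space E" for y
  proof -
    have "\<bar>\<integral>x. p y x * h y x \<partial>M\<bar> \<le> (\<integral>x. \<bar>p y x * h y x\<bar> \<partial>M)" using integral_norm_bound[of M "\<lambda>x. p y x * h y x"] by simp
    also have "\<dots> \<le> (\<integral>x. C * p y x \<partial>M)"
    proof (rule integral_mono)
      show "\<bar>p y x * h y x\<bar> \<le> C * p y x" if x: "x \<in> space M" for x
        using hB[OF y x] p(2)[OF y x] by (simp add: abs_mult mult.commute[of C] mult_left_mono)
    qed (use i[OF y] ip[OF y] in auto)
    also have "\<dots> = C" using Ip[OF y] by simp
    finally show ?thesis .
  qed
  show "bounded_fn E (\<lambda>y. \<integral>x. \<theta> y * p y x * h y x \<partial>M) (B\<theta> * C)"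
    unfolding bounded_fn_def
  proof (intro conjI ballI)
    have "(\<lambda>z. \<theta> (fst z) * p (fst z) (snd z) * h (fst z) (snd z)) \<in> borel_measurable (E \<Otimes>\<^sub>M M)"
      using p(1) h measurable_compose[OF measurable_fst bounded_fnD(1)[OF \<theta>(1)]] by measurable
    then have "case_prod (\<lambda>y x. \<theta> y * p y x * h y x) \<in> borel_measurable (E \<Otimes>\<^sub>M M)" by (simp add: case_prod_beta')
    then show "(\<lambda>y. \<integral>x. \<theta> y * p y x * h y x \<partial>M) \<in> borel_measurable E" by (rule M.borel_measurable_lebesgue_integral)
    show "0 \<le> B\<theta> * C" using bounded_fnD(2)[OF \<theta>(1)] C by simp
    fix y assume y: "y \<in> space E"
    have "(\<integral>x. \<theta> y * p y x * h y x \<partial>M) = \<theta> y * (\<integral>x. p y x * h y x \<partial>M)" by (simp add: mult.assoc)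
    then show "\<bar>\<integral>x. \<theta> y * p y x * h y x \<partial>M\<bar> \<le> B\<theta> * C"
      using b[OF y] bounded_fnD(2,3)[OF \<theta>(1)] y by (simp add: abs_mult mult_mono)
  qed
qed

lemma f_snd: "bounded_fn M f B \<Longrightarrow> (\<lambda>z. f (snd z)) \<in> borel_measurable (E \<Otimes>\<^sub>M M)"
  by (rule measurable_compose[OF measurable_snd bounded_fnD(1)])

lemma k_eq: "y \<in> space E \<Longrightarrow> k f y = (\<integral>x. \<theta> y * p y x * (\<omega> y x * f x) \<partial>M)"
  unfolding k_def by (intro Bochner_Integration.integral_cong refl) (simp add: \<kappa> mult_ac)

lemma k2_eq: "y \<in> space E \<Longrightarrow> k2 f y = (\<integral>x. \<theta> y * p y x * (\<omega> y x * f x)\<^sup>2 \<partial>M)"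
  unfolding k2_def by (intro Bochner_Integration.integral_cong refl) (simp add: \<kappa> mult_ac power2_eq_square)

lemma weight_bound:
  assumes f: "bounded_fn M f B" and "y \<in> space E" "x \<in> space M"
  shows "\<bar>\<omega> y x * f x\<bar> \<le> CW * B" "\<bar>(\<omega> y x * f x)\<^sup>2\<bar> \<le> (CW * B)\<^sup>2"
proof -
  show *: "\<bar>\<omega> y x * f x\<bar> \<le> CW * B"
    unfolding abs_mult using bounded_fnD[OF f] \<omega>(2,3)[OF assms(2,3)] assms(3) CW by (intro mult_mono) auto
  show "\<bar>(\<omega> y x * f x)\<^sup>2\<bar> \<le> (CW * B)\<^sup>2" using power_mono[OF * abs_ge_zero, of 2] by simp
qed

lemma bounded_fn_cong: "(\<And>y. y \<in> space E \<Longrightarrow> f y = f' y) \<Longrightarrow> bounded_fn E f C \<longleftrightarrow> bounded_fn E f' C"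
  unfolding bounded_fn_def by (simp cong: measurable_cong)

lemma CWB: "bounded_fn M f B \<Longrightarrow> 0 \<le> CW * B" using CW bounded_fnD(2) by fastforce

lemma weight_measurable: "bounded_fn M f B \<Longrightarrow> (\<lambda>z. \<omega> (fst z) (snd z) * f (snd z)) \<in> borel_measurable (E \<Otimes>\<^sub>M M)"
  using \<omega>(1) f_snd by measurable

lemma weight2_measurable: "bounded_fn M f B \<Longrightarrow> (\<lambda>z. (\<omega> (fst z) (snd z) * f (snd z))\<^sup>2) \<in> borel_measurable (E \<Otimes>\<^sub>M M)"
  using weight_measurable by (intro borel_measurable_power) auto

lemma k_bounded:
  assumes f: "bounded_fn M f B"
  shows "bounded_fn E (k f) (B\<theta> * (CW * B))"
proof -
  have "bounded_fn E (\<lambda>y. \<integral>x. \<theta> y * p y x * (\<omega> y x * f x) \<partial>M) (B\<theta> * (CW * B))"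
    by (rule kernel_bounded(1)[where h="\<lambda>y x. \<omega> y x * f x", OF weight_measurable[OF f] weight_bound(1)[OF f] CWB[OF f]])
  then show ?thesis by (rule iffD2[OF bounded_fn_cong, rotated]) (rule k_eq)
qed

lemma k2_bounded:
  assumes f: "bounded_fn M f B"
  shows "bounded_fn E (k2 f) (B\<theta> * ((CW * B)\<^sup>2))"
proof -
  have "bounded_fn E (\<lambda>y. \<integral>x. \<theta> y * p y x * ((\<omega> y x * f x)\<^sup>2) \<partial>M) (B\<theta> * ((CW * B)\<^sup>2))"
    by (rule kernel_bounded(1)[where h="\<lambda>y x. (\<omega> y x * f x)\<^sup>2", OF weight2_measurable[OF f] weight_bound(2)[OF f] zero_le_power2])
  then show ?thesis by (rule iffD2[OF bounded_fn_cong, rotated]) (rule k2_eq)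
qed

lemma k2_nonneg: "y \<in> space E \<Longrightarrow> 0 \<le> k2 f y"
  unfolding k2_eq using \<theta>(2) p(2) by (intro Bochner_Integration.integral_nonneg mult_nonneg_nonneg) auto

text \<open>Positivity is inherited from the target: the mass of \<kappa> is positive, and \<kappa>
  = \<omega> \<theta> p with \<omega> at most CW and p of mass one, so it is at most CW times the
  integral of \<theta>.\<close>

lemma \<theta>pos: "0 < (\<integral>y. \<theta> y \<partial>\<mu>)"
proof -
  interpret \<mu>: prob_space \<mu> by (rule \<mu>)
  have one: "bounded_fn M (\<lambda>_. 1) 1" by (simp add: bounded_fn_def)
  have i\<theta>: "integrable \<mu> \<theta>"
    using bounded_fnD[OF \<theta>(1)] by (intro \<mu>.integrable_bounded[of _ B\<theta>]) (auto simp: space_\<mu> measurable_cong_sets[OF \<mu>(2) refl])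
  have ik: "integrable \<mu> (k (\<lambda>_. 1))"
    using bounded_fnD[OF k_bounded[OF one]] by (intro \<mu>.integrable_bounded) (auto simp: space_\<mu> measurable_cong_sets[OF \<mu>(2) refl])
  have "(\<integral>y. k (\<lambda>_. 1) y \<partial>\<mu>) \<le> (\<integral>y. CW * \<theta> y \<partial>\<mu>)"
  proof (rule integral_mono[OF ik])
    show "integrable \<mu> (\<lambda>y. CW * \<theta> y)" using i\<theta> by simp
    fix y assume "y \<in> space \<mu>" then have y: "y \<in> space E" by (simp add: space_\<mu>)
    have "k (\<lambda>_. 1) y = \<theta> y * (\<integral>x. p y x * (\<omega> y x * 1) \<partial>M)" unfolding k_eq[OF y] by (simp add: mult.assoc)
    also have "\<dots> \<le> \<theta> y * CW"
      using kernel_bounded(3)[where h="\<lambda>y x. \<omega> y x * 1", OF weight_measurable[OF one] weight_bound(1)[OF one] CWB[OF one] y] \<theta>(2)[OF y] by (intro mult_left_mono) auto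
    finally show "k (\<lambda>_. 1) y \<le> CW * \<theta> y" by (simp add: mult.commute)
  qed
  then have "0 < CW * (\<integral>y. \<theta> y \<partial>\<mu>)" using \<kappa>pos by (simp add: k_def)
  then show ?thesis using CW by (simp add: zero_less_mult_iff)
qed

lemma W_measurable:
  assumes N: "1 \<le> N"
  shows "W N \<in> borel_measurable (F N \<Otimes>\<^sub>M S N)"
proof -
  have "(\<lambda>z. \<omega> (Y N j (fst z)) (X (snd z))) \<in> borel_measurable (F N \<Otimes>\<^sub>M S N)" if j: "j \<in> J N" for j
    using measurable_compose[OF measurable_Pair[OF measurable_compose[OF measurable_fst Y[OF N j]] measurable_compose[OF measurable_snd X(1)[OF N]]] \<omega>(1)] by simp
  \<comment> \<open>The selected ancestor has a random index. On each of its finitely many values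
    the weight is measurable, and the pieces are glued.\<close>
  from measurable_compose_countable'[where f="\<lambda>j z. \<omega> (Y N j (fst z)) (X (snd z))", OF this
      measurable_compose[OF measurable_snd sel(1)[OF N]] countable_finite[OF indexed_base.J[OF S(1)[OF N]]]]
  show ?thesis by (simp only: W_def[abs_def])
qed

lemma sel_space: "1 \<le> N \<Longrightarrow> z \<in> space (S N) \<Longrightarrow> sel z \<in> J N"
  using measurable_space[OF sel(1)] by fastforce

lemma Y_space: "1 \<le> N \<Longrightarrow> j \<in> J N \<Longrightarrow> w \<in> space (P N) \<Longrightarrow> Y N j w \<in> space E"
  using measurable_space[OF Y] spaceF by blast

lemma W_bound:
  assumes "1 \<le> N" "x \<in> space (F N \<Otimes>\<^sub>M S N)"
  shows "\<bar>W N x\<bar> \<le> CW"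
proof -
  obtain w z where x: "x = (w, z)" "w \<in> space (P N)" "z \<in> space (S N)"
    using assms spaceF by (auto simp: space_pair_measure)
  show ?thesis using \<omega>(2,3)[OF Y_space[OF assms(1) sel_space[OF assms(1) x(3)] x(2)] measurable_space[OF X(1)[OF assms(1)] x(3)]]
    by (simp add: W_def x)
qed

definition d :: "nat \<Rightarrow> 'w \<times> 's \<Rightarrow> real" where
  "d N x = v N (sel (snd x)) (fst x) * (\<theta> (Y N (sel (snd x)) (fst x)) * p (Y N (sel (snd x)) (fst x)) (X (snd x)))"

lemma d_measurable:
  assumes N: "1 \<le> N"
  shows "d N \<in> borel_measurable (F N \<Otimes>\<^sub>M S N)"
proof -
  have "(\<lambda>z. v N j (fst z) * (\<theta> (Y N j (fst z)) * p (Y N j (fst z)) (X (snd z)))) \<in> borel_measurable (F N \<Otimes>\<^sub>M S N)" if j: "j \<in> J N" for j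
  proof -
    have "(\<lambda>z. p (Y N j (fst z)) (X (snd z))) \<in> borel_measurable (F N \<Otimes>\<^sub>M S N)"
      using measurable_compose[OF measurable_Pair[OF measurable_compose[OF measurable_fst Y[OF N j]] measurable_compose[OF measurable_snd X(1)[OF N]]] p(1)] by simp
    then show ?thesis
      by (intro borel_measurable_times measurable_compose[OF measurable_fst v(1)[OF N j]]
          measurable_compose[OF measurable_compose[OF measurable_fst Y[OF N j]] bounded_fnD(1)[OF \<theta>(1)]])
  qed
  from measurable_compose_countable'[where f="\<lambda>j z. v N j (fst z) * (\<theta> (Y N j (fst z)) * p (Y N j (fst z)) (X (snd z)))", OF this
      measurable_compose[OF measurable_snd sel(1)[OF N]] countable_finite[OF indexed_base.J[OF S(1)[OF N]]]]
  show ?thesis by (simp only: d_def[abs_def])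
qed

lemma d_nonneg: "1 \<le> N \<Longrightarrow> w \<in> space (P N) \<Longrightarrow> z \<in> space (S N) \<Longrightarrow> 0 \<le> d N (w, z)"
  unfolding d_def using sel_space v(2) Y_space \<theta>(2) p(2) measurable_space[OF X(1)]
  by (auto intro!: mult_nonneg_nonneg)

lemma d_section:
  assumes N: "1 \<le> N" and w: "w \<in> space (P N)"
  shows "(\<lambda>z. d N (w, z)) \<in> borel_measurable (S N)"
  using measurable_compose[OF measurable_Pair1' d_measurable[OF N], of w] w spaceF[OF N] by simp

lemma p_section: "y \<in> space E \<Longrightarrow> p y \<in> borel_measurable M"
  using measurable_compose[OF measurable_Pair1' p(1), of y] by simp

lemma d_mass:
  assumes N: "1 \<le> N" and w: "w \<in> space (P N)"
  shows "(\<integral>\<^sup>+ z. ennreal (d N (w, z)) \<partial>S N) = ennreal (\<Sum>j\<in>J N. v N j w * \<theta> (Y N j w))"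
proof -
  interpret indexed_base "S N" M "J N" "e N" by (rule S(1)[OF N])
  show ?thesis
  proof (rule mixture_mass[where p="\<lambda>j. p (Y N j w)"])
    show "p (Y N j w) \<in> borel_measurable M" "(\<integral>\<^sup>+ x. ennreal (p (Y N j w) x) \<partial>M) = 1" if "j \<in> J N" for j
      using p_section p(3) Y_space[OF N that w] by auto
    show "0 \<le> v N j w * \<theta> (Y N j w)" if "j \<in> J N" for j using v(2)[OF N that w] \<theta>(2)[OF Y_space[OF N that w]] by simp
    show "(\<lambda>z. d N (w, z)) \<in> borel_measurable (S N)" by (rule d_section[OF N w])
    show "d N (w, e N j x) = v N j w * \<theta> (Y N j w) * p (Y N j w) x" for j x
      by (simp add: d_def sel(2) X(2) mult.assoc)
  qed
qed

lemma kernel_exists: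
  assumes N: "1 \<le> N"
  shows "\<exists>K. K \<in> F N \<rightarrow>\<^sub>M prob_algebra (S N) \<and> cond_iid (P N) (F N) N (S N) (Z N) K \<and>
    (AE w in P N. K w = normalized_density (S N) (\<lambda>z. ennreal (d N (w, z))))"
proof (rule normalized_density_version[OF S(2)[OF N] S(3)[OF N] F[OF N], where d="\<lambda>x. ennreal (d N x)"])
  show "(\<lambda>x. ennreal (d N x)) \<in> borel_measurable (F N \<Otimes>\<^sub>M S N)" using d_measurable[OF N] by measurable
  show "AE w in P N. 0 < (\<integral>\<^sup>+ z. ennreal (d N (w, z)) \<partial>S N) \<and> (\<integral>\<^sup>+ z. ennreal (d N (w, z)) \<partial>S N) < \<infinity>"
    using pos[OF N] AE_space by eventually_elim (simp add: d_mass[OF N])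
  show "cond_iid (P N) (F N) N (S N) (Z N) (\<lambda>w. normalized_density (S N) (\<lambda>z. ennreal (d N (w, z))))"
    using Z[OF N] by (simp add: d_def)
qed

text \<open>A choice, for every N at once, of a Markov kernel agreeing almost everywhere with the
  prescribed sampling law.\<close>

definition K :: "nat \<Rightarrow> 'w \<Rightarrow> 's measure" where
  "K N = (SOME K. K \<in> F N \<rightarrow>\<^sub>M prob_algebra (S N) \<and> cond_iid (P N) (F N) N (S N) (Z N) K \<and>
    (AE w in P N. K w = normalized_density (S N) (\<lambda>z. ennreal (d N (w, z)))))"

lemma K:
  assumes N: "1 \<le> N"
  shows "K N \<in> F N \<rightarrow>\<^sub>M prob_algebra (S N)" "cond_iid (P N) (F N) N (S N) (Z N) (K N)"
    "AE w in P N. K N w = normalized_density (S N) (\<lambda>z. ennreal (d N (w, z)))"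
  using someI_ex[OF kernel_exists[OF N]] unfolding K_def by blast+

text \<open>Selection picks j with probability proportional to v \<theta> and mutation draws from p,
  so the conditional integral is a ratio of sums over the old sample. The normalisation n N cancels,
  which is why both single samples and pairs fit the same scheme.\<close>

lemma mean_general:
  assumes N: "1 \<le> N" and h: "(\<lambda>z. h (fst z) (snd z)) \<in> borel_measurable (E \<Otimes>\<^sub>M M)"
    and hB: "\<And>y x. y \<in> space E \<Longrightarrow> x \<in> space M \<Longrightarrow> \<bar>h y x\<bar> \<le> C"
  shows "AE w in P N. (\<integral>z. h (Y N (sel z) w) (X z) \<partial>K N w) = A N (\<lambda>y. \<integral>x. \<theta> y * p y x * h y x \<partial>M) w / A N \<theta> w"
  using K(3)[OF N] pos[OF N] AE_space
proof eventually_elim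
  case (elim w)
  then have w: "w \<in> space (P N)" by simp
  interpret indexed_base "S N" M "J N" "e N" by (rule S(1)[OF N])
  have hm: "(\<lambda>z. h (Y N (sel z) w) (X z)) \<in> borel_measurable (S N)"
  proof -
    have "(\<lambda>z. h (Y N j w) (X z)) \<in> borel_measurable (S N)" if "j \<in> J N" for j
      using measurable_compose[OF measurable_compose[OF X(1)[OF N] measurable_Pair1'[OF Y_space[OF N that w]]] h] by simp
    from measurable_compose_countable'[where f="\<lambda>j z. h (Y N j w) (X z)", OF this sel(1)[OF N] countable_finite[OF J]]
    show ?thesis .
  qed
  have "(\<integral>z. h (Y N (sel z) w) (X z) \<partial>K N w) = (\<Sum>j\<in>J N. v N j w * \<theta> (Y N j w) * (\<integral>x. p (Y N j w) x * h (Y N (sel (e N j x)) w) (X (e N j x)) \<partial>M)) / (\<Sum>j\<in>J N. v N j w * \<theta> (Y N j w))"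
    unfolding elim(1)
  proof (rule mixture_integral[where p="\<lambda>j. p (Y N j w)"])
    show "p (Y N j w) \<in> borel_measurable M" "(\<integral>\<^sup>+ x. ennreal (p (Y N j w) x) \<partial>M) = 1" if "j \<in> J N" for j
      using p_section p(3) Y_space[OF N that w] by auto
    show "0 \<le> v N j w * \<theta> (Y N j w)" if "j \<in> J N" for j using v(2)[OF N that w] \<theta>(2)[OF Y_space[OF N that w]] by simp
    show "(\<lambda>z. d N (w, z)) \<in> borel_measurable (S N)" by (rule d_section[OF N w])
    show "d N (w, e N j x) = v N j w * \<theta> (Y N j w) * p (Y N j w) x" for j x
      by (simp add: d_def sel(2) X(2) mult.assoc)
    show "0 < (\<Sum>j\<in>J N. v N j w * \<theta> (Y N j w))" by fact
    show "0 \<le> d N (w, z)" if "z \<in> space (S N)" for z by (rule d_nonneg[OF N w that])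
    show "(\<lambda>z. h (Y N (sel z) w) (X z)) \<in> borel_measurable (S N)" by (rule hm)
    show "\<bar>h (Y N (sel z) w) (X z)\<bar> \<le> C" if "z \<in> space (S N)" for z
      by (rule hB[OF Y_space[OF N sel_space[OF N that] w] measurable_space[OF X(1)[OF N] that]])
  qed
  also have "\<dots> = (\<Sum>j\<in>J N. v N j w * (\<integral>x. \<theta> (Y N j w) * p (Y N j w) x * h (Y N j w) x \<partial>M)) / (\<Sum>j\<in>J N. v N j w * \<theta> (Y N j w))"
    by (simp add: sel(2) X(2) mult.assoc)
  also have "\<dots> = A N (\<lambda>y. \<integral>x. \<theta> y * p y x * h y x \<partial>M) w / A N \<theta> w"
    unfolding A_eq[OF N] using n[OF N] by simp
  finally show ?case .
qed

lemma A_cong: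
  assumes "1 \<le> N" "w \<in> space (P N)" "\<And>y. y \<in> space E \<Longrightarrow> f y = f' y"
  shows "A N f w = A N f' w"
  unfolding A_eq[OF assms(1)] using assms Y_space by (intro arg_cong2[where f="(/)"] sum.cong refl) auto

text \<open>The maximum in the last parameter reconciles two bounds: \<open>k f\<close> scales with
  B\<theta> CW and \<open>k2 f\<close> with B\<theta> CW^2, whereas the abstract step uses one
  constant for both.\<close>

sublocale step: resampling_step E M P F A c \<mu> V S Z K W "\<lambda>_. X" \<theta> k k2 c' \<mu>' CW B\<theta> "max (B\<theta> * CW) (B\<theta> * CW\<^sup>2)"
proof (rule resampling_step.intro)
  show "prob_space (P N)" "subalgebra (P N) (F N)" "cond_iid (P N) (F N) N (S N) (Z N) (K N)"
    "K N \<in> F N \<rightarrow>\<^sub>M prob_algebra (S N)" "W N \<in> borel_measurable (F N \<Otimes>\<^sub>M S N)" "X \<in> S N \<rightarrow>\<^sub>M M" if "1 \<le> N" for N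
    using P[OF that] F[OF that] K[OF that] W_measurable[OF that] X(1)[OF that] by auto
  show "emp_clt E P A c \<mu> V" "0 \<le> CW" "bounded_fn E \<theta> B\<theta>" "0 < (\<integral>x. \<theta> x \<partial>\<mu>)" "prob_space \<mu>'" "sets \<mu>' = sets M"
    by (rule A CW \<theta>(1) \<theta>pos \<mu>')+
  show "A N f \<in> borel_measurable (F N)" if "1 \<le> N" "bounded_fn E f B" for N f B by (rule AF[OF that])
  show "\<bar>W N x\<bar> \<le> CW" if "1 \<le> N" "x \<in> space (F N \<Otimes>\<^sub>M S N)" for N x by (rule W_bound[OF that])
  have mono: "bounded_fn L f C \<Longrightarrow> C \<le> C' \<Longrightarrow> bounded_fn L f C'" for L :: "'e measure" and f C C'
    unfolding bounded_fn_def by force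
  show "bounded_fn E (k f) (max (B\<theta> * CW) (B\<theta> * CW\<^sup>2) * B)" if f: "bounded_fn M f B" for f B
    by (rule mono[OF k_bounded[OF f]]) (use bounded_fnD(2)[OF f] in \<open>simp add: mult.assoc[symmetric] mult_right_mono\<close>)
  show "bounded_fn E (k2 f) (max (B\<theta> * CW) (B\<theta> * CW\<^sup>2) * B\<^sup>2)" if f: "bounded_fn M f B" for f B
    by (rule mono[OF k2_bounded[OF f]]) (simp add: power_mult_distrib mult.assoc[symmetric] mult_right_mono)
  show "0 \<le> k2 f y" if "y \<in> space E" for f y by (rule k2_nonneg[OF that])
  show "AE w in P N. 0 < A N \<theta> w" if N: "1 \<le> N" for N
    using pos[OF N] by eventually_elim (use n[OF N] in \<open>simp add: A_eq[OF N]\<close>)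
  show "AE w in P N. (\<integral>z. W N (w, z) * f (X z) \<partial>K N w) = A N (k f) w / A N \<theta> w"
    if N: "1 \<le> N" and f: "bounded_fn M f B" for N f B
  proof -
    have "AE w in P N. (\<integral>z. \<omega> (Y N (sel z) w) (X z) * f (X z) \<partial>K N w) = A N (\<lambda>y. \<integral>x. \<theta> y * p y x * (\<omega> y x * f x) \<partial>M) w / A N \<theta> w"
      by (rule mean_general[where h="\<lambda>y x. \<omega> y x * f x", OF N weight_measurable[OF f] weight_bound(1)[OF f]])
    with AE_space show ?thesis
      by eventually_elim (simp add: W_def A_cong[OF N _ k_eq])
  qed
  show "AE w in P N. (\<integral>z. (W N (w, z) * f (X z))\<^sup>2 \<partial>K N w) = A N (k2 f) w / A N \<theta> w"
    if N: "1 \<le> N" and f: "bounded_fn M f B" for N f B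
  proof -
    have "AE w in P N. (\<integral>z. (\<omega> (Y N (sel z) w) (X z) * f (X z))\<^sup>2 \<partial>K N w) = A N (\<lambda>y. \<integral>x. \<theta> y * p y x * ((\<omega> y x * f x)\<^sup>2) \<partial>M) w / A N \<theta> w"
      by (rule mean_general[where h="\<lambda>y x. (\<omega> y x * f x)\<^sup>2", OF N weight2_measurable[OF f] weight_bound(2)[OF f]])
    with AE_space show ?thesis
      by eventually_elim (simp add: W_def A_cong[OF N _ k2_eq])
  qed
  show "0 < c'" using \<kappa>pos \<theta>pos by (simp add: c'_def)
  show "c' * (\<integral>x. f x \<partial>\<mu>') = (\<integral>y. k f y \<partial>\<mu>) / (\<integral>y. \<theta> y \<partial>\<mu>)" if "bounded_fn M f B" for f B
    using target[OF that] \<kappa>pos by (simp add: c'_def k_def)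
qed

end

lemma emp_clt_cong:
  assumes "emp_clt L P A c \<mu> V" "A = A'" "\<And>f B. bounded_fn L f B \<Longrightarrow> V f = V' f"
  shows "emp_clt L P A' c \<mu> V'"
  using assms unfolding emp_clt_def by simp

text \<open>With a one-point past, \<open>k f\<close> and \<open>k2 f\<close> are constants and
  \<theta> = 1. The inherited variance is zero, so only the sampling noise, the integral of
  (\<omega> f)^2 under the initial proposal, remains. This is the starting value of the recursion
  before division by the squared mean weight.\<close>

lemma initial_step:
  fixes \<omega> :: "'x \<Rightarrow> real"
  assumes P: "\<And>N. 1 \<le> N \<Longrightarrow> prob_space (P N)" and \<rho>: "prob_space \<rho>" "sets \<rho> = sets M"
    and ind: "\<And>N. 1 \<le> N \<Longrightarrow> prob_space.indep_vars (P N) (\<lambda>_. M) (\<xi> N) {1..N}"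
    and law: "\<And>N l. 1 \<le> N \<Longrightarrow> l \<in> {1..N} \<Longrightarrow> distr (P N) M (\<xi> N l) = \<rho>"
    and \<omega>: "bounded_fn M \<omega> C" "\<And>x. x \<in> space M \<Longrightarrow> 0 \<le> \<omega> x" and pos: "0 < (\<integral>x. \<omega> x \<partial>\<rho>)"
    and \<mu>': "prob_space \<mu>'" "sets \<mu>' = sets M"
    and target: "\<And>f B. bounded_fn M f B \<Longrightarrow> (\<integral>x. f x \<partial>\<mu>') = (\<integral>x. \<omega> x * f x \<partial>\<rho>) / (\<integral>x. \<omega> x \<partial>\<rho>)"
  shows "emp_clt M P (\<lambda>N f w. (\<Sum>l\<in>{1..N}. \<omega> (\<xi> N l w) * f (\<xi> N l w)) / real N) (\<integral>x. \<omega> x \<partial>\<rho>) \<mu>' (\<lambda>f. \<integral>x. (\<omega> x)\<^sup>2 * (f x)\<^sup>2 \<partial>\<rho>)"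
    and "emp_L1 M P (\<lambda>N f w. (\<Sum>l\<in>{1..N}. \<omega> (\<xi> N l w) * f (\<xi> N l w)) / real N) (\<integral>x. \<omega> x \<partial>\<rho>) \<mu>'"
proof -
  interpret \<rho>: prob_space \<rho> by (rule \<rho>)
  have sp\<rho>: "space \<rho> = space M" using sets_eq_imp_space_eq[OF \<rho>(2)] .
  have C: "0 \<le> C" using bounded_fnD(2)[OF \<omega>(1)] .
  let ?U = "count_space (UNIV :: unit set)"
  have fm: "(\<lambda>x. \<omega> x * f x) \<in> borel_measurable \<rho>" and fb: "\<bar>\<omega> x * f x\<bar> \<le> C * B" if "bounded_fn M f B" "x \<in> space M" for f B x
  proof -
    show "(\<lambda>x. \<omega> x * f x) \<in> borel_measurable \<rho>"
      unfolding measurable_cong_sets[OF \<rho>(2) refl] using bounded_fnD(1)[OF \<omega>(1)] bounded_fnD(1)[OF that(1)] by measurable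
    show "\<bar>\<omega> x * f x\<bar> \<le> C * B"
      unfolding abs_mult using bounded_fnD[OF \<omega>(1)] bounded_fnD[OF that(1)] that(2) by (intro mult_mono) auto
  qed
  have M_ne: "space M \<noteq> {}" using \<rho>.not_empty sp\<rho> by simp
  have fm': "(\<lambda>x. \<omega> x * f x) \<in> borel_measurable \<rho>" if "bounded_fn M f B" for f B
    using fm[OF that] M_ne by auto
  have kb: "\<bar>\<integral>x. \<omega> x * f x \<partial>\<rho>\<bar> \<le> C * B" and k2b: "\<bar>\<integral>x. (\<omega> x * f x)\<^sup>2 \<partial>\<rho>\<bar> \<le> (C * B)\<^sup>2" if f: "bounded_fn M f B" for f B
  proof -
    have i: "integrable \<rho> (\<lambda>x. \<omega> x * f x)"
      using fb[OF f] by (intro \<rho>.integrable_bounded[OF fm'[OF f], of "C * B"]) (auto simp: sp\<rho>)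
    have "\<bar>\<integral>x. \<omega> x * f x \<partial>\<rho>\<bar> \<le> (\<integral>x. \<bar>\<omega> x * f x\<bar> \<partial>\<rho>)" using integral_norm_bound[of \<rho> "\<lambda>x. \<omega> x * f x"] by simp
    also have "\<dots> \<le> C * B" using i fb[OF f] by (intro \<rho>.integral_le_const) (auto simp: sp\<rho>)
    finally show "\<bar>\<integral>x. \<omega> x * f x \<partial>\<rho>\<bar> \<le> C * B" .
    have "integrable \<rho> (\<lambda>x. (\<omega> x * f x)\<^sup>2)"
      using fb[OF f] by (intro \<rho>.integrable_bounded_sq[OF fm'[OF f], of "C * B"]) (auto simp: sp\<rho>)
    moreover have "(\<omega> x * f x)\<^sup>2 \<le> (C * B)\<^sup>2" if "x \<in> space M" for x
      using power_mono[OF fb[OF f that] abs_ge_zero, of 2] by simp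
    ultimately have "(\<integral>x. (\<omega> x * f x)\<^sup>2 \<partial>\<rho>) \<le> (C * B)\<^sup>2" by (intro \<rho>.integral_le_const) (auto simp: sp\<rho>)
    then show "\<bar>\<integral>x. (\<omega> x * f x)\<^sup>2 \<partial>\<rho>\<bar> \<le> (C * B)\<^sup>2" by simp
  qed
  interpret ret: prob_space "return ?U ()" by (rule prob_space_return) simp
  have ret1: "measure (return ?U ()) UNIV = 1" using ret.prob_space by simp
  interpret st: resampling_step ?U M P "\<lambda>N. sigma (space (P N)) {}" "\<lambda>N f w. f ()" 1 "return ?U ()" "\<lambda>_. 0" "\<lambda>_. M" \<xi> "\<lambda>N w. \<rho>"
    "\<lambda>N z. \<omega> (snd z)" "\<lambda>N x. x" "\<lambda>_. 1" "\<lambda>f _. \<integral>x. \<omega> x * f x \<partial>\<rho>" "\<lambda>f _. \<integral>x. (\<omega> x * f x)\<^sup>2 \<partial>\<rho>" "\<integral>x. \<omega> x \<partial>\<rho>" \<mu>' C 1 "max C (C\<^sup>2)"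
  proof (rule resampling_step.intro)
    show "prob_space (P N)" if "1 \<le> N" for N by (rule P[OF that])
    show "subalgebra (P N) (sigma (space (P N)) {})" for N by (simp add: subalgebra_def sigma_sets_empty_eq)
    show "emp_clt ?U P (\<lambda>N f w. f ()) 1 (return ?U ()) (\<lambda>_. 0)" by (rule unit_emp(1)[OF P])
    show "cond_iid (P N) (sigma (space (P N)) {}) N M (\<xi> N) (\<lambda>w. \<rho>)" if "1 \<le> N" for N
      by (rule cond_iid_trivial[OF P[OF that] that ind[OF that] law[OF that]])
    show "(\<lambda>w. \<rho>) \<in> sigma (space (P N)) {} \<rightarrow>\<^sub>M prob_algebra M" for N
      using \<rho> by (simp add: space_prob_algebra)
    show "(\<lambda>z. \<omega> (snd z)) \<in> borel_measurable (sigma (space (P N)) {} \<Otimes>\<^sub>M M)" for N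
      by (rule measurable_compose[OF measurable_snd bounded_fnD(1)[OF \<omega>(1)]])
    show "\<bar>\<omega> (snd x)\<bar> \<le> C" if "x \<in> space (sigma (space (P N)) {} \<Otimes>\<^sub>M M)" for N x
      using that bounded_fnD(3)[OF \<omega>(1)] by (auto simp: space_pair_measure)
    show "bounded_fn ?U (\<lambda>_. 1) 1" by (simp add: bounded_fn_def)
    show "0 < (\<integral>x. (1::real) \<partial>return ?U ())" by (simp add: ret1)
    show "bounded_fn ?U (\<lambda>_. \<integral>x. \<omega> x * f x \<partial>\<rho>) (max C (C\<^sup>2) * B)" if f: "bounded_fn M f B" for f B
    proof -
      have "C * B \<le> max C (C\<^sup>2) * B" using bounded_fnD(2)[OF f] by (intro mult_right_mono) auto
      then show ?thesis using kb[OF f] bounded_fnD(2)[OF f] C by (auto simp: bounded_fn_def intro!: mult_nonneg_nonneg)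
    qed
    show "bounded_fn ?U (\<lambda>_. \<integral>x. (\<omega> x * f x)\<^sup>2 \<partial>\<rho>) (max C (C\<^sup>2) * B\<^sup>2)" if f: "bounded_fn M f B" for f B
    proof -
      have "(C * B)\<^sup>2 \<le> max C (C\<^sup>2) * B\<^sup>2" unfolding power_mult_distrib by (intro mult_right_mono) auto
      then show ?thesis using k2b[OF f] C by (auto simp: bounded_fn_def intro!: mult_nonneg_nonneg)
    qed
    show "(\<integral>x. \<omega> x \<partial>\<rho>) * (\<integral>x. f x \<partial>\<mu>') = (\<integral>_. (\<integral>x. \<omega> x * f x \<partial>\<rho>) \<partial>return ?U ()) / (\<integral>_. 1 \<partial>return ?U ())" if "bounded_fn M f B" for f B
      using target[OF that] pos by (simp add: ret1)
  qed (use C pos \<mu>' in auto)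
  have A: "st.A' = (\<lambda>N f w. (\<Sum>l\<in>{1..N}. \<omega> (\<xi> N l w) * f (\<xi> N l w)) / real N)"
    by (intro ext) (simp add: st.A'_def)
  show "emp_clt M P (\<lambda>N f w. (\<Sum>l\<in>{1..N}. \<omega> (\<xi> N l w) * f (\<xi> N l w)) / real N) (\<integral>x. \<omega> x \<partial>\<rho>) \<mu>' (\<lambda>f. \<integral>x. (\<omega> x)\<^sup>2 * (f x)\<^sup>2 \<partial>\<rho>)"
  proof (rule emp_clt_cong[OF st.clt A])
    show "st.V' f = (\<integral>x. (\<omega> x)\<^sup>2 * (f x)\<^sup>2 \<partial>\<rho>)" for f
      unfolding st.V'_def by (simp add: ret1 power_mult_distrib)
  qed
  have "emp_L1 M P st.A' (\<integral>x. \<omega> x \<partial>\<rho>) \<mu>'"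
  \<comment> \<open>The dominating kernel is constant, equal to the initial proposal: the square of
    an expectation is at most the second moment, and \<omega>^2 \<le> C^2.\<close>
  proof (rule st.L1_step[OF unit_emp(2)[OF P], where q="\<lambda>_. \<rho>" and Cq="C\<^sup>2"])
    show "(\<lambda>_. \<rho>) \<in> ?U \<rightarrow>\<^sub>M prob_algebra M" using \<rho> by (simp add: space_prob_algebra)
    show "(\<integral>x. \<omega> x * f x \<partial>\<rho>)\<^sup>2 \<le> C\<^sup>2 * (\<integral>x. (f x)\<^sup>2 \<partial>\<rho>)" if f: "bounded_fn M f B" for f B
    proof -
      have fmm: "f \<in> borel_measurable \<rho>" using bounded_fnD(1)[OF f] by (simp add: measurable_cong_sets[OF \<rho>(2) refl])
      have "(\<integral>x. \<omega> x * f x \<partial>\<rho>)\<^sup>2 \<le> (\<integral>x. (\<omega> x * f x)\<^sup>2 \<partial>\<rho>)"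
        using fb[OF f] by (intro \<rho>.expectation_sq_le[OF fm'[OF f], of "C * B"]) (auto simp: sp\<rho>)
      also have "\<dots> \<le> (\<integral>x. C\<^sup>2 * (f x)\<^sup>2 \<partial>\<rho>)"
      proof (rule integral_mono')
        show "integrable \<rho> (\<lambda>x. C\<^sup>2 * (f x)\<^sup>2)"
          using bounded_fnD(3)[OF f] by (intro integrable_mult_right \<rho>.integrable_bounded_sq[OF fmm, of B]) (auto simp: sp\<rho>)
        show "(\<omega> x * f x)\<^sup>2 \<le> C\<^sup>2 * (f x)\<^sup>2" if "x \<in> space \<rho>" for x
          unfolding power_mult_distrib
          using power_mono[OF bounded_fnD(3)[OF \<omega>(1)] abs_ge_zero, of x 2] that by (intro mult_right_mono) (auto simp: sp\<rho>)
      qed auto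
      finally show ?thesis by simp
    qed
  qed simp_all
  then show "emp_L1 M P (\<lambda>N f w. (\<Sum>l\<in>{1..N}. \<omega> (\<xi> N l w) * f (\<xi> N l w)) / real N) (\<integral>x. \<omega> x \<partial>\<rho>) \<mu>'"
    by (simp only: A)
qed

section \<open>Generated \<sigma>-fields and extended-valued weights\<close>

lemma sigma_subalgebra:
  assumes G: "G \<subseteq> sets P"
  shows "subalgebra P (sigma (space P) G)"
proof -
  have "G \<subseteq> Pow (space P)" using G sets.space_closed[of P] by blast
  then show ?thesis
    using sets.sigma_sets_subset[OF G] by (simp add: subalgebra_def space_measure_of_conv)
qed

lemma sigma_measurable:
  assumes G: "G \<subseteq> sets P" and f: "f \<in> P \<rightarrow>\<^sub>M L" and "\<And>B. B \<in> sets L \<Longrightarrow> f -` B \<inter> space P \<in> G"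
  shows "f \<in> sigma (space P) G \<rightarrow>\<^sub>M L"
proof (rule measurableI)
  have sub: "G \<subseteq> Pow (space P)" using G sets.space_closed[of P] by blast
  show "f x \<in> space L" if "x \<in> space (sigma (space P) G)" for x
    using measurable_space[OF f] that by (simp add: space_measure_of_conv)
  show "f -` B \<inter> space (sigma (space P) G) \<in> sets (sigma (space P) G)" if "B \<in> sets L" for B
    using assms(3)[OF that] sub by (simp add: space_measure_of_conv sets_measure_of)
qed

text \<open>A finite bound on the extended quotient forces the numerator to vanish where the
  denominator does. Target = weight times proposal therefore holds at every point, which is the
  identity that makes importance weighting unbiased.\<close>

lemma ennreal_quotient_real:
  assumes "0 \<le> a" "0 \<le> b" "ennreal a / ennreal b \<le> ennreal C"
  shows "a = enn2real (ennreal a / ennreal b) * b"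
proof (cases "b = 0")
  case True
  have "a = 0"
  proof (rule ccontr)
    assume "a \<noteq> 0"
    then have "ennreal a / ennreal b = \<top>" using assms True by (simp add: ennreal_divide_zero ennreal_eq_0_iff)
    then show False using assms(3) by (simp add: top_unique)
  qed
  then show ?thesis using True by simp
next
  case False
  then have "ennreal a / ennreal b = ennreal (a / b)" using assms by (intro divide_ennreal) auto
  then show ?thesis using False assms by simp
qed

lemma enn2real_bound:
  assumes "x \<le> ennreal C" "0 \<le> C"
  shows "enn2real x \<le> C" "ennreal (enn2real x) = x"
proof -
  show "enn2real x \<le> C" using enn2real_mono[OF assms(1)] assms(2) by simp
  have "x < \<top>" using assms(1) by (simp add: le_less_trans)
  then show "ennreal (enn2real x) = x" by simp
qed

lemma markov_densityD:
  assumes "markov_density L p"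
  shows "(\<lambda>z. p (fst z) (snd z)) \<in> borel_measurable (L \<Otimes>\<^sub>M L)"
    "\<And>x y. x \<in> space L \<Longrightarrow> y \<in> space L \<Longrightarrow> 0 \<le> p x y"
    "\<And>x. x \<in> space L \<Longrightarrow> (\<integral>\<^sup>+ y. ennreal (p x y) \<partial>L) = 1"
  using assms by (auto simp: markov_density_def case_prod_beta')

context filter_model
begin

abbreviation "NL N \<equiv> count_space {1..N::nat} \<Otimes>\<^sub>M L"
abbreviation "NNL N \<equiv> count_space {1..N::nat} \<Otimes>\<^sub>M NL N"

end

section \<open>The forward and backward filters\<close>

locale forward_particles = filter_model A for A :: "'a two_filter" +
  fixes P :: "nat \<Rightarrow> 'w measure" and xi :: "nat \<Rightarrow> nat \<Rightarrow> nat \<Rightarrow> 'w \<Rightarrow> 'a" and I :: "nat \<Rightarrow> nat \<Rightarrow> nat \<Rightarrow> 'w \<Rightarrow> nat"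
  assumes fdesign: "valid_forward_design A"
    and weight0: "esup_norm (states A) (fweight0 A) < \<infinity>"
    and weight: "\<And>t. 1 \<le> t \<Longrightarrow> t \<le> hor A \<Longrightarrow> esup_norm (states A \<times> states A) (\<lambda>(x, x'). fweight A t x x') < \<infinity>"
    and adj: "\<And>t. 1 \<le> t \<Longrightarrow> t \<le> hor A \<Longrightarrow> sup_norm (states A) (fadj A t) < \<infinity>"
    and prob: "\<And>N. 1 \<le> N \<Longrightarrow> prob_space (P N)"
    and forward: "\<And>N. 1 \<le> N \<Longrightarrow> forward_system A N (P N) (xi N) (I N)"
begin

abbreviation "fw N \<equiv> fpw A (xi N) (I N)"
abbreviation "FH N s \<equiv> forward_history A N (P N) (xi N) (I N) s"

definition om :: "nat \<Rightarrow> nat \<Rightarrow> nat \<Rightarrow> 'w \<Rightarrow> real" where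
  "om s N l w = enn2real (fw N s l w)"

definition AA :: "nat \<Rightarrow> nat \<Rightarrow> ('a \<Rightarrow> real) \<Rightarrow> 'w \<Rightarrow> real" where
  "AA s N f w = (\<Sum>l\<in>{1..N}. om s N l w * f (xi N s l w)) / real N"

lemma rho0: "prob_space (rho0 A)" "sets (rho0 A) = sets L"
  and dini: "dini A \<in> borel_measurable L" "density (rho0 A) (dini A) = ini A"
  using fdesign by (auto simp: valid_forward_design_def cong: measurable_cong_sets)

lemma fadj_meas: "s \<in> {1..T} \<Longrightarrow> fadj A s \<in> borel_measurable L" and fadj_nonneg: "s \<in> {1..T} \<Longrightarrow> x \<in> space L \<Longrightarrow> 0 \<le> fadj A s x"
  and fprop: "s \<in> {1..T} \<Longrightarrow> markov_density L (fprop A s)"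
  using fdesign by (auto simp: valid_forward_design_def)

lemma system_Suc:
  assumes N: "1 \<le> N" and s: "s \<in> {1..T}"
  shows "cond_iid (P N) (FH N s) N (NL N) (\<lambda>l w. (I N s l w, xi N s l w))
          (\<lambda>w. normalized_density (NL N)
             (\<lambda>(i, x). fw N (s - 1) i w *
                ennreal (fadj A s (xi N (s - 1) i w) * fprop A s (xi N (s - 1) i w) x)))"
    and "AE w in P N. 0 < (\<Sum>i\<in>{1..N}. fw N (s - 1) i w * ennreal (fadj A s (xi N (s - 1) i w)))"
  using forward[OF N] s unfolding forward_system_def by blast+

lemma xi_meas:
  assumes N: "1 \<le> N" and l: "l \<in> {1..N}" and s: "s \<le> T"
  shows "xi N s l \<in> P N \<rightarrow>\<^sub>M L"
proof (cases "s = 0")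
  case True
  interpret prob_space "P N" by (rule prob[OF N])
  have "indep_vars (\<lambda>_. L) (xi N 0) {1..N}" using forward[OF N] unfolding forward_system_def by blast
  then show ?thesis using l True unfolding indep_vars_def by blast
next
  case False
  then have "(\<lambda>w. (I N s l w, xi N s l w)) \<in> P N \<rightarrow>\<^sub>M NL N"
    using system_Suc(1)[OF N, of s] s l unfolding cond_iid_def by fastforce
  from measurable_compose[OF this measurable_snd] show ?thesis by simp
qed

lemma I_meas:
  assumes N: "1 \<le> N" and l: "l \<in> {1..N}" and s: "1 \<le> s" "s \<le> T"
  shows "I N s l \<in> P N \<rightarrow>\<^sub>M count_space {1..N}"
proof -
  have "(\<lambda>w. (I N s l w, xi N s l w)) \<in> P N \<rightarrow>\<^sub>M NL N"
    using system_Suc(1)[OF N, of s] s l unfolding cond_iid_def by fastforce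
  from measurable_compose[OF this measurable_fst] show ?thesis by simp
qed

definition gens :: "nat \<Rightarrow> nat \<Rightarrow> 'w set set" where
  "gens N s = {xi N u l -` B \<inter> space (P N) | u l B. u < s \<and> l \<in> {1..N} \<and> B \<in> sets L} \<union>
      {I N u l -` B \<inter> space (P N) | u l B. 1 \<le> u \<and> u < s \<and> l \<in> {1..N}}"

lemma FH_eq: "FH N s = sigma (space (P N)) (gens N s)"
  by (simp add: forward_history_def gens_def)

lemma gens_sets:
  assumes N: "1 \<le> N" and s: "s \<le> Suc T"
  shows "gens N s \<subseteq> sets (P N)"
proof -
  have "xi N u l -` B \<inter> space (P N) \<in> sets (P N)" if "u < s" "l \<in> {1..N}" "B \<in> sets L" for u l B
    using measurable_sets[OF xi_meas[OF N that(2), of u] that(3)] that(1) s by simp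
  moreover have "I N u l -` B \<inter> space (P N) \<in> sets (P N)" if "1 \<le> u" "u < s" "l \<in> {1..N}" for u l B
  proof -
    have m: "I N u l \<in> P N \<rightarrow>\<^sub>M count_space {1..N}" using I_meas[OF N that(3,1)] that(2) s by simp
    \<comment> \<open>The history is generated by preimages of arbitrary sets of naturals, while
      measurability is known for subsets of {1..N}. On the space of outcomes the index never leaves
      this range.\<close>
    have "I N u l -` B \<inter> space (P N) = I N u l -` (B \<inter> {1..N}) \<inter> space (P N)"
      using measurable_space[OF m] by auto
    then show ?thesis using measurable_sets[OF m, of "B \<inter> {1..N}"] by simp
  qed
  ultimately show ?thesis unfolding gens_def by blast
qed

lemma FH_sub: "1 \<le> N \<Longrightarrow> s \<le> Suc T \<Longrightarrow> subalgebra (P N) (FH N s)"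
  unfolding FH_eq by (rule sigma_subalgebra[OF gens_sets])

lemma xi_FH:
  assumes N: "1 \<le> N" and l: "l \<in> {1..N}" and "u < s" "s \<le> Suc T"
  shows "xi N u l \<in> FH N s \<rightarrow>\<^sub>M L"
  unfolding FH_eq
proof (rule sigma_measurable[OF gens_sets[OF N assms(4)] xi_meas[OF N l]])
  show "u \<le> T" using assms by simp
  show "xi N u l -` B \<inter> space (P N) \<in> gens N s" if "B \<in> sets L" for B
    unfolding gens_def using assms that by blast
qed

lemma I_FH:
  assumes N: "1 \<le> N" and l: "l \<in> {1..N}" and "1 \<le> u" "u < s" "s \<le> Suc T"
  shows "I N u l \<in> FH N s \<rightarrow>\<^sub>M count_space {1..N}"
  unfolding FH_eq
proof (rule sigma_measurable[OF gens_sets[OF N assms(5)] I_meas[OF N l assms(3)]])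
  show "u \<le> T" using assms by simp
  show "I N u l -` B \<inter> space (P N) \<in> gens N s" for B
    unfolding gens_def using assms by blast
qed

lemma fweight0_meas: "fweight0 A \<in> borel_measurable L"
proof -
  note [measurable] = g_meas[of 0, simplified] dini(1)
  show ?thesis unfolding fweight0_def[abs_def] by measurable
qed

lemma fweight_meas:
  assumes s: "s \<in> {1..T}"
  shows "(\<lambda>z. fweight A s (fst z) (snd z)) \<in> borel_measurable (L \<Otimes>\<^sub>M L)"
proof -
  note [measurable] = markov_densityD(1)[OF fprop[OF s]] fadj_meas[OF s] g_meas[of s]
  have [measurable]: "g s \<in> borel_measurable L" using g_meas s by simp
  show ?thesis unfolding fweight_def[abs_def] by measurable
qed

lemma xi_space: "1 \<le> N \<Longrightarrow> l \<in> {1..N} \<Longrightarrow> s \<le> T \<Longrightarrow> w \<in> space (P N) \<Longrightarrow> xi N s l w \<in> space L"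
  using measurable_space[OF xi_meas] .

lemma I_space: "1 \<le> N \<Longrightarrow> l \<in> {1..N} \<Longrightarrow> 1 \<le> s \<Longrightarrow> s \<le> T \<Longrightarrow> w \<in> space (P N) \<Longrightarrow> I N s l w \<in> {1..N}"
  using measurable_space[OF I_meas] by fastforce

lemma weight_bound:
  assumes "s \<le> T"
  shows "\<exists>C\<ge>0. \<forall>N\<ge>1. \<forall>l\<in>{1..N}. \<forall>w\<in>space (P N). fw N s l w \<le> ennreal C"
proof (cases "s = 0")
  case True
  obtain C where "0 \<le> C" "\<And>x. x \<in> space L \<Longrightarrow> fweight0 A x \<le> ennreal C"
    by (rule esup_norm_bound[OF weight0]) auto
  then show ?thesis using True xi_space[of _ _ 0] by (intro exI[of _ C]) (simp add: fpw_def)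
next
  case False
  obtain C where C: "0 \<le> C" "\<And>x. x \<in> space L \<times> space L \<Longrightarrow> (case x of (x, x') \<Rightarrow> fweight A s x x') \<le> ennreal C"
    by (rule esup_norm_bound[OF weight[of s]]) (use False assms in auto)
  have "fw N s l w \<le> ennreal C" if N: "1 \<le> N" and l: "l \<in> {1..N}" and w: "w \<in> space (P N)" for N l w
  proof -
    have i: "I N s l w \<in> {1..N}" using I_space[OF N l _ assms w] False by simp
    show ?thesis
      using C(2)[of "(xi N (s - 1) (I N s l w) w, xi N s l w)"] xi_space[OF N i, of "s - 1" w] xi_space[OF N l assms w] w assms False
      by (simp add: fpw_def)
  qed
  then show ?thesis using C(1) by blast
qed

lemma fpw_om: "1 \<le> N \<Longrightarrow> l \<in> {1..N} \<Longrightarrow> s \<le> T \<Longrightarrow> w \<in> space (P N) \<Longrightarrow> fw N s l w = ennreal (om s N l w)"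
  using weight_bound[of s] enn2real_bound(2) unfolding om_def by metis

lemma om_nonneg: "0 \<le> om s N l w" by (simp add: om_def)

lemma fpw_FH:
  assumes N: "1 \<le> N" and l: "l \<in> {1..N}" and u: "u < s" "s \<le> Suc T"
  shows "fw N u l \<in> borel_measurable (FH N s)"
proof (cases "u = 0")
  case True
  have "fw N u l = (\<lambda>w. fweight0 A (xi N u l w))" by (rule ext) (simp add: fpw_def True)
  then show ?thesis using measurable_compose[OF xi_FH[OF N l u] fweight0_meas] by (simp only:)
next
  case False
  \<comment> \<open>The ancestor's position is evaluated at a random index. Both the index and all
    candidate positions belong to the history, and there are finitely many candidates.\<close>
  have "(\<lambda>w. xi N (u - 1) (I N u l w) w) \<in> FH N s \<rightarrow>\<^sub>M L"
  proof (rule measurable_compose_countable'[where I="{1..N}" and f="\<lambda>i. xi N (u - 1) i"])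
    show "xi N (u - 1) i \<in> FH N s \<rightarrow>\<^sub>M L" if "i \<in> {1..N}" for i using u False by (intro xi_FH[OF N that]) auto
    show "I N u l \<in> FH N s \<rightarrow>\<^sub>M count_space {1..N}" using u False by (intro I_FH[OF N l]) auto
  qed simp
  from measurable_compose[OF measurable_Pair[OF this xi_FH[OF N l u]] fweight_meas[of u]]
  have "(\<lambda>w. fweight A u (xi N (u - 1) (I N u l w) w) (xi N u l w)) \<in> borel_measurable (FH N s)" using False u by simp
  moreover have "fw N u l = (\<lambda>w. fweight A u (xi N (u - 1) (I N u l w) w) (xi N u l w))"
    by (rule ext) (simp add: fpw_def False)
  ultimately show ?thesis by (simp only:)
qed

lemma om_FH: "1 \<le> N \<Longrightarrow> l \<in> {1..N} \<Longrightarrow> u < s \<Longrightarrow> s \<le> Suc T \<Longrightarrow> om u N l \<in> borel_measurable (FH N s)"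
  unfolding om_def[abs_def] using fpw_FH by measurable

text \<open>The initial weight is the density of the initial law times the first potential, so a
  weighted integral under the proposal is an integral of the potential under the initial law, whose
  normalised form is the filter at time 0.\<close>

lemma base:
  shows "\<exists>c. emp_clt L P (AA 0) c (filtering A 0) (\<lambda>f. c\<^sup>2 * fvar A 0 f) \<and> emp_L1 L P (AA 0) c (filtering A 0)"
proof -
  define \<omega> where "\<omega> x = enn2real (fweight0 A x)" for x
  obtain C where C: "0 \<le> C" "\<And>x. x \<in> space L \<Longrightarrow> fweight0 A x \<le> ennreal C"
    by (rule esup_norm_bound[OF weight0]) auto
  have \<omega>b: "bounded_fn L \<omega> C"
    unfolding bounded_fn_def \<omega>_def using C fweight0_meas enn2real_bound(1)[OF C(2) C(1)] by auto
  have \<omega>0: "0 \<le> \<omega> x" for x by (simp add: \<omega>_def)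
  note gm = g_meas[of 0, simplified]
  have dm: "dini A \<in> borel_measurable (rho0 A)" using dini(1) by (simp add: measurable_cong_sets[OF rho0(2) refl])
  have spr: "space (rho0 A) = space L" using sets_eq_imp_space_eq[OF rho0(2)] .
  \<comment> \<open>The density is extended-valued; it is finite everywhere because its product with
    a positive potential is bounded.\<close>
  have d_fin: "dini A x = ennreal (enn2real (dini A x))" if x: "x \<in> space L" for x
  proof -
    have "dini A x * ennreal (g 0 x) < \<top>" using C(2)[OF x] by (simp add: fweight0_def le_less_trans)
    then have "dini A x \<noteq> \<top>" using g_pos[of 0 x] x by (auto simp: ennreal_top_mult ennreal_eq_0_iff)
    then show ?thesis by (simp add: less_top)
  qed
  have \<omega>d: "\<omega> x = enn2real (dini A x) * g 0 x" if x: "x \<in> space L" for x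
    using g_pos[of 0 x] x by (simp add: \<omega>_def fweight0_def enn2real_mult less_imp_le)
  have ini_eq: "ini A = density (rho0 A) (\<lambda>x. ennreal (enn2real (dini A x)))"
    unfolding dini(2)[symmetric] using dm d_fin by (intro density_cong) (auto simp: spr)
  have chg: "(\<integral>x. g 0 x * f x \<partial>ini A) = (\<integral>x. \<omega> x * f x \<partial>rho0 A)" if f: "f \<in> borel_measurable L" for f
  proof -
    have "(\<integral>x. g 0 x * f x \<partial>ini A) = (\<integral>x. enn2real (dini A x) *\<^sub>R (g 0 x * f x) \<partial>rho0 A)"
      unfolding ini_eq using dm gm f
      by (intro integral_density) (auto simp: measurable_cong_sets[OF rho0(2) refl])
    also have "\<dots> = (\<integral>x. \<omega> x * f x \<partial>rho0 A)"
      by (intro Bochner_Integration.integral_cong refl) (simp add: \<omega>d spr)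
    finally show ?thesis .
  qed
  have chg1: "(\<integral>x. g 0 x \<partial>ini A) = (\<integral>x. \<omega> x \<partial>rho0 A)" using chg[of "\<lambda>_. 1"] by simp
  have pos: "0 < (\<integral>x. \<omega> x \<partial>rho0 A)"
    using filtering_0(2)[of "\<lambda>_. 0" 0] chg1 by (simp add: bounded_fn_def)
  have target: "(\<integral>x. f x \<partial>filtering A 0) = (\<integral>x. \<omega> x * f x \<partial>rho0 A) / (\<integral>x. \<omega> x \<partial>rho0 A)" if "bounded_fn L f B" for f B
    using filtering_0(1)[OF that] chg[OF bounded_fnD(1)[OF that]] chg1 by simp
  have ind: "prob_space.indep_vars (P N) (\<lambda>_. L) (\<lambda>l. xi N 0 l) {1..N}"
    and law: "l \<in> {1..N} \<Longrightarrow> distr (P N) L (xi N 0 l) = rho0 A" if "1 \<le> N" for N l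
    using forward[OF that] unfolding forward_system_def by auto
  have b: "emp_clt L P (\<lambda>N f w. (\<Sum>l\<in>{1..N}. \<omega> (xi N 0 l w) * f (xi N 0 l w)) / real N) (\<integral>x. \<omega> x \<partial>rho0 A) (filtering A 0)
      (\<lambda>f. \<integral>x. (\<omega> x)\<^sup>2 * (f x)\<^sup>2 \<partial>rho0 A)"
    by (rule initial_step(1)[where \<xi>="\<lambda>N l. xi N 0 l" and \<omega>=\<omega>, OF prob rho0 ind law \<omega>b \<omega>0 pos filtering_prob[of 0] sets_filtering]) (use target in auto)
  have b1: "emp_L1 L P (\<lambda>N f w. (\<Sum>l\<in>{1..N}. \<omega> (xi N 0 l w) * f (xi N 0 l w)) / real N) (\<integral>x. \<omega> x \<partial>rho0 A) (filtering A 0)"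
    by (rule initial_step(2)[where \<xi>="\<lambda>N l. xi N 0 l" and \<omega>=\<omega>, OF prob rho0 ind law \<omega>b \<omega>0 pos filtering_prob[of 0] sets_filtering]) (use target in auto)
  have AA: "(\<lambda>N f w. (\<Sum>l\<in>{1..N}. \<omega> (xi N 0 l w) * f (xi N 0 l w)) / real N) = AA 0"
    by (intro ext) (simp add: AA_def om_def fpw_def \<omega>_def)
  have V: "(\<integral>x. (\<omega> x)\<^sup>2 * (f x)\<^sup>2 \<partial>rho0 A) = (\<integral>x. \<omega> x \<partial>rho0 A)\<^sup>2 * fvar A 0 f" for f
    using pos by (simp add: \<omega>_def)
  have "emp_clt L P (AA 0) (\<integral>x. \<omega> x \<partial>rho0 A) (filtering A 0) (\<lambda>f. (\<integral>x. \<omega> x \<partial>rho0 A)\<^sup>2 * fvar A 0 f)"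
    by (rule emp_clt_cong[OF b AA V])
  moreover have "emp_L1 L P (AA 0) (\<integral>x. \<omega> x \<partial>rho0 A) (filtering A 0)"
    using b1 by (simp only: AA)
  ultimately show ?thesis by blast
qed

text \<open>Besides the limit, the error bound in mean has to be carried forward, since the pair
  argument later asks it of the forward sample. The transition kernel of the model itself dominates
  there.\<close>

lemma induction_step:
  assumes s: "Suc s \<le> T" and clt: "emp_clt L P (AA s) c (filtering A s) (\<lambda>f. c\<^sup>2 * fvar A s f)"
    and L1: "emp_L1 L P (AA s) c (filtering A s)"
  shows "\<exists>c. emp_clt L P (AA (Suc s)) c (filtering A (Suc s)) (\<lambda>f. c\<^sup>2 * fvar A (Suc s) f) \<and> emp_L1 L P (AA (Suc s)) c (filtering A (Suc s))"
proof -
  have s1: "Suc s \<in> {1..T}" "s \<le> T" using s by auto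
  define \<omega> where "\<omega> y x = enn2real (fweight A (Suc s) y x)" for y x
  obtain CW where CW: "0 \<le> CW" "\<And>x. x \<in> space L \<times> space L \<Longrightarrow> (case x of (x, x') \<Rightarrow> fweight A (Suc s) x x') \<le> ennreal CW"
    by (rule esup_norm_bound[OF weight[of "Suc s"]]) (use s in auto)
  have CW': "fweight A (Suc s) y x \<le> ennreal CW" if "y \<in> space L" "x \<in> space L" for y x using CW(2)[of "(y, x)"] that by simp
  obtain B\<theta> where B\<theta>: "0 \<le> B\<theta>" "\<And>x. x \<in> space L \<Longrightarrow> \<bar>fadj A (Suc s) x\<bar> \<le> B\<theta>"
    by (rule sup_norm_bound[OF adj[of "Suc s"]]) (use s in auto)
  note fp = markov_densityD[OF fprop[OF s1(1)]]
  interpret st: mixture_step L L P "\<lambda>N. FH N (Suc s)" "AA s" c "filtering A s" "\<lambda>f. c\<^sup>2 * fvar A s f"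
    "\<lambda>N. {1..N}" "\<lambda>N. om s N" "\<lambda>N. xi N s" real "\<lambda>N. NL N" "\<lambda>N. Pair" fst snd
    "\<lambda>N l w. (I N (Suc s) l w, xi N (Suc s) l w)" "fadj A (Suc s)" "fprop A (Suc s)" \<omega> "\<lambda>y x. q y x * g (Suc s) x" B\<theta> CW "filtering A (Suc s)"
  proof (rule mixture_step.intro)
    show "prob_space (P N)" if "1 \<le> N" for N by (rule prob[OF that])
    show "subalgebra (P N) (FH N (Suc s))" if "1 \<le> N" for N using FH_sub[OF that, of "Suc s"] s by simp
    show "emp_clt L P (AA s) c (filtering A s) (\<lambda>f. c\<^sup>2 * fvar A s f)" by (rule clt)
    show "AA s N f w = (\<Sum>j\<in>{1..N}. om s N j w * f (xi N s j w)) / real N" for N f w by (simp add: AA_def)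
    show "0 < real N" if "1 \<le> N" for N using that by simp
    show "sigma_finite_measure L" by (rule sigma_finite_L)
    show "indexed_base (NL N) L {1..N} Pair" for N :: nat by (rule indexed_base_single[OF sigma_finite_L]) simp
    show "sigma_finite_measure (NL N)" for N :: nat by (rule sigma_finite_count_pair[OF sigma_finite_L]) simp
    show "space (NL N) \<noteq> {}" if "1 \<le> N" for N :: nat
      using that prob_space.not_empty[OF ini(1)] space_ini by (auto simp: space_pair_measure)
    show "om s N j \<in> borel_measurable (FH N (Suc s))" if "1 \<le> N" "j \<in> {1..N}" for N j using om_FH[OF that] s by simp
    show "0 \<le> om s N j w" for N j w by (rule om_nonneg)
    show "xi N s j \<in> FH N (Suc s) \<rightarrow>\<^sub>M L" if "1 \<le> N" "j \<in> {1..N}" for N j using xi_FH[OF that] s by simp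
    show "fst \<in> NL N \<rightarrow>\<^sub>M count_space {1..N}" "snd \<in> NL N \<rightarrow>\<^sub>M L" for N by simp_all
    show "bounded_fn L (fadj A (Suc s)) B\<theta>" using fadj_meas[OF s1(1)] B\<theta> by (simp add: bounded_fn_def)
    show "0 \<le> fadj A (Suc s) y" if "y \<in> space L" for y by (rule fadj_nonneg[OF s1(1) that])
    show "(\<lambda>z. fprop A (Suc s) (fst z) (snd z)) \<in> borel_measurable (L \<Otimes>\<^sub>M L)" by (rule fp(1))
    show "0 \<le> fprop A (Suc s) y x" if "y \<in> space L" "x \<in> space L" for y x by (rule fp(2)[OF that])
    show "(\<integral>\<^sup>+ x. ennreal (fprop A (Suc s) y x) \<partial>L) = 1" if "y \<in> space L" for y by (rule fp(3)[OF that])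
    show "(\<lambda>z. \<omega> (fst z) (snd z)) \<in> borel_measurable (L \<Otimes>\<^sub>M L)" unfolding \<omega>_def using fweight_meas[OF s1(1)] by measurable
    show "0 \<le> \<omega> y x" for y x by (simp add: \<omega>_def)
    show "\<omega> y x \<le> CW" if "y \<in> space L" "x \<in> space L" for y x
      unfolding \<omega>_def using CW'[OF that] CW(1) by (rule enn2real_bound(1))
    show "0 \<le> CW" by (rule CW(1))
    show "q y x * g (Suc s) x = \<omega> y x * (fadj A (Suc s) y * fprop A (Suc s) y x)" if "y \<in> space L" "x \<in> space L" for y x
      unfolding \<omega>_def fweight_def
    proof (rule ennreal_quotient_real)
      show "0 \<le> q y x * g (Suc s) x" using q_nonneg[OF that] g_pos[OF s that(2)] by simp
      show "0 \<le> fadj A (Suc s) y * fprop A (Suc s) y x" using fadj_nonneg[OF s1(1) that(1)] fp(2)[OF that] by simp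
      show "ennreal (q y x * g (Suc s) x) / ennreal (fadj A (Suc s) y * fprop A (Suc s) y x) \<le> ennreal CW"
        using CW'[OF that] by (simp add: fweight_def)
    qed
    show "cond_iid (P N) (FH N (Suc s)) N (NL N) (\<lambda>l w. (I N (Suc s) l w, xi N (Suc s) l w))
        (\<lambda>w. normalized_density (NL N)
          (\<lambda>z. ennreal (om s N (fst z) w * (fadj A (Suc s) (xi N s (fst z) w) * fprop A (Suc s) (xi N s (fst z) w) (snd z)))))"
      if N: "1 \<le> N" for N
    proof (rule cond_iid_cong_AE[OF system_Suc(1)[OF N s1(1)]], rule AE_I2, rule normalized_density_cong)
      fix w z assume w: "w \<in> space (P N)" and "z \<in> space (NL N)"
      then obtain i x where z: "z = (i, x)" "i \<in> {1..N}" by (auto simp: space_pair_measure)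
      show "(case z of (i, x) \<Rightarrow> fw N (Suc s - 1) i w * ennreal (fadj A (Suc s) (xi N (Suc s - 1) i w) * fprop A (Suc s) (xi N (Suc s - 1) i w) x))
        = ennreal (om s N (fst z) w * (fadj A (Suc s) (xi N s (fst z) w) * fprop A (Suc s) (xi N s (fst z) w) (snd z)))"
        using fpw_om[OF N z(2) s1(2) w] om_nonneg by (simp add: z ennreal_mult')
    qed
    show "AE w in P N. 0 < (\<Sum>j\<in>{1..N}. om s N j w * fadj A (Suc s) (xi N s j w))" if N: "1 \<le> N" for N
      using system_Suc(2)[OF N s1(1)] AE_space
    proof eventually_elim
      case (elim w)
      have "(\<Sum>i\<in>{1..N}. fw N s i w * ennreal (fadj A (Suc s) (xi N s i w))) = ennreal (\<Sum>j\<in>{1..N}. om s N j w * fadj A (Suc s) (xi N s j w))"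
      proof -
        have "(\<Sum>i\<in>{1..N}. fw N s i w * ennreal (fadj A (Suc s) (xi N s i w))) = (\<Sum>i\<in>{1..N}. ennreal (om s N i w * fadj A (Suc s) (xi N s i w)))"
          using fpw_om[OF N _ s1(2) elim(2)] om_nonneg by (intro sum.cong refl) (simp add: ennreal_mult')
        also have "\<dots> = ennreal (\<Sum>j\<in>{1..N}. om s N j w * fadj A (Suc s) (xi N s j w))"
          using om_nonneg fadj_nonneg[OF s1(1) xi_space[OF N _ s1(2) elim(2)]] by (intro sum_ennreal) simp
        finally show ?thesis .
      qed
      then show ?case using elim(1) by simp
    qed
    show "prob_space (filtering A (Suc s))" by (rule filtering_prob[OF s])
    show "sets (filtering A (Suc s)) = sets L" by simp
    show "0 < (\<integral>y. (\<integral>x. q y x * g (Suc s) x \<partial>L) \<partial>filtering A s)" by (rule filtering_Suc(1)[OF s])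
    show "(\<integral>x. f x \<partial>filtering A (Suc s)) = (\<integral>y. (\<integral>x. q y x * g (Suc s) x * f x \<partial>L) \<partial>filtering A s) / (\<integral>y. (\<integral>x. q y x * g (Suc s) x \<partial>L) \<partial>filtering A s)"
      if "bounded_fn L f B" for f B by (rule filtering_Suc(2)[OF s that])
  qed simp_all
  have AA: "st.step.A' = AA (Suc s)"
    by (intro ext) (simp add: st.step.A'_def AA_def st.W_def \<omega>_def om_def fpw_def)
  have c: "c \<noteq> 0" using st.c by simp
  \<comment> \<open>With \<theta>-mass t and kernel mass u, c' = u / t. The inherited part c^2
    \<Gamma> / (c t)^2 and the fresh part k2 / t both acquire the factor (u / t)^2 once u^2 is
    pulled into the recursion, which also explains the factor t in front of k2 there.\<close>
  have V: "st.step.V' f = st.c'\<^sup>2 * fvar A (Suc s) f" for f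
  proof -
    have k2: "st.k2 f = (\<lambda>y. \<integral>x. enn2real (fweight A (Suc s) y x) * q y x * g (Suc s) x * (f x)\<^sup>2 \<partial>L)"
      by (rule ext) (simp add: st.k2_def \<omega>_def mult.assoc)
    have k: "st.k f = (\<lambda>y. \<integral>x. q y x * g (Suc s) x * f x \<partial>L)" by (rule ext) (simp add: st.k_def)
    have t: "(\<integral>y. fadj A (Suc s) y \<partial>filtering A s) \<noteq> 0" using st.\<theta>pos by simp
    have u: "(\<integral>y. (\<integral>x. q y x * g (Suc s) x \<partial>L) \<partial>filtering A s) \<noteq> 0" using filtering_Suc(1)[OF s] by simp
    show ?thesis
      using c t u by (simp add: st.step.V'_def st.c'_def k2 k power_divide power_mult_distrib) (simp add: field_simps power2_eq_square)
  qed
  obtain G where G: "0 \<le> G" "\<And>x. x \<in> space L \<Longrightarrow> \<bar>g (Suc s) x\<bar> \<le> G" by (rule sup_norm_bound[OF g_fin[OF s]]) auto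
  \<comment> \<open>\<open>k f\<close> is the expectation of g f under this Markov kernel. By the
    inequality between squared mean and second moment its square is at most G^2 times the kernel
    average of f^2, hence the constant \<open>G\<^sup>2\<close>.\<close>
  define qk where "qk y = density L (\<lambda>x. ennreal (q y x))" for y
  have qk_prob: "prob_space (qk y)" if y: "y \<in> space L" for y
    unfolding qk_def using y q_mass[OF y] by (intro prob_spaceI) (simp add: emeasure_density cong: nn_integral_cong)
  have "emp_L1 L P st.step.A' st.c' (filtering A (Suc s))"
  proof (rule st.step.L1_step[OF L1, where q=qk and Cq="G\<^sup>2"])
    show "qk \<in> L \<rightarrow>\<^sub>M prob_algebra L"
    proof (rule measurable_prob_algebra_generated[where \<Omega>="space L" and G="sets L", OF sets.sigma_sets_eq[of L, symmetric] sets.Int_stable[of L] sets.space_closed[of L]])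
      show "prob_space (qk y)" if "y \<in> space L" for y by (rule qk_prob[OF that])
      show "sets (qk y) = sets L" for y by (simp add: qk_def)
      show "(\<lambda>y. emeasure (qk y) B) \<in> borel_measurable L" if B[measurable]: "B \<in> sets L" for B
      proof -
        have "emeasure (qk y) B = (\<integral>\<^sup>+ x. ennreal (q y x) * indicator B x \<partial>L)" if "y \<in> space L" for y
          unfolding qk_def using that by (intro emeasure_density) measurable
        then show ?thesis by (subst measurable_cong) auto
      qed
    qed
    fix f B y assume f: "bounded_fn L f B" and y: "y \<in> space L"
    interpret Q: prob_space "qk y" by (rule qk_prob[OF y])
    note [measurable] = bounded_fnD(1)[OF f] g_meas[OF s]
    have dens: "(\<integral>x. h x \<partial>qk y) = (\<integral>x. q y x * h x \<partial>L)" if [measurable]: "h \<in> borel_measurable L" for h :: "'a \<Rightarrow> real"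
      unfolding qk_def using y q_nonneg[OF y] by (subst integral_density) auto
    have gf: "\<bar>g (Suc s) x * f x\<bar> \<le> G * B" if "x \<in> space L" for x
      unfolding abs_mult using G bounded_fnD[OF f] that by (intro mult_mono) auto
    have mq: "h \<in> borel_measurable L \<Longrightarrow> h \<in> borel_measurable (qk y)" for h :: "'a \<Rightarrow> real" by (simp add: qk_def)
    have "st.k f y = (\<integral>x. g (Suc s) x * f x \<partial>qk y)"
      by (subst dens) (auto simp: st.k_def mult.assoc)
    then have "(st.k f y)\<^sup>2 \<le> (\<integral>x. (g (Suc s) x * f x)\<^sup>2 \<partial>qk y)"
      using Q.expectation_sq_le[OF mq, of "\<lambda>x. g (Suc s) x * f x" "G * B"] gf by (simp add: qk_def)
    also have "\<dots> \<le> (\<integral>x. G\<^sup>2 * (f x)\<^sup>2 \<partial>qk y)"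
    proof (rule integral_mono')
      show "integrable (qk y) (\<lambda>x. G\<^sup>2 * (f x)\<^sup>2)"
        using bounded_fnD(3)[OF f] by (intro integrable_mult_right Q.integrable_bounded_sq[OF mq, of _ B]) (auto simp: qk_def)
      show "(g (Suc s) x * f x)\<^sup>2 \<le> G\<^sup>2 * (f x)\<^sup>2" if "x \<in> space (qk y)" for x
        unfolding power_mult_distrib using power_mono[OF G(2) abs_ge_zero, of x 2] that by (intro mult_right_mono) (auto simp: qk_def)
    qed auto
    finally show "(st.k f y)\<^sup>2 \<le> G\<^sup>2 * (\<integral>x. (f x)\<^sup>2 \<partial>qk y)" by simp
  qed simp
  then have "emp_L1 L P (AA (Suc s)) st.c' (filtering A (Suc s))" by (simp only: AA)
  moreover have "emp_clt L P (AA (Suc s)) st.c' (filtering A (Suc s)) (\<lambda>f. st.c'\<^sup>2 * fvar A (Suc s) f)"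
    by (rule emp_clt_cong[OF st.step.clt AA V])
  ultimately show ?thesis by blast
qed

theorem forward_clt:
  "s \<le> T \<Longrightarrow> \<exists>c. emp_clt L P (AA s) c (filtering A s) (\<lambda>f. c\<^sup>2 * fvar A s f) \<and> emp_L1 L P (AA s) c (filtering A s)"
proof (induction s)
  case 0
  show ?case by (rule base)
next
  case (Suc s)
  then show ?case using induction_step by (meson Suc_leD)
qed

end

section \<open>The backward filter\<close>

locale backward_particles = filter_model A for A :: "'a two_filter" +
  fixes P :: "nat \<Rightarrow> 'w measure" and bxi :: "nat \<Rightarrow> nat \<Rightarrow> nat \<Rightarrow> 'w \<Rightarrow> 'a" and bI :: "nat \<Rightarrow> nat \<Rightarrow> nat \<Rightarrow> 'w \<Rightarrow> nat"
  assumes bdesign: "valid_backward_design A"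
    and weightT: "esup_norm (states A) (bweightT A) < \<infinity>"
    and weight: "\<And>t. t < hor A \<Longrightarrow> esup_norm (states A \<times> states A) (\<lambda>(x, x'). bweight A t x x') < \<infinity>"
    and adj: "\<And>t. t < hor A \<Longrightarrow> sup_norm (states A) (\<lambda>x. badj A t x / gam A (t + 1) x) < \<infinity>"
    and prob: "\<And>N. 1 \<le> N \<Longrightarrow> prob_space (P N)"
    and backward: "\<And>N. 1 \<le> N \<Longrightarrow> backward_system A N (P N) (bxi N) (bI N)"
begin

abbreviation "bw N \<equiv> bpw A (bxi N) (bI N)"
abbreviation "BH N t \<equiv> backward_history A N (P N) (bxi N) (bI N) t"

definition om :: "nat \<Rightarrow> nat \<Rightarrow> nat \<Rightarrow> 'w \<Rightarrow> real" where
  "om t N l w = enn2real (bw N t l w)"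

definition BB :: "nat \<Rightarrow> nat \<Rightarrow> ('a \<Rightarrow> real) \<Rightarrow> 'w \<Rightarrow> real" where
  "BB t N f w = (\<Sum>l\<in>{1..N}. om t N l w * f (bxi N t l w)) / real N"

lemma rhoT: "rhoT A \<in> borel_measurable L" "\<And>x. x \<in> space L \<Longrightarrow> 0 \<le> rhoT A x" "(\<integral>\<^sup>+ x. ennreal (rhoT A x) \<partial>L) = 1"
  and badj_meas: "t < T \<Longrightarrow> badj A t \<in> borel_measurable L" and badj_nonneg: "t < T \<Longrightarrow> x \<in> space L \<Longrightarrow> 0 \<le> badj A t x"
  and bprop: "t < T \<Longrightarrow> markov_density L (bprop A t)"
  using bdesign by (auto simp: valid_backward_design_def)

lemma system_step:
  assumes N: "1 \<le> N" and t: "t < T"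
  shows "cond_iid (P N) (BH N (Suc t)) N (NL N) (\<lambda>l w. (bI N t l w, bxi N t l w))
          (\<lambda>w. normalized_density (NL N)
             (\<lambda>(j, x). bw N (Suc t) j w *
                ennreal (badj A t (bxi N (Suc t) j w) / \<gamma> (Suc t) (bxi N (Suc t) j w) * bprop A t (bxi N (Suc t) j w) x)))"
    and "AE w in P N. 0 < (\<Sum>j\<in>{1..N}. bw N (Suc t) j w *
        ennreal (badj A t (bxi N (Suc t) j w) / \<gamma> (Suc t) (bxi N (Suc t) j w)))"
  using backward[OF N] t unfolding backward_system_def Suc_eq_plus1 by blast+

lemma pair_meas: "1 \<le> N \<Longrightarrow> l \<in> {1..N} \<Longrightarrow> t < T \<Longrightarrow> (\<lambda>w. (bI N t l w, bxi N t l w)) \<in> P N \<rightarrow>\<^sub>M NL N"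
  using system_step(1)[of N t] unfolding cond_iid_def by blast

lemma bxi_meas:
  assumes N: "1 \<le> N" and l: "l \<in> {1..N}" and t: "t \<le> T"
  shows "bxi N t l \<in> P N \<rightarrow>\<^sub>M L"
proof (cases "t = T")
  case True
  interpret prob_space "P N" by (rule prob[OF N])
  have "indep_vars (\<lambda>_. L) (bxi N T) {1..N}" using backward[OF N] unfolding backward_system_def by blast
  then show ?thesis using l True unfolding indep_vars_def by blast
next
  case False
  then have "t < T" using t by simp
  from measurable_compose[OF pair_meas[OF N l this] measurable_snd] show ?thesis by simp
qed

lemma bI_meas: "1 \<le> N \<Longrightarrow> l \<in> {1..N} \<Longrightarrow> t < T \<Longrightarrow> bI N t l \<in> P N \<rightarrow>\<^sub>M count_space {1..N}"
  using measurable_compose[OF pair_meas measurable_fst] by simp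

definition gens :: "nat \<Rightarrow> nat \<Rightarrow> 'w set set" where
  "gens N t = {bxi N u l -` B \<inter> space (P N) | u l B. t \<le> u \<and> u \<le> T \<and> l \<in> {1..N} \<and> B \<in> sets L} \<union>
      {bI N u l -` B \<inter> space (P N) | u l B. t \<le> u \<and> u < T \<and> l \<in> {1..N}}"

lemma BH_eq: "BH N t = sigma (space (P N)) (gens N t)"
  by (simp add: backward_history_def gens_def)

lemma gens_sets:
  assumes N: "1 \<le> N"
  shows "gens N t \<subseteq> sets (P N)"
proof -
  have "bxi N u l -` B \<inter> space (P N) \<in> sets (P N)" if "u \<le> T" "l \<in> {1..N}" "B \<in> sets L" for u l B
    using measurable_sets[OF bxi_meas[OF N that(2,1)] that(3)] .
  moreover have "bI N u l -` B \<inter> space (P N) \<in> sets (P N)" if "u < T" "l \<in> {1..N}" for u l B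
  proof -
    note m = bI_meas[OF N that(2,1)]
    have "bI N u l -` B \<inter> space (P N) = bI N u l -` (B \<inter> {1..N}) \<inter> space (P N)"
      using measurable_space[OF m] by auto
    then show ?thesis using measurable_sets[OF m, of "B \<inter> {1..N}"] by simp
  qed
  ultimately show ?thesis unfolding gens_def by blast
qed

lemma BH_sub: "1 \<le> N \<Longrightarrow> subalgebra (P N) (BH N t)"
  unfolding BH_eq by (rule sigma_subalgebra[OF gens_sets])

lemma bxi_BH:
  assumes N: "1 \<le> N" and l: "l \<in> {1..N}" and "t \<le> u" "u \<le> T"
  shows "bxi N u l \<in> BH N t \<rightarrow>\<^sub>M L"
  unfolding BH_eq
proof (rule sigma_measurable[OF gens_sets[OF N] bxi_meas[OF N l assms(4)]])
  show "bxi N u l -` B \<inter> space (P N) \<in> gens N t" if "B \<in> sets L" for B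
    unfolding gens_def using assms that by blast
qed

lemma bI_BH:
  assumes N: "1 \<le> N" and l: "l \<in> {1..N}" and "t \<le> u" "u < T"
  shows "bI N u l \<in> BH N t \<rightarrow>\<^sub>M count_space {1..N}"
  unfolding BH_eq
proof (rule sigma_measurable[OF gens_sets[OF N] bI_meas[OF N l assms(4)]])
  show "bI N u l -` B \<inter> space (P N) \<in> gens N t" for B
    unfolding gens_def using assms by blast
qed

lemma bweightT_meas: "bweightT A \<in> borel_measurable L"
proof -
  note [measurable] = g_meas[of T, simplified] rhoT(1) \<gamma>_meas[of T, simplified]
  show ?thesis unfolding bweightT_def[abs_def] by measurable
qed

lemma bweight_meas:
  assumes t: "t < T"
  shows "(\<lambda>z. bweight A t (snd z) (fst z)) \<in> borel_measurable (L \<Otimes>\<^sub>M L)"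
proof -
  have [measurable]: "g t \<in> borel_measurable L" "\<gamma> t \<in> borel_measurable L" using g_meas \<gamma>_meas t by simp_all
  note [measurable] = markov_densityD(1)[OF bprop[OF t]] badj_meas[OF t]
  show ?thesis unfolding bweight_def[abs_def] by measurable
qed

lemma bxi_space: "1 \<le> N \<Longrightarrow> l \<in> {1..N} \<Longrightarrow> t \<le> T \<Longrightarrow> w \<in> space (P N) \<Longrightarrow> bxi N t l w \<in> space L"
  using measurable_space[OF bxi_meas] .

lemma bI_space: "1 \<le> N \<Longrightarrow> l \<in> {1..N} \<Longrightarrow> t < T \<Longrightarrow> w \<in> space (P N) \<Longrightarrow> bI N t l w \<in> {1..N}"
  using measurable_space[OF bI_meas] by fastforce

lemma weight_bound:
  assumes t: "t \<le> T"
  shows "\<exists>C\<ge>0. \<forall>N\<ge>1. \<forall>l\<in>{1..N}. \<forall>w\<in>space (P N). bw N t l w \<le> ennreal C"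
proof (cases "t = T")
  case True
  obtain C where "0 \<le> C" "\<And>x. x \<in> space L \<Longrightarrow> bweightT A x \<le> ennreal C"
    by (rule esup_norm_bound[OF weightT]) auto
  then show ?thesis using True bxi_space[of _ _ T] by (intro exI[of _ C]) (simp add: bpw_def)
next
  case False
  then have t': "t < T" using t by simp
  obtain C where C: "0 \<le> C" "\<And>x. x \<in> space L \<times> space L \<Longrightarrow> (case x of (x, x') \<Rightarrow> bweight A t x x') \<le> ennreal C"
    by (rule esup_norm_bound[OF weight[OF t']]) auto
  have "bw N t l w \<le> ennreal C" if N: "1 \<le> N" and l: "l \<in> {1..N}" and w: "w \<in> space (P N)" for N l w
    using C(2)[of "(bxi N t l w, bxi N (t + 1) (bI N t l w) w)"] bxi_space[OF N bI_space[OF N l t' w], of "t + 1" w]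
      bxi_space[OF N l t w] w t' by (simp add: bpw_def)
  then show ?thesis using C(1) by blast
qed

lemma bpw_om: "1 \<le> N \<Longrightarrow> l \<in> {1..N} \<Longrightarrow> t \<le> T \<Longrightarrow> w \<in> space (P N) \<Longrightarrow> bw N t l w = ennreal (om t N l w)"
  using weight_bound[of t] enn2real_bound(2) unfolding om_def by metis

lemma om_nonneg: "0 \<le> om t N l w" by (simp add: om_def)

text \<open>Time runs downwards, so the parent of a particle at time u sits at u + 1, inside the
  history from t on. At the horizon there is no parent and the weight depends on the particle
  alone.\<close>

lemma bpw_BH:
  assumes N: "1 \<le> N" and l: "l \<in> {1..N}" and u: "t \<le> u" "u \<le> T"
  shows "bw N u l \<in> borel_measurable (BH N t)"
proof (cases "u = T")
  case True
  have "bw N u l = (\<lambda>w. bweightT A (bxi N u l w))" by (rule ext) (simp add: bpw_def True)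
  then show ?thesis using measurable_compose[OF bxi_BH[OF N l u] bweightT_meas] by (simp only:)
next
  case False
  have "(\<lambda>w. bxi N (u + 1) (bI N u l w) w) \<in> BH N t \<rightarrow>\<^sub>M L"
  proof (rule measurable_compose_countable'[where I="{1..N}" and f="\<lambda>i. bxi N (u + 1) i"])
    show "bxi N (u + 1) i \<in> BH N t \<rightarrow>\<^sub>M L" if "i \<in> {1..N}" for i using u False by (intro bxi_BH[OF N that]) auto
    show "bI N u l \<in> BH N t \<rightarrow>\<^sub>M count_space {1..N}" using u False by (intro bI_BH[OF N l]) auto
  qed simp
  from measurable_compose[OF measurable_Pair[OF this bxi_BH[OF N l u]] bweight_meas[of u]]
  have "(\<lambda>w. bweight A u (bxi N u l w) (bxi N (u + 1) (bI N u l w) w)) \<in> borel_measurable (BH N t)" using False u by simp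
  moreover have "bw N u l = (\<lambda>w. bweight A u (bxi N u l w) (bxi N (u + 1) (bI N u l w) w))"
    by (rule ext) (simp add: bpw_def False)
  ultimately show ?thesis by (simp only:)
qed

lemma om_BH: "1 \<le> N \<Longrightarrow> l \<in> {1..N} \<Longrightarrow> t \<le> u \<Longrightarrow> u \<le> T \<Longrightarrow> om u N l \<in> borel_measurable (BH N t)"
  unfolding om_def[abs_def] using bpw_BH by measurable

lemma base_T: "\<exists>c. emp_clt L P (BB T) c (backward_info A T) (\<lambda>f. c\<^sup>2 * bvar A T f)"
proof -
  define \<omega> where "\<omega> x = enn2real (bweightT A x)" for x
  define \<rho> where "\<rho> = density L (\<lambda>x. ennreal (rhoT A x))"
  obtain C where C: "0 \<le> C" "\<And>x. x \<in> space L \<Longrightarrow> bweightT A x \<le> ennreal C"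
    by (rule esup_norm_bound[OF weightT]) auto
  have \<omega>b: "bounded_fn L \<omega> C"
    unfolding bounded_fn_def \<omega>_def using C bweightT_meas enn2real_bound(1)[OF C(2) C(1)] by auto
  have \<omega>0: "0 \<le> \<omega> x" for x by (simp add: \<omega>_def)
  have gr: "g T x * \<gamma> T x = \<omega> x * rhoT A x" if x: "x \<in> space L" for x
    unfolding \<omega>_def bweightT_def
  \<comment> \<open>The initial proposal density may vanish; the finite bound on the weight then
    makes the target g \<gamma> vanish as well, so the change of measure loses no mass.\<close>
  proof (rule ennreal_quotient_real)
    show "0 \<le> g T x * \<gamma> T x" using g_pos[of T x] \<gamma>_pos[of T x] x by simp
    show "0 \<le> rhoT A x" by (rule rhoT(2)[OF x])
    show "ennreal (g T x * \<gamma> T x) / ennreal (rhoT A x) \<le> ennreal C" using C(2)[OF x] by (simp add: bweightT_def)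
  qed
  have dens: "(\<integral>x. f x \<partial>\<rho>) = (\<integral>x. rhoT A x * f x \<partial>L)" if f: "f \<in> borel_measurable L" for f :: "'a \<Rightarrow> real"
    unfolding \<rho>_def using f rhoT(1,2) by (subst integral_density) auto
  have chg: "(\<integral>x. \<omega> x * f x \<partial>\<rho>) = (\<integral>x. g T x * \<gamma> T x * f x \<partial>L)" if f: "f \<in> borel_measurable L" for f
    using f bounded_fnD(1)[OF \<omega>b] by (subst dens) (auto intro!: Bochner_Integration.integral_cong simp: gr)
  have chg1: "(\<integral>x. \<omega> x \<partial>\<rho>) = (\<integral>x. g T x * \<gamma> T x \<partial>L)" using chg[of "\<lambda>_. 1"] by simp
  have pos: "0 < (\<integral>x. \<omega> x \<partial>\<rho>)" using backward_info_T(2)[of "\<lambda>_. 0" 0] chg1 by (simp add: bounded_fn_def)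
  have target: "(\<integral>x. f x \<partial>backward_info A T) = (\<integral>x. \<omega> x * f x \<partial>\<rho>) / (\<integral>x. \<omega> x \<partial>\<rho>)" if "bounded_fn L f B" for f B
    using backward_info_T(1)[OF that] chg[OF bounded_fnD(1)[OF that]] chg1 by simp
  have ind: "prob_space.indep_vars (P N) (\<lambda>_. L) (\<lambda>l. bxi N T l) {1..N}"
    and law: "l \<in> {1..N} \<Longrightarrow> distr (P N) L (bxi N T l) = \<rho>" if "1 \<le> N" for N l
    using backward[OF that] unfolding backward_system_def distributed_def \<rho>_def by auto
  have \<rho>: "prob_space \<rho>" "sets \<rho> = sets L"
  proof -
    show "prob_space \<rho>"
      unfolding \<rho>_def using rhoT by (intro prob_spaceI) (simp add: emeasure_density cong: nn_integral_cong)
  qed (simp add: \<rho>_def)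
  have b: "emp_clt L P (\<lambda>N f w. (\<Sum>l\<in>{1..N}. \<omega> (bxi N T l w) * f (bxi N T l w)) / real N) (\<integral>x. \<omega> x \<partial>\<rho>) (backward_info A T)
      (\<lambda>f. \<integral>x. (\<omega> x)\<^sup>2 * (f x)\<^sup>2 \<partial>\<rho>)"
    by (rule initial_step(1)[where \<xi>="\<lambda>N l. bxi N T l" and \<omega>=\<omega>, OF prob \<rho> ind law \<omega>b \<omega>0 pos backward_info_prob[of T] sets_backward_info]) (use target in auto)
  have BB: "(\<lambda>N f w. (\<Sum>l\<in>{1..N}. \<omega> (bxi N T l w) * f (bxi N T l w)) / real N) = BB T"
    by (intro ext) (simp add: BB_def om_def bpw_def \<omega>_def)
  have V: "(\<integral>x. (\<omega> x)\<^sup>2 * (f x)\<^sup>2 \<partial>\<rho>) = (\<integral>x. \<omega> x \<partial>\<rho>)\<^sup>2 * bvar A T f" if f: "bounded_fn L f B" for f B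
  proof -
    have "(\<integral>x. (\<omega> x)\<^sup>2 * (f x)\<^sup>2 \<partial>\<rho>) = (\<integral>x. rhoT A x * (\<omega> x)\<^sup>2 * (f x)\<^sup>2 \<partial>L)"
      using bounded_fnD(1)[OF f] bounded_fnD(1)[OF \<omega>b] by (subst dens) (auto simp: mult.assoc)
    moreover have "(\<integral>x. \<omega> x \<partial>\<rho>) = (\<integral>x. rhoT A x * \<omega> x \<partial>L)" using bounded_fnD(1)[OF \<omega>b] by (rule dens)
    ultimately show ?thesis using pos by (subst bvar.simps) (simp add: \<omega>_def[abs_def])
  qed
  have "emp_clt L P (BB T) (\<integral>x. \<omega> x \<partial>\<rho>) (backward_info A T) (\<lambda>f. (\<integral>x. \<omega> x \<partial>\<rho>)\<^sup>2 * bvar A T f)"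
    by (rule emp_clt_cong[OF b BB V])
  then show ?thesis by blast
qed

text \<open>The adjustment multiplier in selection is the adjustment function divided by the
  artificial density at the parent, matching the same division in \<open>bkernel\<close>. With this
  choice, kernel = weight times multiplier times proposal.\<close>

lemma induction_step:
  assumes t: "t < T" and clt: "emp_clt L P (BB (Suc t)) c (backward_info A (Suc t)) (\<lambda>f. c\<^sup>2 * bvar A (Suc t) f)"
  shows "\<exists>c. emp_clt L P (BB t) c (backward_info A t) (\<lambda>f. c\<^sup>2 * bvar A t f)"
proof -
  have t1: "Suc t \<le> T" using t by simp
  \<comment> \<open>The parent y is placed first, as in the abstract step, whereas
    \<open>bweight\<close> and \<open>bkernel\<close> take the new, earlier state first.\<close>
  define \<omega> where "\<omega> y x = enn2real (bweight A t x y)" for y x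
  define \<theta> where "\<theta> y = badj A t y / \<gamma> (Suc t) y" for y
  obtain CW where CW: "0 \<le> CW" "\<And>x. x \<in> space L \<times> space L \<Longrightarrow> (case x of (x, x') \<Rightarrow> bweight A t x x') \<le> ennreal CW"
    by (rule esup_norm_bound[OF weight[OF t]]) auto
  have CW': "bweight A t x y \<le> ennreal CW" if "y \<in> space L" "x \<in> space L" for y x using CW(2)[of "(x, y)"] that by simp
  obtain B\<theta> where B\<theta>: "0 \<le> B\<theta>" "\<And>x. x \<in> space L \<Longrightarrow> \<bar>badj A t x / \<gamma> (t + 1) x\<bar> \<le> B\<theta>"
    by (rule sup_norm_bound[OF adj[OF t]]) auto
  have \<theta>0: "0 \<le> \<theta> y" if "y \<in> space L" for y
    using badj_nonneg[OF t that] \<gamma>_pos[OF t1 that] by (simp add: \<theta>_def)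
  have \<theta>b: "bounded_fn L \<theta> B\<theta>"
    unfolding bounded_fn_def \<theta>_def[abs_def] using badj_meas[OF t] \<gamma>_meas[OF t1] B\<theta> by simp
  note bp = markov_densityD[OF bprop[OF t]]
  have \<omega>B: "\<omega> y x \<le> CW" if "y \<in> space L" "x \<in> space L" for y x
    unfolding \<omega>_def using CW'[OF that] CW(1) by (rule enn2real_bound(1))
  have \<kappa>: "bkernel A t x y = \<omega> y x * (\<theta> y * bprop A t y x)" if y: "y \<in> space L" and x: "x \<in> space L" for y x
  proof -
    have "\<gamma> t x * g t x * q x y = \<omega> y x * (badj A t y * bprop A t y x)"
      unfolding \<omega>_def bweight_def
    proof (rule ennreal_quotient_real)
      show "0 \<le> \<gamma> t x * g t x * q x y" using q_nonneg[OF x y] g_pos[of t x] \<gamma>_pos[of t x] t x by simp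
      show "0 \<le> badj A t y * bprop A t y x" using badj_nonneg[OF t y] bp(2)[OF y x] by simp
      show "ennreal (\<gamma> t x * g t x * q x y) / ennreal (badj A t y * bprop A t y x) \<le> ennreal CW"
        using CW'[OF y x] by (simp add: bweight_def)
    qed
    then show ?thesis by (simp add: bkernel_def \<theta>_def)
  qed
  \<comment> \<open>In this direction the kernel is not a transition density. Its mass is controlled
    through the factorisation: weight at most CW, multiplier at most B\<theta>, and a proposal of
    mass one.\<close>
  have mass: "(\<integral>\<^sup>+ x. ennreal (bkernel A t x y) \<partial>L) \<le> ennreal (CW * B\<theta>)" if y: "y \<in> space L" for y
  proof -
    have "(\<integral>\<^sup>+ x. ennreal (bkernel A t x y) \<partial>L) \<le> (\<integral>\<^sup>+ x. ennreal (CW * B\<theta>) * ennreal (bprop A t y x) \<partial>L)"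
    proof (rule nn_integral_mono)
      fix x assume x: "x \<in> space L"
      have "bkernel A t x y \<le> CW * (B\<theta> * bprop A t y x)"
        unfolding \<kappa>[OF y x] using \<omega>B[OF y x] \<theta>0[OF y] bp(2)[OF y x] CW(1) B\<theta>(1) bounded_fnD(3)[OF \<theta>b y] by (intro mult_mono) auto
      then show "ennreal (bkernel A t x y) \<le> ennreal (CW * B\<theta>) * ennreal (bprop A t y x)"
        using CW(1) B\<theta>(1) bp(2)[OF y x] by (simp add: ennreal_mult'[symmetric] mult.assoc ennreal_leI)
    qed
    also have "\<dots> = ennreal (CW * B\<theta>)"
      using bp(3)[OF y] measurable_compose[OF measurable_Pair1'[OF y] bp(1)] by (subst nn_integral_cmult) auto
    finally show ?thesis .
  qed
  note st = backward_info_step[OF t mass, simplified]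
  interpret st: mixture_step L L P "\<lambda>N. BH N (Suc t)" "BB (Suc t)" c "backward_info A (Suc t)" "\<lambda>f. c\<^sup>2 * bvar A (Suc t) f"
    "\<lambda>N. {1..N}" "\<lambda>N. om (Suc t) N" "\<lambda>N. bxi N (Suc t)" real "\<lambda>N. NL N" "\<lambda>N. Pair" fst snd
    "\<lambda>N l w. (bI N t l w, bxi N t l w)" \<theta> "bprop A t" \<omega> "\<lambda>y x. bkernel A t x y" B\<theta> CW "backward_info A t"
  proof (rule mixture_step.intro)
    show "prob_space (P N)" if "1 \<le> N" for N by (rule prob[OF that])
    show "subalgebra (P N) (BH N (Suc t))" if "1 \<le> N" for N by (rule BH_sub[OF that])
    show "emp_clt L P (BB (Suc t)) c (backward_info A (Suc t)) (\<lambda>f. c\<^sup>2 * bvar A (Suc t) f)" by (rule clt)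
    show "BB (Suc t) N f w = (\<Sum>j\<in>{1..N}. om (Suc t) N j w * f (bxi N (Suc t) j w)) / real N" for N f w by (simp add: BB_def)
    show "0 < real N" if "1 \<le> N" for N using that by simp
    show "sigma_finite_measure L" by (rule sigma_finite_L)
    show "indexed_base (NL N) L {1..N} Pair" for N :: nat by (rule indexed_base_single[OF sigma_finite_L]) simp
    show "sigma_finite_measure (NL N)" for N :: nat by (rule sigma_finite_count_pair[OF sigma_finite_L]) simp
    show "space (NL N) \<noteq> {}" if "1 \<le> N" for N :: nat
      using that prob_space.not_empty[OF ini(1)] space_ini by (auto simp: space_pair_measure)
    show "om (Suc t) N j \<in> borel_measurable (BH N (Suc t))" if "1 \<le> N" "j \<in> {1..N}" for N j using om_BH[OF that order_refl t1] .
    show "0 \<le> om (Suc t) N j w" for N j w by (rule om_nonneg)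
    show "bxi N (Suc t) j \<in> BH N (Suc t) \<rightarrow>\<^sub>M L" if "1 \<le> N" "j \<in> {1..N}" for N j using bxi_BH[OF that order_refl t1] .
    show "fst \<in> NL N \<rightarrow>\<^sub>M count_space {1..N}" "snd \<in> NL N \<rightarrow>\<^sub>M L" for N by simp_all
    show "bounded_fn L \<theta> B\<theta>" by (rule \<theta>b)
    show "0 \<le> \<theta> y" if "y \<in> space L" for y by (rule \<theta>0[OF that])
    show "(\<lambda>z. bprop A t (fst z) (snd z)) \<in> borel_measurable (L \<Otimes>\<^sub>M L)" by (rule bp(1))
    show "0 \<le> bprop A t y x" if "y \<in> space L" "x \<in> space L" for y x by (rule bp(2)[OF that])
    show "(\<integral>\<^sup>+ x. ennreal (bprop A t y x) \<partial>L) = 1" if "y \<in> space L" for y by (rule bp(3)[OF that])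
    show "(\<lambda>z. \<omega> (fst z) (snd z)) \<in> borel_measurable (L \<Otimes>\<^sub>M L)" unfolding \<omega>_def using bweight_meas[OF t] by measurable
    show "0 \<le> \<omega> y x" for y x by (simp add: \<omega>_def)
    show "\<omega> y x \<le> CW" if "y \<in> space L" "x \<in> space L" for y x by (rule \<omega>B[OF that])
    show "0 \<le> CW" by (rule CW(1))
    show "bkernel A t x y = \<omega> y x * (\<theta> y * bprop A t y x)" if "y \<in> space L" "x \<in> space L" for y x by (rule \<kappa>[OF that])
    show "cond_iid (P N) (BH N (Suc t)) N (NL N) (\<lambda>l w. (bI N t l w, bxi N t l w))
        (\<lambda>w. normalized_density (NL N)
          (\<lambda>z. ennreal (om (Suc t) N (fst z) w * (\<theta> (bxi N (Suc t) (fst z) w) * bprop A t (bxi N (Suc t) (fst z) w) (snd z)))))"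
      if N: "1 \<le> N" for N
    proof (rule cond_iid_cong_AE[OF system_step(1)[OF N t]], rule AE_I2, rule normalized_density_cong)
      fix w z assume w: "w \<in> space (P N)" and "z \<in> space (NL N)"
      then obtain i x where z: "z = (i, x)" "i \<in> {1..N}" by (auto simp: space_pair_measure)
      show "(case z of (j, x) \<Rightarrow> bw N (Suc t) j w *
           ennreal (badj A t (bxi N (Suc t) j w) / \<gamma> (Suc t) (bxi N (Suc t) j w) * bprop A t (bxi N (Suc t) j w) x))
        = ennreal (om (Suc t) N (fst z) w * (\<theta> (bxi N (Suc t) (fst z) w) * bprop A t (bxi N (Suc t) (fst z) w) (snd z)))"
        using bpw_om[OF N z(2) t1 w] om_nonneg by (simp add: z ennreal_mult'[symmetric] \<theta>_def)
    qed
    show "AE w in P N. 0 < (\<Sum>j\<in>{1..N}. om (Suc t) N j w * \<theta> (bxi N (Suc t) j w))" if N: "1 \<le> N" for N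
      using system_step(2)[OF N t] AE_space
    proof eventually_elim
      case (elim w)
      have "(\<Sum>j\<in>{1..N}. bw N (Suc t) j w * ennreal (badj A t (bxi N (Suc t) j w) / \<gamma> (Suc t) (bxi N (Suc t) j w)))
          = (\<Sum>j\<in>{1..N}. ennreal (om (Suc t) N j w * \<theta> (bxi N (Suc t) j w)))"
        using bpw_om[OF N _ t1 elim(2)] om_nonneg by (intro sum.cong refl) (simp add: ennreal_mult'[symmetric] \<theta>_def)
      also have "\<dots> = ennreal (\<Sum>j\<in>{1..N}. om (Suc t) N j w * \<theta> (bxi N (Suc t) j w))"
        using om_nonneg \<theta>0[OF bxi_space[OF N _ t1 elim(2)]] by (intro sum_ennreal mult_nonneg_nonneg)
      finally show ?case using elim(1) by simp
    qed
    show "prob_space (backward_info A t)" using t by (intro backward_info_prob) simp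
    show "sets (backward_info A t) = sets L" by simp
    show "0 < (\<integral>y. (\<integral>x. bkernel A t x y \<partial>L) \<partial>backward_info A (Suc t))" by (rule st(1))
    show "(\<integral>x. f x \<partial>backward_info A t) = (\<integral>y. (\<integral>x. bkernel A t x y * f x \<partial>L) \<partial>backward_info A (Suc t)) / (\<integral>y. (\<integral>x. bkernel A t x y \<partial>L) \<partial>backward_info A (Suc t))"
      if "bounded_fn L f B" for f B by (rule st(2)[OF that])
  qed simp_all
  have BB: "st.step.A' = BB t"
    using t by (intro ext) (simp add: st.step.A'_def BB_def st.W_def \<omega>_def om_def bpw_def)
  have c: "c \<noteq> 0" using st.c by simp
  have V: "st.step.V' f = st.c'\<^sup>2 * bvar A t f" for f
  proof -
    have k2: "st.k2 f = (\<lambda>y. \<integral>x. enn2real (bweight A t x y) * bkernel A t x y * (f x)\<^sup>2 \<partial>L)"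
      by (rule ext) (simp add: st.k2_def \<omega>_def mult.assoc)
    have k: "st.k f = (\<lambda>y. \<integral>x. bkernel A t x y * f x \<partial>L)" by (rule ext) (simp add: st.k_def)
    have d: "(\<integral>y. \<theta> y \<partial>backward_info A (Suc t)) \<noteq> 0" using st.\<theta>pos by simp
    have u: "(\<integral>y. (\<integral>x. bkernel A t x y \<partial>L) \<partial>backward_info A (Suc t)) \<noteq> 0" using st(1) by simp
    have bv: "bvar A t f = (bvar A (Suc t) (st.k f) + (\<integral>y. st.k2 f y \<partial>backward_info A (Suc t)) * (\<integral>y. \<theta> y \<partial>backward_info A (Suc t))) /
        (\<integral>y. (\<integral>x. bkernel A t x y \<partial>L) \<partial>backward_info A (Suc t))\<^sup>2"
      using t by (subst bvar.simps) (simp add: k2 k \<theta>_def[abs_def])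
    show ?thesis
      unfolding bv using c d u by (simp add: st.step.V'_def st.c'_def power_divide power_mult_distrib) (simp add: field_simps power2_eq_square)
  qed
  have "emp_clt L P (BB t) st.c' (backward_info A t) (\<lambda>f. st.c'\<^sup>2 * bvar A t f)"
    by (rule emp_clt_cong[OF st.step.clt BB V])
  then show ?thesis by blast
qed

theorem backward_clt:
  assumes "t \<le> T"
  shows "\<exists>c. emp_clt L P (BB t) c (backward_info A t) (\<lambda>f. c\<^sup>2 * bvar A t f)"
  using assms
proof (induction rule: inc_induct)
  case base
  show ?case by (rule base_T)
next
  case (step t)
  then show ?case using induction_step by blast
qed

end

lemma ennreal_weight_product:
  assumes "0 \<le> a" "0 \<le> t" "0 \<le> b" "0 < c"
  shows "ennreal a * ennreal t * ennreal b / ennreal c = ennreal (a * b * (t / c))"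
proof -
  have "ennreal a * ennreal t * ennreal b / ennreal c = ennreal (a * t * b / c)"
    using assms by (simp add: ennreal_mult'[symmetric] divide_ennreal)
  then show ?thesis by (simp add: mult_ac)
qed

section \<open>The two-filter sampler\<close>

locale two_filter_particles = filter_model A + fwd: forward_particles A P xi I + bwd: backward_particles A P bxi bI
  for A :: "'a two_filter" and P :: "nat \<Rightarrow> 'w measure" and xi bxi I bI +
  fixes s :: nat and tI tJ :: "nat \<Rightarrow> nat \<Rightarrow> 'w \<Rightarrow> nat" and txi :: "nat \<Rightarrow> nat \<Rightarrow> 'w \<Rightarrow> 'a"
  assumes tdesign: "valid_two_filter_design A"
    and s: "1 \<le> s" "s < hor A"
    and tadj_fin: "sup_norm (states A \<times> states A) (\<lambda>(x, x'). tadj A s x x' * inverse (gam A (s + 1) x')) < \<infinity>"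
    and tweight_fin: "esup_norm (states A \<times> states A \<times> states A) (\<lambda>(x, x', x''). tweight A s x x' x'') < \<infinity>"
    and indep: "\<And>N. 1 \<le> N \<Longrightarrow> prob_space.indep_set (P N)
          (sets (forward_history A N (P N) (xi N) (I N) (hor A + 1))) (sets (backward_history A N (P N) (bxi N) (bI N) 0))"
    and sample: "\<And>N. 1 \<le> N \<Longrightarrow> two_filter_sample A N (P N) (xi N) (I N) (bxi N) (bI N) s (tI N) (tJ N) (txi N)"
begin

abbreviation "ew N \<equiv> tpw A (xi N) (bxi N) s (tI N) (tJ N) (txi N)"
abbreviation "SH N \<equiv> sampling_history A N (P N) (xi N) (I N) (bxi N) (bI N) s"

definition gens :: "nat \<Rightarrow> 'w set set" where
  "gens N = {xi N u l -` B \<inter> space (P N) | u l B. u < s \<and> l \<in> {1..N} \<and> B \<in> sets L} \<union>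
      {fwd.fw N u l -` B \<inter> space (P N) | u l B. u < s \<and> l \<in> {1..N} \<and> B \<in> sets borel} \<union>
      {bxi N u l -` B \<inter> space (P N) | u l B. s < u \<and> u \<le> T \<and> l \<in> {1..N} \<and> B \<in> sets L} \<union>
      {bwd.bw N u l -` B \<inter> space (P N) | u l B. s < u \<and> u \<le> T \<and> l \<in> {1..N} \<and> B \<in> sets borel}"

lemma SH_eq: "SH N = sigma (space (P N)) (gens N)"
  by (simp add: sampling_history_def gens_def)

lemma fpw_meas: "1 \<le> N \<Longrightarrow> l \<in> {1..N} \<Longrightarrow> u < s \<Longrightarrow> fwd.fw N u l \<in> borel_measurable (P N)"
  using measurable_from_subalg[OF fwd.FH_sub[of N "Suc T"] fwd.fpw_FH[of N l u "Suc T"]] s by simp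

lemma bpw_meas: "1 \<le> N \<Longrightarrow> l \<in> {1..N} \<Longrightarrow> u \<le> T \<Longrightarrow> bwd.bw N u l \<in> borel_measurable (P N)"
  using measurable_from_subalg[OF bwd.BH_sub[of N 0] bwd.bpw_BH[of N l 0 u]] by simp

lemma gens_sets:
  assumes N: "1 \<le> N"
  shows "gens N \<subseteq> sets (P N)"
  unfolding gens_def
  using measurable_sets[OF fwd.xi_meas[OF N]] measurable_sets[OF fpw_meas[OF N]] measurable_sets[OF bwd.bxi_meas[OF N]]
    measurable_sets[OF bpw_meas[OF N]] s by fastforce

lemma SH_sub: "1 \<le> N \<Longrightarrow> subalgebra (P N) (SH N)"
  unfolding SH_eq by (rule sigma_subalgebra[OF gens_sets])

text \<open>The \<sigma>-field used for drawing the triples is generated by particles and weights,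
  without the ancestor indices of the filters. Measurability of the weights therefore comes directly
  from their being generators and not from their formula.\<close>

lemma sampling_history_measurable:
  assumes N: "1 \<le> N" and l: "l \<in> {1..N}"
  shows "xi N (s - 1) l \<in> SH N \<rightarrow>\<^sub>M L" "bxi N (s + 1) l \<in> SH N \<rightarrow>\<^sub>M L"
    "fwd.om (s - 1) N l \<in> borel_measurable (SH N)" "bwd.om (s + 1) N l \<in> borel_measurable (SH N)"
proof -
  have u: "s - 1 < s" "s < s + 1" "s + 1 \<le> T" "s - 1 \<le> T" using s by auto
  note sm = sigma_measurable[OF gens_sets[OF N], folded SH_eq]
  show "xi N (s - 1) l \<in> SH N \<rightarrow>\<^sub>M L"
    using u l by (intro sm fwd.xi_meas[OF N l]) (auto simp: gens_def)
  show "bxi N (s + 1) l \<in> SH N \<rightarrow>\<^sub>M L"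
    using u l by (intro sm bwd.bxi_meas[OF N l]) (auto simp: gens_def)
  have "fwd.fw N (s - 1) l \<in> borel_measurable (SH N)"
    using u l by (intro sm fpw_meas[OF N l]) (auto simp: gens_def)
  then show "fwd.om (s - 1) N l \<in> borel_measurable (SH N)" unfolding fwd.om_def[abs_def] by measurable
  have "bwd.bw N (s + 1) l \<in> borel_measurable (SH N)"
    using u l by (intro sm bpw_meas[OF N l]) (auto simp: gens_def)
  then show "bwd.om (s + 1) N l \<in> borel_measurable (SH N)" unfolding bwd.om_def[abs_def] by measurable
qed

lemma tadj_meas: "(\<lambda>y. tadj A s (fst y) (snd y)) \<in> borel_measurable (L \<Otimes>\<^sub>M L)"
  and tadj_nonneg: "x \<in> space L \<Longrightarrow> x' \<in> space L \<Longrightarrow> 0 \<le> tadj A s x x'"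
  and tprop_nonneg: "x \<in> space L \<Longrightarrow> x' \<in> space L \<Longrightarrow> z \<in> space L \<Longrightarrow> 0 \<le> tprop A s x x' z"
  and tprop_mass: "x \<in> space L \<Longrightarrow> x' \<in> space L \<Longrightarrow> (\<integral>\<^sup>+ z. ennreal (tprop A s x x' z) \<partial>L) = 1"
  and tprop_meas: "(\<lambda>y. tprop A s (fst (fst y)) (snd (fst y)) (snd y)) \<in> borel_measurable ((L \<Otimes>\<^sub>M L) \<Otimes>\<^sub>M L)"
proof -
  have d: "(\<lambda>(x, x'). tadj A s x x') \<in> borel_measurable (L \<Otimes>\<^sub>M L)" "\<forall>x\<in>space L. \<forall>x'\<in>space L. 0 \<le> tadj A s x x'"
    "(\<lambda>(x, x', x''). tprop A s x x' x'') \<in> borel_measurable (L \<Otimes>\<^sub>M L \<Otimes>\<^sub>M L)"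
    "\<forall>x\<in>space L. \<forall>x'\<in>space L. (\<forall>x''\<in>space L. 0 \<le> tprop A s x x' x'') \<and> (\<integral>\<^sup>+ x''. ennreal (tprop A s x x' x'') \<partial>L) = 1"
    using tdesign s unfolding valid_two_filter_design_def by blast+
  show "(\<lambda>y. tadj A s (fst y) (snd y)) \<in> borel_measurable (L \<Otimes>\<^sub>M L)" using d(1) by (simp add: case_prod_beta')
  have m: "(\<lambda>y. (fst (fst y), snd (fst y), snd y)) \<in> (L \<Otimes>\<^sub>M L) \<Otimes>\<^sub>M L \<rightarrow>\<^sub>M L \<Otimes>\<^sub>M L \<Otimes>\<^sub>M L" by measurable
  show "(\<lambda>y. tprop A s (fst (fst y)) (snd (fst y)) (snd y)) \<in> borel_measurable ((L \<Otimes>\<^sub>M L) \<Otimes>\<^sub>M L)"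
    using measurable_compose[OF m d(3)] by simp
  show "x \<in> space L \<Longrightarrow> x' \<in> space L \<Longrightarrow> 0 \<le> tadj A s x x'"
    "x \<in> space L \<Longrightarrow> x' \<in> space L \<Longrightarrow> z \<in> space L \<Longrightarrow> 0 \<le> tprop A s x x' z"
    "x \<in> space L \<Longrightarrow> x' \<in> space L \<Longrightarrow> (\<integral>\<^sup>+ z. ennreal (tprop A s x x' z) \<partial>L) = 1" using d(2,4) by blast+
qed

lemma tweight_meas: "(\<lambda>y. tweight A s (fst (fst y)) (snd (fst y)) (snd y)) \<in> borel_measurable ((L \<Otimes>\<^sub>M L) \<Otimes>\<^sub>M L)"
proof -
  have [measurable]: "g s \<in> borel_measurable L" using g_meas s by simp
  note [measurable] = tprop_meas measurable_compose[OF measurable_fst tadj_meas, of L]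
  show ?thesis unfolding tweight_def q2_def by measurable
qed

definition \<theta> :: "'a \<times> 'a \<Rightarrow> real" where
  "\<theta> y = tadj A s (fst y) (snd y) / \<gamma> (s + 1) (snd y)"

definition \<omega> :: "'a \<times> 'a \<Rightarrow> 'a \<Rightarrow> real" where
  "\<omega> y z = enn2real (tweight A s (fst y) (snd y) z)"

abbreviation "pr y z \<equiv> tprop A s (fst y) (snd y) z"

lemma \<theta>_nonneg: "y \<in> space (L \<Otimes>\<^sub>M L) \<Longrightarrow> 0 \<le> \<theta> y"
  unfolding \<theta>_def using tadj_nonneg \<gamma>_pos[of "s + 1"] s by (auto simp: space_pair_measure less_imp_le)

lemma \<theta>_bounded: obtains B where "bounded_fn (L \<Otimes>\<^sub>M L) \<theta> B"
proof -
  obtain B where B: "0 \<le> B" "\<And>y. y \<in> space L \<times> space L \<Longrightarrow> \<bar>case y of (x, x') \<Rightarrow> tadj A s x x' * inverse (\<gamma> (s + 1) x')\<bar> \<le> B"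
    by (rule sup_norm_bound[OF tadj_fin]) auto
  have [measurable]: "\<gamma> (s + 1) \<in> borel_measurable L" using \<gamma>_meas s by simp
  have "\<theta> \<in> borel_measurable (L \<Otimes>\<^sub>M L)" unfolding \<theta>_def[abs_def] using tadj_meas by measurable
  moreover have "\<bar>\<theta> y\<bar> \<le> B" if "y \<in> space (L \<Otimes>\<^sub>M L)" for y
    using B(2)[of y] that by (cases y) (simp add: \<theta>_def space_pair_measure divide_inverse)
  ultimately show ?thesis using B(1) by (intro that[of B]) (simp add: bounded_fn_def)
qed

lemma \<omega>_bounded: obtains C where "0 \<le> C"
    "\<And>y z. y \<in> space (L \<Otimes>\<^sub>M L) \<Longrightarrow> z \<in> space L \<Longrightarrow> tweight A s (fst y) (snd y) z \<le> ennreal C"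
proof -
  obtain C where C: "0 \<le> C" "\<And>y. y \<in> space L \<times> space L \<times> space L \<Longrightarrow> (case y of (x, x', x'') \<Rightarrow> tweight A s x x' x'') \<le> ennreal C"
    by (rule esup_norm_bound[OF tweight_fin]) auto
  show ?thesis
  proof (rule that[OF C(1)])
    fix y z assume "y \<in> space (L \<Otimes>\<^sub>M L)" "z \<in> space L"
    then show "tweight A s (fst y) (snd y) z \<le> ennreal C" using C(2)[of "(fst y, snd y, z)"] by (auto simp: space_pair_measure)
  qed
qed

text \<open>The importance weighting identity for the bridge, divided on both sides by the
  artificial density. This division turns the adjustment function into the selection multiplier
  \<theta>.\<close>

lemma kernel_factor:
  assumes y: "y \<in> space (L \<Otimes>\<^sub>M L)" and z: "z \<in> space L"
  shows "pair_kernel s (y, z) = \<omega> y z * (\<theta> y * pr y z)"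
proof -
  obtain C where C: "0 \<le> C" "\<And>y z. y \<in> space (L \<Otimes>\<^sub>M L) \<Longrightarrow> z \<in> space L \<Longrightarrow> tweight A s (fst y) (snd y) z \<le> ennreal C"
    using \<omega>_bounded by metis
  have y': "fst y \<in> space L" "snd y \<in> space L" using y by (auto simp: space_pair_measure)
  have "q2 A (fst y) (snd y) z * g s z = \<omega> y z * (tadj A s (fst y) (snd y) * pr y z)"
    unfolding \<omega>_def tweight_def
  proof (rule ennreal_quotient_real)
    show "0 \<le> q2 A (fst y) (snd y) z * g s z"
      using q_nonneg[OF y'(1) z] q_nonneg[OF z y'(2)] g_pos[of s z] s z by (simp add: q2_def)
    show "0 \<le> tadj A s (fst y) (snd y) * pr y z" using tadj_nonneg[OF y'] tprop_nonneg[OF y' z] by simp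
    show "ennreal (q2 A (fst y) (snd y) z * g s z) / ennreal (tadj A s (fst y) (snd y) * pr y z) \<le> ennreal C"
      using C(2)[OF y z] by (simp add: tweight_def)
  qed
  then show ?thesis by (simp add: pair_kernel_def \<theta>_def case_prod_beta')
qed

text \<open>The factorisation bounds the mass of the bridge kernel by the product of the bounds on
  weight and multiplier, the proposal having mass one. This is the finiteness that the
  representation of the smoothing law asks for.\<close>

lemma kernel_mass: "\<exists>C. \<forall>y\<in>space (L \<Otimes>\<^sub>M L). (\<integral>\<^sup>+ z. ennreal (pair_kernel s (y, z)) \<partial>L) \<le> ennreal C"
proof -
  obtain B where B: "bounded_fn (L \<Otimes>\<^sub>M L) \<theta> B" by (rule \<theta>_bounded)
  obtain C where C: "0 \<le> C" "\<And>y z. y \<in> space (L \<Otimes>\<^sub>M L) \<Longrightarrow> z \<in> space L \<Longrightarrow> tweight A s (fst y) (snd y) z \<le> ennreal C"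
    using \<omega>_bounded by metis
  have B0: "0 \<le> B" by (rule bounded_fnD(2)[OF B])
  have "(\<integral>\<^sup>+ z. ennreal (pair_kernel s (y, z)) \<partial>L) \<le> ennreal (C * B)" if y: "y \<in> space (L \<Otimes>\<^sub>M L)" for y
  proof -
    have y': "fst y \<in> space L" "snd y \<in> space L" using y by (auto simp: space_pair_measure)
    have "(\<integral>\<^sup>+ z. ennreal (pair_kernel s (y, z)) \<partial>L) \<le> (\<integral>\<^sup>+ z. ennreal (C * B) * ennreal (pr y z) \<partial>L)"
    proof (rule nn_integral_mono)
      fix z assume z: "z \<in> space L"
      have "\<omega> y z \<le> C" unfolding \<omega>_def using C(2)[OF y z] C(1) by (rule enn2real_bound(1))
      then have "pair_kernel s (y, z) \<le> C * (B * pr y z)"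
        unfolding kernel_factor[OF y z] using \<theta>_nonneg[OF y] tprop_nonneg[OF y' z] C(1) B0 bounded_fnD(3)[OF B y] by (intro mult_mono) auto
      then show "ennreal (pair_kernel s (y, z)) \<le> ennreal (C * B) * ennreal (pr y z)"
        using C(1) B0 tprop_nonneg[OF y' z] by (simp add: ennreal_mult'[symmetric] mult.assoc ennreal_leI)
    qed
    also have "\<dots> = ennreal (C * B)"
      using tprop_mass[OF y'] measurable_compose[OF measurable_Pair1'[OF y] tprop_meas] by (subst nn_integral_cmult) auto
    finally show ?thesis .
  qed
  then show ?thesis by blast
qed

definition TT :: "nat \<Rightarrow> ('a \<Rightarrow> real) \<Rightarrow> 'w \<Rightarrow> real" where
  "TT N f w = (\<Sum>l\<in>{1..N}. enn2real (ew N l w) * f (txi N l w)) / real N"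

lemma sample_meas: "1 \<le> N \<Longrightarrow> l \<in> {1..N} \<Longrightarrow>
    (\<lambda>w. (tI N l w, tJ N l w, txi N l w)) \<in> P N \<rightarrow>\<^sub>M NNL N"
  using sample[of N] unfolding two_filter_sample_def cond_iid_def by blast

lemma sampling_density:
  assumes N: "1 \<le> N" and ij: "i \<in> {1..N}" "j \<in> {1..N}" and w: "w \<in> space (P N)"
  shows "fwd.fw N (s - 1) i w * ennreal (tadj A s (xi N (s - 1) i w) (bxi N (s + 1) j w)) *
           bwd.bw N (s + 1) j w / ennreal (\<gamma> (s + 1) (bxi N (s + 1) j w))
         = ennreal (fwd.om (s - 1) N i w * bwd.om (s + 1) N j w * \<theta> (xi N (s - 1) i w, bxi N (s + 1) j w))"
proof -
  have u: "s - 1 \<le> T" "s + 1 \<le> T" using s by auto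
  note x = fwd.xi_space[OF N ij(1) u(1) w] bwd.bxi_space[OF N ij(2) u(2) w]
  show ?thesis
    unfolding fwd.fpw_om[OF N ij(1) u(1) w] bwd.bpw_om[OF N ij(2) u(2) w]
    using ennreal_weight_product[OF fwd.om_nonneg tadj_nonneg[OF x] bwd.om_nonneg \<gamma>_pos[OF u(2) x(2)]]
    by (simp only: \<theta>_def fst_conv snd_conv)
qed

text \<open>Constant and variance are existentially quantified because only V / c^2 survives in a
  self-normalised estimator, and this quotient is free of the unknown constants of the two
  filters.\<close>

theorem two_filter_clt:
  shows "\<exists>c V. emp_clt L P TT c (smoothing A s T) V \<and> (\<forall>f. V f / c\<^sup>2 = Upsilon A s f)"
proof -
  have u: "s - 1 \<le> T" "s + 1 \<le> T" "Suc (s - 1) = s" using s by auto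
  obtain c1 where c1: "emp_clt L P (fwd.AA (s - 1)) c1 (filtering A (s - 1)) (\<lambda>f. c1\<^sup>2 * fvar A (s - 1) f)"
    "emp_L1 L P (fwd.AA (s - 1)) c1 (filtering A (s - 1))"
    using fwd.forward_clt[OF u(1)] by blast
  obtain c2 where c2: "emp_clt L P (bwd.BB (s + 1)) c2 (backward_info A (s + 1)) (\<lambda>f. c2\<^sup>2 * bvar A (s + 1) f)"
    using bwd.backward_clt[OF u(2)] by blast
  \<comment> \<open>Independence is available between the complete forward and backward histories,
    so these are the \<sigma>-fields of the pair average. The sampling step below conditions on the
    history of particles and weights around time s, with respect to which the same averages are
    measurable.\<close>
  interpret pa: pair_average L L P "\<lambda>N. fwd.FH N (T + 1)" "\<lambda>N. bwd.BH N 0" "fwd.om (s - 1)" "bwd.om (s + 1)"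
    "\<lambda>N. xi N (s - 1)" "\<lambda>N. bxi N (s + 1)" "fwd.AA (s - 1)" "bwd.BB (s + 1)" c1 c2 "filtering A (s - 1)" "backward_info A (s + 1)"
    "\<lambda>f. c1\<^sup>2 * fvar A (s - 1) f" "\<lambda>f. c2\<^sup>2 * bvar A (s + 1) f"
  proof (rule pair_average.intro)
    show "prob_space (P N)" "subalgebra (P N) (fwd.FH N (T + 1))" "subalgebra (P N) (bwd.BH N 0)" if "1 \<le> N" for N
      using fwd.prob[OF that] fwd.FH_sub[OF that] bwd.BH_sub[OF that] by simp_all
    show "prob_space.indep_set (P N) (sets (fwd.FH N (T + 1))) (sets (bwd.BH N 0))" if "1 \<le> N" for N by (rule indep[OF that])
    show "fwd.om (s - 1) N l \<in> borel_measurable (fwd.FH N (T + 1))" "xi N (s - 1) l \<in> fwd.FH N (T + 1) \<rightarrow>\<^sub>M L" if "1 \<le> N" "l \<in> {1..N}" for N l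
      using fwd.om_FH[OF that, of "s - 1" "T + 1"] fwd.xi_FH[OF that, of "s - 1" "T + 1"] u by simp_all
    show "bwd.om (s + 1) N l \<in> borel_measurable (bwd.BH N 0)" "bxi N (s + 1) l \<in> bwd.BH N 0 \<rightarrow>\<^sub>M L" if "1 \<le> N" "l \<in> {1..N}" for N l
      using bwd.om_BH[OF that, of 0 "s + 1"] bwd.bxi_BH[OF that, of 0 "s + 1"] u by simp_all
  qed (use c1 c2 in \<open>simp_all add: fwd.AA_def bwd.BB_def\<close>)
  have ms: "filtering A (s - 1) \<Otimes>\<^sub>M backward_info A (s + 1) = pair_law A s" by (simp add: pair_law_def)
  \<comment> \<open>The nested average is a single average over the grid of pairs, whence the
    normalisation by the square of N in the mixture step.\<close>
  have A_eq: "pa.A N H w = (\<Sum>p\<in>{1..N} \<times> {1..N}. fwd.om (s - 1) N (fst p) w * bwd.om (s + 1) N (snd p) w * H (xi N (s - 1) (fst p) w, bxi N (s + 1) (snd p) w)) / (real N)\<^sup>2" for N H w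
    unfolding pa.A_def fwd.AA_def bwd.BB_def
    by (simp del: One_nat_def add: sum_distrib_left sum_divide_distrib sum.cartesian_product case_prod_beta' power2_eq_square mult_ac)
  obtain B where B: "bounded_fn (L \<Otimes>\<^sub>M L) \<theta> B" by (rule \<theta>_bounded)
  obtain CW where CW: "0 \<le> CW" "\<And>y z. y \<in> space (L \<Otimes>\<^sub>M L) \<Longrightarrow> z \<in> space L \<Longrightarrow> tweight A s (fst y) (snd y) z \<le> ennreal CW"
    using \<omega>_bounded by metis
  obtain C where C: "\<And>y. y \<in> space (L \<Otimes>\<^sub>M L) \<Longrightarrow> (\<integral>\<^sup>+ z. ennreal (pair_kernel s (y, z)) \<partial>L) \<le> ennreal C"
    using kernel_mass by blast
  have C': "(\<integral>\<^sup>+ z. ennreal (pair_kernel s ((x, x'), z)) \<partial>L) \<le> ennreal C" if "x \<in> space L" "x' \<in> space L" for x x'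
    using C[of "(x, x')"] that by (simp add: space_pair_measure)
  note sp = smoothing_pair[OF s C']
  interpret st: mixture_step "L \<Otimes>\<^sub>M L" L P SH pa.A "c1 * c2" "pair_law A s" pa.V "\<lambda>N. {1..N} \<times> {1..N}"
    "\<lambda>N p w. fwd.om (s - 1) N (fst p) w * bwd.om (s + 1) N (snd p) w" "\<lambda>N p w. (xi N (s - 1) (fst p) w, bxi N (s + 1) (snd p) w)"
    "\<lambda>N. (real N)\<^sup>2" "\<lambda>N. NNL N" "\<lambda>N p x. (fst p, snd p, x)" "\<lambda>z. (fst z, fst (snd z))" "\<lambda>z. snd (snd z)"
    "\<lambda>N l w. (tI N l w, tJ N l w, txi N l w)" \<theta> "\<lambda>y z. pr y z" \<omega> "\<lambda>y z. pair_kernel s (y, z)" B CW "smoothing A s T"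
  proof (rule mixture_step.intro)
    show "prob_space (P N)" "subalgebra (P N) (SH N)" if "1 \<le> N" for N using fwd.prob[OF that] SH_sub[OF that] by simp_all
    show "emp_clt (L \<Otimes>\<^sub>M L) P pa.A (c1 * c2) (pair_law A s) pa.V" using pa.clt by (simp only: ms)
    show "pa.A N H w = (\<Sum>p\<in>{1..N} \<times> {1..N}. fwd.om (s - 1) N (fst p) w * bwd.om (s + 1) N (snd p) w * H (xi N (s - 1) (fst p) w, bxi N (s + 1) (snd p) w)) / (real N)\<^sup>2" for N H w
      by (rule A_eq)
    show "0 < (real N)\<^sup>2" if "1 \<le> N" for N using that by simp
    show "sigma_finite_measure L" by (rule sigma_finite_L)
    show "indexed_base (NNL N) L ({1..N} \<times> {1..N}) (\<lambda>p x. (fst p, snd p, x))" for N :: nat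
      by (rule indexed_base_double[OF sigma_finite_L]) simp_all
    show "sigma_finite_measure (NNL N)" for N :: nat
      by (rule sigma_finite_count_pair[OF sigma_finite_count_pair[OF sigma_finite_L]]) simp_all
    show "space (NNL N) \<noteq> {}" if "1 \<le> N" for N :: nat
      using that prob_space.not_empty[OF ini(1)] space_ini by (auto simp: space_pair_measure)
    show "(\<lambda>w. fwd.om (s - 1) N (fst j) w * bwd.om (s + 1) N (snd j) w) \<in> borel_measurable (SH N)"
      if "1 \<le> N" "j \<in> {1..N} \<times> {1..N}" for N j
      using sampling_history_measurable(3,4)[OF that(1)] that(2) by (intro borel_measurable_times) auto
    show "0 \<le> fwd.om (s - 1) N (fst j) w * bwd.om (s + 1) N (snd j) w" for N j w using fwd.om_nonneg bwd.om_nonneg by simp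
    show "(\<lambda>w. (xi N (s - 1) (fst j) w, bxi N (s + 1) (snd j) w)) \<in> SH N \<rightarrow>\<^sub>M L \<Otimes>\<^sub>M L" if "1 \<le> N" "j \<in> {1..N} \<times> {1..N}" for N j
      using sampling_history_measurable(1,2)[OF that(1)] that(2) by (intro measurable_Pair) auto
    show "(\<lambda>z. (fst z, fst (snd z))) \<in> NNL N \<rightarrow>\<^sub>M count_space ({1..N} \<times> {1..N})" for N :: nat
    proof -
      have "count_space ({1..N} \<times> {1..N}) = count_space {1..N} \<Otimes>\<^sub>M count_space {1..N}" by (rule pair_measure_countable[symmetric]) simp_all
      then show ?thesis
        by (simp only:) (intro measurable_Pair measurable_compose[OF measurable_snd measurable_fst] measurable_fst)
    qed
    show "(\<lambda>z. snd (snd z)) \<in> NNL N \<rightarrow>\<^sub>M L" for N :: nat by simp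
    show "bounded_fn (L \<Otimes>\<^sub>M L) \<theta> B" by (rule B)
    show "0 \<le> \<theta> y" if "y \<in> space (L \<Otimes>\<^sub>M L)" for y by (rule \<theta>_nonneg[OF that])
    show "(\<lambda>z. pr (fst z) (snd z)) \<in> borel_measurable ((L \<Otimes>\<^sub>M L) \<Otimes>\<^sub>M L)" by (rule tprop_meas)
    show "0 \<le> pr y x" if "y \<in> space (L \<Otimes>\<^sub>M L)" "x \<in> space L" for y x using tprop_nonneg that by (auto simp: space_pair_measure)
    show "(\<integral>\<^sup>+ x. ennreal (pr y x) \<partial>L) = 1" if "y \<in> space (L \<Otimes>\<^sub>M L)" for y using tprop_mass that by (auto simp: space_pair_measure)
    show "(\<lambda>z. \<omega> (fst z) (snd z)) \<in> borel_measurable ((L \<Otimes>\<^sub>M L) \<Otimes>\<^sub>M L)" unfolding \<omega>_def using tweight_meas by measurable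
    show "0 \<le> \<omega> y x" for y x by (simp add: \<omega>_def)
    show "\<omega> y x \<le> CW" if "y \<in> space (L \<Otimes>\<^sub>M L)" "x \<in> space L" for y x
      unfolding \<omega>_def using CW(2)[OF that] CW(1) by (rule enn2real_bound(1))
    show "0 \<le> CW" by (rule CW(1))
    show "pair_kernel s (y, x) = \<omega> y x * (\<theta> y * pr y x)" if "y \<in> space (L \<Otimes>\<^sub>M L)" "x \<in> space L" for y x by (rule kernel_factor[OF that])
    show "cond_iid (P N) (SH N) N (NNL N) (\<lambda>l w. (tI N l w, tJ N l w, txi N l w))
       (\<lambda>w. normalized_density (NNL N)
          (\<lambda>z. ennreal (fwd.om (s - 1) N (fst (fst z, fst (snd z))) w * bwd.om (s + 1) N (snd (fst z, fst (snd z))) w *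
             (\<theta> (xi N (s - 1) (fst (fst z, fst (snd z))) w, bxi N (s + 1) (snd (fst z, fst (snd z))) w) *
              pr (xi N (s - 1) (fst (fst z, fst (snd z))) w, bxi N (s + 1) (snd (fst z, fst (snd z))) w) (snd (snd z))))))"
      if N: "1 \<le> N" for N
    proof (rule cond_iid_cong_AE[OF conjunct1[OF sample[OF N, unfolded two_filter_sample_def]]], rule AE_I2, rule normalized_density_cong)
      fix w z assume w: "w \<in> space (P N)" and "z \<in> space (NNL N)"
      then obtain i j x where z: "z = (i, j, x)" "i \<in> {1..N}" "j \<in> {1..N}" "x \<in> space L" by (auto simp: space_pair_measure)
      have "0 \<le> fwd.om (s - 1) N i w * bwd.om (s + 1) N j w * \<theta> (xi N (s - 1) i w, bxi N (s + 1) j w)"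
        using fwd.om_nonneg bwd.om_nonneg \<theta>_nonneg fwd.xi_space[OF N z(2) u(1) w] bwd.bxi_space[OF N z(3) u(2) w] by (simp add: space_pair_measure)
      then show "(case z of (i, j, x) \<Rightarrow> fwd.fw N (s - 1) i w * ennreal (tadj A s (xi N (s - 1) i w) (bxi N (s + 1) j w)) *
             bwd.bw N (s + 1) j w / ennreal (\<gamma> (s + 1) (bxi N (s + 1) j w)) *
             ennreal (tprop A s (xi N (s - 1) i w) (bxi N (s + 1) j w) x))
        = ennreal (fwd.om (s - 1) N (fst (fst z, fst (snd z))) w * bwd.om (s + 1) N (snd (fst z, fst (snd z))) w *
             (\<theta> (xi N (s - 1) (fst (fst z, fst (snd z))) w, bxi N (s + 1) (snd (fst z, fst (snd z))) w) *
              pr (xi N (s - 1) (fst (fst z, fst (snd z))) w, bxi N (s + 1) (snd (fst z, fst (snd z))) w) (snd (snd z))))"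
        unfolding z(1) prod.case sampling_density[OF N z(2,3) w] by (simp only: fst_conv snd_conv ennreal_mult'[symmetric] mult.assoc)
    qed
    show "AE w in P N. 0 < (\<Sum>j\<in>{1..N} \<times> {1..N}. fwd.om (s - 1) N (fst j) w * bwd.om (s + 1) N (snd j) w * \<theta> (xi N (s - 1) (fst j) w, bxi N (s + 1) (snd j) w))"
      if N: "1 \<le> N" for N
      using conjunct1[OF conjunct2[OF sample[OF N, unfolded two_filter_sample_def]]] AE_space
    proof eventually_elim
      case (elim w)
      let ?f = "\<lambda>i j. fwd.om (s - 1) N i w * bwd.om (s + 1) N j w * \<theta> (xi N (s - 1) i w, bxi N (s + 1) j w)"
      have "(\<Sum>i\<in>{1..N}. \<Sum>j\<in>{1..N}. fwd.fw N (s - 1) i w * ennreal (tadj A s (xi N (s - 1) i w) (bxi N (s + 1) j w)) *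
             bwd.bw N (s + 1) j w / ennreal (\<gamma> (s + 1) (bxi N (s + 1) j w))) = (\<Sum>i\<in>{1..N}. \<Sum>j\<in>{1..N}. ennreal (?f i j))"
        by (intro sum.cong refl sampling_density[OF N _ _ elim(2)])
      also have "\<dots> = (\<Sum>p\<in>{1..N} \<times> {1..N}. ennreal (?f (fst p) (snd p)))" by (simp only: sum.cartesian_product case_prod_beta')
      also have "\<dots> = ennreal (\<Sum>p\<in>{1..N} \<times> {1..N}. ?f (fst p) (snd p))"
        using fwd.om_nonneg bwd.om_nonneg fwd.xi_space[OF N _ u(1) elim(2)] bwd.bxi_space[OF N _ u(2) elim(2)]
        by (intro sum_ennreal mult_nonneg_nonneg \<theta>_nonneg) (auto simp: space_pair_measure)
      finally show ?case using elim(1) by simp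
    qed
    show "prob_space (smoothing A s T)" by (rule sp(1))
    show "sets (smoothing A s T) = sets L" by (simp add: smoothing_def)
    show "0 < (\<integral>y. (\<integral>x. pair_kernel s (y, x) \<partial>L) \<partial>pair_law A s)" by (rule sp(2))
    show "(\<integral>x. f x \<partial>smoothing A s T) = (\<integral>y. (\<integral>x. pair_kernel s (y, x) * f x \<partial>L) \<partial>pair_law A s) / (\<integral>y. (\<integral>x. pair_kernel s (y, x) \<partial>L) \<partial>pair_law A s)"
      if "bounded_fn L f D" for f D by (rule sp(3)[OF _ _ that])
  qed simp_all
  have TT: "st.step.A' = TT"
    unfolding st.step.A'_def[abs_def] TT_def[abs_def] st.W_def \<omega>_def tpw_def by simp
  have V: "st.step.V' f / (st.c')\<^sup>2 = Upsilon A s f" for f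
  proof -
    have c: "c1 \<noteq> 0" "c2 \<noteq> 0" using pa.c by simp_all
    have k: "st.k f = (\<lambda>(x, x'). (\<integral>z. q2 A x x' z * g s z * f z \<partial>L) / \<gamma> (s + 1) x')"
      unfolding st.k_def[abs_def] by (simp add: pair_kernel_def case_prod_beta')
    have k2: "st.k2 f = (\<lambda>(x, x'). (\<integral>z. enn2real (tweight A s x x' z) * q2 A x x' z * g s z * (f z)\<^sup>2 \<partial>L) / \<gamma> (s + 1) x')"
      unfolding st.k2_def[abs_def] by (simp add: pair_kernel_def \<omega>_def case_prod_beta' mult.assoc)
    have \<sigma>: "(\<integral>y. (\<integral>x. pair_kernel s (y, x) \<partial>L) \<partial>pair_law A s) = sigma_const A s"
      by (simp add: sigma_const_def pair_kernel_def case_prod_beta')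
    have t: "(\<integral>y. \<theta> y \<partial>pair_law A s) = (\<integral>(x, x'). tadj A s x x' / \<gamma> (s + 1) x' \<partial>pair_law A s)"
      by (simp add: \<theta>_def case_prod_beta')
    have t0: "(\<integral>y. \<theta> y \<partial>pair_law A s) \<noteq> 0" using st.\<theta>pos by simp
    have \<sigma>0: "sigma_const A s \<noteq> 0" using st.\<kappa>pos unfolding \<sigma> by simp
    \<comment> \<open>Each filter contributes the square of its own constant and the pair average
      that of the other, so (c1 c2)^2 factors out of both terms.\<close>
    have v: "pa.V (st.k f) = (c1 * c2)\<^sup>2 * Sigma_var A s f"
      unfolding pa.V_def k Sigma_var_def pair_var_def by (simp add: algebra_simps)
    have "Upsilon A s f = (Sigma_var A s f + (\<integral>y. \<theta> y \<partial>pair_law A s) * (\<integral>y. st.k2 f y \<partial>pair_law A s)) / (sigma_const A s)\<^sup>2"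
      unfolding Upsilon_def k2 t ..
    then show ?thesis
      unfolding st.step.V'_def st.c'_def v \<sigma> using c t0 \<sigma>0 by (simp add: power_divide power_mult_distrib) (simp add: field_simps power2_eq_square)
  qed
  show ?thesis using st.step.clt V unfolding TT by blast
qed

end

section \<open>From characteristic functions to weak convergence\<close>

lemma gaussian_law_char:
  assumes v: "0 \<le> v"
  shows "real_distribution (gaussian_law v)" "char (gaussian_law v) t = complex_of_real (exp (- (t\<^sup>2 * v / 2)))"
proof -
  have "real_distribution (gaussian_law v) \<and> char (gaussian_law v) t = complex_of_real (exp (- (t\<^sup>2 * v / 2)))"
  proof (cases "v = 0")
    case True
    have "real_distribution (return borel (0::real))"
      by (simp add: real_distribution_def real_distribution_axioms_def prob_space_return)
    moreover have "char (return borel 0) t = 1" unfolding char_def by (subst integral_return) auto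
    ultimately show ?thesis using True by (simp add: gaussian_law_def)
  next
    case False
    then have sv: "0 < sqrt v" using v by simp
    interpret S: real_distribution std_normal_distribution by (rule real_dist_normal_dist)
    have "distributed std_normal_distribution lborel (\<lambda>x. x) std_normal_density"
      unfolding distributed_def by (auto simp: distr_id2)
    from S.normal_density_affine[OF this, of "sqrt v" 0]
    have d: "distributed std_normal_distribution lborel (\<lambda>x. sqrt v * x) (\<lambda>x. ennreal (normal_density 0 (sqrt v) x))"
      using sv by simp
    have g: "gaussian_law v = distr std_normal_distribution borel (\<lambda>x. sqrt v * x)"
      using d False unfolding distributed_def gaussian_law_def by (simp cong: distr_cong)
    have "char (gaussian_law v) t = char std_normal_distribution (t * sqrt v)"
      unfolding g char_def by (subst integral_distr) (auto simp: mult.assoc)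
    also have "\<dots> = complex_of_real (exp (- (t\<^sup>2 * v / 2)))"
      using v by (simp add: char_std_normal_distribution power_mult_distrib)
    finally show ?thesis unfolding g using S.real_distribution_distr[of "\<lambda>x. sqrt v * x"] by simp
  qed
  then show "real_distribution (gaussian_law v)" "char (gaussian_law v) t = complex_of_real (exp (- (t\<^sup>2 * v / 2)))" by auto
qed

text \<open>The sign of v is a consequence: characteristic functions have modulus at most one, hence
  so has their limit at t = 1, which forces v \<ge> 0. This is how the asymptotic variance is seen
  to be non-negative.\<close>

lemma weak_conv_gaussian:
  assumes P: "\<And>N. 1 \<le> N \<Longrightarrow> prob_space (P N)" and X: "\<And>N. 1 \<le> N \<Longrightarrow> X N \<in> borel_measurable (P N)"
    and lim: "\<And>t. (\<lambda>N. \<integral>w. iexp (t * X N w) \<partial>P N) \<longlonglongrightarrow> complex_of_real (exp (- (t\<^sup>2 * v / 2)))"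
  shows "weak_conv_m (\<lambda>N. distr (P N) borel (X N)) (gaussian_law v)"
proof -
  have v: "0 \<le> v"
  proof -
    have "cmod (complex_of_real (exp (- (1\<^sup>2 * v / 2)))) \<le> 1"
    proof (rule Lim_bounded[OF tendsto_norm[OF lim[of 1]], of 1], intro allI impI)
      fix N :: nat assume N: "1 \<le> N"
      interpret prob_space "P N" by (rule P[OF N])
      interpret D: real_distribution "distr (P N) borel (X N)" by (rule real_distribution_distr[OF X[OF N]])
      show "cmod (\<integral>w. iexp (1 * X N w) \<partial>P N) \<le> 1"
        using D.cmod_char_le_1[of 1] X[OF N] by (simp add: char_def integral_distr)
    qed
    then show ?thesis by simp
  qed
  \<comment> \<open>\<open>P 0\<close> need not be a probability, so Levy's theorem is applied to the shifted sequence.\<close>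
  have "weak_conv_m (\<lambda>N. distr (P (Suc N)) borel (X (Suc N))) (gaussian_law v)"
  proof (rule levy_continuity)
    show "real_distribution (distr (P (Suc N)) borel (X (Suc N)))" for N
      using prob_space.real_distribution_distr[OF P X, of "Suc N"] by simp
    show "real_distribution (gaussian_law v)" by (rule gaussian_law_char(1)[OF v])
    show "(\<lambda>N. char (distr (P (Suc N)) borel (X (Suc N))) t) \<longlonglongrightarrow> char (gaussian_law v) t" for t
    proof -
      have "char (distr (P (Suc N)) borel (X (Suc N))) t = (\<integral>w. iexp (t * X (Suc N) w) \<partial>P (Suc N))" for N
        unfolding char_def using X[of "Suc N"] by (subst integral_distr) auto
      then show ?thesis using LIMSEQ_Suc[OF lim[of t]] gaussian_law_char(2)[OF v] by simp
    qed
  qed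
  then show ?thesis
    unfolding weak_conv_m_def weak_conv_def by (auto intro: LIMSEQ_imp_Suc)
qed

section \<open>The self-normalised estimator\<close>

context two_filter_particles
begin

abbreviation "tw N \<equiv> \<lambda>l w. enn2real (ew N l w)"
abbreviation "est N \<equiv> two_filter_estimate A N (xi N) (bxi N) s (tI N) (tJ N) (txi N)"

lemma sample_components:
  assumes N: "1 \<le> N" and l: "l \<in> {1..N}"
  shows "tI N l \<in> P N \<rightarrow>\<^sub>M count_space {1..N}" "tJ N l \<in> P N \<rightarrow>\<^sub>M count_space {1..N}" "txi N l \<in> P N \<rightarrow>\<^sub>M L"
    "(\<lambda>w. (xi N (s - 1) (tI N l w) w, bxi N (s + 1) (tJ N l w) w)) \<in> P N \<rightarrow>\<^sub>M L \<Otimes>\<^sub>M L"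
proof -
  note m = measurable_compose[OF sample_meas[OF N l]]
  show i: "tI N l \<in> P N \<rightarrow>\<^sub>M count_space {1..N}" using m[OF measurable_fst] by simp
  show j: "tJ N l \<in> P N \<rightarrow>\<^sub>M count_space {1..N}" using m[OF measurable_compose[OF measurable_snd measurable_fst]] by simp
  show "txi N l \<in> P N \<rightarrow>\<^sub>M L" using m[OF measurable_compose[OF measurable_snd measurable_snd]] by simp
  have u: "s - 1 \<le> T" "s + 1 \<le> T" using s by auto
  show "(\<lambda>w. (xi N (s - 1) (tI N l w) w, bxi N (s + 1) (tJ N l w) w)) \<in> P N \<rightarrow>\<^sub>M L \<Otimes>\<^sub>M L"
  proof (rule measurable_Pair)
    show "(\<lambda>w. xi N (s - 1) (tI N l w) w) \<in> P N \<rightarrow>\<^sub>M L"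
      by (rule measurable_compose_countable'[where f="\<lambda>i. xi N (s - 1) i", OF fwd.xi_meas[OF N _ u(1)] i]) simp_all
    show "(\<lambda>w. bxi N (s + 1) (tJ N l w) w) \<in> P N \<rightarrow>\<^sub>M L"
      by (rule measurable_compose_countable'[where f="\<lambda>i. bxi N (s + 1) i", OF bwd.bxi_meas[OF N _ u(2)] j]) simp_all
  qed
qed

lemma tw_meas: "1 \<le> N \<Longrightarrow> l \<in> {1..N} \<Longrightarrow> tw N l \<in> borel_measurable (P N)"
  using measurable_compose[OF measurable_Pair[OF sample_components(4,3)] tweight_meas] unfolding tpw_def by simp

lemma tw_pos: "1 \<le> N \<Longrightarrow> AE w in P N. 0 < (\<Sum>l\<in>{1..N}. tw N l w)"
proof -
  assume N: "1 \<le> N"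
  obtain C where C: "0 \<le> C" "\<And>y z. y \<in> space (L \<Otimes>\<^sub>M L) \<Longrightarrow> z \<in> space L \<Longrightarrow> tweight A s (fst y) (snd y) z \<le> ennreal C"
    using \<omega>_bounded by metis
  have "AE w in P N. 0 < (\<Sum>l\<in>{1..N}. ew N l w)"
    using sample[OF N] unfolding two_filter_sample_def by blast
  then show ?thesis using AE_space
  proof eventually_elim
    case (elim w)
    have "ew N l w = ennreal (tw N l w)" if l: "l \<in> {1..N}" for l
      using enn2real_bound(2)[OF C(2)[OF measurable_space[OF sample_components(4)[OF N l] elim(2)] measurable_space[OF sample_components(3)[OF N l] elim(2)]] C(1)]
      by (simp add: tpw_def)
    then have "(\<Sum>l\<in>{1..N}. ew N l w) = (\<Sum>l\<in>{1..N}. ennreal (tw N l w))" by (rule sum.cong[OF refl])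
    also have "\<dots> = ennreal (\<Sum>l\<in>{1..N}. tw N l w)" by (rule sum_ennreal) simp
    finally show ?case using elim(1) by simp
  qed
qed

text \<open>Recentred at \<phi>, the estimator is the ratio of the averages of h - \<phi> and of 1.
  As a weighted mean it is bounded even where the total weight is small, so the ratio theorem
  applies with \<theta> = 1 and divides the variance by c^2.\<close>

theorem two_filter_weak_conv:
  assumes h: "bounded_fn L h B"
  shows "weak_conv_m (\<lambda>N. distr (P N) borel (\<lambda>w. sqrt (real N) *
      (est N h w - (\<integral>x. h x \<partial>smoothing A s T))))
    (gaussian_law (Upsilon A s (\<lambda>x. h x - (\<integral>y. h y \<partial>smoothing A s T))))"
proof -
  define \<phi> where "\<phi> = (\<integral>x. h x \<partial>smoothing A s T)"
  define m where "m N w = est N h w - \<phi>" for N w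
  obtain c V where clt: "emp_clt L P TT c (smoothing A s T) V" and V: "\<And>f. V f / c\<^sup>2 = Upsilon A s f"
    using two_filter_clt by blast
  have sm: "prob_space (smoothing A s T)" "sets (smoothing A s T) = sets L" using clt by (auto simp: emp_clt_def)
  interpret S: prob_space "smoothing A s T" by (rule sm(1))
  have hm: "h \<in> borel_measurable (smoothing A s T)"
    unfolding measurable_cong_sets[OF sm(2) refl] by (rule bounded_fnD(1)[OF h])
  have hi: "integrable (smoothing A s T) h"
    using bounded_fnD(3)[OF h] sets_eq_imp_space_eq[OF sm(2)] by (intro S.integrable_bounded[OF hm, of B]) auto
  have hb: "bounded_fn L (\<lambda>x. h x - \<phi>) (B + \<bar>\<phi>\<bar>)"
    unfolding bounded_fn_def
  proof (intro conjI ballI)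
    show "(\<lambda>x. h x - \<phi>) \<in> borel_measurable L" using bounded_fnD(1)[OF h] by simp
    show "0 \<le> B + \<bar>\<phi>\<bar>" using bounded_fnD(2)[OF h] by simp
    show "\<bar>h x - \<phi>\<bar> \<le> B + \<bar>\<phi>\<bar>" if "x \<in> space L" for x using bounded_fnD(3)[OF h that] by linarith
  qed
  have one: "measure (smoothing A s T) (space L) = 1"
    using S.prob_space sets_eq_imp_space_eq[OF sm(2)] by simp
  have h0: "(\<integral>x. h x - \<phi> \<partial>smoothing A s T) = 0" using hi one by (simp add: \<phi>_def)
  have m_meas: "m N \<in> borel_measurable (P N)" if N: "1 \<le> N" for N
    unfolding m_def[abs_def] two_filter_estimate_def
    by (intro borel_measurable_diff borel_measurable_sum borel_measurable_times borel_measurable_divide borel_measurable_const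
        tw_meas[OF N] measurable_compose[OF sample_components(3)[OF N] bounded_fnD(1)[OF h]])
  have est: "est N h w = (\<Sum>l\<in>{1..N}. tw N l w * h (txi N l w)) / (\<Sum>l\<in>{1..N}. tw N l w)" for N w
    by (simp add: two_filter_estimate_def sum_divide_distrib)
  have bound: "AE w in P N. \<bar>m N w\<bar> \<le> B + \<bar>\<phi>\<bar>" if N: "1 \<le> N" for N
    using tw_pos[OF N] AE_space
  proof eventually_elim
    case (elim w)
    have "\<bar>\<Sum>l\<in>{1..N}. tw N l w * h (txi N l w)\<bar> \<le> (\<Sum>l\<in>{1..N}. \<bar>tw N l w * h (txi N l w)\<bar>)" by (rule sum_abs)
    also have "\<dots> \<le> (\<Sum>l\<in>{1..N}. tw N l w * B)"
    proof (rule sum_mono)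
      fix l assume l: "l \<in> {1..N}"
      have "\<bar>h (txi N l w)\<bar> \<le> B" by (rule bounded_fnD(3)[OF h measurable_space[OF sample_components(3)[OF N l] elim(2)]])
      then have "tw N l w * \<bar>h (txi N l w)\<bar> \<le> tw N l w * B" by (rule mult_left_mono) simp
      then show "\<bar>tw N l w * h (txi N l w)\<bar> \<le> tw N l w * B" by (simp only: abs_mult abs_of_nonneg[OF enn2real_nonneg])
    qed
    also have "\<dots> = B * (\<Sum>l\<in>{1..N}. tw N l w)" by (simp only: sum_distrib_left mult.commute)
    finally have "\<bar>est N h w\<bar> \<le> B"
      unfolding est abs_divide abs_of_pos[OF elim(1)] by (simp only: pos_divide_le_eq[OF elim(1)])
    then show ?case unfolding m_def by linarith
  qed
  have ratio: "AE w in P N. m N w * TT N (\<lambda>_. 1) w = TT N (\<lambda>x. h x - \<phi>) w" if N: "1 \<le> N" for N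
    using tw_pos[OF N]
  proof eventually_elim
    case (elim w)
    have "m N w * (\<Sum>l\<in>{1..N}. tw N l w) = (\<Sum>l\<in>{1..N}. tw N l w * h (txi N l w)) - \<phi> * (\<Sum>l\<in>{1..N}. tw N l w)"
      unfolding m_def est left_diff_distrib times_divide_eq_left using elim by (simp del: One_nat_def)
    also have "\<dots> = (\<Sum>l\<in>{1..N}. tw N l w * (h (txi N l w) - \<phi>))"
      by (simp only: right_diff_distrib sum_subtractf sum_distrib_left mult.commute[of \<phi>])
    finally have "m N w * (\<Sum>l\<in>{1..N}. tw N l w) = (\<Sum>l\<in>{1..N}. tw N l w * (h (txi N l w) - \<phi>))" .
    then show ?case by (simp add: TT_def)
  qed
  \<comment> \<open>The smoothing law is a probability, so the limiting denominator c times the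
    integral of 1 is c itself, and V / c^2 is \<open>Upsilon\<close>.\<close>
  have "(\<lambda>N. \<integral>w. iexp (t * (sqrt (real N) * m N w)) \<partial>P N) \<longlonglongrightarrow> complex_of_real (exp (- (t\<^sup>2 * Upsilon A s (\<lambda>x. h x - \<phi>) / 2)))" for t
    using emp_clt_ratio(1)[OF clt fwd.prob hb h0, of "\<lambda>_. 1" 1 m "B + \<bar>\<phi>\<bar>" t] m_meas bound ratio V[of "\<lambda>x. h x - \<phi>", symmetric]
    by (simp add: bounded_fn_def one)
  then have "weak_conv_m (\<lambda>N. distr (P N) borel (\<lambda>w. sqrt (real N) * m N w)) (gaussian_law (Upsilon A s (\<lambda>x. h x - \<phi>)))"
    by (intro weak_conv_gaussian[OF fwd.prob] borel_measurable_times borel_measurable_const m_meas)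
  then show ?thesis by (simp only: m_def \<phi>_def)
qed

end

theorem theorem5:
  fixes A :: "'a two_filter"
    and P :: "nat \<Rightarrow> 'w measure"
    and xi bxi :: "nat \<Rightarrow> nat \<Rightarrow> nat \<Rightarrow> 'w \<Rightarrow> 'a"
    and I bI :: "nat \<Rightarrow> nat \<Rightarrow> nat \<Rightarrow> 'w \<Rightarrow> nat"
    and tI tJ :: "nat \<Rightarrow> nat \<Rightarrow> 'w \<Rightarrow> nat"
    and txi :: "nat \<Rightarrow> nat \<Rightarrow> 'w \<Rightarrow> 'a"
    and s :: nat and h :: "'a \<Rightarrow> real"
  assumes model: "valid_model A"
    and fdesign: "valid_forward_design A"
    and bdesign: "valid_backward_design A"
    and tdesign: "valid_two_filter_design A"
    and A1_q: "sup_norm (states A \<times> states A) (\<lambda>(x, x'). qd A x x') < \<infinity>"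
    and A1_g: "\<And>t. t \<le> hor A \<Longrightarrow> (\<forall>x\<in>states A. 0 < pot A t x) \<and> sup_norm (states A) (pot A t) < \<infinity>"
    and A2_weight0: "esup_norm (states A) (fweight0 A) < \<infinity>"
    and A2_weight: "\<And>t. 1 \<le> t \<Longrightarrow> t \<le> hor A \<Longrightarrow>
          esup_norm (states A \<times> states A) (\<lambda>(x, x'). fweight A t x x') < \<infinity>"
    and A2_adj: "\<And>t. 1 \<le> t \<Longrightarrow> t \<le> hor A \<Longrightarrow> sup_norm (states A) (fadj A t) < \<infinity>"
    and A2_prop: "\<And>t. 1 \<le> t \<Longrightarrow> t \<le> hor A \<Longrightarrow>
          sup_norm (states A \<times> states A) (\<lambda>(x, x'). fprop A t x x') < \<infinity>"
    and A3_badj: "\<And>t. t < hor A \<Longrightarrow> sup_norm (states A) (\<lambda>x. badj A t x / gam A (t + 1) x) < \<infinity>"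
    and A3_bprop: "\<And>t. t < hor A \<Longrightarrow> sup_norm (states A \<times> states A) (\<lambda>(x', x). bprop A t x' x) < \<infinity>"
    and A3_bweightT: "esup_norm (states A) (bweightT A) < \<infinity>"
    and A3_bweight: "\<And>t. t < hor A \<Longrightarrow>
          esup_norm (states A \<times> states A) (\<lambda>(x, x'). bweight A t x x') < \<infinity>"
    and A3_tadj: "\<And>t. 1 \<le> t \<Longrightarrow> t < hor A \<Longrightarrow>
          sup_norm (states A \<times> states A) (\<lambda>(x, x'). tadj A t x x' * inverse (gam A (t + 1) x')) < \<infinity>"
    and A3_q: "\<And>t. 1 \<le> t \<Longrightarrow> t < hor A \<Longrightarrow>
          sup_norm (states A \<times> states A) (\<lambda>(x, x'). qd A x x' * inverse (gam A (t + 1) x')) < \<infinity>"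
    and A3_tweight: "\<And>t. 1 \<le> t \<Longrightarrow> t < hor A \<Longrightarrow>
          esup_norm (states A \<times> states A \<times> states A) (\<lambda>(x, x', x''). tweight A t x x' x'') < \<infinity>"
    and A3_tprop: "\<And>t. 1 \<le> t \<Longrightarrow> t < hor A \<Longrightarrow>
          sup_norm (states A \<times> states A \<times> states A) (\<lambda>(x, x', x''). tprop A t x x' x'') < \<infinity>"
    and s: "1 \<le> s" "s < hor A"
    and h: "h \<in> borel_measurable (base A)" "sup_norm (states A) h < \<infinity>"
    and prob: "\<And>N. 1 \<le> N \<Longrightarrow> prob_space (P N)"
    and forward: "\<And>N. 1 \<le> N \<Longrightarrow> forward_system A N (P N) (xi N) (I N)"
    and backward: "\<And>N. 1 \<le> N \<Longrightarrow> backward_system A N (P N) (bxi N) (bI N)"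
    and indep: "\<And>N. 1 \<le> N \<Longrightarrow> prob_space.indep_set (P N)
          (sets (forward_history A N (P N) (xi N) (I N) (hor A + 1)))
          (sets (backward_history A N (P N) (bxi N) (bI N) 0))"
    and sample: "\<And>N. 1 \<le> N \<Longrightarrow>
          two_filter_sample A N (P N) (xi N) (I N) (bxi N) (bI N) s (tI N) (tJ N) (txi N)"
  shows "weak_conv_m
      (\<lambda>N. distr (P N) borel (\<lambda>w. sqrt (real N) *
         (two_filter_estimate A N (xi N) (bxi N) s (tI N) (tJ N) (txi N) h w
          - (\<integral>x. h x \<partial>smoothing A s (hor A)))))
      (gaussian_law (Upsilon A s (\<lambda>x. h x - (\<integral>y. h y \<partial>smoothing A s (hor A)))))"
proof -
  have g_fin: "sup_norm (states A) (pot A t) < \<infinity>" if "t \<le> hor A" for t using A1_g[OF that] by simp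
  have fm: "filter_model A" by (rule filter_model.intro[OF model g_fin])
  interpret two_filter_particles A P xi bxi I bI s tI tJ txi
  proof (rule two_filter_particles.intro)
    show "filter_model A" by (rule fm)
    show "forward_particles A P xi I"
      by (rule forward_particles.intro[OF fm forward_particles_axioms.intro[OF fdesign A2_weight0 A2_weight A2_adj prob forward]])
    show "backward_particles A P bxi bI"
      by (rule backward_particles.intro[OF fm backward_particles_axioms.intro[OF bdesign A3_bweightT A3_bweight A3_badj prob backward]])
    show "two_filter_particles_axioms A P xi bxi I bI s tI tJ txi"
      by (rule two_filter_particles_axioms.intro[OF tdesign s A3_tadj[OF s] A3_tweight[OF s] indep sample])
  qed
  obtain B where "0 \<le> B" "\<And>x. x \<in> states A \<Longrightarrow> \<bar>h x\<bar> \<le> B" by (rule sup_norm_bound[OF h(2)]) auto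
  then have "bounded_fn (base A) h B" using h(1) by (simp add: bounded_fn_def)
  then show ?thesis by (rule two_filter_weak_conv)
qed

end
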